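(* Let $a,b>0$ and $\frac{14}{3}\le p<6$. Then for every $c>0$ there exists a pair $(u_c,\lambda_c)\in S(c)\times\mathbb{R}$ such that $u_c$ is a weak solution of $$-\left(a+b\int_{\mathbb{R}^3}|\nabla u_c|^2\,dx\right)\Delta u_c=\lambda_c u_c+|u_c|^{p-2}u_c+u_c^5\quad\text{in }\mathbb{R}^3 .$$ Moreover, $$E(u_c)=\inf_{u\in V(c)}E(u).$$
   Context: All functions are real-valued and $\|\cdot\|_q$ denotes the norm of $L^q(\mathbb{R}^3)$. For $c>0$, $S(c)=\{u\in H^1(\mathbb{R}^3):\int_{\mathbb{R}^3}u^2\,dx=c^2\}$. A function $u\in H^1(\mathbb{R}^3)$ is a weak solution of $-(a+b\int|\nabla u|^2)\Delta u=\lambda u+|u|^{p-2}u+u^5$ if $$\left(a+b\|\nabla u\|_2^2\right)\int_{\mathbb{R}^3}\nabla u\cdot\nabla\phi\,dx=\lambda\int_{\mathbb{R}^3}u\phi\,dx+\int_{\mathbb{R}^3}|u|^{p-2}u\phi\,dx+\int_{\mathbb{R}^3}u^5\phi\,dx\quad\text{for all }\phi\in H^1(\mathbb{R}^3).$$ The energy functional is $$E(u)=\frac a2\|\nabla u\|_2^2+\frac b4\|\nabla u\|_2^4-\frac1p\|u\|_p^p-\frac16\|u\|_6^6 ,\quad u\in H^1(\mathbb{R}^3).$$ Set $\beta_p=\frac{3(p-2)}{2p}$ and $$P(u)=a\|\nabla u\|_2^2+b\|\nabla u\|_2^4-\beta_p\|u\|_p^p-\|u\|_6^6 .$$ The Pohozaev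 manifold is $V(c)=\{u\in S(c):P(u)=0\}$. *)

theory Defs
  imports "HOL-Analysis.Analysis"
begin

text \<open>
  Elements of Lebesgue and Sobolev spaces are represented by Borel functions, not by
  classes modulo null sets; every quantity below is invariant under changes on null sets.
\<close>

definition Lq :: "real \<Rightarrow> ('a::euclidean_space \<Rightarrow> 'b::euclidean_space) set" where
  "Lq q = {f \<in> borel_measurable lborel. integrable lborel (\<lambda>x. norm (f x) powr q)}"

definition Lq_norm :: "real \<Rightarrow> ('a::euclidean_space \<Rightarrow> 'b::euclidean_space) \<Rightarrow> real" where
  "Lq_norm q f = (LINT x|lborel. norm (f x) powr q) powr (1 / q)"

definition locally_integrable :: "('a::euclidean_space \<Rightarrow> 'b::euclidean_space) \<Rightarrow> bool" where
  "locally_integrable f \<longleftrightarrow> (\<forall>K. compact K \<longrightarrow> set_integrable lborel K f)"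

fun C_k :: "nat \<Rightarrow> ('a::euclidean_space \<Rightarrow> real) \<Rightarrow> bool" where
  "C_k 0 f \<longleftrightarrow> continuous_on UNIV f"
| "C_k (Suc k) f \<longleftrightarrow> (\<forall>x. f differentiable (at x)) \<and>
     (\<forall>i\<in>Basis. C_k k (\<lambda>x. frechet_derivative f (at x) i))"

definition test_function :: "('a::euclidean_space \<Rightarrow> real) \<Rightarrow> bool" where
  "test_function \<phi> \<longleftrightarrow> (\<forall>k. C_k k \<phi>) \<and> compact (closure {x. \<phi> x \<noteq> 0})"

definition is_weak_gradient :: "('a::euclidean_space \<Rightarrow> real) \<Rightarrow> ('a \<Rightarrow> 'a) \<Rightarrow> bool" where
  "is_weak_gradient u g \<longleftrightarrow> locally_integrable u \<and> locally_integrable g \<and>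
     (\<forall>\<phi>. test_function \<phi> \<longrightarrow> (\<forall>i\<in>Basis.
        (LINT x|lborel. u x * frechet_derivative \<phi> (at x) i)
          = - (LINT x|lborel. (g x \<bullet> i) * \<phi> x)))"

definition H1 :: "('a::euclidean_space \<Rightarrow> real) set" where
  "H1 = {u \<in> Lq 2. \<exists>g \<in> Lq 2. is_weak_gradient u g}"

text \<open>A weak gradient is unique up to null sets, so the choice below is immaterial.\<close>

definition weak_gradient :: "('a::euclidean_space \<Rightarrow> real) \<Rightarrow> 'a \<Rightarrow> 'a" where
  "weak_gradient u = (SOME g. g \<in> borel_measurable lborel \<and> is_weak_gradient u g)"

definition mass_sphere :: "real \<Rightarrow> (real^3 \<Rightarrow> real) set" where
  "mass_sphere c = {u \<in> H1. (LINT x|lborel. (u x)\<^sup>2) = c\<^sup>2}"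

definition kirchhoff_weak_solution ::
    "real \<Rightarrow> real \<Rightarrow> real \<Rightarrow> real \<Rightarrow> (real^3 \<Rightarrow> real) \<Rightarrow> bool" where
  "kirchhoff_weak_solution a b p lam u \<longleftrightarrow> u \<in> H1 \<and>
     (\<forall>\<phi>\<in>H1. (a + b * (Lq_norm 2 (weak_gradient u))\<^sup>2)
                * (LINT x|lborel. weak_gradient u x \<bullet> weak_gradient \<phi> x)
            = lam * (LINT x|lborel. u x * \<phi> x)
              + (LINT x|lborel. \<bar>u x\<bar> powr (p - 2) * u x * \<phi> x)
              + (LINT x|lborel. (u x) ^ 5 * \<phi> x))"

definition energy :: "real \<Rightarrow> real \<Rightarrow> real \<Rightarrow> (real^3 \<Rightarrow> real) \<Rightarrow> real" where
  "energy a b p u =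
     a / 2 * (Lq_norm 2 (weak_gradient u)) ^ 2 + b / 4 * (Lq_norm 2 (weak_gradient u)) ^ 4
     - 1 / p * Lq_norm p u powr p - 1 / 6 * (Lq_norm 6 u) ^ 6"

definition pohozaev_exponent :: "real \<Rightarrow> real" where
  "pohozaev_exponent p = 3 * (p - 2) / (2 * p)"

definition pohozaev :: "real \<Rightarrow> real \<Rightarrow> real \<Rightarrow> (real^3 \<Rightarrow> real) \<Rightarrow> real" where
  "pohozaev a b p u =
     a * (Lq_norm 2 (weak_gradient u)) ^ 2 + b * (Lq_norm 2 (weak_gradient u)) ^ 4
     - pohozaev_exponent p * Lq_norm p u powr p - (Lq_norm 6 u) ^ 6"

definition pohozaev_manifold :: "real \<Rightarrow> real \<Rightarrow> real \<Rightarrow> real \<Rightarrow> (real^3 \<Rightarrow> real) set" where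
  "pohozaev_manifold a b p c = {u \<in> mass_sphere c. pohozaev a b p u = 0}"

end

(* The sharp Sobolev inequality is proved by transport: the Knothe map pushes |u|^6 to the extremal
profile (1 + |x|^2)^(-3), and the arithmetic-geometric mean inequality bounds its Jacobian.
On the Pohozaev manifold the energy E equals J = E - P/4, a nonnegative combination of the kinetic,
p-th and sixth power integrals, and for P(u) <= 0 the energy along the mass-preserving dilations of u
stays below J(u). Hence the infimum m of E on V(c) is also a lower bound of J on the nonzero functions
with P <= 0 and mass at most c^2. Truncated bubbles show that m lies strictly below the level to which
the energy is confined when the p-th power integral vanishes, so after translations (Lions) a
minimising sequence u_n has a nonzero weak limit U. If P(U) > 0, then P(u_n - U) < 0 eventually and,
by Brezis-Lieb, J(u_n - U) tends to m - J(U) < m, a contradiction; so P(U) <= 0 and the projection of U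
to V(c) is a minimiser. It also maximises E along its own dilations, so comparing it with its
perturbations, dilated back to V(c), yields the equation without a multiplier for the constraint P = 0. *)
theory Submission
  imports Defs "HOL-Probability.Sinc_Integral" "HOL-Real_Asymp.Real_Asymp" "HOL-Library.Diagonal_Subsequence"
begin

text \<open>Compactness fails twice: by translations, and at the critical power, where bubbles can
  concentrate. The second failure is excluded by comparing two energies built on the same number, so
  the Sobolev inequality has to carry its sharp constant; transport yields it through the integral
  \<open>SN\<close> of the extremal profile, which the bubbles reproduce. The nonlocal coefficient a
  + b * kin is a further obstacle: it need not pass to weak limits, so a limit of approximate
  solutions may solve another equation. Minimisation avoids this, because in the splitting of P the
  only non-additive term is b * kin^2, whose cross term is non-negative in the limit; removing a
  part U with P(U) > 0 therefore pushes P of the remainder below 0. The bound p >= 14/3 says that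
  the dilation exponent \<open>s\<close> of the p-th power integral is at least 4, the exponent of
  the Kirchhoff term: the coefficients of J are then non-negative, and P has exactly one zero on
  each dilation fibre.\<close>

abbreviation fd :: "('a::euclidean_space \<Rightarrow> real) \<Rightarrow> 'a \<Rightarrow> 'a \<Rightarrow> real" where "fd f x \<equiv> frechet_derivative f (at x)"
abbreviation NINT :: "('a::euclidean_space \<Rightarrow> ennreal) \<Rightarrow> ennreal" (binder "NINT " 10) where "NINT x. F x \<equiv> nn_integral lborel F"
abbreviation sqd :: "'a measure \<Rightarrow> ('a \<Rightarrow> 'b::real_normed_vector) \<Rightarrow> ('a \<Rightarrow> 'b) \<Rightarrow> ennreal" where
 "sqd M f g \<equiv> \<integral>\<^sup>+x. ennreal ((norm (f x - g x))^2) \<partial>M"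
abbreviation nsq :: "('a::euclidean_space \<Rightarrow> 'b::real_normed_vector) \<Rightarrow> real" where "nsq f \<equiv> LBINT x. (norm (f x))^2"

text \<open>The unqualified names of these Bochner facts are taken by the Henstock--Kurzweil integral.\<close>

lemmas lint_nonneg = Bochner_Integration.integral_nonneg
lemmas lint_add = Bochner_Integration.integral_add
lemmas lint_diff = Bochner_Integration.integral_diff
lemmas lint_sum = Bochner_Integration.integral_sum
lemmas lint_cong = Bochner_Integration.integral_cong
lemmas lintegrable_add = Bochner_Integration.integrable_add
lemmas lintegrable_diff = Bochner_Integration.integrable_diff
lemmas lintegrable_bound = Bochner_Integration.integrable_bound
lemmas lintegrable_divide = Bochner_Integration.integrable_divide
lemmas measurable_cont = borel_measurable_continuous_onI

section \<open>Sharp Sobolev inequality by Knothe transport\<close>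

text \<open>Not normalised: the densities used later are marginals of a sixth power, whose total
  mass is arbitrary; \<open>transport\<close> divides by the totals.\<close>

definition cdf_of :: "(real \<Rightarrow> real) \<Rightarrow> real \<Rightarrow> real" where
 "cdf_of r x = (LBINT t. indicator {..x} t * r t)"

text \<open>Positivity and continuity make the distribution function a C1 bijection onto the open
  interval from 0 to \<open>tot\<close>, so the transport is a classical differentiable map.
  \<open>sobolev_C1_compact\<close> arranges the positivity.\<close>

locale pos_density =
 fixes r :: "real \<Rightarrow> real"
 assumes cont: "continuous_on UNIV r" and pos: "\<And>x. r x > 0" and int: "integrable lborel r"
begin

lemma int_ind: "A \<in> sets borel \<Longrightarrow> integrable lborel (\<lambda>t. indicator A t * r t)"
 using integrable_real_mult_indicator[of A lborel r] int by (simp add: mult.commute)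

lemma cdf_diff:
 assumes "x \<le> y" shows "cdf_of r y - cdf_of r x = (LBINT t. indicator {x<..y} t * r t)"
proof -
 have "cdf_of r y - cdf_of r x = (LBINT t. indicator {..y} t * r t - indicator {..x} t * r t)"
  unfolding cdf_of_def by (rule lint_diff[symmetric]) (auto intro: int_ind)
 also have "\<dots> = (LBINT t. indicator {x<..y} t * r t)"
  using assms by (intro lint_cong) (auto simp: indicator_def)
 finally show ?thesis .
qed

lemma cdf_interval:
 assumes "x \<le> y" shows "cdf_of r y - cdf_of r x = (LBINT t=x..y. r t)"
 unfolding cdf_diff[OF assms] using assms
 by (subst interval_integral_Ioc) (auto simp: set_lebesgue_integral_def)

lemma cdf_deriv: "(cdf_of r has_real_derivative r x) (at x)"
proof -
 have "((\<lambda>u. LBINT y=x-1..u. r y) has_vector_derivative r x) (at x within {x-1..x+1})"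
  by (rule interval_integral_FTC2) (auto intro: continuous_on_subset[OF cont])
 then have "((\<lambda>u. LBINT y=x-1..u. r y) has_real_derivative r x) (at x within {x-1<..<x+1})"
  unfolding has_real_derivative_iff_has_vector_derivative
  by (rule has_vector_derivative_within_subset) auto
 then have "((\<lambda>u. LBINT y=x-1..u. r y) has_real_derivative r x) (at x)"
  by (subst (asm) at_within_open) auto
 then have "((\<lambda>u. cdf_of r (x-1) + (LBINT y=x-1..u. r y)) has_real_derivative r x) (at x)"
  by (auto intro!: derivative_eq_intros)
 then show ?thesis
 proof (rule has_field_derivative_transform_within_open[where S="{x-1<..<x+1}"])
  fix u assume "u \<in> {x-1<..<x+1}"
  then have "x - 1 \<le> u" by auto
  from cdf_interval[OF this] show "cdf_of r (x - 1) + (LBINT y=x-1..u. r y) = cdf_of r u" by simp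
 qed auto
qed

lemma cdf_strict_mono: "strict_mono (cdf_of r)"
proof (rule strict_monoI)
 fix x y :: real assume "x < y"
 then show "cdf_of r x < cdf_of r y"
  by (rule DERIV_pos_imp_increasing) (use cdf_deriv pos in blast)
qed

lemma cdf_less_iff: "cdf_of r x < cdf_of r y \<longleftrightarrow> x < y"
 and cdf_le_iff: "cdf_of r x \<le> cdf_of r y \<longleftrightarrow> x \<le> y"
 using cdf_strict_mono by (auto simp: strict_mono_less strict_mono_less_eq)

lemma cdf_at_top: "(cdf_of r \<longlongrightarrow> integral\<^sup>L lborel r) at_top"
proof -
 have "((\<lambda>y. LBINT t. indicator {..y} t * r t) \<longlongrightarrow> integral\<^sup>L lborel r) at_top"
 proof (rule integral_dominated_convergence_at_top[where w="\<lambda>t. norm (r t)"])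
  show "\<forall>\<^sub>F i in at_top. AE x in lborel. norm (indicator {..i} x * r x) \<le> norm (r x)"
   by (auto simp: indicator_def intro!: always_eventually)
  show "AE x in lborel. ((\<lambda>i. indicator {..i} x * r x) \<longlongrightarrow> r x) at_top"
  proof (rule AE_I2)
   fix x show "((\<lambda>i. indicator {..i} x * r x) \<longlongrightarrow> r x) at_top"
    by (rule tendsto_eventually, rule eventually_at_top_linorderI[of x]) (auto simp: indicator_def)
  qed
 qed (use int in \<open>auto intro: borel_measurable_integrable\<close>)
 then show ?thesis by (simp add: cdf_of_def[abs_def])
qed

lemma cdf_at_bot: "(cdf_of r \<longlongrightarrow> 0) at_bot"
proof -
 have "((\<lambda>y. LBINT t. indicator {..-y} t * r t) \<longlongrightarrow> integral\<^sup>L lborel (\<lambda>_::real. 0::real)) at_top"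
 proof (rule integral_dominated_convergence_at_top[where f="\<lambda>_. 0" and w="\<lambda>t. norm (r t)"])
  show "\<forall>\<^sub>F i in at_top. AE x in lborel. norm (indicator {..-i} x * r x) \<le> norm (r x)"
   by (auto simp: indicator_def intro!: always_eventually)
  show "AE x in lborel. ((\<lambda>i. indicator {..-i} x * r x) \<longlongrightarrow> 0) at_top"
  proof (rule AE_I2)
   fix x show "((\<lambda>i. indicator {..-i} x * r x) \<longlongrightarrow> 0) at_top"
    by (rule tendsto_eventually, rule eventually_at_top_linorderI[of "-x + 1"]) (auto simp: indicator_def)
  qed
 qed (use int in \<open>auto intro: borel_measurable_integrable\<close>)
 then show ?thesis by (simp add: cdf_of_def[abs_def] filterlim_at_bot_mirror)
qed

definition "tot = integral\<^sup>L lborel r"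

lemma cdf_pos: "cdf_of r x > 0"
proof -
 have "cdf_of r (x - 1) \<ge> 0" unfolding cdf_of_def
  by (intro lint_nonneg) (auto intro!: mult_nonneg_nonneg less_imp_le[OF pos])
 moreover have "cdf_of r (x-1) < cdf_of r x" by (simp add: cdf_less_iff)
 ultimately show ?thesis by linarith
qed

lemma cdf_less_tot: "cdf_of r x < tot"
proof -
 have "cdf_of r (x+1) \<le> tot" unfolding tot_def
  by (rule tendsto_lowerbound[OF cdf_at_top])
    (auto simp: cdf_le_iff intro!: eventually_at_top_linorderI[of "x+1"])
 moreover have "cdf_of r x < cdf_of r (x+1)" by (simp add: cdf_less_iff)
 ultimately show ?thesis by linarith
qed

lemma tot_pos: "tot > 0" using cdf_pos[of 0] cdf_less_tot[of 0] by linarith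

lemma isCont_cdf: "isCont (cdf_of r) x" using cdf_deriv DERIV_isCont by blast

lemma cdf_surj: assumes "0 < u" "u < tot" shows "\<exists>x. cdf_of r x = u"
proof -
 have "\<forall>\<^sub>F x in at_top. cdf_of r x > u"
  using assms cdf_at_top order_tendstoD(1) unfolding tot_def by blast
 then obtain b where b: "cdf_of r b > u" by (metis eventually_at_top_linorder order_refl)
 have "\<forall>\<^sub>F x in at_bot. cdf_of r x < u"
  using assms cdf_at_bot order_tendstoD(2) by blast
 then obtain a where a: "cdf_of r a < u" by (metis eventually_at_bot_linorder order_refl)
 have "a \<le> b" using a b cdf_less_iff[of a b] by linarith
 then show ?thesis using IVT[of "cdf_of r" a u b] a b isCont_cdf by (metis less_imp_le)
qed

end

text \<open>The increasing map pushing the density \<open>r\<close> forward to the density \<open>k\<close>.\<close>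

definition transport :: "(real \<Rightarrow> real) \<Rightarrow> (real \<Rightarrow> real) \<Rightarrow> real \<Rightarrow> real" where
 "transport k r x = (THE z. cdf_of k z / integral\<^sup>L lborel k = cdf_of r x / integral\<^sup>L lborel r)"

locale transport_pair = k: pos_density k + r: pos_density r for k r
begin

lemma transport_eq: "cdf_of k (transport k r x) / k.tot = cdf_of r x / r.tot"
proof -
 have "0 < cdf_of r x / r.tot * k.tot" using r.cdf_pos r.tot_pos k.tot_pos by simp
 moreover have "cdf_of r x / r.tot * k.tot < k.tot"
  using r.cdf_less_tot[of x] r.tot_pos k.tot_pos by (simp add: field_simps)
 ultimately obtain z where z: "cdf_of k z = cdf_of r x / r.tot * k.tot" using k.cdf_surj by blast
 show ?thesis unfolding transport_def k.tot_def[symmetric] r.tot_def[symmetric]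
 proof (rule theI[of _ z])
  show "cdf_of k z / k.tot = cdf_of r x / r.tot" using z k.tot_pos by simp
  fix y assume "cdf_of k y / k.tot = cdf_of r x / r.tot"
  then have "cdf_of k y = cdf_of k z" using z k.tot_pos by (simp add: field_simps)
  then show "y = z" using k.cdf_strict_mono by (simp add: strict_mono_eq)
 qed
qed

text \<open>Comparisons with the transport turn into comparisons of normalised distribution
  functions; its continuity and its measurability in parameters are both read off from this.\<close>

lemma transport_le_iff: "transport k r x \<le> t \<longleftrightarrow> cdf_of r x / r.tot \<le> cdf_of k t / k.tot"
 unfolding transport_eq[symmetric] using k.tot_pos k.cdf_le_iff by (simp add: divide_le_cancel)

lemma transport_less_iff: "transport k r x < t \<longleftrightarrow> cdf_of r x / r.tot < cdf_of k t / k.tot"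
 unfolding transport_eq[symmetric] using k.tot_pos k.cdf_less_iff by (simp add: divide_less_cancel)

lemma transport_less_iff': "t < transport k r x \<longleftrightarrow> cdf_of k t / k.tot < cdf_of r x / r.tot"
 using transport_le_iff[of x t] by linarith

lemma isCont_transport: "isCont (transport k r) x"
 unfolding isCont_def
proof (rule order_tendstoI)
 have c: "((\<lambda>y. cdf_of r y / r.tot) \<longlongrightarrow> cdf_of r x / r.tot) (at x)"
  using r.isCont_cdf[of x] r.tot_pos unfolding isCont_def by (intro tendsto_divide) auto
 fix t
 { assume "t < transport k r x"
  then show "\<forall>\<^sub>F y in at x. t < transport k r y"
   unfolding transport_less_iff' by (rule order_tendstoD(1)[OF c]) }
 { assume "transport k r x < t"
  then show "\<forall>\<^sub>F y in at x. transport k r y < t"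
   unfolding transport_less_iff by (rule order_tendstoD(2)[OF c]) }
qed

lemma transport_deriv:
 "(transport k r has_real_derivative (r x / r.tot) * (k.tot / k (transport k r x))) (at x)"
proof -
 let ?z = "transport k r"
 let ?K = "\<lambda>z. cdf_of k z / k.tot" and ?R = "\<lambda>x. cdf_of r x / r.tot"
 have K: "(?K has_real_derivative k (?z x) / k.tot) (at (?z x))"
  using k.cdf_deriv[of "?z x"] by (rule DERIV_cdivide)
 have R: "(?R has_real_derivative r x / r.tot) (at x)"
  using r.cdf_deriv[of x] by (rule DERIV_cdivide)
 \<comment> \<open>Caratheodory factor of the target distribution function. Dividing the increments
   by it inverts the chain rule; its limit at the point is positive, so the quotient
   converges.\<close>
 obtain g where g: "\<And>y. ?K y - ?K (?z x) = g y * (y - ?z x)" and gc: "isCont g (?z x)"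
  and g0: "g (?z x) = k (?z x) / k.tot"
  using K unfolding CARAT_DERIV by auto
 have g0p: "g (?z x) > 0" unfolding g0 using k.pos k.tot_pos by simp
 have gz: "((\<lambda>y. g (?z y)) \<longlongrightarrow> g (?z x)) (at x)"
  using isCont_o2[OF isCont_transport gc] by (simp add: isCont_def)
 have "((\<lambda>y. ((?R y - ?R x) / (y - x)) / g (?z y)) \<longlongrightarrow> (r x / r.tot) / g (?z x)) (at x)"
  by (rule tendsto_divide[OF R[unfolded has_field_derivative_iff] gz]) (use g0p in simp)
 moreover have "\<forall>\<^sub>F y in at x. ((?R y - ?R x) / (y - x)) / g (?z y) = (?z y - ?z x) / (y - x)"
  using order_tendstoD(1)[OF gz g0p]
 proof eventually_elim
  fix y assume gy: "0 < g (?z y)"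
  have "?R y - ?R x = g (?z y) * (?z y - ?z x)"
   using g[of "?z y"] by (simp add: transport_eq)
  then show "((?R y - ?R x) / (y - x)) / g (?z y) = (?z y - ?z x) / (y - x)"
   using gy by simp
 qed
 ultimately have "((\<lambda>y. (?z y - ?z x) / (y - x)) \<longlongrightarrow> (r x / r.tot) / g (?z x)) (at x)"
  by (rule Lim_transform_eventually)
 then show ?thesis unfolding has_field_derivative_iff g0 by simp
qed

lemma transport_at_top: "filterlim (transport k r) at_top at_top"
 unfolding filterlim_at_top_gt[where c=0]
proof (intro allI impI)
 fix Z :: real
 have "((\<lambda>y. cdf_of r y / r.tot) \<longlongrightarrow> r.tot / r.tot) at_top"
  using r.cdf_at_top r.tot_pos unfolding r.tot_def by (intro tendsto_divide) auto
 moreover have "cdf_of k Z / k.tot < r.tot / r.tot"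
  using k.cdf_less_tot[of Z] k.tot_pos r.tot_pos by simp
 ultimately have "\<forall>\<^sub>F y in at_top. cdf_of k Z / k.tot < cdf_of r y / r.tot" by (rule order_tendstoD(1))
 then show "\<forall>\<^sub>F x in at_top. Z \<le> transport k r x"
  by eventually_elim (simp add: transport_less_iff'[symmetric])
qed

lemma transport_at_bot: "filterlim (transport k r) at_bot at_bot"
 unfolding filterlim_at_bot_lt[where c=0]
proof (intro allI impI)
 fix Z :: real
 have "((\<lambda>y. cdf_of r y / r.tot) \<longlongrightarrow> 0 / r.tot) at_bot"
  using r.cdf_at_bot r.tot_pos by (intro tendsto_divide) auto
 moreover have "0 / r.tot < cdf_of k Z / k.tot"
  using k.cdf_pos[of Z] k.tot_pos r.tot_pos by simp
 ultimately have "\<forall>\<^sub>F y in at_bot. cdf_of r y / r.tot < cdf_of k Z / k.tot" by (rule order_tendstoD(2))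
 then show "\<forall>\<^sub>F x in at_bot. transport k r x \<le> Z"
  by eventually_elim (simp add: transport_less_iff[symmetric])
qed

text \<open>The integrand is the derivative of the distribution function of h * k evaluated at the
  transport, up to the constant r.tot / k.tot. The improper fundamental theorem of calculus for
  non-negative integrands then yields integrability and value together.\<close>

lemma transport_integral:
 assumes h: "continuous_on UNIV h" "\<And>x. h x > 0" and hk: "integrable lborel (\<lambda>z. h z * k z)"
 shows "integrable lborel (\<lambda>x. r x * h (transport k r x))"
  and "(LBINT x. r x * h (transport k r x)) = r.tot / k.tot * (LBINT z. h z * k z)"
proof -
 interpret hk: pos_density "\<lambda>z. h z * k z"
  by unfold_locales (use h hk k.cont k.pos in \<open>auto intro!: continuous_intros mult_pos_pos\<close>)
 let ?z = "transport k r" and ?\<Phi> = "\<lambda>x. r.tot / k.tot * cdf_of (\<lambda>z. h z * k z) (transport k r x)"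
 have D: "(?\<Phi> has_real_derivative r x * h (?z x)) (at x)" for x
 proof -
  have "(?\<Phi> has_real_derivative r.tot / k.tot * ((h (?z x) * k (?z x)) * ((r x / r.tot) * (k.tot / k (?z x))))) (at x)"
   by (intro DERIV_cmult DERIV_chain2[OF hk.cdf_deriv transport_deriv])
  also have "r.tot / k.tot * ((h (?z x) * k (?z x)) * ((r x / r.tot) * (k.tot / k (?z x)))) = r x * h (?z x)"
   using r.tot_pos k.tot_pos k.pos[of "?z x"] by (simp add: field_simps)
  finally show ?thesis .
 qed
 have hc: "isCont h x" and rc: "isCont r x" for x
  using h(1) r.cont by (auto simp: continuous_on_eq_continuous_at)
 have c: "isCont (\<lambda>x. r x * h (?z x)) x" for x
  using isCont_o2[OF isCont_transport hc] rc by (intro isCont_mult)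
 have A: "((?\<Phi> \<circ> real_of_ereal) \<longlongrightarrow> 0) (at_right (-\<infinity>))"
  unfolding ereal_tendsto_simps
  using tendsto_mult[OF tendsto_const filterlim_compose[OF hk.cdf_at_bot transport_at_bot], of "r.tot / k.tot"] by simp
 have B: "((?\<Phi> \<circ> real_of_ereal) \<longlongrightarrow> r.tot / k.tot * hk.tot) (at_left \<infinity>)"
  unfolding ereal_tendsto_simps hk.tot_def
  by (rule tendsto_mult[OF tendsto_const filterlim_compose[OF hk.cdf_at_top transport_at_top]])
 have n: "AE x in lborel. - \<infinity> < ereal x \<longrightarrow> ereal x < \<infinity> \<longrightarrow> 0 \<le> r x * h (?z x)"
  using h(2) r.pos by (auto intro!: AE_I2 mult_nonneg_nonneg less_imp_le)
 note ftc = interval_integral_FTC_nonneg[of "-\<infinity>" \<infinity> ?\<Phi> "\<lambda>x. r x * h (?z x)", OF _ D c n A B]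
 show "integrable lborel (\<lambda>x. r x * h (?z x))"
  using ftc(1) by (simp add: set_integrable_def)
 show "(LBINT x. r x * h (?z x)) = r.tot / k.tot * (LBINT z. h z * k z)"
  using ftc(2) by (simp add: interval_lebesgue_integral_def set_lebesgue_integral_def hk.tot_def)
qed

end

section \<open>One-dimensional factors of the extremal profile\<close>

definition kern :: "real \<Rightarrow> real \<Rightarrow> real" where
 "kern q z = (1 + z^2) powr (- q)"

lemma one_plus_sq_pos: "1 + z^2 > (0::real)"
 by (simp add: add_pos_nonneg)

lemma kern_cont: "continuous_on UNIV (kern q)"
 unfolding kern_def using one_plus_sq_pos
 by (intro continuous_intros) (auto simp: less_imp_neq[symmetric])

lemma kern_pos: "kern q z > 0"
 unfolding kern_def using one_plus_sq_pos[of z] by simp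

lemma kern_1: "kern 1 z = inverse (1 + z^2)"
 unfolding kern_def using one_plus_sq_pos[of z] by (simp add: powr_minus)

lemma integrable_inverse_1_plus_sq: "integrable lborel (\<lambda>z::real. inverse (1 + z^2))"
 using integrable_inverse_1_plus_square by (simp add: set_integrable_def)

lemma kern_le: "1 \<le> q \<Longrightarrow> kern q z \<le> inverse (1 + z^2)"
 unfolding kern_1[symmetric] unfolding kern_def by (rule powr_mono) auto

lemma kern_int: "1 \<le> q \<Longrightarrow> integrable lborel (kern q)"
 by (rule lintegrable_bound[OF integrable_inverse_1_plus_sq])
   (use kern_le kern_pos kern_cont in \<open>auto simp: less_imp_le abs_of_pos measurable_cont one_plus_sq_pos\<close>)

lemma kern_mult: "kern p z * kern q z = kern (p + q) z"
 unfolding kern_def by (simp add: powr_add[symmetric])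

lemma pos_density_kern: "1 \<le> q \<Longrightarrow> pos_density (kern q)"
 by unfold_locales (auto simp: kern_cont kern_pos kern_int)

text \<open>This is the Beta value B(1/2, q - 1/2). It is never evaluated: the recursion
  \<open>Kq_rec\<close> and positivity carry all the later constants.\<close>

definition Kq :: "real \<Rightarrow> real" where "Kq q = integral\<^sup>L lborel (kern q)"

lemma Kq_pos: "1 \<le> q \<Longrightarrow> Kq q > 0"
 using pos_density.tot_pos[OF pos_density_kern, of q] pos_density.tot_def[OF pos_density_kern, of q] by (simp add: Kq_def)

text \<open>Integrate the derivative of z * (1 + z^2) powr (1 - q) over the line. The boundary terms
  vanish because for q >= 2 this function is bounded by |z| / (1 + z^2).\<close>

lemma Kq_rec:
 assumes q: "2 \<le> q"
 shows "(2 * q - 3) * Kq (q - 1) = (2 * q - 2) * Kq q"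
proof -
 let ?F = "\<lambda>z::real. z * (1 + z^2) powr (1 - q)"
 let ?f = "\<lambda>z::real. (2 * q - 2) * kern q z - (2 * q - 3) * kern (q - 1) z"
 have D: "DERIV ?F z :> ?f z" for z
 proof -
  have "DERIV ?F z :> (1 + z^2) powr (1 - q) + z * ((1 - q) * (1 + z^2) powr (1 - q - 1) * (2 * z))"
   using one_plus_sq_pos[of z] by (auto intro!: derivative_eq_intros simp: algebra_simps)
  also have "(1 - q - 1) = - q" by simp
  also have "(1 + z^2) powr (1 - q) + z * ((1 - q) * (1 + z^2) powr - q * (2 * z))
    = (1 + z^2) powr (1 - q) + 2 * (1 - q) * ((1 + z^2) - 1) * (1 + z^2) powr - q"
   by (simp add: power2_eq_square)
  also have "\<dots> = (1 + z^2) powr (1 - q) + 2 * (1 - q) * ((1 + z^2) powr (1 - q) - (1 + z^2) powr - q)"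
   using one_plus_sq_pos[of z] powr_add[of "1 + z^2" 1 "- q"] by (simp add: algebra_simps)
  also have "\<dots> = ?f z" by (simp add: kern_def algebra_simps)
  finally show ?thesis .
 qed
 have int: "integrable lborel ?f"
  using q by (intro lintegrable_diff integrable_mult_right kern_int) auto
 have c: "isCont ?f z" for z
  using kern_cont[of q] kern_cont[of "q-1"] by (auto simp: continuous_on_eq_continuous_at intro!: continuous_intros)
 have bnd: "\<bar>?F z\<bar> \<le> \<bar>z / (1 + z^2)\<bar>" for z
 proof -
  have "(1 + z^2) powr (1 - q) \<le> (1 + z^2) powr (- 1)" by (rule powr_mono) (use q in auto)
  also have "\<dots> = 1 / (1 + z^2)" using one_plus_sq_pos[of z] by (simp add: powr_minus field_simps)
  finally show ?thesis by (simp add: abs_mult mult_left_mono divide_inverse)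
 qed
 have top: "(?F \<longlongrightarrow> 0) at_top"
 proof (rule Lim_null_comparison)
  show "\<forall>\<^sub>F x in at_top. norm (?F x) \<le> \<bar>x / (1 + x^2)\<bar>" using bnd by auto
  show "((\<lambda>x::real. \<bar>x / (1 + x^2)\<bar>) \<longlongrightarrow> 0) at_top" by real_asymp
 qed
 have bot: "(?F \<longlongrightarrow> 0) at_bot"
 proof (rule Lim_null_comparison)
  show "\<forall>\<^sub>F x in at_bot. norm (?F x) \<le> \<bar>x / (1 + x^2)\<bar>" using bnd by auto
  show "((\<lambda>x::real. \<bar>x / (1 + x^2)\<bar>) \<longlongrightarrow> 0) at_bot" by real_asymp
 qed
 have "(LBINT x=-\<infinity>..\<infinity>. ?f x) = 0 - 0"
  by (rule interval_integral_FTC_integrable[where F="?F"])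
    (use D int c top bot in \<open>auto simp: has_real_derivative_iff_has_vector_derivative[symmetric] set_integrable_def ereal_tendsto_simps\<close>)
 then have "integral\<^sup>L lborel ?f = 0"
  by (simp add: interval_lebesgue_integral_def set_lebesgue_integral_def)
 moreover have "integral\<^sup>L lborel ?f = (2 * q - 2) * Kq q - (2 * q - 3) * Kq (q - 1)"
  using q unfolding Kq_def by (subst lint_diff) (auto intro!: integrable_mult_right kern_int)
 ultimately show ?thesis by simp
qed

text \<open>For q = 2, 5/2 and 3 the factor (2 * q - 2) / (2 * q - 3) equals 2, 3/2 and 4/3; the
  product of these values is the constant 4 in \<open>moment\<close>.\<close>

lemma transport_kern:
 assumes r: "pos_density r" and q: "2 \<le> q"
 defines "z \<equiv> transport (kern q) r"
 shows "(z has_real_derivative (r x / integral\<^sup>L lborel r) * (Kq q * (1 + (z x)^2) powr q)) (at x)"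
  and "integrable lborel (\<lambda>x. r x * (1 + (z x)^2))"
  and "(LBINT x. r x * (1 + (z x)^2)) = (2 * q - 2) / (2 * q - 3) * integral\<^sup>L lborel r"
proof -
 interpret transport_pair "kern q" r
  using r pos_density_kern[of q] q by (simp add: transport_pair_def)
 show "(z has_real_derivative (r x / integral\<^sup>L lborel r) * (Kq q * (1 + (z x)^2) powr q)) (at x)"
  using transport_deriv[of x] unfolding z_def k.tot_def r.tot_def Kq_def
  by (simp add: kern_def powr_minus divide_inverse)
 have e: "(1 + z^2) * kern q z = kern (q - 1) z" for z
  using kern_mult[of "-1" z q] one_plus_sq_pos[of z] by (simp add: kern_def)
 have i: "integrable lborel (\<lambda>z. (1 + z^2) * kern q z)" unfolding e using q by (intro kern_int) simp
 note t = transport_integral[of "\<lambda>z. 1 + z^2", OF _ one_plus_sq_pos i]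
 show "integrable lborel (\<lambda>x. r x * (1 + (z x)^2))"
  unfolding z_def by (rule t(1)) (auto intro!: continuous_intros)
 have "(LBINT x. r x * (1 + (z x)^2)) = r.tot / k.tot * Kq (q - 1)"
  unfolding z_def Kq_def e[symmetric] by (rule t(2)) (auto intro!: continuous_intros)
 also have "Kq (q - 1) = (2 * q - 2) / (2 * q - 3) * Kq q" using Kq_rec[OF q] q by (simp add: field_simps)
 finally show "(LBINT x. r x * (1 + (z x)^2)) = (2 * q - 2) / (2 * q - 3) * integral\<^sup>L lborel r"
  using Kq_pos[of q] q by (simp add: r.tot_def k.tot_def Kq_def)
qed

section \<open>Integration by parts without decay of the vector field\<close>

lemma abs_arctan_le_abs: "\<bar>arctan x\<bar> \<le> \<bar>x\<bar>"
proof -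
 have "arctan y \<le> y" if "y \<ge> 0" for y :: real
 proof -
  have "(\<lambda>y. y - arctan y) 0 \<le> (\<lambda>y. y - arctan y) y"
  proof (rule DERIV_nonneg_imp_nondecreasing[OF that])
   fix u :: real
   have "DERIV (\<lambda>y. y - arctan y) u :> 1 - inverse (1 + u^2)" by (intro DERIV_diff DERIV_ident DERIV_arctan)
   moreover have "inverse (1 + u^2) \<le> 1" by (rule inverse_le_1_iff[THEN iffD2]) auto
   ultimately show "\<exists>d. ((\<lambda>y. y - arctan y) has_real_derivative d) (at u) \<and> 0 \<le> d" by auto
  qed
  then show ?thesis by simp
 qed
 from this[of x] this[of "- x"] show ?thesis
  by (cases "x \<ge> 0") (auto simp: arctan_minus abs_if)
qed

text \<open>The factor \<open>T\<close> is replaced by the bounded \<open>L * arctan (T / L)\<close>, with \<open>L\<close> growing so slowly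
 that the boundary terms still vanish.\<close>

lemma nn_ibp:
 fixes \<phi> \<phi>' T D :: "real \<Rightarrow> real"
 assumes \<phi>: "\<And>x. (\<phi> has_real_derivative \<phi>' x) (at x)" "\<And>x. isCont \<phi>' x" "\<And>x. \<phi> x \<ge> 0"
  and lim: "(\<phi> \<longlongrightarrow> 0) at_top" "(\<phi> \<longlongrightarrow> 0) at_bot"
  and T: "\<And>x. (T has_real_derivative D x) (at x)" "\<And>x. isCont D x" "\<And>x. D x \<ge> 0"
 shows "(NINT x. ennreal (\<phi> x * D x)) \<le> (NINT x. ennreal (\<bar>\<phi>' x\<bar> * \<bar>T x\<bar>))" (is "_ \<le> ?R")
proof -
 have \<phi>c: "isCont \<phi> x" and Tc: "isCont T x" for x using \<phi>(1) T(1) DERIV_isCont by blast+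
 have [measurable]: "\<phi> \<in> borel_measurable borel" "\<phi>' \<in> borel_measurable borel" "T \<in> borel_measurable borel" "D \<in> borel_measurable borel"
  using \<phi>c Tc \<phi>(2) T(2) by (auto intro!: measurable_cont simp: continuous_on_eq_continuous_at)
 \<comment> \<open>\<open>e n\<close> dominates the values of \<phi> at both ends of the interval,
   and 1 / \<open>l n\<close> with l = sqrt e is the cap on T. The boundary terms are then at most e
   * (2 / l) = 2 * l, which still tends to 0. The summand 1 / (n + 1) keeps \<open>l n\<close>
   positive.\<close>
 define e where "e n = \<phi> (real n) + \<phi> (- real n) + inverse (real (Suc n))" for n
 have epos: "e n > 0" for n using \<phi>(3)[of "real n"] \<phi>(3)[of "- real n"] unfolding e_def
  by (metis add_nonneg_nonneg add_nonneg_pos inverse_positive_iff_positive of_nat_0_less_iff zero_less_Suc)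
 have "((\<lambda>n. \<phi> (- real n)) \<longlongrightarrow> 0) sequentially"
  by (rule filterlim_compose[OF lim(2)]) (simp add: filterlim_uminus_at_bot filterlim_real_sequentially)
 then have e0: "e \<longlonglongrightarrow> 0"
  using tendsto_add[OF tendsto_add[OF filterlim_compose[OF lim(1) filterlim_real_sequentially]] LIMSEQ_inverse_real_of_nat]
  unfolding e_def by simp
 define l where "l n = sqrt (e n)" for n
 have lpos: "l n > 0" for n using epos by (simp add: l_def)
 have l0: "l \<longlonglongrightarrow> 0" unfolding l_def using tendsto_real_sqrt[OF e0] by simp
 let ?g = "\<lambda>n x. indicator {-real n..real n} x * (\<phi> x * (D x / (1 + (T x * l n)^2)))"
 let ?\<theta> = "\<lambda>n x. arctan (T x * l n) / l n"
 have \<theta>b: "\<bar>?\<theta> n x\<bar> \<le> \<bar>T x\<bar>" for n x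
 proof -
  have "\<bar>arctan (T x * l n)\<bar> \<le> \<bar>T x * l n\<bar>" using abs_arctan_le_abs .
  then show ?thesis using lpos[of n] by (simp add: abs_mult field_simps)
 qed
 have \<theta>b2: "\<bar>?\<theta> n x\<bar> \<le> 2 / l n" for n x
 proof -
  have "\<bar>arctan (T x * l n)\<bar> \<le> 2" using arctan_bounded[of "T x * l n"] pi_less_4 by linarith
  then show ?thesis using lpos[of n] by (simp add: divide_right_mono)
 qed
 have key: "(NINT x. ennreal (?g n x)) \<le> ennreal (2 * l n) + ?R" for n
 proof -
  let ?n = "real n"
  have dpos: "1 + (T x * l n)^2 > 0" for x by (rule one_plus_sq_pos)
  have d\<theta>: "(?\<theta> n has_real_derivative D x / (1 + (T x * l n)^2)) (at x)" for x
  proof -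
   have "((\<lambda>x. arctan (T x * l n)) has_real_derivative inverse (1 + (T x * l n)^2) * (D x * l n)) (at x)"
    by (rule DERIV_chain2[OF DERIV_arctan DERIV_cmult_right[OF T(1)]])
   from DERIV_cdivide[OF this, of "l n"] show "(?\<theta> n has_real_derivative D x / (1 + (T x * l n)^2)) (at x)"
   proof (rule back_subst[where P="\<lambda>d. (?\<theta> n has_real_derivative d) (at x)"])
    show "inverse (1 + (T x * l n)^2) * (D x * l n) / l n = D x / (1 + (T x * l n)^2)"
     using lpos[of n] by (simp add: divide_inverse)
   qed
  qed
  let ?h1 = "\<lambda>x. \<phi> x * (D x / (1 + (T x * l n)^2))" and ?h2 = "\<lambda>x. \<phi>' x * ?\<theta> n x"
  have c1: "isCont ?h1 x" for x using \<phi>c T(2) Tc dpos[of x] by (intro continuous_intros) (auto simp: less_imp_neq[symmetric])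
  have c2: "isCont ?h2 x" for x using \<phi>(2) Tc lpos[of n] by (intro continuous_intros) auto
  have i1: "set_integrable lborel {-?n..?n} ?h1" by (rule borel_integrable_atLeastAtMost') (use c1 in \<open>auto simp: continuous_at_imp_continuous_on\<close>)
  have i2: "set_integrable lborel {-?n..?n} ?h2" by (rule borel_integrable_atLeastAtMost') (use c2 in \<open>auto simp: continuous_at_imp_continuous_on\<close>)
  have ftc: "(LINT x:{-?n..?n}|lborel. ?h1 x + ?h2 x) = \<phi> ?n * ?\<theta> n ?n - \<phi> (-?n) * ?\<theta> n (-?n)"
  proof -
   have d: "((\<lambda>x. \<phi> x * ?\<theta> n x) has_real_derivative ?h1 x + ?h2 x) (at x)" for x
    using DERIV_mult[OF \<phi>(1) d\<theta>, of x] by (simp add: add.commute mult.commute)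
   have "(LBINT x. (?h1 x + ?h2 x) * indicator {-?n..?n} x) = \<phi> ?n * ?\<theta> n ?n - \<phi> (-?n) * ?\<theta> n (-?n)"
    by (rule integral_FTC_Icc_real[where F="\<lambda>x. \<phi> x * ?\<theta> n x"]) (use d isCont_add[OF c1 c2] in auto)
   then show ?thesis unfolding set_lebesgue_integral_def real_scaleR_def by (simp only: mult.commute)
  qed
  have ibd: "\<bar>\<phi> y * ?\<theta> n y\<bar> \<le> \<phi> y * (2 / l n)" for y
   using mult_left_mono[OF \<theta>b2[of y n] \<phi>(3)[of y]] \<phi>(3)[of y] by (simp only: abs_mult abs_of_nonneg)
  have "(LINT x:{-?n..?n}|lborel. ?h1 x) = \<phi> ?n * ?\<theta> n ?n - \<phi> (-?n) * ?\<theta> n (-?n) - (LINT x:{-?n..?n}|lborel. ?h2 x)"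
   using set_integral_add(2)[OF i1 i2] ftc by simp
  also have "\<dots> \<le> e n * (2 / l n) + \<bar>LINT x:{-?n..?n}|lborel. ?h2 x\<bar>"
  proof -
   have "e n * (2 / l n) = \<phi> ?n * (2 / l n) + \<phi> (-?n) * (2 / l n) + inverse (real (Suc n)) * (2 / l n)"
    unfolding e_def by (simp add: algebra_simps)
   moreover have "inverse (real (Suc n)) * (2 / l n) \<ge> 0" using lpos[of n] by simp
   ultimately show ?thesis using ibd[of ?n] ibd[of "-?n"] by linarith
  qed
  also have "e n * (2 / l n) = 2 * l n"
   using epos[of n] lpos[of n] unfolding l_def by (simp add: field_simps real_sqrt_mult_self)
  also have "\<bar>LINT x:{-?n..?n}|lborel. ?h2 x\<bar> \<le> (LINT x:{-?n..?n}|lborel. \<bar>?h2 x\<bar>)"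
   using integral_norm_bound[of lborel "\<lambda>x. indicator {-?n..?n} x *\<^sub>R ?h2 x"]
   by (simp add: set_lebesgue_integral_def abs_mult)
  finally have le: "(LINT x:{-?n..?n}|lborel. ?h1 x) \<le> 2 * l n + (LINT x:{-?n..?n}|lborel. \<bar>?h2 x\<bar>)" by simp
  have "(NINT x. ennreal (?g n x)) = ennreal (LINT x:{-?n..?n}|lborel. ?h1 x)"
   unfolding set_lebesgue_integral_def real_scaleR_def
   by (rule nn_integral_eq_integral) (use i1 \<phi>(3) T(3) in \<open>auto simp: set_integrable_def add_nonneg_nonneg\<close>)
  also have "\<dots> \<le> ennreal (2 * l n + (LINT x:{-?n..?n}|lborel. \<bar>?h2 x\<bar>))" using le by (rule ennreal_leI)
  also have "\<dots> = ennreal (2 * l n) + ennreal (LINT x:{-?n..?n}|lborel. \<bar>?h2 x\<bar>)"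
   using lpos[of n] by (intro ennreal_plus) (auto simp: set_lebesgue_integral_def intro!: lint_nonneg)
  also have "ennreal (LINT x:{-?n..?n}|lborel. \<bar>?h2 x\<bar>) = (NINT x. ennreal (indicator {-?n..?n} x * \<bar>?h2 x\<bar>))"
   unfolding set_lebesgue_integral_def real_scaleR_def
   by (rule nn_integral_eq_integral[symmetric]) (use integrable_abs[OF i2[unfolded set_integrable_def]] in \<open>auto simp: abs_mult\<close>)
  also have "\<dots> \<le> ?R"
  proof (intro nn_integral_mono ennreal_leI)
   fix x
   have "\<bar>?h2 x\<bar> \<le> \<bar>\<phi>' x\<bar> * \<bar>T x\<bar>"
    using mult_left_mono[OF \<theta>b[of x n], of "\<bar>\<phi>' x\<bar>"] by (simp only: abs_mult abs_ge_zero simp_thms)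
   moreover have "indicator {-?n..?n} x * \<bar>?h2 x\<bar> \<le> 1 * \<bar>?h2 x\<bar>"
    by (rule mult_right_mono) (auto simp: indicator_def)
   ultimately show "indicator {-?n..?n} x * \<bar>?h2 x\<bar> \<le> \<bar>\<phi>' x\<bar> * \<bar>T x\<bar>" by linarith
  qed
  finally show ?thesis by (simp add: add_left_mono)
 qed
 \<comment> \<open>On each fixed x the capped integrand converges to \<phi> * D, since
   \<open>l n\<close> tends to 0 and x eventually lies in the interval; Fatou then passes the bound
   \<open>key\<close> to the limit.\<close>
 have "(NINT x. ennreal (\<phi> x * D x)) = (NINT x. liminf (\<lambda>n. ennreal (?g n x)))"
 proof (rule nn_integral_cong)
  fix x :: real
  obtain m :: nat where m: "\<bar>x\<bar> \<le> real m" using real_arch_simple by blast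
  have "(\<lambda>n. \<phi> x * (D x / (1 + (T x * l n)^2))) \<longlonglongrightarrow> \<phi> x * (D x / (1 + (T x * 0)^2))"
   by (intro tendsto_intros l0) auto
  moreover have "\<forall>\<^sub>F n in sequentially. \<phi> x * (D x / (1 + (T x * l n)^2)) = ?g n x"
   using eventually_ge_at_top[of m] by eventually_elim (use m in \<open>auto simp: indicator_def\<close>)
  ultimately have "(\<lambda>n. ?g n x) \<longlonglongrightarrow> \<phi> x * D x"
   using Lim_transform_eventually by fastforce
  then have "(\<lambda>n. ennreal (?g n x)) \<longlonglongrightarrow> ennreal (\<phi> x * D x)" by (rule tendsto_ennrealI)
  then show "ennreal (\<phi> x * D x) = liminf (\<lambda>n. ennreal (?g n x))"
   by (simp add: lim_imp_Liminf)
 qed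
 also have "\<dots> \<le> liminf (\<lambda>n. NINT x. ennreal (?g n x))"
  by (rule nn_integral_liminf) auto
 also have "\<dots> \<le> liminf (\<lambda>n. ennreal (2 * l n) + ?R)"
  by (rule Liminf_mono) (use key in auto)
 also have "\<dots> = ?R"
 proof -
  have "(\<lambda>n. ennreal (2 * l n) + ?R) \<longlonglongrightarrow> ennreal (2 * 0) + ?R"
   by (intro tendsto_add tendsto_ennrealI tendsto_mult l0 tendsto_const)
  then show ?thesis by (simp add: lim_imp_Liminf)
 qed
 finally show ?thesis .
qed

section \<open>Marginals of a density on R^3 and the Knothe map\<close>

lemma continuous_on_lint_param:
 fixes G :: "'a::metric_space \<Rightarrow> real \<Rightarrow> real"
 assumes c: "continuous_on UNIV (\<lambda>p. G (fst p) (snd p))"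
  and b: "\<And>a t. \<bar>G a t\<bar> \<le> w t" and w: "integrable lborel w"
 shows "continuous_on UNIV (\<lambda>a. LBINT t. G a t)"
 unfolding continuous_on_eq_continuous_at[OF open_UNIV] continuous_at_sequentially
proof (intro ballI allI impI)
 fix a and x :: "nat \<Rightarrow> 'a" assume x: "x \<longlonglongrightarrow> a"
 have gc: "continuous_on UNIV (\<lambda>t. G a t)" for a
  using continuous_on_compose2[OF c, of UNIV "\<lambda>t. (a, t)"] by (simp add: continuous_on_Pair)
 have m: "(\<lambda>t. G a t) \<in> borel_measurable lborel" for a
  using measurable_cont[OF gc] by simp
 have "(\<lambda>n. LBINT t. G (x n) t) \<longlonglongrightarrow> (LBINT t. G a t)"
 proof (rule integral_dominated_convergence[where w=w])
  show "AE t in lborel. (\<lambda>n. G (x n) t) \<longlonglongrightarrow> G a t"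
  proof (rule AE_I2)
   fix t
   have "(\<lambda>n. (\<lambda>p. G (fst p) (snd p)) (x n, t)) \<longlonglongrightarrow> (\<lambda>p. G (fst p) (snd p)) (a, t)"
    by (rule continuous_on_tendsto_compose[OF c tendsto_Pair[OF x tendsto_const]]) auto
   then show "(\<lambda>n. G (x n) t) \<longlonglongrightarrow> G a t" by simp
  qed
 qed (use m w b in auto)
 then show "((\<lambda>a. LBINT t. G a t) \<circ> x) \<longlonglongrightarrow> (LBINT t. G a t)" by (simp add: o_def)
qed

text \<open>The profile \<open>kern 1\<close>. A product of three copies is an integrable majorant
  that factorises, so integrating out one coordinate leaves a majorant of the same kind for the
  marginal.\<close>

definition lz :: "real \<Rightarrow> real" where "lz t = inverse (1 + t^2)"

lemma lz_pos: "lz t > 0" and lz_le1: "lz t \<le> 1"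
 unfolding lz_def using one_plus_sq_pos[of t] by (auto simp: inverse_le_1_iff)

lemma lz_int: "integrable lborel lz" unfolding lz_def by (rule integrable_inverse_1_plus_sq)

lemma lz_cont: "continuous_on A lz"
 unfolding lz_def using one_plus_sq_pos by (auto intro!: continuous_intros simp: less_imp_neq[symmetric])

lemma lz_lim: "(lz \<longlongrightarrow> 0) at_top" "(lz \<longlongrightarrow> 0) at_bot"
 unfolding lz_def by real_asymp+

locale density3 =
 fixes r :: "real \<Rightarrow> real \<Rightarrow> real \<Rightarrow> real" and C :: real
 assumes rc: "continuous_on UNIV (\<lambda>(x,y,z). r x y z)" and rpos: "\<And>x y z. r x y z > 0"
  and rb: "\<And>x y z. r x y z \<le> C * (lz x * lz y * lz z)"
begin

definition "r2 x y = (LBINT z. r x y z)"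
definition "r1 x = (LBINT y. r2 x y)"
definition "r0 = (LBINT x. r1 x)"

lemma C_pos: "C > 0"
proof -
 have "0 < C * (lz 0 * lz 0 * lz 0)" using rpos[of 0 0 0] rb[of 0 0 0] by linarith
 then show ?thesis using lz_pos[of 0] by (meson mult_pos_pos zero_less_mult_pos2)
qed

lemma lz3: "C * (lz x * lz y * lz z) \<le> C * (lz y * lz z)" "C * (lz y * lz z) \<le> C * lz z"
proof -
 have "lz x * (lz y * lz z) \<le> 1 * (lz y * lz z)"
  using lz_le1[of x] lz_pos[of y] lz_pos[of z] by (intro mult_right_mono) auto
 then show "C * (lz x * lz y * lz z) \<le> C * (lz y * lz z)" using C_pos by (simp add: mult.assoc)
 have "lz y * lz z \<le> 1 * lz z" using lz_le1[of y] lz_pos[of z] by (intro mult_right_mono) auto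
 then show "C * (lz y * lz z) \<le> C * lz z" using C_pos by simp
qed

lemma r_comp: "continuous_on S f \<Longrightarrow> continuous_on S g \<Longrightarrow> continuous_on S h \<Longrightarrow> continuous_on S (\<lambda>p. r (f p) (g p) (h p))"
 using continuous_on_compose2[OF rc, of S "\<lambda>p. (f p, g p, h p)"]
 by (simp add: continuous_on_Pair)

lemma r_bound: "r x y z \<le> C * lz z" using rb lz3 order_trans by metis

lemma r3_density: "pos_density (r x y)"
proof
 show c: "continuous_on UNIV (r x y)" by (rule r_comp) (auto intro!: continuous_intros)
 show "integrable lborel (r x y)"
  by (rule lintegrable_bound[of _ "\<lambda>z. C * lz z"])
    (use lz_int c r_bound rpos lz_pos C_pos in \<open>auto simp: measurable_cont less_imp_le abs_of_pos\<close>)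
qed (rule rpos)

definition "Hz = integral\<^sup>L lborel lz"

lemma Hz_pos: "Hz > 0"
 unfolding Hz_def using pos_density.tot_pos[of lz] pos_density.tot_def[of lz]
 by (simp add: pos_density_def lz_cont lz_pos lz_int)

lemma r2_pos: "r2 x y > 0"
 unfolding r2_def using pos_density.tot_pos[OF r3_density, of x y] pos_density.tot_def[OF r3_density, of x y] by simp

lemma r2_le: "r2 x y \<le> C * Hz * (lz x * lz y)"
proof -
 have "r2 x y \<le> (LBINT z. C * (lz x * lz y) * lz z)"
  unfolding r2_def using rb lz_int pos_density.int[OF r3_density]
  by (intro integral_mono) (auto simp: mult.assoc)
 then show ?thesis by (simp add: Hz_def algebra_simps)
qed

lemma r2_cont: "continuous_on UNIV (\<lambda>p. r2 (fst p) (snd p))"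
 unfolding r2_def
proof (rule continuous_on_lint_param[where w="\<lambda>z. C * lz z"])
 show "continuous_on UNIV (\<lambda>p. r (fst (fst p)) (snd (fst p)) (snd p))"
  by (rule r_comp) (intro continuous_intros)+
qed (use r_bound rpos lz_int in \<open>auto simp: abs_of_pos\<close>)

lemma r2_comp: "continuous_on S f \<Longrightarrow> continuous_on S g \<Longrightarrow> continuous_on S (\<lambda>p. r2 (f p) (g p))"
 using continuous_on_compose2[OF r2_cont, of S "\<lambda>p. (f p, g p)"] by (auto intro!: continuous_intros)

lemma r2_bound: "r2 x y \<le> C * Hz * lz y"
proof -
 have "lz x * lz y \<le> 1 * lz y" using lz_le1[of x] lz_pos[of y] by (intro mult_right_mono) auto
 then have "C * Hz * (lz x * lz y) \<le> C * Hz * lz y" using C_pos Hz_pos by simp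
 then show ?thesis using r2_le order_trans by blast
qed

lemma r2_density: "pos_density (r2 x)"
proof
 show c: "continuous_on UNIV (r2 x)" by (rule r2_comp) (auto intro!: continuous_intros)
 show "integrable lborel (r2 x)"
  by (rule lintegrable_bound[of _ "\<lambda>z. C * Hz * lz z"])
    (use lz_int c r2_bound r2_pos lz_pos C_pos Hz_pos in \<open>auto simp: measurable_cont less_imp_le abs_of_pos\<close>)
qed (rule r2_pos)

lemma r1_pos: "r1 x > 0"
 unfolding r1_def using pos_density.tot_pos[OF r2_density, of x] pos_density.tot_def[OF r2_density, of x] by simp

lemma r1_le: "r1 x \<le> C * Hz * Hz * lz x"
proof -
 have "r1 x \<le> (LBINT z. C * Hz * lz x * lz z)"
  unfolding r1_def using r2_le lz_int pos_density.int[OF r2_density]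
  by (intro integral_mono) (auto simp: mult.assoc)
 then show ?thesis by (simp add: Hz_def algebra_simps)
qed

lemma r1_cont: "continuous_on UNIV r1"
proof -
 have "continuous_on UNIV (\<lambda>x. LBINT y. r2 x y)"
 proof (rule continuous_on_lint_param[where w="\<lambda>z. C * Hz * lz z"])
  show "continuous_on UNIV (\<lambda>p. r2 (fst p) (snd p))" by (rule r2_cont)
 qed (use r2_bound r2_pos lz_int in \<open>auto simp: abs_of_pos\<close>)
 then show ?thesis by (simp add: r1_def[abs_def])
qed

lemma r1_density: "pos_density r1"
proof
 show "continuous_on UNIV r1" by (rule r1_cont)
 show "integrable lborel r1"
  by (rule lintegrable_bound[of _ "\<lambda>z. C * Hz * Hz * lz z"])
    (use lz_int r1_cont r1_le r1_pos lz_pos C_pos Hz_pos in \<open>auto simp: measurable_cont less_imp_le abs_of_pos\<close>)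
qed (rule r1_pos)

lemma r0_pos: "r0 > 0"
 unfolding r0_def using pos_density.tot_pos[OF r1_density] pos_density.tot_def[OF r1_density] by simp

text \<open>The exponents 2, 5/2, 3 are dictated by the target (1 + |x|^2)^(-3): integrating out a
  coordinate lowers the exponent by 1/2, and each conditional density becomes a \<open>kern\<close>
  after scaling the coordinate by the square root of 1 plus the squares of the earlier ones.
  \<open>T2\<close> and \<open>T3\<close> undo that scaling.\<close>

definition "Z1 = transport (kern 2) r1"
definition "Z2 x = transport (kern (5/2)) (r2 x)"
definition "Z3 x y = transport (kern 3) (r x y)"
definition "T1 = Z1"
definition "T2 x y = sqrt (1 + (Z1 x)^2) * Z2 x y"
definition "T3 x y z = sqrt ((1 + (Z1 x)^2) * (1 + (Z2 x y)^2)) * Z3 x y z"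
definition "D1 x = r1 x / r0 * (Kq 2 * (1 + (Z1 x)^2) powr 2)"
definition "D2 x y = sqrt (1 + (Z1 x)^2) * (r2 x y / r1 x * (Kq (5/2) * (1 + (Z2 x y)^2) powr (5/2)))"
definition "D3 x y z = sqrt ((1 + (Z1 x)^2) * (1 + (Z2 x y)^2)) * (r x y z / r2 x y * (Kq 3 * (1 + (Z3 x y z)^2) powr 3))"
definition "SS x y z = (1 + (Z1 x)^2) * (1 + (Z2 x y)^2) * (1 + (Z3 x y z)^2)"

lemma SS_eq: "SS x y z = 1 + (T1 x)^2 + (T2 x y)^2 + (T3 x y z)^2"
 unfolding SS_def T1_def T2_def T3_def by (simp add: power_mult_distrib add_nonneg_nonneg algebra_simps)

lemma dT1: "(T1 has_real_derivative D1 x) (at x)"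
 using transport_kern(1)[OF r1_density, of 2 x] unfolding D1_def T1_def Z1_def r0_def by simp
lemma dT2: "(T2 x has_real_derivative D2 x y) (at y)"
 using DERIV_cmult[OF transport_kern(1)[OF r2_density, of "5/2" x y]] unfolding D2_def T2_def[abs_def] Z2_def r1_def by simp
lemma dT3: "(T3 x y has_real_derivative D3 x y z) (at z)"
 using DERIV_cmult[OF transport_kern(1)[OF r3_density, of 3 x y z]] unfolding D3_def T3_def[abs_def] Z3_def r2_def by simp

lemma D_nonneg: "D1 x \<ge> 0" "D2 x y \<ge> 0" "D3 x y z \<ge> 0"
 unfolding D1_def D2_def D3_def using r0_pos r1_pos[of x] r2_pos[of x y] rpos[of x y z] Kq_pos[of 2] Kq_pos[of 3] Kq_pos[of "5/2"]
 by (auto intro!: mult_nonneg_nonneg simp: less_imp_le)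

text \<open>The left-hand side is the Jacobian determinant of the triangular map, hence source
  density over target density. The target density is the \<open>SS\<close> ^ (-3) profile divided by
  its mass, and \<open>r0\<close> normalises the source.\<close>

lemma DDD: "D1 x * D2 x y * D3 x y z = SS x y z^3 * (r x y z * (Kq 2 * Kq (5/2) * Kq 3) / r0)"
proof -
 define a b c where "a = 1 + (Z1 x)^2" and "b = 1 + (Z2 x y)^2" and "c = 1 + (Z3 x y z)^2"
 have p: "a > 0" "b > 0" "c > 0" unfolding a_def b_def c_def by (rule one_plus_sq_pos)+
 \<comment> \<open>The scaling factors in \<open>T2\<close> and \<open>T3\<close> supply exactly the
   missing half powers, so that each of the three factors ends with exponent 3.\<close>
 have e: "a powr 2 * sqrt a * sqrt (a * b) * b powr (5/2) * c powr 3 = (a * b * c)^3"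
 proof -
  have "a powr 2 * sqrt a * sqrt (a * b) * b powr (5/2) * c powr 3
   = (a powr 2 * a powr (1/2) * a powr (1/2)) * (b powr (1/2) * b powr (5/2)) * c powr 3"
   using p by (simp add: powr_half_sqrt real_sqrt_mult)
  also have "\<dots> = a powr 3 * b powr 3 * c powr 3" by (simp add: powr_add[symmetric])
  finally show ?thesis using p by (simp add: powr_numeral power_mult_distrib)
 qed
 have "D1 x * D2 x y * D3 x y z = (a powr 2 * sqrt a * sqrt (a * b) * b powr (5/2) * c powr 3) * (r x y z * (Kq 2 * Kq (5/2) * Kq 3) / r0)"
  unfolding D1_def D2_def D3_def a_def[symmetric] b_def[symmetric] c_def[symmetric]
  using r1_pos[of x] r2_pos[of x y] by (simp add: field_simps)
 then show ?thesis unfolding e by (simp only: SS_def a_def b_def c_def)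
qed

lemma Z1_cont: "isCont Z1 x"
 using DERIV_isCont[OF dT1] by (simp add: T1_def)

lemma cD: "isCont D1 x" "isCont (D2 x) y" "isCont (D3 x y) z"
proof -
 have z2: "isCont (Z2 x) y" unfolding Z2_def
  using transport_kern(1)[OF r2_density, of "5/2" x y] DERIV_isCont by fastforce
 have z3: "isCont (Z3 x y) z" unfolding Z3_def
  using transport_kern(1)[OF r3_density, of 3 x y z] DERIV_isCont by fastforce
 have c: "isCont r1 x" "isCont (r2 x) y" "isCont (r x y) z"
  using pos_density.cont[OF r1_density] pos_density.cont[OF r2_density] pos_density.cont[OF r3_density]
  by (auto simp: continuous_on_eq_continuous_at)
 show "isCont D1 x" unfolding D1_def[abs_def] using Z1_cont c r0_pos one_plus_sq_pos[of "Z1 x"]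
  by (intro continuous_intros) auto
 show "isCont (D2 x) y" unfolding D2_def[abs_def] using z2 c r1_pos[of x] one_plus_sq_pos[of "Z2 x y"]
  by (intro continuous_intros) auto
 show "isCont (D3 x y) z" unfolding D3_def[abs_def] using z3 c r2_pos[of x y] one_plus_sq_pos[of "Z3 x y z"]
  by (intro continuous_intros) auto
qed

lemma r_meas[measurable (raw)]:
 "f \<in> borel_measurable M \<Longrightarrow> g \<in> borel_measurable M \<Longrightarrow> h \<in> borel_measurable M \<Longrightarrow> (\<lambda>p. r (f p) (g p) (h p)) \<in> borel_measurable M"
proof -
 assume [measurable]: "f \<in> borel_measurable M" "g \<in> borel_measurable M" "h \<in> borel_measurable M"
 have [measurable]: "(\<lambda>(x,y,z). r x y z) \<in> borel_measurable (borel \<Otimes>\<^sub>M borel \<Otimes>\<^sub>M borel)"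
  unfolding borel_prod by (rule measurable_cont[OF rc])
 have "(\<lambda>p. (\<lambda>(x,y,z). r x y z) (f p, g p, h p)) \<in> borel_measurable M" by measurable
 then show ?thesis by simp
qed

text \<open>A sublevel set of the transport is, by \<open>transport_le_iff\<close>, a comparison of
  a distribution function with a constant after normalisation, and such integrals of jointly
  measurable functions are measurable in the parameter.\<close>

lemma transport_measurable:
 assumes k: "pos_density k" and q: "\<And>x. pos_density (q x)"
  and [measurable]: "(\<lambda>(p, t). q p t) \<in> borel_measurable (N \<Otimes>\<^sub>M borel)"
  and [measurable]: "f \<in> measurable M N" "g \<in> borel_measurable M"
 shows "(\<lambda>p. transport k (q (f p)) (g p)) \<in> borel_measurable M"
 unfolding borel_measurable_iff_le
proof
 fix t
 have tp: "transport_pair k (q x)" for x using k q by (simp add: transport_pair_def)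
 have "(\<lambda>x. (\<lambda>(p, t). q p t) (f (fst x), snd x)) \<in> borel_measurable (M \<Otimes>\<^sub>M borel)" by measurable
 then have [measurable]: "(\<lambda>x. q (f (fst x)) (snd x)) \<in> borel_measurable (M \<Otimes>\<^sub>M lborel)"
  by (simp cong: measurable_cong_sets sets_pair_measure_cong)
 have "cdf_of (q (f p)) (g p) = (LBINT t. (if t \<le> g p then q (f p) t else 0))" for p
  unfolding cdf_of_def by (rule lint_cong) auto
 then have [measurable]: "(\<lambda>p. cdf_of (q (f p)) (g p)) \<in> borel_measurable M"
  by simp
 have [measurable]: "(\<lambda>p. integral\<^sup>L lborel (q (f p))) \<in> borel_measurable M"
  by measurable
 have "{w \<in> space M. transport k (q (f w)) (g w) \<le> t} =
  {w \<in> space M. cdf_of (q (f w)) (g w) / integral\<^sup>L lborel (q (f w)) \<le> cdf_of k t / integral\<^sup>L lborel k}"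
  using transport_pair.transport_le_iff[OF tp] pos_density.tot_def[OF k] pos_density.tot_def[OF q] by simp
 then show "{w \<in> space M. transport k (q (f w)) (g w) \<le> t} \<in> sets M" by simp
qed

end

lemma amgm3:
 fixes x y z w :: real
 assumes "x \<ge> 0" "y \<ge> 0" "z \<ge> 0" "w^3 = x * y * z"
 shows "3 * w \<le> x + y + z"
proof (rule power_le_imp_le_base[of _ 2])
 \<comment> \<open>A certificate whose terms are visibly non-negative for non-negative x, y,
   z.\<close>
 have "(x + y + z)^3 - 27 * (x * y * z) = (x + y + z) * ((x - y)^2 + (y - z)^2 + (z - x)^2) / 2
   + 3 * (x * (y - z)^2 + y * (z - x)^2 + z * (x - y)^2)"
  by (simp add: power2_eq_square power3_eq_cube field_simps)
 also have "\<dots> \<ge> 0" using assms by (intro add_nonneg_nonneg mult_nonneg_nonneg divide_nonneg_nonneg) auto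
 finally show "(3 * w) ^ Suc 2 \<le> (x + y + z) ^ Suc 2" using assms(4) by (simp add: power_mult_distrib)
qed (use assms in auto)

text \<open>Three orders of integration, each with another coordinate innermost, for the
  one-dimensional integration by parts in that coordinate.\<close>

lemma nn_integral_real3:
 fixes F :: "real \<times> real \<times> real \<Rightarrow> ennreal"
 assumes [measurable]: "F \<in> borel_measurable borel"
 shows "(NINT p. F p) = (NINT x. NINT y. NINT z. F (x, y, z))"
  and "(NINT p. F p) = (NINT x. NINT z. NINT y. F (x, y, z))"
  and "(NINT p. F p) = (NINT y. NINT z. NINT x. F (x, y, z))"
proof -
 have m: "F \<in> borel_measurable (lborel \<Otimes>\<^sub>M lborel \<Otimes>\<^sub>M lborel)"
  unfolding lborel_prod using assms by simp
 have mx: "(\<lambda>q. F (x, q)) \<in> borel_measurable (lborel \<Otimes>\<^sub>M lborel)" for x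
  using measurable_Pair2[OF m, of x] by simp
 have fst1: "(NINT p. F p) = (NINT x. \<integral>\<^sup>+q. F (x, q) \<partial>(lborel \<Otimes>\<^sub>M lborel))"
  using sigma_finite_measure.nn_integral_fst[OF _ m] lborel_prod sigma_finite_lborel by metis
 show "(NINT p. F p) = (NINT x. NINT y. NINT z. F (x, y, z))"
  unfolding fst1 by (intro nn_integral_cong lborel.nn_integral_fst[symmetric] mx)
 show "(NINT p. F p) = (NINT x. NINT z. NINT y. F (x, y, z))"
  unfolding fst1 by (intro nn_integral_cong lborel_pair.nn_integral_snd[symmetric] mx)
 interpret p: pair_sigma_finite "lborel :: real measure" "lborel \<Otimes>\<^sub>M lborel :: (real \<times> real) measure"
  unfolding lborel_prod by (simp add: pair_sigma_finite_def sigma_finite_lborel)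
 have "(NINT p. F p) = (\<integral>\<^sup>+q. (NINT x. F (x, q)) \<partial>(lborel \<Otimes>\<^sub>M lborel))"
  using p.nn_integral_snd[OF m] unfolding lborel_prod by simp
 also have "\<dots> = (NINT y. NINT z. NINT x. F (x, y, z))"
  by (rule lborel.nn_integral_fst[symmetric]) (use m in measurable)
 finally show "(NINT p. F p) = (NINT y. NINT z. NINT x. F (x, y, z))" .
qed

context density3 begin

lemma r2_meas[measurable (raw)]:
 assumes [measurable]: "f \<in> borel_measurable M" "g \<in> borel_measurable M"
 shows "(\<lambda>p. r2 (f p) (g p)) \<in> borel_measurable M"
 unfolding r2_def by measurable

lemma r1_meas[measurable (raw)]:
 assumes [measurable]: "f \<in> borel_measurable M"
 shows "(\<lambda>p. r1 (f p)) \<in> borel_measurable M"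
 unfolding r1_def by measurable

lemma Z1_meas[measurable (raw)]:
 "f \<in> borel_measurable M \<Longrightarrow> (\<lambda>p. Z1 (f p)) \<in> borel_measurable M"
 unfolding Z1_def by (rule transport_measurable[OF pos_density_kern r1_density, where N=borel and f="\<lambda>_. 0"]) auto

lemma Z2_meas[measurable (raw)]:
 "f \<in> borel_measurable M \<Longrightarrow> g \<in> borel_measurable M \<Longrightarrow> (\<lambda>p. Z2 (f p) (g p)) \<in> borel_measurable M"
 unfolding Z2_def by (rule transport_measurable[OF pos_density_kern r2_density, where N=borel]) (auto simp: case_prod_unfold)

lemma Z3_meas[measurable (raw)]:
 "f \<in> borel_measurable M \<Longrightarrow> g \<in> borel_measurable M \<Longrightarrow> h \<in> borel_measurable M \<Longrightarrow> (\<lambda>p. Z3 (f p) (g p) (h p)) \<in> borel_measurable M"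
 unfolding Z3_def
 using transport_measurable[of "kern 3" "\<lambda>p. r (fst p) (snd p)" "borel \<Otimes>\<^sub>M borel" "\<lambda>p. (f p, g p)" M h]
 by (simp add: pos_density_kern r3_density case_prod_unfold)

text \<open>From the inside out, the conditional transports contribute 4/3, 3/2 and 2. As
  \<open>SS\<close> is 1 + |T|^2, the second moment of T is three times the mass
  \<open>r0\<close>.\<close>

lemma moment: "(NINT x. NINT y. NINT z. ennreal (r x y z * SS x y z)) = ennreal (4 * r0)"
proof -
 have nn: "0 \<le> (1 + (Z1 x)^2)" "0 \<le> (1 + (Z2 x y)^2)" "0 \<le> (1 + (Z3 x y z)^2)" for x y z by auto
 have "(NINT z. ennreal (r x y z * SS x y z)) = ennreal ((1 + (Z1 x)^2) * (1 + (Z2 x y)^2)) * ennreal (4 / 3 * r2 x y)" for x y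
 proof -
  have "(NINT z. ennreal (r x y z * SS x y z)) = (NINT z. ennreal ((1 + (Z1 x)^2) * (1 + (Z2 x y)^2)) * ennreal (r x y z * (1 + (Z3 x y z)^2)))"
   unfolding SS_def using nn rpos[of x y] by (intro nn_integral_cong) (subst ennreal_mult[symmetric], auto simp: less_imp_le algebra_simps)
  also have "\<dots> = ennreal ((1 + (Z1 x)^2) * (1 + (Z2 x y)^2)) * (NINT z. ennreal (r x y z * (1 + (Z3 x y z)^2)))"
   by (rule nn_integral_cmult) measurable
  also have "(NINT z. ennreal (r x y z * (1 + (Z3 x y z)^2))) = ennreal (LBINT z. r x y z * (1 + (Z3 x y z)^2))"
   using transport_kern(2)[OF r3_density, of 3 x y] rpos[of x y] nn
   by (intro nn_integral_eq_integral) (auto simp: Z3_def less_imp_le intro!: AE_I2 mult_nonneg_nonneg)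
  also have "(LBINT z. r x y z * (1 + (Z3 x y z)^2)) = 4 / 3 * r2 x y"
   using transport_kern(3)[OF r3_density, of 3 x y] by (simp add: Z3_def r2_def)
  finally show ?thesis .
 qed
 moreover have "(NINT y. ennreal ((1 + (Z1 x)^2) * (1 + (Z2 x y)^2)) * ennreal (4 / 3 * r2 x y)) = ennreal (1 + (Z1 x)^2) * ennreal (2 * r1 x)" for x
 proof -
  have "(NINT y. ennreal ((1 + (Z1 x)^2) * (1 + (Z2 x y)^2)) * ennreal (4 / 3 * r2 x y))
   = (NINT y. ennreal (4/3 * (1 + (Z1 x)^2)) * ennreal (r2 x y * (1 + (Z2 x y)^2)))"
   using nn r2_pos[of x] by (intro nn_integral_cong) (subst (1 2) ennreal_mult[symmetric], auto simp: less_imp_le algebra_simps)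
  also have "\<dots> = ennreal (4/3 * (1 + (Z1 x)^2)) * (NINT y. ennreal (r2 x y * (1 + (Z2 x y)^2)))"
   by (rule nn_integral_cmult) measurable
  also have "(NINT y. ennreal (r2 x y * (1 + (Z2 x y)^2))) = ennreal (LBINT y. r2 x y * (1 + (Z2 x y)^2))"
   using transport_kern(2)[OF r2_density, of "5/2" x] r2_pos[of x] nn
   by (intro nn_integral_eq_integral) (auto simp: Z2_def less_imp_le intro!: AE_I2 mult_nonneg_nonneg)
  also have "(LBINT y. r2 x y * (1 + (Z2 x y)^2)) = 3 / 2 * r1 x"
   using transport_kern(3)[OF r2_density, of "5/2" x] by (simp add: Z2_def r1_def)
  also have "ennreal (4/3 * (1 + (Z1 x)^2)) * ennreal (3 / 2 * r1 x) = ennreal (1 + (Z1 x)^2) * ennreal (2 * r1 x)"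
   using nn r1_pos[of x] by (subst (1 2) ennreal_mult[symmetric]) (auto simp: less_imp_le algebra_simps)
  finally show ?thesis .
 qed
 moreover have "(NINT x. ennreal (1 + (Z1 x)^2) * ennreal (2 * r1 x)) = ennreal (4 * r0)"
 proof -
  have "(NINT x. ennreal (1 + (Z1 x)^2) * ennreal (2 * r1 x))
   = (NINT x. 2 * ennreal (r1 x * (1 + (Z1 x)^2)))"
   using nn r1_pos by (intro nn_integral_cong) (subst ennreal_mult[symmetric], auto simp: less_imp_le algebra_simps ennreal_mult[symmetric] simp flip: ennreal_numeral)
  also have "\<dots> = 2 * (NINT x. ennreal (r1 x * (1 + (Z1 x)^2)))"
   by (rule nn_integral_cmult) measurable
  also have "(NINT x. ennreal (r1 x * (1 + (Z1 x)^2))) = ennreal (LBINT x. r1 x * (1 + (Z1 x)^2))"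
   using transport_kern(2)[OF r1_density, of 2] r1_pos nn
   by (intro nn_integral_eq_integral) (auto simp: Z1_def less_imp_le intro!: AE_I2 mult_nonneg_nonneg)
  also have "(LBINT x. r1 x * (1 + (Z1 x)^2)) = 2 * r0"
   using transport_kern(3)[OF r1_density, of 2] by (simp add: Z1_def r0_def)
  finally show ?thesis using r0_pos by (simp add: ennreal_mult[symmetric] flip: ennreal_numeral)
 qed
 ultimately show ?thesis by simp
qed

lemma nn_r: "(NINT x. NINT y. NINT z. ennreal (r x y z)) = ennreal r0"
proof -
 have "(NINT z. ennreal (r x y z)) = ennreal (r2 x y)" for x y
  unfolding r2_def by (rule nn_integral_eq_integral) (use pos_density.int[OF r3_density] rpos in \<open>auto simp: less_imp_le\<close>)
 moreover have "(NINT y. ennreal (r2 x y)) = ennreal (r1 x)" for x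
  unfolding r1_def by (rule nn_integral_eq_integral) (use pos_density.int[OF r2_density] r2_pos in \<open>auto simp: less_imp_le\<close>)
 moreover have "(NINT x. ennreal (r1 x)) = ennreal r0"
  unfolding r0_def by (rule nn_integral_eq_integral) (use pos_density.int[OF r1_density] r1_pos in \<open>auto simp: less_imp_le\<close>)
 ultimately show ?thesis by simp
qed

lemma T1_D1_meas[measurable (raw)]:
 assumes [measurable]: "f \<in> borel_measurable M"
 shows "(\<lambda>p. T1 (f p)) \<in> borel_measurable M" "(\<lambda>p. D1 (f p)) \<in> borel_measurable M"
 unfolding T1_def D1_def by measurable

lemma T2_D2_meas[measurable (raw)]:
 assumes [measurable]: "f \<in> borel_measurable M" "g \<in> borel_measurable M"
 shows "(\<lambda>p. T2 (f p) (g p)) \<in> borel_measurable M" "(\<lambda>p. D2 (f p) (g p)) \<in> borel_measurable M"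
 unfolding T2_def D2_def by measurable

lemma T3_D3_meas[measurable (raw)]:
 assumes [measurable]: "f \<in> borel_measurable M" "g \<in> borel_measurable M" "h \<in> borel_measurable M"
 shows "(\<lambda>p. T3 (f p) (g p) (h p)) \<in> borel_measurable M" "(\<lambda>p. D3 (f p) (g p) (h p)) \<in> borel_measurable M" "(\<lambda>p. SS (f p) (g p) (h p)) \<in> borel_measurable M"
 unfolding T3_def D3_def SS_def by measurable

end

text \<open>The Knothe map \<open>(T1, T2, T3)\<close> transports \<open>f^6\<close> to the extremal profile \<open>(1 + |x|^2) ^ (-3)\<close>; its Jacobian
 matrix is triangular, so the arithmetic-geometric mean inequality applies to the diagonal entries.\<close>

theorem knothe_sobolev:
 fixes f fx fy fz :: "real \<Rightarrow> real \<Rightarrow> real \<Rightarrow> real"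
 assumes cf: "continuous_on UNIV (\<lambda>(x,y,z). f x y z)"
  and cx: "continuous_on UNIV (\<lambda>(x,y,z). fx x y z)"
  and cy: "continuous_on UNIV (\<lambda>(x,y,z). fy x y z)"
  and cz: "continuous_on UNIV (\<lambda>(x,y,z). fz x y z)"
  and dx: "\<And>x y z. ((\<lambda>t. f t y z) has_real_derivative fx x y z) (at x)"
  and dy: "\<And>x y z. ((\<lambda>t. f x t z) has_real_derivative fy x y z) (at y)"
  and dz: "\<And>x y z. ((\<lambda>t. f x y t) has_real_derivative fz x y z) (at z)"
  and pos: "\<And>x y z. f x y z > 0"
  and bnd: "\<And>x y z. f x y z \<le> B * (lz x * lz y * lz z)"
  and A: "(NINT p. (case p of (x,y,z) \<Rightarrow> ennreal ((fx x y z)^2 + (fy x y z)^2 + (fz x y z)^2))) \<le> ennreal A" "A > 0"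
  and I: "ennreal I \<le> (NINT p. (case p of (x,y,z) \<Rightarrow> ennreal (f x y z^6)))"
 shows "27 * (Kq 2 * Kq (5/2) * Kq 3)^2 * I \<le> A^3"
proof -
 have Bpos: "B > 0"
 proof -
  have "0 < B * (lz 0 * lz 0 * lz 0)" using pos[of 0 0 0] bnd[of 0 0 0] by linarith
  then show ?thesis using lz_pos[of 0] by (meson mult_pos_pos zero_less_mult_pos2)
 qed
 have l3: "0 < lz x * lz y * lz z" "lz x * lz y * lz z \<le> 1" for x y z
  using lz_pos lz_le1 by (auto intro!: mult_pos_pos mult_le_one simp: less_imp_le)
 interpret density3 "\<lambda>x y z. f x y z^6" "B^6"
 proof
  show "continuous_on UNIV (\<lambda>(x, y, z). f x y z^6)"
   using continuous_on_power[OF cf, of 6] by (simp add: case_prod_unfold)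
  fix x y z
  have "f x y z^6 \<le> (B * (lz x * lz y * lz z))^6" using pos bnd by (intro power_mono) (auto simp: less_imp_le)
  also have "\<dots> = B^6 * (lz x * lz y * lz z)^6" by (rule power_mult_distrib)
  also have "\<dots> \<le> B^6 * (lz x * lz y * lz z)^1"
   using Bpos l3[of x y z] by (intro mult_left_mono power_decreasing) auto
  finally show "f x y z^6 \<le> B^6 * (lz x * lz y * lz z)" by simp
 qed (rule zero_less_power[OF pos])
 define N where "N = Kq 2 * Kq (5/2) * Kq 3"
 have Npos: "N > 0" unfolding N_def using Kq_pos[of 2] Kq_pos[of "5/2"] Kq_pos[of 3] by simp
 \<comment> \<open>\<beta>^3 is the constant of \<open>DDD\<close>, so the cube root of the Jacobian
   determinant is \<open>SS\<close> * f^2 * \<beta>. Multiplying the arithmetic-geometric mean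
   inequality by f^4 restores the weight f^6 of \<open>moment\<close>.\<close>
 define \<beta> where "\<beta> = (N / r0) powr (1/3)"
 have \<beta>: "\<beta> > 0" "\<beta>^3 = N / r0"
  using Npos r0_pos unfolding \<beta>_def by (auto simp: powr_power)
 have f_meas: "(\<lambda>p. g (a p) (b p) (c p)) \<in> borel_measurable M"
  if "continuous_on UNIV (\<lambda>(x,y,z). g x y z)" and [measurable]: "a \<in> borel_measurable M" "b \<in> borel_measurable M" "c \<in> borel_measurable M"
  for g :: "real \<Rightarrow> real \<Rightarrow> real \<Rightarrow> real" and a b c and M :: "(real \<times> real \<times> real) measure"
 proof -
  have [measurable]: "(\<lambda>(x,y,z). g x y z) \<in> borel_measurable (borel \<Otimes>\<^sub>M borel \<Otimes>\<^sub>M borel)"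
   unfolding borel_prod by (rule measurable_cont[OF that(1)])
  have "(\<lambda>p. (\<lambda>(x,y,z). g x y z) (a p, b p, c p)) \<in> borel_measurable M" by measurable
  then show ?thesis by simp
 qed
 note [measurable (raw)] = f_meas[OF cf] f_meas[OF cx] f_meas[OF cy] f_meas[OF cz]
 have [measurable]: "fst \<in> borel_measurable (borel :: (real \<times> real \<times> real) measure)"
  "(\<lambda>p. fst (snd p)) \<in> borel_measurable (borel :: (real \<times> real \<times> real) measure)"
  "(\<lambda>p. snd (snd p)) \<in> borel_measurable (borel :: (real \<times> real \<times> real) measure)"
  unfolding borel_prod[symmetric] by measurable
 let ?x = "\<lambda>p::real\<times>real\<times>real. fst p" and ?y = "\<lambda>p::real\<times>real\<times>real. fst (snd p)" and ?z = "\<lambda>p::real\<times>real\<times>real. snd (snd p)"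
 let ?f = "\<lambda>p. f (?x p) (?y p) (?z p)" and ?fx = "\<lambda>p. fx (?x p) (?y p) (?z p)"
  and ?fy = "\<lambda>p. fy (?x p) (?y p) (?z p)" and ?fz = "\<lambda>p. fz (?x p) (?y p) (?z p)"
 let ?T1 = "\<lambda>p. T1 (?x p)" and ?T2 = "\<lambda>p. T2 (?x p) (?y p)" and ?T3 = "\<lambda>p. T3 (?x p) (?y p) (?z p)"
 let ?D1 = "\<lambda>p. D1 (?x p)" and ?D2 = "\<lambda>p. D2 (?x p) (?y p)" and ?D3 = "\<lambda>p. D3 (?x p) (?y p) (?z p)"
 let ?S = "\<lambda>p. SS (?x p) (?y p) (?z p)"
 let ?e1 = "\<lambda>p. 4 * ?f p^3 * \<bar>?fx p\<bar> * \<bar>?T1 p\<bar>" and ?e2 = "\<lambda>p. 4 * ?f p^3 * \<bar>?fy p\<bar> * \<bar>?T2 p\<bar>" and ?e3 = "\<lambda>p. 4 * ?f p^3 * \<bar>?fz p\<bar> * \<bar>?T3 p\<bar>"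
 let ?q = "\<lambda>p. (?fx p)^2 + (?fy p)^2 + (?fz p)^2" and ?w = "\<lambda>p. ?f p^6 * ((?T1 p)^2 + (?T2 p)^2 + (?T3 p)^2)"
 let ?c1 = "\<lambda>p. ?f p^4 * ?D1 p" and ?c2 = "\<lambda>p. ?f p^4 * ?D2 p" and ?c3 = "\<lambda>p. ?f p^4 * ?D3 p"
 have mom: "(NINT p. ennreal (?f p^6 * ?S p)) = ennreal (4 * r0)"
  by (subst nn_integral_real3(1), measurable) (simp only: fst_conv snd_conv moment)
 have nr: "(NINT p. ennreal (?f p^6)) = ennreal r0"
  by (subst nn_integral_real3(1), measurable) (simp only: fst_conv snd_conv nn_r)
 have nT: "(NINT p. ennreal (?w p)) = ennreal (3 * r0)" (is "?X = _")
 proof -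
  have "ennreal (4 * r0) = (NINT p. ennreal (?f p^6) + ennreal (?w p))"
   unfolding mom[symmetric] SS_eq using pos
   by (intro nn_integral_cong) (subst ennreal_plus[symmetric], auto simp: less_imp_le algebra_simps)
  also have "\<dots> = ennreal r0 + ?X" unfolding nr[symmetric] by (rule nn_integral_add) measurable
  finally have e: "ennreal r0 + ?X = ennreal r0 + ennreal (3 * r0)"
   using r0_pos by (simp flip: ennreal_plus)
  then show ?thesis by (simp add: ennreal_add_left_cancel)
 qed
 have ibp: "(NINT t. ennreal (\<phi> t^4 * D t)) \<le> (NINT t. ennreal (4 * \<phi> t^3 * \<bar>\<phi>' t\<bar> * \<bar>T t\<bar>))"
  if "\<And>t. (\<phi> has_real_derivative \<phi>' t) (at t)" "\<And>t. isCont \<phi>' t" "\<And>t. \<phi> t > 0" "\<And>t. \<phi> t \<le> B * lz t"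
   "\<And>t. (T has_real_derivative D t) (at t)" "\<And>t. isCont D t" "\<And>t. D t \<ge> 0" for \<phi> \<phi>' T D :: "real \<Rightarrow> real"
 proof -
  have "(\<phi> \<longlongrightarrow> 0) at_top"
   by (rule tendsto_sandwich[of "\<lambda>_. 0" _ _ "\<lambda>t. B * lz t"])
     (use that(3,4) tendsto_mult[OF tendsto_const lz_lim(1), of B] in \<open>auto simp: less_imp_le\<close>)
  then have l1: "((\<lambda>t. \<phi> t^4) \<longlongrightarrow> 0) at_top" using tendsto_power[of \<phi> 0 at_top 4] by simp
  have "(\<phi> \<longlongrightarrow> 0) at_bot"
   by (rule tendsto_sandwich[of "\<lambda>_. 0" _ _ "\<lambda>t. B * lz t"])
     (use that(3,4) tendsto_mult[OF tendsto_const lz_lim(2), of B] in \<open>auto simp: less_imp_le\<close>)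
  then have l2: "((\<lambda>t. \<phi> t^4) \<longlongrightarrow> 0) at_bot" using tendsto_power[of \<phi> 0 at_bot 4] by simp
  have d: "((\<lambda>t. \<phi> t^4) has_real_derivative 4 * \<phi> t^3 * \<phi>' t) (at t)" for t
   using DERIV_power[OF that(1), of 4 t] by (simp add: ac_simps)
  have c: "isCont (\<lambda>t. 4 * \<phi> t^3 * \<phi>' t) t" for t
   using that(2) DERIV_isCont[OF that(1)] by (intro continuous_intros)
  have "(NINT t. ennreal (\<phi> t^4 * D t)) \<le> (NINT t. ennreal (\<bar>4 * \<phi> t^3 * \<phi>' t\<bar> * \<bar>T t\<bar>))"
   by (rule nn_ibp[OF d c _ l1 l2 that(5,6,7)]) auto
  then show ?thesis using that(3) by (simp add: abs_mult abs_of_pos)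
 qed
 have lzb: "f x y z \<le> B * lz x" "f x y z \<le> B * lz y" "f x y z \<le> B * lz z" for x y z
 proof -
  have l: "lz a * lz b \<le> 1" "lz a * lz b \<ge> 0" for a b using lz_le1 lz_pos by (auto intro!: mult_le_one simp: less_imp_le)
  have "(lz y * lz z) * lz x \<le> 1 * lz x" "(lz x * lz z) * lz y \<le> 1 * lz y" "(lz x * lz y) * lz z \<le> 1 * lz z"
   by (intro mult_right_mono l less_imp_le[OF lz_pos])+
  then have "lz x * lz y * lz z \<le> lz x" "lz x * lz y * lz z \<le> lz y" "lz x * lz y * lz z \<le> lz z" by (simp_all add: ac_simps)
  then have "B * (lz x * lz y * lz z) \<le> B * lz x" "B * (lz x * lz y * lz z) \<le> B * lz y" "B * (lz x * lz y * lz z) \<le> B * lz z"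
   using Bpos by simp_all
  then show "f x y z \<le> B * lz x" "f x y z \<le> B * lz y" "f x y z \<le> B * lz z" using bnd[of x y z] by linarith+
 qed
 have slice: "isCont (\<lambda>t. g t y z) x" "isCont (\<lambda>t. g x t z) y" "isCont (\<lambda>t. g x y t) z"
  if "continuous_on UNIV (\<lambda>(x,y,z). g x y z)" for g :: "real \<Rightarrow> real \<Rightarrow> real \<Rightarrow> real" and x y z
 proof -
  have c: "isCont (\<lambda>(x,y,z). g x y z) p" for p
   using that[unfolded continuous_on_eq_continuous_at[OF open_UNIV]] by blast
  show "isCont (\<lambda>t. g t y z) x" using isCont_o2[of x "\<lambda>t. (t, y, z)", OF _ c] by simp
  show "isCont (\<lambda>t. g x t z) y" using isCont_o2[of y "\<lambda>t. (x, t, z)", OF _ c] by simp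
  show "isCont (\<lambda>t. g x y t) z" using isCont_o2[of z "\<lambda>t. (x, y, t)", OF _ c] by simp
 qed
 have I1: "(NINT p. ennreal (?c1 p)) \<le> (NINT p. ennreal (?e1 p))"
  apply (subst (1 2) nn_integral_real3(3), unfold borel_prod[symmetric], measurable)
  unfolding fst_conv snd_conv by (intro nn_integral_mono ibp dx slice(1)[OF cx] dT1 cD D_nonneg lzb pos)
 have I2: "(NINT p. ennreal (?c2 p)) \<le> (NINT p. ennreal (?e2 p))"
  apply (subst (1 2) nn_integral_real3(2), unfold borel_prod[symmetric], measurable)
  unfolding fst_conv snd_conv by (intro nn_integral_mono ibp dy slice(2)[OF cy] dT2 cD D_nonneg lzb pos)
 have I3: "(NINT p. ennreal (?c3 p)) \<le> (NINT p. ennreal (?e3 p))"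
  apply (subst (1 2) nn_integral_real3(1), unfold borel_prod[symmetric], measurable)
  unfolding fst_conv snd_conv by (intro nn_integral_mono ibp dz slice(3)[OF cz] dT3 cD D_nonneg lzb pos)
 \<comment> \<open>The minimiser of 2 * l * A + 6 * r0 / l, the bound that Young's inequality with
   weight l leaves at the end of the chain.\<close>
 define l where "l = sqrt (3 * r0 / A)"
 have lpos: "l > 0" unfolding l_def using r0_pos A(2) by simp
 have young: "a * b \<le> l / 2 * a^2 + b^2 / (2 * l)" for a b :: real
 proof -
  have "0 \<le> (l * a - b)^2 / (2 * l)" using lpos by simp
  also have "\<dots> = l / 2 * a^2 + b^2 / (2 * l) - a * b" using lpos by (simp add: power2_eq_square field_simps)
  finally show ?thesis by simp
 qed
 have pw: "f x y z^6 * SS x y z * (3 * \<beta>) \<le> f x y z^4 * (D1 x + D2 x y + D3 x y z)" for x y z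
 proof -
  let ?g = "f x y z"
  have "(SS x y z * (?g^2 * \<beta>))^3 = SS x y z^3 * (?g^6 * \<beta>^3)" by (simp add: power_mult_distrib flip: power_mult)
  also have "\<dots> = D1 x * D2 x y * D3 x y z" unfolding DDD \<beta>(2) N_def by simp
  finally have "3 * (SS x y z * (?g^2 * \<beta>)) \<le> D1 x + D2 x y + D3 x y z" by (intro amgm3 D_nonneg)
  from mult_left_mono[OF this, of "?g^4"] pos[of x y z]
  have "?g^4 * (3 * (SS x y z * (?g^2 * \<beta>))) \<le> ?g^4 * (D1 x + D2 x y + D3 x y z)" by simp
  moreover have "?g^4 * (3 * (SS x y z * (?g^2 * \<beta>))) = (?g^4 * ?g^2) * SS x y z * (3 * \<beta>)" by (simp only: ac_simps)
  moreover have "?g^4 * ?g^2 = ?g^6" by (simp flip: power_add)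
  ultimately show ?thesis by simp
 qed
 have g3: "4 * ?f p^3 * a * \<bar>b\<bar> \<le> 2 * l * a^2 + 2 / l * (?f p^6 * b^2)" for p a b
 proof -
  have "a * (?f p^3 * \<bar>b\<bar>) \<le> l / 2 * a^2 + (?f p^3 * \<bar>b\<bar>)^2 / (2 * l)" by (rule young)
  also have "(?f p^3 * \<bar>b\<bar>)^2 = ?f p^6 * b^2" by (simp add: power_mult_distrib flip: power_mult)
  finally have "4 * (a * (?f p^3 * \<bar>b\<bar>)) \<le> 4 * (l / 2 * a^2 + ?f p^6 * b^2 / (2 * l))" by (rule mult_left_mono) simp
  also have "\<dots> = 2 * l * a^2 + 2 / l * (?f p^6 * b^2)" using lpos by (simp add: field_simps)
  finally show ?thesis by (simp add: ac_simps)
 qed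
 \<comment> \<open>The chain bounds 3 * \<beta> times the integral of f^6 * \<open>SS\<close> by the
   integral of f^4 times the trace of the Jacobian matrix, then by that of 4 * f^3 times the
   componentwise products of gradient and T, and finally by \<open>A\<close> and the second moment
   of T.\<close>
 have "ennreal (12 * r0 * \<beta>) = ennreal (3 * \<beta>) * ennreal (4 * r0)"
  using \<beta> r0_pos by (subst ennreal_mult[symmetric]) (auto simp: ac_simps)
 also have "\<dots> = (NINT p. ennreal (3 * \<beta>) * ennreal (?f p^6 * ?S p))"
  unfolding mom[symmetric] by (rule nn_integral_cmult[symmetric]) measurable
 also have "\<dots> \<le> (NINT p. ennreal (?c1 p) + ennreal (?c2 p) + ennreal (?c3 p))"
 proof (rule nn_integral_mono)
  fix p
  have "ennreal (3 * \<beta>) * ennreal (?f p^6 * ?S p) = ennreal (3 * \<beta> * (?f p^6 * ?S p))"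
   using \<beta> by (intro ennreal_mult'[symmetric]) auto
  also have "\<dots> \<le> ennreal (?c1 p + ?c2 p + ?c3 p)"
   using pw[of "?x p" "?y p" "?z p"] by (intro ennreal_leI) (simp add: algebra_simps)
  also have "\<dots> = ennreal (?c1 p) + ennreal (?c2 p) + ennreal (?c3 p)"
   by (simp add: D_nonneg)
  finally show "ennreal (3 * \<beta>) * ennreal (?f p^6 * ?S p) \<le> ennreal (?c1 p) + ennreal (?c2 p) + ennreal (?c3 p)" .
 qed
 also have "\<dots> = (NINT p. ennreal (?c1 p)) + (NINT p. ennreal (?c2 p)) + (NINT p. ennreal (?c3 p))"
  by (subst nn_integral_add, unfold measurable_lborel2 borel_prod[symmetric], measurable)+
 also have "\<dots> \<le> (NINT p. ennreal (?e1 p))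
  + (NINT p. ennreal (?e2 p)) + (NINT p. ennreal (?e3 p))"
  by (intro add_mono I1 I2 I3)
 also have "\<dots> = (NINT p. ennreal (?e1 p)
  + ennreal (?e2 p) + ennreal (?e3 p))"
  by (subst nn_integral_add, unfold measurable_lborel2 borel_prod[symmetric], measurable)+
 also have "\<dots> \<le> (NINT p. ennreal (2 * l) * ennreal (?q p)
   + ennreal (2 / l) * ennreal (?w p))"
 proof (rule nn_integral_mono)
  fix p
  have nn: "0 \<le> 4 * ?f p^3 * \<bar>a\<bar> * \<bar>b\<bar>" for a b using pos[of "?x p" "?y p" "?z p"] by simp
  have "ennreal (?e1 p) + ennreal (?e2 p) + ennreal (?e3 p)
   = ennreal (?e1 p + ?e2 p + ?e3 p)"
   by (simp only: ennreal_plus nn add_nonneg_nonneg)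
  also have "\<dots> \<le> ennreal (2 * l * (?q p) + 2 / l * (?w p))"
   using g3[of p "\<bar>?fx p\<bar>" "?T1 p"] g3[of p "\<bar>?fy p\<bar>" "?T2 p"] g3[of p "\<bar>?fz p\<bar>" "?T3 p"]
   by (intro ennreal_leI) (simp only: distrib_left power2_abs)
  also have "\<dots> = ennreal (2 * l * (?q p)) + ennreal (2 / l * (?w p))"
   using lpos by (intro ennreal_plus mult_nonneg_nonneg add_nonneg_nonneg) auto
  also have "\<dots> = ennreal (2 * l) * ennreal (?q p)
   + ennreal (2 / l) * ennreal (?w p)"
   using lpos by (subst (1 2) ennreal_mult') auto
  finally show "ennreal (?e1 p) + ennreal (?e2 p) + ennreal (?e3 p)
   \<le> ennreal (2 * l) * ennreal (?q p)
   + ennreal (2 / l) * ennreal (?w p)" .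
 qed
 also have "\<dots> = ennreal (2 * l) * (NINT p. ennreal (?q p))
   + ennreal (2 / l) * ?X"
  by (subst nn_integral_add, unfold measurable_lborel2 borel_prod[symmetric], measurable, (subst nn_integral_cmult, unfold measurable_lborel2 borel_prod[symmetric], measurable)+)
 also have "\<dots> \<le> ennreal (2 * l) * ennreal A + ennreal (2 / l) * ennreal (3 * r0)"
  unfolding nT using A(1) by (intro add_mono mult_left_mono) (auto simp: case_prod_unfold)
 also have "\<dots> = ennreal (2 * l * A + 2 / l * (3 * r0))"
 proof -
  have "0 \<le> 2 * l" "0 \<le> 2 / l" "0 \<le> A" "0 \<le> 3 * r0" using lpos A(2) r0_pos by auto
  then show ?thesis by (simp only: ennreal_mult[symmetric] ennreal_plus[symmetric] mult_nonneg_nonneg)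
 qed
 finally have "12 * r0 * \<beta> \<le> 2 * l * A + 2 / l * (3 * r0)"
  using lpos A(2) r0_pos by (subst (asm) ennreal_le_iff) auto
 also have "\<dots> = 4 * sqrt (3 * r0 * A)"
 proof -
  have l2: "l * l * A = 3 * r0" unfolding l_def using A(2) r0_pos by simp
  have "l * A = sqrt (3 * r0 * A)"
   by (rule real_sqrt_unique[symmetric]) (use l2 lpos A(2) in \<open>auto simp: power2_eq_square\<close>)
  moreover have "3 * r0 / l = l * A" using l2 lpos by (simp add: field_simps)
  ultimately show ?thesis by simp
 qed
 finally have "3 * r0 * \<beta> \<le> sqrt (3 * r0 * A)" by (simp add: ac_simps)
 then have "(3 * r0 * \<beta>)^2 \<le> (sqrt (3 * r0 * A))^2" using r0_pos \<beta> by (intro power_mono) auto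
 also have "\<dots> = 3 * r0 * A" using r0_pos A(2) by simp
 finally have "(3 * r0) * (3 * r0 * \<beta>^2) \<le> (3 * r0) * A" by (simp add: power2_eq_square algebra_simps)
 then have "3 * r0 * \<beta>^2 \<le> A" using r0_pos by (simp add: ac_simps)
 then have "(3 * r0 * \<beta>^2)^3 \<le> A^3" using r0_pos by (intro power_mono) auto
 moreover have "(3 * r0 * \<beta>^2)^3 = 27 * r0^3 * (\<beta>^3)^2"
  by (simp add: power_mult_distrib flip: power_mult)
 moreover have "27 * r0^3 * (\<beta>^3)^2 = 27 * N^2 * r0"
  unfolding \<beta>(2) using r0_pos by (simp add: power2_eq_square power3_eq_cube)
 moreover have "I \<le> r0" using I nr r0_pos by (simp add: case_prod_unfold)
 then have "27 * N^2 * I \<le> 27 * N^2 * r0" by (intro mult_left_mono) auto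
 ultimately show ?thesis unfolding N_def by linarith
qed

section \<open>Test functions\<close>

lemma frechet_derivative_eqI: "(f has_derivative f') (at x) \<Longrightarrow> fd f x = f'"
 by (rule frechet_derivative_at[symmetric])

lemma frechet_has_derivative: "f differentiable (at x) \<Longrightarrow> (f has_derivative fd f x) (at x)"
 by (simp add: frechet_derivative_works)

lemma C_k_SucI:
 assumes "\<And>x. (f has_derivative f' x) (at x)" "\<And>i. i \<in> Basis \<Longrightarrow> C_k k (\<lambda>x. f' x i)"
 shows "C_k (Suc k) f"
proof -
 have "fd f x = f' x" for x by (rule frechet_derivative_eqI[OF assms(1)])
 moreover have "f differentiable (at x)" for x using assms(1) by (auto simp: differentiable_def)
 ultimately show ?thesis using assms(2) by simp
qed

lemma C_k_Suc_D:
 assumes "C_k (Suc k) f"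
 shows "(f has_derivative fd f x) (at x)" "i \<in> Basis \<Longrightarrow> C_k k (\<lambda>x. fd f x i)"
 using assms by (auto intro: frechet_has_derivative)

declare C_k.simps(2)[simp del]

lemma C_k_mono_Suc: "C_k (Suc k) f \<Longrightarrow> C_k k f"
proof (induction k arbitrary: f)
 case 0
 have "isCont f x" for x by (rule has_derivative_continuous[OF C_k_Suc_D(1)[OF 0]])
 then show ?case by (simp add: continuous_on_eq_continuous_at)
next
 case (Suc k)
 show ?case by (rule C_k_SucI[OF C_k_Suc_D(1)[OF Suc.prems]]) (rule Suc.IH[OF C_k_Suc_D(2)[OF Suc.prems]])
qed

lemma C_k_continuous: "C_k k f \<Longrightarrow> continuous_on UNIV f"
 by (induction k) (auto dest: C_k_mono_Suc)

lemma C_k_const: "C_k k (\<lambda>_. c)"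
proof (induction k arbitrary: c)
 case (Suc k)
 show ?case by (rule C_k_SucI[of _ "\<lambda>_ _. 0"]) (auto intro: Suc)
qed simp

lemma C_k_add: "C_k k f \<Longrightarrow> C_k k g \<Longrightarrow> C_k k (\<lambda>x. f x + g x)"
proof (induction k arbitrary: f g)
 case 0
 then show ?case by (simp add: continuous_on_add)
next
 case (Suc k)
 have d: "((\<lambda>x. f x + g x) has_derivative (\<lambda>h. fd f x h + fd g x h)) (at x)" for x
  by (intro has_derivative_add C_k_Suc_D(1)[OF Suc.prems(1)] C_k_Suc_D(1)[OF Suc.prems(2)])
 show ?case
  by (rule C_k_SucI[OF d], rule Suc.IH; rule C_k_Suc_D(2)[OF Suc.prems(1)] C_k_Suc_D(2)[OF Suc.prems(2)])
qed

lemma C_k_mult: "C_k k f \<Longrightarrow> C_k k g \<Longrightarrow> C_k k (\<lambda>x. f x * g x)"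
proof (induction k arbitrary: f g)
 case 0
 then show ?case by (simp add: continuous_on_mult)
next
 case (Suc k)
 have d: "((\<lambda>x. f x * g x) has_derivative (\<lambda>h. f x * fd g x h + fd f x h * g x)) (at x)" for x
  by (rule has_derivative_mult[OF C_k_Suc_D(1)[OF Suc.prems(1)] C_k_Suc_D(1)[OF Suc.prems(2)]])
 show ?case
 proof (rule C_k_SucI[OF d], rule C_k_add)
  fix i :: 'a assume i: "i \<in> Basis"
  show "C_k k (\<lambda>x. f x * fd g x i)"
   by (rule Suc.IH[OF C_k_mono_Suc[OF Suc.prems(1)] C_k_Suc_D(2)[OF Suc.prems(2) i]])
  show "C_k k (\<lambda>x. fd f x i * g x)"
   by (rule Suc.IH[OF C_k_Suc_D(2)[OF Suc.prems(1) i] C_k_mono_Suc[OF Suc.prems(2)]])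
 qed
qed

lemma C_k_prod: "finite I \<Longrightarrow> (\<And>i. i \<in> I \<Longrightarrow> C_k k (f i)) \<Longrightarrow> C_k k (\<lambda>x. \<Prod>i\<in>I. f i x)"
proof (induction I rule: finite_induct)
 case empty
 show ?case by (simp add: C_k_const)
next
 case (insert i I)
 have "C_k k (\<lambda>x. f i x * (\<Prod>i\<in>I. f i x))"
  by (rule C_k_mult) (use insert in auto)
 then show ?case using insert by simp
qed

lemma C_k_compose_affine:
 fixes f :: "'a::euclidean_space \<Rightarrow> real"
 shows "C_k k f \<Longrightarrow> C_k k (\<lambda>x. f (t *\<^sub>R x + y))"
proof (induction k arbitrary: f)
 case 0
 then have "continuous_on UNIV f" by simp
 then have "continuous_on UNIV (\<lambda>x. f (t *\<^sub>R x + y))"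
  by (rule continuous_on_compose2[of UNIV f]) (auto intro!: continuous_intros)
 then show ?case by simp
next
 case (Suc k)
 let ?D = "\<lambda>x. fd f x"
 have d: "((\<lambda>x. f (t *\<^sub>R x + y)) has_derivative (\<lambda>h. t * ?D (t *\<^sub>R x + y) h)) (at x)" for x
 proof -
  have "((\<lambda>x. f (t *\<^sub>R x + y)) has_derivative (\<lambda>h. ?D (t *\<^sub>R x + y) (t *\<^sub>R h))) (at x)"
   by (rule has_derivative_compose[of "\<lambda>x. t *\<^sub>R x + y" "\<lambda>h. t *\<^sub>R h", OF _ C_k_Suc_D(1)[OF Suc.prems]])
     (auto intro!: derivative_eq_intros)
  moreover have "linear (?D (t *\<^sub>R x + y))" using C_k_Suc_D(1)[OF Suc.prems] has_derivative_linear by blast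
  ultimately show ?thesis by (simp add: linear_scale)
 qed
 show ?case
  by (rule C_k_SucI[OF d]) (intro C_k_mult C_k_const Suc.IH C_k_Suc_D(2)[OF Suc.prems])
qed

lemma C_k_compose_inner:
 fixes h :: "real \<Rightarrow> real" and b :: "'a::euclidean_space"
 shows "C_k k h \<Longrightarrow> C_k k (\<lambda>x. h (x \<bullet> b))"
proof (induction k arbitrary: h)
 case 0
 then have "continuous_on UNIV h" by simp
 then have "continuous_on UNIV (\<lambda>x. h (x \<bullet> b))"
  by (rule continuous_on_compose2[of UNIV h]) (auto intro!: continuous_intros)
 then show ?case by simp
next
 case (Suc k)
 let ?D = "\<lambda>x. fd h x"
 have d: "((\<lambda>x. h (x \<bullet> b)) has_derivative (\<lambda>v. (v \<bullet> b) * ?D (x \<bullet> b) 1)) (at x)" for x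
 proof -
  have "((\<lambda>x. h (x \<bullet> b)) has_derivative (\<lambda>v. ?D (x \<bullet> b) (v \<bullet> b))) (at x)"
   by (rule has_derivative_compose[of "\<lambda>x. x \<bullet> b" "\<lambda>v. v \<bullet> b", OF _ C_k_Suc_D(1)[OF Suc.prems]])
     (auto intro!: derivative_eq_intros)
  moreover have "linear (?D (x \<bullet> b))" using C_k_Suc_D(1)[OF Suc.prems] has_derivative_linear by blast
  then have "?D (x \<bullet> b) v = v * ?D (x \<bullet> b) 1" for v
   using linear_scale[of "?D (x \<bullet> b)" v 1] by simp
  then have "(\<lambda>v. ?D (x \<bullet> b) (v \<bullet> b)) = (\<lambda>v. (v \<bullet> b) * ?D (x \<bullet> b) 1)" by blast
  ultimately show ?thesis by (simp only:)
 qed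
 show ?case
  by (rule C_k_SucI[OF d]) (intro C_k_mult C_k_const Suc.IH C_k_Suc_D(2)[OF Suc.prems], simp)
qed

section \<open>Smooth bump functions on boxes\<close>

definition eflat :: "real \<Rightarrow> nat \<Rightarrow> real \<Rightarrow> real" where
 "eflat c n t = (if t > 0 then inverse t^n * exp (- c / t) else 0)"

text \<open>The powers of 1 / t are carried along because they make the family closed under
  differentiation, so smoothness follows by induction. The parameter c stays free: letting it tend
  to 0 turns bumps into box indicators.\<close>

lemma eflat_deriv:
 assumes c: "c > 0"
 shows "(eflat c n has_real_derivative (c * eflat c (n + 2) t - real n * eflat c (n + 1) t)) (at t)"
proof -
 consider "t < 0" | "t = 0" | "t > 0" by linarith
 then show ?thesis
 proof cases
  case 1
  have "(eflat c n has_real_derivative 0) (at t)"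
   by (rule has_field_derivative_transform_within_open[of "\<lambda>_. 0" _ _ "{..<0}"]) (use 1 in \<open>auto simp: eflat_def\<close>)
  then show ?thesis using 1 by (simp add: eflat_def)
 next
  case 3
  have d1: "((\<lambda>t. inverse t^n) has_real_derivative - (real n * inverse t ^ (n + 1))) (at t)"
  proof -
   have "((\<lambda>t. inverse t^n) has_real_derivative real n * (- (inverse t ^ Suc (Suc 0)) * inverse t ^ (n - Suc 0))) (at t)"
    by (rule DERIV_power[OF DERIV_inverse]) (use 3 in simp)
   also have "real n * (- (inverse t ^ Suc (Suc 0)) * inverse t ^ (n - Suc 0)) = - (real n * inverse t ^ (n + 1))"
    by (cases n) simp_all
   finally show ?thesis .
  qed
  have "((\<lambda>t. - c * inverse t) has_real_derivative c * inverse t^2) (at t)"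
   using DERIV_cmult[OF DERIV_inverse[of t], of "- c"] 3 by (simp add: power2_eq_square)
  from DERIV_mult[OF d1 DERIV_chain2[OF DERIV_exp this]]
  have "((\<lambda>t. inverse t^n * exp (- c / t)) has_real_derivative
    - (real n * inverse t ^ (n + 1)) * exp (- c / t) + exp (- c / t) * (c * inverse t^2) * inverse t^n) (at t)"
   by (simp only: divide_inverse)
  also have "- (real n * inverse t ^ (n + 1)) * exp (- c / t) + exp (- c / t) * (c * inverse t^2) * inverse t^n
   = c * eflat c (n + 2) t - real n * eflat c (n + 1) t"
   using 3 by (simp only: eflat_def if_True power_add) (simp add: algebra_simps)
  finally have "((\<lambda>t. inverse t^n * exp (- c / t)) has_real_derivative (c * eflat c (n + 2) t - real n * eflat c (n + 1) t)) (at t)" .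
  then show ?thesis
   by (rule has_field_derivative_transform_within_open[of _ _ _ "{0<..}"]) (use 3 in \<open>auto simp: eflat_def\<close>)
 next
  case 2
  \<comment> \<open>At the junction the substitution x = 1 / h turns the quotient into a power of x
    over exp (c * x).\<close>
  have lim: "((\<lambda>h. eflat c n h / h) \<longlongrightarrow> 0) (at_right 0)"
  proof -
   have "filterlim (\<lambda>x. c * x) at_top at_top" using c by (rule filterlim_tendsto_pos_mult_at_top[OF tendsto_const _ filterlim_ident])
   from filterlim_compose[OF tendsto_power_div_exp_0[of "Suc n"] this]
   have "((\<lambda>x. (c * x) ^ Suc n / exp (c * x)) \<longlongrightarrow> 0) at_top" .
   from tendsto_mult[OF tendsto_const this, of "inverse (c ^ Suc n)"]
   have "((\<lambda>x. inverse (c ^ Suc n) * ((c * x) ^ Suc n / exp (c * x))) \<longlongrightarrow> 0) at_top" by simp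
   then have "((\<lambda>x. eflat c n (inverse x) / inverse x) \<longlongrightarrow> 0) at_top"
   proof (rule Lim_transform_eventually)
    show "\<forall>\<^sub>F x in at_top. inverse (c ^ Suc n) * ((c * x) ^ Suc n / exp (c * x)) = eflat c n (inverse x) / inverse x"
     using eventually_gt_at_top[of 0]
    proof eventually_elim
     case (elim x)
     have "exp (- c / inverse x) = inverse (exp (c * x))" using elim by (simp add: divide_inverse exp_minus)
     moreover have "inverse (c ^ Suc n) * ((c * x) ^ Suc n / exp (c * x)) = x ^ Suc n * inverse (exp (c * x))"
      using c by (simp add: power_mult_distrib field_simps)
     ultimately show ?case using elim c by (simp add: eflat_def divide_inverse)
    qed
   qed
   then show ?thesis unfolding filterlim_at_right_to_top .
  qed
  moreover have "((\<lambda>h. eflat c n h / h) \<longlongrightarrow> 0) (at_left 0)"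
   by (rule tendsto_eventually) (auto simp: eflat_def eventually_at_left_field intro: exI[of _ "-1"])
  ultimately have "((\<lambda>h. eflat c n h / h) \<longlongrightarrow> 0) (at 0)" by (simp add: filterlim_split_at)
  then have "DERIV (eflat c n) 0 :> 0" unfolding DERIV_def by (simp add: eflat_def)
  then show ?thesis using 2 by (simp add: eflat_def)
 qed
qed

lemma C_k_eflat: "c > 0 \<Longrightarrow> C_k k (eflat c n)"
proof (induction k arbitrary: n)
 case 0
 then show ?case using DERIV_isCont[OF eflat_deriv] by (simp add: continuous_on_eq_continuous_at)
next
 case (Suc k)
 show ?case
 proof (rule C_k_SucI[of _ "\<lambda>x. (*) (c * eflat c (n + 2) x - real n * eflat c (n + 1) x)"])
  show "(eflat c n has_derivative (*) (c * eflat c (n + 2) x - real n * eflat c (n + 1) x)) (at x)" for x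
   using eflat_deriv[OF Suc.prems] unfolding has_field_derivative_def .
  have "C_k k (\<lambda>x. (c * eflat c (n + 2) x + (- real n) * eflat c (n + 1) x) * i)" for i
   by (intro C_k_mult C_k_add C_k_const Suc.IH Suc.prems)
  then show "C_k k (\<lambda>x. (c * eflat c (n + 2) x - real n * eflat c (n + 1) x) * i)" for i by simp
 qed
qed

definition bump :: "real \<Rightarrow> 'a::euclidean_space \<Rightarrow> 'a \<Rightarrow> 'a \<Rightarrow> real" where
 "bump c a b x = (\<Prod>i\<in>Basis. eflat c 0 (x \<bullet> i - a \<bullet> i) * eflat c 0 (b \<bullet> i - x \<bullet> i))"

lemma C_k_bump: "c > 0 \<Longrightarrow> C_k k (bump c a b)"
proof -
 assume c: "c > 0"
 have "C_k k (\<lambda>t. eflat c 0 (1 *\<^sub>R t + (- a \<bullet> i)))" "C_k k (\<lambda>t. eflat c 0 ((-1) *\<^sub>R t + (b \<bullet> i)))" for i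
  by (intro C_k_compose_affine C_k_eflat c)+
 then have "C_k k (\<lambda>x. eflat c 0 (x \<bullet> i - a \<bullet> i))" "C_k k (\<lambda>x. eflat c 0 (b \<bullet> i - x \<bullet> i))" for i
  using C_k_compose_inner[of k "\<lambda>t. eflat c 0 (1 *\<^sub>R t + (- a \<bullet> i))" i] C_k_compose_inner[of k "\<lambda>t. eflat c 0 ((-1) *\<^sub>R t + (b \<bullet> i))" i]
  by simp_all
 then show ?thesis unfolding bump_def[abs_def] by (intro C_k_prod C_k_mult) auto
qed

lemma eflat0: "eflat c 0 t = (if t > 0 then exp (- c / t) else 0)"
 by (simp add: eflat_def)

lemma eflat_bounds: "c > 0 \<Longrightarrow> 0 \<le> eflat c 0 t" "c > 0 \<Longrightarrow> eflat c 0 t \<le> 1" by (auto simp: eflat0)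

lemma bump_nonneg: "c > 0 \<Longrightarrow> 0 \<le> bump c a b x" and bump_le1: "c > 0 \<Longrightarrow> bump c a b x \<le> 1"
 unfolding bump_def by (auto intro!: prod_nonneg prod_le_1 mult_nonneg_nonneg mult_le_one eflat_bounds)

lemma bump_pos_iff:
 fixes x :: "'a::euclidean_space"
 shows "c > 0 \<Longrightarrow> bump c a b x > 0 \<longleftrightarrow> x \<in> box a b"
proof
 assume c: "c > 0"
 assume "bump c a b x > 0"
 show "x \<in> box a b"
  unfolding mem_box
 proof (rule ballI, rule ccontr)
  fix i :: 'a assume i: "i \<in> Basis" and "\<not> (a \<bullet> i < x \<bullet> i \<and> x \<bullet> i < b \<bullet> i)"
  then have "eflat c 0 (x \<bullet> i - a \<bullet> i) * eflat c 0 (b \<bullet> i - x \<bullet> i) = 0" by (auto simp: eflat0)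
  then have "bump c a b x = 0" unfolding bump_def using i by (intro prod_zero) auto
  then show False using \<open>bump c a b x > 0\<close> by simp
 qed
next
 assume "x \<in> box a b" then show "bump c a b x > 0"
  unfolding bump_def by (intro prod_pos mult_pos_pos) (auto simp: mem_box eflat0)
qed

lemma bump_support: "c > 0 \<Longrightarrow> x \<notin> box a b \<Longrightarrow> bump c a b x = 0"
 using bump_pos_iff[of c a b x] bump_nonneg[of c a b x] by linarith

lemma test_functionI:
 assumes "\<And>k. C_k k \<phi>" and K: "compact K" and "\<And>x. x \<notin> K \<Longrightarrow> \<phi> x = 0"
 shows "test_function \<phi>"
 unfolding test_function_def
proof
 have "{x. \<phi> x \<noteq> 0} \<subseteq> K" using assms(3) by auto
 then have "closure {x. \<phi> x \<noteq> 0} \<subseteq> K" by (intro closure_minimal compact_imp_closed K)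
 then show "compact (closure {x. \<phi> x \<noteq> 0})"
  using compact_Int_closed[OF K, of "closure {x. \<phi> x \<noteq> 0}"] by (simp add: Int_absorb1)
qed (use assms(1) in blast)

lemma test_function_bump: "c > 0 \<Longrightarrow> test_function (bump c a b)"
 by (rule test_functionI[of _ "cbox a b"]) (use box_subset_cbox[of a b] bump_support[of c _ a b] in \<open>auto intro: C_k_bump\<close>)

lemma test_function_C_k: "test_function \<phi> \<Longrightarrow> C_k k \<phi>"
 by (simp add: test_function_def)

lemma test_function_continuous: "test_function \<phi> \<Longrightarrow> continuous_on UNIV \<phi>"
 using test_function_C_k C_k_continuous by blast

lemma test_function_deriv: "test_function \<phi> \<Longrightarrow> (\<phi> has_derivative fd \<phi> x) (at x)"
 using C_k_Suc_D(1)[OF test_function_C_k] by blast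

lemma test_function_deriv_cont: "test_function \<phi> \<Longrightarrow> i \<in> Basis \<Longrightarrow> continuous_on UNIV (\<lambda>x. fd \<phi> x i)"
 using C_k_Suc_D(2)[OF test_function_C_k] C_k_continuous by blast

lemma test_function_support:
 assumes "test_function \<phi>"
 obtains K where "compact K" "\<And>x. x \<notin> K \<Longrightarrow> \<phi> x = 0" "\<And>x. x \<notin> K \<Longrightarrow> fd \<phi> x = (\<lambda>_. 0)"
proof
 let ?K = "closure {x. \<phi> x \<noteq> 0}"
 show "compact ?K" using assms by (simp add: test_function_def)
 show z: "x \<notin> ?K \<Longrightarrow> \<phi> x = 0" for x using closure_subset[of "{x. \<phi> x \<noteq> 0}"] by auto
 fix x assume x: "x \<notin> ?K"
 have "(\<phi> has_derivative (\<lambda>_. 0)) (at x)"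
 proof (rule has_derivative_transform_within_open)
  show "((\<lambda>_. 0) has_derivative (\<lambda>_. 0)) (at x)" by (rule has_derivative_const)
  show "open (- ?K)" by (rule open_Compl[OF closed_closure])
  show "x \<in> - ?K" using x by simp
  show "0 = \<phi> y" if "y \<in> - ?K" for y using z[OF ComplD[OF that]] by (rule sym)
 qed
 then show "fd \<phi> x = (\<lambda>_. 0)" by (rule frechet_derivative_eqI)
qed

lemma test_function_mult:
 assumes "test_function \<phi>" "\<And>k. C_k k \<zeta>" shows "test_function (\<lambda>x. \<zeta> x * \<phi> x)"
proof -
 obtain K where "compact K" "\<And>x. x \<notin> K \<Longrightarrow> \<phi> x = 0" using test_function_support[OF assms(1)] by metis
 then show ?thesis
  by (intro test_functionI[of _ K]) (auto intro: C_k_mult assms(2) test_function_C_k[OF assms(1)])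
qed

lemma test_function_affine:
 fixes \<phi> :: "'a::euclidean_space \<Rightarrow> real"
 assumes "test_function \<phi>" and t: "t \<noteq> 0" shows "test_function (\<lambda>x. \<phi> (t *\<^sub>R x + y))"
proof -
 obtain K where K: "compact K" "\<And>x. x \<notin> K \<Longrightarrow> \<phi> x = 0" using test_function_support[OF assms(1)] by metis
 show ?thesis
 proof (rule test_functionI[of _ "(\<lambda>z. (1/t) *\<^sub>R (z - y)) ` K"])
  show "compact ((\<lambda>z. (1 / t) *\<^sub>R (z - y)) ` K)"
   by (intro compact_continuous_image K continuous_intros)
  show "C_k k (\<lambda>x. \<phi> (t *\<^sub>R x + y))" for k by (rule C_k_compose_affine[OF test_function_C_k[OF assms(1)]])
  fix x assume "x \<notin> (\<lambda>z. (1 / t) *\<^sub>R (z - y)) ` K"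
  moreover have "x = (1 / t) *\<^sub>R ((t *\<^sub>R x + y) - y)" using t by simp
  ultimately show "\<phi> (t *\<^sub>R x + y) = 0" using K(2) by blast
 qed
qed

lemma frechet_affine:
 fixes \<phi> :: "'a::euclidean_space \<Rightarrow> real"
 assumes "test_function \<phi>"
 shows "frechet_derivative (\<lambda>x. \<phi> (t *\<^sub>R x + y)) (at x) i = t * fd \<phi> (t *\<^sub>R x + y) i"
proof -
 let ?D = "fd \<phi> (t *\<^sub>R x + y)"
 have "((\<lambda>x. \<phi> (t *\<^sub>R x + y)) has_derivative (\<lambda>h. ?D (t *\<^sub>R h))) (at x)"
  by (rule has_derivative_compose[of "\<lambda>x. t *\<^sub>R x + y" "\<lambda>h. t *\<^sub>R h", OF _ test_function_deriv[OF assms]])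
    (auto intro!: derivative_eq_intros)
 moreover have "linear ?D" using test_function_deriv[OF assms] has_derivative_linear by blast
 ultimately show ?thesis by (simp add: frechet_derivative_eqI linear_scale)
qed

lemma bounded_of_compact_support:
 fixes f :: "'a::euclidean_space \<Rightarrow> real"
 assumes c: "continuous_on UNIV f" and K: "compact K" "\<And>x. x \<notin> K \<Longrightarrow> f x = 0"
 obtains B where "B > 0" "\<And>x. \<bar>f x\<bar> \<le> B * indicator K x"
proof -
 have "bounded (f ` K)" by (intro compact_imp_bounded compact_continuous_image continuous_on_subset[OF c] K) auto
 then obtain B where "B > 0" "\<And>x. x \<in> K \<Longrightarrow> \<bar>f x\<bar> \<le> B" by (auto simp: bounded_pos)
 then show ?thesis using K(2) by (intro that[of B]) (auto simp: indicator_def)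
qed

lemma test_function_bounds:
 fixes \<phi> :: "'a::euclidean_space \<Rightarrow> real"
 assumes "test_function \<phi>"
 obtains K B where "compact K" "B > 0" "\<And>x. \<bar>\<phi> x\<bar> \<le> B * indicator K x" "\<And>x i. i \<in> Basis \<Longrightarrow> \<bar>fd \<phi> x i\<bar> \<le> B * indicator K x"
proof -
 obtain K where K: "compact K" "\<And>x. x \<notin> K \<Longrightarrow> \<phi> x = 0" "\<And>x. x \<notin> K \<Longrightarrow> fd \<phi> x = (\<lambda>_. 0)"
  using test_function_support[OF assms] by metis
 obtain B where B: "B > 0" "\<And>x. \<bar>\<phi> x\<bar> \<le> B * indicator K x"
  using bounded_of_compact_support[OF test_function_continuous[OF assms] K(1,2)] by metis
 have "\<forall>i\<in>Basis. \<exists>B>0. \<forall>x. \<bar>fd \<phi> x i\<bar> \<le> B * indicator K x"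
 proof
  fix i :: 'a assume "i \<in> Basis"
  from bounded_of_compact_support[OF test_function_deriv_cont[OF assms this] K(1)] K(3)
  show "\<exists>B>0. \<forall>x. \<bar>fd \<phi> x i\<bar> \<le> B * indicator K x" by metis
 qed
 then obtain B' where B': "\<And>i. i \<in> Basis \<Longrightarrow> B' i > 0" "\<And>i x. i \<in> Basis \<Longrightarrow> \<bar>fd \<phi> x i\<bar> \<le> B' i * indicator K x"
  by metis
 let ?B = "B + (\<Sum>i\<in>Basis. B' i)"
 have le: "B' i \<le> ?B" if "i \<in> Basis" for i
  using member_le_sum[of i Basis B'] that B'(1) B(1) by (auto simp: less_imp_le intro: add_increasing)
 have s: "0 \<le> (\<Sum>i\<in>Basis. B' i)" by (intro sum_nonneg) (auto simp: less_imp_le B')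
 show ?thesis
 proof (rule that[of K ?B])
  show "?B > 0" using B(1) s by linarith
  show "\<bar>\<phi> x\<bar> \<le> ?B * indicator K x" for x
   using B(2)[of x] s by (auto simp: indicator_def)
  show "\<bar>fd \<phi> x i\<bar> \<le> ?B * indicator K x" if "i \<in> Basis" for x i
   using B'(2)[OF that, of x] le[OF that] by (auto simp: indicator_def)
 qed (rule K(1))
qed

section \<open>Fundamental lemma of the calculus of variations\<close>

lemma bump_tendsto_indicator:
 "(\<lambda>n. bump (inverse (real (Suc n))) a b x) \<longlonglongrightarrow> indicator (box a b) x"
proof (cases "x \<in> box a b")
 case False
 then show ?thesis by (simp add: bump_support)
next
 case True
 have e: "(\<lambda>n. eflat (inverse (real (Suc n))) 0 t) \<longlonglongrightarrow> 1" if "t > 0" for t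
 proof -
  have "(\<lambda>n. exp (- inverse (real (Suc n)) / t)) \<longlonglongrightarrow> exp (- 0 / t)"
   using that by (intro tendsto_intros LIMSEQ_inverse_real_of_nat) auto
  then show ?thesis using that by (simp add: eflat0)
 qed
 have "(\<lambda>n. bump (inverse (real (Suc n))) a b x) \<longlonglongrightarrow> (\<Prod>i\<in>(Basis::'a set). 1 * 1)"
  unfolding bump_def using True by (intro tendsto_prod tendsto_mult e) (auto simp: mem_box)
 then show ?thesis using True by simp
qed

text \<open>Boxes form an intersection-stable generator of the Borel sets, so vanishing integrals
  spread to all Borel sets by Dynkin induction; the total integral serves the complements.
  Uniqueness of densities concludes.\<close>

lemma AE_0_of_box_integrals:
 fixes f :: "'a::euclidean_space \<Rightarrow> real"
 assumes f: "integrable lborel f" and b: "\<And>a b. (LINT x:box a b|lborel. f x) = 0"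
  and u: "(LBINT x. f x) = 0"
 shows "AE x in lborel. f x = 0"
proof -
 let ?E = "range (\<lambda>(a, b). box a b::'a set)"
 have si: "set_integrable lborel A f" if "A \<in> sets borel" for A
  unfolding set_integrable_def using that f by (intro integrable_mult_indicator) auto
 have "(LINT x:A|lborel. f x) = 0" if "A \<in> sets borel" for A
 proof -
  have "A \<in> sigma_sets UNIV ?E" using that by (simp add: borel_eq_box)
  have stable: "Int_stable ?E" and ps: "?E \<subseteq> Pow UNIV" by (auto simp: Int_stable_def box_Int_box)
  from \<open>A \<in> sigma_sets UNIV ?E\<close> show ?thesis
  proof (induction rule: sigma_sets_induct_disjoint[OF stable ps, consumes 1, case_names basic empty compl union])
   case (basic A) then show ?case using b by auto
  next
   case empty show ?case by (simp add: set_lebesgue_integral_def)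
  next
   case (compl A)
   then have A: "A \<in> sets borel" by (simp add: borel_eq_box)
   have "(LINT x:A|lborel. f x) + (LINT x:UNIV - A|lborel. f x) = (LINT x:A \<union> (UNIV - A)|lborel. f x)"
    by (rule set_integral_Un[symmetric]) (use A si in auto)
   also have "\<dots> = 0" using u by (simp add: set_lebesgue_integral_def Un_Diff_cancel)
   finally show ?case using compl by simp
  next
   case (union A)
   then have "range A \<subseteq> sets borel" by (auto simp: borel_eq_box)
   then have A: "A i \<in> sets borel" for i by auto
   have "(LINT x:(\<Union>i. A i)|lborel. f x) = (\<Sum>i. (LINT x:A i|lborel. f x))"
    by (rule lebesgue_integral_countable_add) (use A si union(1) in \<open>auto simp: disjoint_family_on_def\<close>)
   then show ?case using union by simp
  qed
 qed
 then show ?thesis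
  using density_unique_real[of lborel f "\<lambda>_. 0"] f by simp
qed

text \<open>Bumps converge boundedly to the indicator of their box, so h has integral 0 over every
  box. As h is only locally integrable, \<open>AE_0_of_box_integrals\<close> is applied to its
  restrictions to cubes that exhaust the space.\<close>

lemma AE_0_of_test_integrals:
 fixes h :: "'a::euclidean_space \<Rightarrow> real"
 assumes h: "locally_integrable h" and t: "\<And>\<phi>. test_function \<phi> \<Longrightarrow> (LBINT x. h x * \<phi> x) = 0"
 shows "AE x in lborel. h x = 0"
proof -
 have hm: "set_integrable lborel (cbox a b) h" for a b using h by (simp add: locally_integrable_def)
 have hb: "set_integrable lborel (box a b) h" for a b
  by (rule set_integrable_subset[OF hm[of a b]]) (auto simp: box_subset_cbox)
 have box0: "(LINT x:box a b|lborel. h x) = 0" for a b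
 proof -
  let ?s = "\<lambda>n x. indicator (box a b) x *\<^sub>R h x * bump (inverse (real (Suc n))) a b x"
  have "(\<lambda>n. LBINT x. ?s n x) \<longlonglongrightarrow> (LBINT x. indicator (box a b) x *\<^sub>R h x)"
  proof (rule integral_dominated_convergence[where w="\<lambda>x. norm (indicator (box a b) x *\<^sub>R h x)"])
   show m: "(\<lambda>x. indicator (box a b) x *\<^sub>R h x) \<in> borel_measurable lborel"
    using hb[of a b] by (simp add: set_integrable_def borel_measurable_integrable)
   show "?s n \<in> borel_measurable lborel" for n
    using m measurable_cont[OF test_function_continuous[OF test_function_bump[of "inverse (real (Suc n))" a b]]]
    by (intro borel_measurable_times) auto
   show "integrable lborel (\<lambda>x. norm (indicator (box a b) x *\<^sub>R h x))"
    using hb[of a b] unfolding set_integrable_def by (rule integrable_norm)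
   show "AE x in lborel. (\<lambda>n. ?s n x) \<longlonglongrightarrow> indicator (box a b) x *\<^sub>R h x"
   proof (rule AE_I2)
    fix x
    have "(\<lambda>n. ?s n x) \<longlonglongrightarrow> indicator (box a b) x *\<^sub>R h x * indicator (box a b) x"
     by (intro tendsto_intros bump_tendsto_indicator)
    moreover have "indicator (box a b) x *\<^sub>R h x * indicator (box a b) x = indicator (box a b) x *\<^sub>R h x"
     by (simp add: indicator_def)
    ultimately show "(\<lambda>n. ?s n x) \<longlonglongrightarrow> indicator (box a b) x *\<^sub>R h x" by (simp only:)
   qed
   show "AE x in lborel. norm (?s n x) \<le> norm (indicator (box a b) x *\<^sub>R h x)" for n
    using bump_nonneg[of "inverse (real (Suc n))" a b] bump_le1[of "inverse (real (Suc n))" a b]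
    by (auto simp: abs_mult indicator_def intro!: AE_I2 mult_left_le)
  qed
  moreover have "(LBINT x. ?s n x) = 0" for n
  proof -
   have "(LBINT x. ?s n x) = (LBINT x. h x * bump (inverse (real (Suc n))) a b x)"
    by (rule lint_cong) (auto simp: indicator_def bump_support)
   then show ?thesis using t[OF test_function_bump] by simp
  qed
  ultimately show ?thesis by (simp add: LIMSEQ_const_iff set_lebesgue_integral_def)
 qed
 have "AE x in lborel. x \<in> box (- (real n *\<^sub>R One)) (real n *\<^sub>R One) \<longrightarrow> h x = 0" for n
 proof -
  let ?B = "box (- (real n *\<^sub>R One)) (real n *\<^sub>R One) :: 'a set"
  have "AE x in lborel. indicator ?B x *\<^sub>R h x = 0"
  proof (rule AE_0_of_box_integrals)
   show "integrable lborel (\<lambda>x. indicator ?B x *\<^sub>R h x)" using hb by (simp add: set_integrable_def)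
   show "(LBINT x. indicator ?B x *\<^sub>R h x) = 0" using box0 by (simp add: set_lebesgue_integral_def)
   fix a b :: 'a
   have "\<exists>a' b'. box a b \<inter> ?B = box a' b'" by (rule exI, rule exI, rule box_Int_box)
   then obtain a' b' where e: "box a b \<inter> ?B = box a' b'" by blast
   have "(LINT x:box a b|lborel. indicator ?B x *\<^sub>R h x) = (LINT x:box a' b'|lborel. h x)"
    unfolding set_lebesgue_integral_def e[symmetric]
    by (rule lint_cong) (auto simp: indicator_def)
   then show "(LINT x:box a b|lborel. indicator ?B x *\<^sub>R h x) = 0" using box0 by simp
  qed
  then show ?thesis by eventually_elim (auto simp: indicator_def)
 qed
 then have "AE x in lborel. \<forall>n. x \<in> box (- (real n *\<^sub>R One)) (real n *\<^sub>R One) \<longrightarrow> h x = 0"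
  unfolding AE_all_countable by blast
 then show ?thesis
 proof eventually_elim
  case (elim x)
  have "x \<in> (\<Union>n. box (- (real n *\<^sub>R One)) (real n *\<^sub>R One))" unfolding UN_box_eq_UNIV by simp
  then show ?case using elim by blast
 qed
qed

section \<open>Weak gradients\<close>

lemma Lq2_iff:
 fixes f :: "'a::euclidean_space \<Rightarrow> 'b::euclidean_space"
 shows "f \<in> Lq 2 \<longleftrightarrow> f \<in> borel_measurable borel \<and> integrable lborel (\<lambda>x. (norm (f x))^2)"
 by (simp add: Lq_def powr_numeral)

lemma Lq2_real_iff:
 fixes f :: "'a::euclidean_space \<Rightarrow> real"
 shows "f \<in> Lq 2 \<longleftrightarrow> f \<in> borel_measurable borel \<and> integrable lborel (\<lambda>x. (f x)^2)"
 by (simp add: Lq2_iff)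

lemma Lq2D:
 fixes f :: "'a::euclidean_space \<Rightarrow> 'b::euclidean_space"
 assumes "f \<in> Lq 2"
 shows "f \<in> borel_measurable borel" "integrable lborel (\<lambda>x. (norm (f x))^2)"
 using assms by (auto simp: Lq2_iff)

lemma inner_le_sq: "\<bar>a \<bullet> b\<bar> \<le> (norm a)^2 + (norm b)^2" for a b :: "'b::euclidean_space"
proof -
 have "\<bar>a \<bullet> b\<bar> \<le> norm a * norm b" by (rule Cauchy_Schwarz_ineq2)
 also have "\<dots> \<le> (norm a)^2 + (norm b)^2"
  using sum_squares_bound[of "norm a" "norm b"] mult_nonneg_nonneg[OF norm_ge_zero norm_ge_zero, of a b] by linarith
 finally show ?thesis .
qed

lemma Lq2_inner:
 fixes f g :: "'a::euclidean_space \<Rightarrow> 'b::euclidean_space"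
 assumes f: "f \<in> Lq 2" and g: "g \<in> Lq 2"
 shows "integrable lborel (\<lambda>x. f x \<bullet> g x)"
proof (rule lintegrable_bound)
 show "integrable lborel (\<lambda>x. (norm (f x))^2 + (norm (g x))^2)"
  by (intro lintegrable_add Lq2D f g)
 show "(\<lambda>x. f x \<bullet> g x) \<in> borel_measurable lborel" using Lq2D[OF f] Lq2D[OF g] by simp
 show "AE x in lborel. norm (f x \<bullet> g x) \<le> norm ((norm (f x))^2 + (norm (g x))^2)"
 proof (rule AE_I2)
  fix x show "norm (f x \<bullet> g x) \<le> norm ((norm (f x))^2 + (norm (g x))^2)" using inner_le_sq[of "f x" "g x"] by simp
 qed
qed

lemma Lq2_add:
 fixes f g :: "'a::euclidean_space \<Rightarrow> 'b::euclidean_space"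
 assumes f: "f \<in> Lq 2" and g: "g \<in> Lq 2"
 shows "(\<lambda>x. f x + g x) \<in> Lq 2"
proof -
 have e: "(norm (f x + g x))^2 = (norm (f x))^2 + 2 * (f x \<bullet> g x) + (norm (g x))^2" for x
  by (simp add: power2_norm_eq_inner inner_add inner_commute)
 show ?thesis
  unfolding Lq2_iff e using Lq2D[OF f] Lq2D[OF g] Lq2_inner[OF f g]
  by (auto intro!: borel_measurable_add)
qed

lemma Lq2_scale:
 fixes f :: "'a::euclidean_space \<Rightarrow> 'b::euclidean_space"
 assumes f: "f \<in> Lq 2" shows "(\<lambda>x. c *\<^sub>R f x) \<in> Lq 2"
 using Lq2D[OF f] unfolding Lq2_iff by (auto simp: power_mult_distrib)

lemma Lq2_diff:
 fixes f g :: "'a::euclidean_space \<Rightarrow> 'b::euclidean_space"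
 assumes f: "f \<in> Lq 2" and g: "g \<in> Lq 2"
 shows "(\<lambda>x. f x - g x) \<in> Lq 2"
 using Lq2_add[OF f Lq2_scale[OF g, of "-1"]] by simp

lemma Lq2_comp:
 fixes g :: "'a::euclidean_space \<Rightarrow> 'b::euclidean_space"
 assumes g: "g \<in> Lq 2" shows "(\<lambda>x. g x \<bullet> i) \<in> Lq 2"
proof -
 have "(g x \<bullet> i)^2 \<le> (norm (g x))^2 * (norm i)^2" for x
  using power_mono[OF Cauchy_Schwarz_ineq2[of "g x" i], of 2] by (simp add: power_mult_distrib)
 then have "integrable lborel (\<lambda>x. (g x \<bullet> i)^2)"
  by (intro lintegrable_bound[OF integrable_mult_left[OF Lq2D(2)[OF g], of "(norm i)^2"]])
    (use Lq2D(1)[OF g] in auto)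
 then show ?thesis
  unfolding Lq2_real_iff using Lq2D(1)[OF g] by simp
qed

lemma cauchy_schwarz_integral:
 fixes f g :: "'c \<Rightarrow> real"
 assumes ff: "integrable M (\<lambda>x. (f x)^2)" and gg: "integrable M (\<lambda>x. (g x)^2)" and fg: "integrable M (\<lambda>x. f x * g x)"
 shows "(LINT x|M. f x * g x)^2 \<le> (LINT x|M. (f x)^2) * (LINT x|M. (g x)^2)"
proof -
 let ?F = "LINT x|M. (f x)^2" and ?G = "LINT x|M. (g x)^2" and ?H = "LINT x|M. f x * g x"
 have q: "0 \<le> s^2 * ?F + 2 * s * t * ?H + t^2 * ?G" for s t
 proof -
  have "0 \<le> (LINT x|M. (s * f x + t * g x)^2)" by (rule lint_nonneg) simp
  also have "(LINT x|M. (s * f x + t * g x)^2) = (LINT x|M. s^2 * (f x)^2 + 2 * s * t * (f x * g x) + t^2 * (g x)^2)"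
   by (rule lint_cong) (auto simp: power2_eq_square algebra_simps)
  also have "\<dots> = s^2 * ?F + 2 * s * t * ?H + t^2 * ?G"
   using ff gg fg by (subst lint_add) auto
  finally show ?thesis .
 qed
 have F0: "?F \<ge> 0" and G0: "?G \<ge> 0" by (auto intro!: lint_nonneg)
 show ?thesis
 proof (cases "?F = 0")
  case True
  have "?H = 0"
  proof (rule ccontr)
   assume H: "?H \<noteq> 0"
   \<comment> \<open>With ?F = 0 the quadratic form is linear in its first argument, and this
     argument gives it the value -1.\<close>
   have "2 * (- (?G + 1) / (2 * ?H)) * 1 * ?H = - (?G + 1)" using H by simp
   with q[of "- (?G + 1) / (2 * ?H)" 1] True show False by (simp only: power_one mult_zero_right mult_1)
  qed
  then show ?thesis using True by simp
 next
  case False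
  then have "?F > 0" using F0 by linarith
  have "0 \<le> ?F * (?F * ?G - ?H^2)" using q[of "- ?H" ?F] by (simp add: power2_eq_square algebra_simps)
  then have "0 \<le> ?F * ?G - ?H^2" using \<open>?F > 0\<close> by (simp add: zero_le_mult_iff)
  then show ?thesis by simp
 qed
qed

lemma locally_integrable_Lq2:
 fixes f :: "'a::euclidean_space \<Rightarrow> 'b::euclidean_space"
 assumes f: "f \<in> Lq 2" shows "locally_integrable f"
 unfolding locally_integrable_def set_integrable_def
proof (intro allI impI)
 fix K :: "'a set" assume K: "compact K"
 show "integrable lborel (\<lambda>x. indicator K x *\<^sub>R f x)"
 proof (rule lintegrable_bound)
  show "integrable lborel (\<lambda>x. indicator K x + (norm (f x))^2)"
   using Lq2D[OF f] K by (auto intro!: integrable_real_indicator emeasure_bounded_finite simp: compact_imp_bounded borel_compact)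
  show "(\<lambda>x. indicator K x *\<^sub>R f x) \<in> borel_measurable lborel"
   using Lq2D[OF f] borel_compact[OF K] by simp
  have "2 * norm y \<le> 1 + (norm y)^2" for y :: 'b
   using sum_squares_bound[of 1 "norm y"] by simp
  then have "norm y \<le> 1 + (norm y)^2" for y :: 'b
   using norm_ge_zero[of y] by (smt (verit))
  then show "AE x in lborel. norm (indicator K x *\<^sub>R f x) \<le> norm (indicator K x + (norm (f x))^2)"
   by (auto simp: indicator_def)
 qed
qed

lemma integrable_loc_mult:
 fixes f \<phi> :: "'a::euclidean_space \<Rightarrow> real"
 assumes f: "locally_integrable f" and \<phi>: "\<phi> \<in> borel_measurable borel" "compact K" "\<And>x. \<bar>\<phi> x\<bar> \<le> B * indicator K x"
 shows "integrable lborel (\<lambda>x. f x * \<phi> x)"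
proof -
 have i: "integrable lborel (\<lambda>x. indicator K x *\<^sub>R f x)"
  using f \<phi>(2) by (simp add: locally_integrable_def set_integrable_def)
 have m: "(\<lambda>x. (indicator K x *\<^sub>R f x) * \<phi> x) \<in> borel_measurable lborel"
  using borel_measurable_integrable[OF i] \<phi>(1) by simp
 have e: "f x * \<phi> x = (indicator K x *\<^sub>R f x) * \<phi> x" for x
  using \<phi>(3)[of x] by (cases "x \<in> K") auto
 show ?thesis
  unfolding e
 proof (rule lintegrable_bound[OF integrable_mult_right[OF i, of B] m])
  show "AE x in lborel. norm ((indicator K x *\<^sub>R f x) * \<phi> x) \<le> norm (B * (indicator K x *\<^sub>R f x))"
  proof (rule AE_I2)
   fix x
   have "\<bar>\<phi> x\<bar> \<le> \<bar>B\<bar>" using \<phi>(3)[of x] by (cases "x \<in> K") auto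
   then have "\<bar>indicator K x *\<^sub>R f x\<bar> * \<bar>\<phi> x\<bar> \<le> \<bar>indicator K x *\<^sub>R f x\<bar> * \<bar>B\<bar>" by (rule mult_left_mono) simp
   then show "norm ((indicator K x *\<^sub>R f x) * \<phi> x) \<le> norm (B * (indicator K x *\<^sub>R f x))" by (simp add: abs_mult ac_simps)
  qed
 qed
qed

lemma integrable_test:
 fixes f :: "'a::euclidean_space \<Rightarrow> real"
 assumes "locally_integrable f" "test_function \<phi>"
 shows "integrable lborel (\<lambda>x. f x * \<phi> x)" "i \<in> Basis \<Longrightarrow> integrable lborel (\<lambda>x. f x * fd \<phi> x i)"
proof -
 obtain K B where b: "compact K" "\<And>x. \<bar>\<phi> x\<bar> \<le> B * indicator K x" "\<And>x i. i \<in> Basis \<Longrightarrow> \<bar>fd \<phi> x i\<bar> \<le> B * indicator K x"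
  by (rule test_function_bounds[OF assms(2)]) blast
 show "integrable lborel (\<lambda>x. f x * \<phi> x)"
  by (rule integrable_loc_mult[OF assms(1) _ b(1,2)]) (rule measurable_cont[OF test_function_continuous[OF assms(2)]])
 show "integrable lborel (\<lambda>x. f x * fd \<phi> x i)" if "i \<in> Basis"
  by (rule integrable_loc_mult[OF assms(1) _ b(1) b(3)[OF that]]) (rule measurable_cont[OF test_function_deriv_cont[OF assms(2) that]])
qed

lemma locally_integrable_comp: "locally_integrable g \<Longrightarrow> locally_integrable (\<lambda>x. g x \<bullet> i)"
 unfolding locally_integrable_def set_integrable_def
 using integrable_inner_left[of i lborel] by fastforce

text \<open>The weak gradient is an explicit argument, so that sums, scalings, cutoffs and limits
  come with a concrete gradient instead of the choice made in \<open>weak_gradient\<close>.\<close>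

definition sob :: "('a::euclidean_space \<Rightarrow> real) \<Rightarrow> ('a \<Rightarrow> 'a) \<Rightarrow> bool" where
 "sob u g \<longleftrightarrow> u \<in> Lq 2 \<and> g \<in> Lq 2 \<and> is_weak_gradient u g"

lemma sobD:
 assumes "sob u g"
 shows "u \<in> Lq 2" "g \<in> Lq 2" "is_weak_gradient u g" "u \<in> borel_measurable borel" "g \<in> borel_measurable borel"
  "integrable lborel (\<lambda>x. (u x)^2)" "integrable lborel (\<lambda>x. (norm (g x))^2)"
  "locally_integrable u" "locally_integrable g"
 using assms Lq2D unfolding sob_def is_weak_gradient_def Lq2_real_iff by blast+

lemma sobI:
 assumes "u \<in> Lq 2" "g \<in> Lq 2"
  "\<And>\<phi> i. test_function \<phi> \<Longrightarrow> i \<in> Basis \<Longrightarrow> (LBINT x. u x * fd \<phi> x i) = - (LBINT x. (g x \<bullet> i) * \<phi> x)"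
 shows "sob u g"
 using assms locally_integrable_Lq2[OF assms(1)] locally_integrable_Lq2[OF assms(2)]
 unfolding sob_def is_weak_gradient_def by auto

lemma sob_test: "sob u g \<Longrightarrow> test_function \<phi> \<Longrightarrow> i \<in> Basis \<Longrightarrow>
  (LBINT x. u x * fd \<phi> x i) = - (LBINT x. (g x \<bullet> i) * \<phi> x)"
 unfolding sob_def is_weak_gradient_def by blast

lemma sob_H1: "sob u g \<Longrightarrow> u \<in> H1" unfolding sob_def H1_def by blast
lemma H1_sob: "u \<in> H1 \<Longrightarrow> \<exists>g. sob u g" unfolding sob_def H1_def by blast

lemma weak_gradient_unique:
 assumes "is_weak_gradient u g" "is_weak_gradient u g'"
 shows "AE x in lborel. g x = g' x"
proof -
 have "AE x in lborel. \<forall>i\<in>Basis. (g x - g' x) \<bullet> i = 0"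
 proof (rule AE_finite_allI[OF finite_Basis])
  fix i :: 'a assume i: "i \<in> Basis"
  have l: "locally_integrable (\<lambda>x. g x \<bullet> i)" "locally_integrable (\<lambda>x. g' x \<bullet> i)"
   using assms by (auto simp: is_weak_gradient_def intro: locally_integrable_comp)
  then have l2: "locally_integrable (\<lambda>x. g x \<bullet> i - g' x \<bullet> i)"
   unfolding locally_integrable_def by (auto intro: set_integral_diff)
  have "AE x in lborel. g x \<bullet> i - g' x \<bullet> i = 0"
  proof (rule AE_0_of_test_integrals[OF l2])
   fix \<phi> :: "'a \<Rightarrow> real" assume \<phi>: "test_function \<phi>"
   have "(LBINT x. (g x \<bullet> i - g' x \<bullet> i) * \<phi> x) = (LBINT x. (g x \<bullet> i) * \<phi> x - (g' x \<bullet> i) * \<phi> x)"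
    by (simp add: algebra_simps)
   also have "\<dots> = (LBINT x. (g x \<bullet> i) * \<phi> x) - (LBINT x. (g' x \<bullet> i) * \<phi> x)"
    by (rule lint_diff) (rule integrable_test[OF l(1) \<phi>] integrable_test[OF l(2) \<phi>])+
   also have "\<dots> = 0" using assms \<phi> i unfolding is_weak_gradient_def by (metis diff_self neg_equal_iff_equal)
   finally show "(LBINT x. (g x \<bullet> i - g' x \<bullet> i) * \<phi> x) = 0" .
  qed
  then show "AE x in lborel. (g x - g' x) \<bullet> i = 0" by (simp add: inner_diff_left)
 qed
 then show ?thesis by eventually_elim (metis eq_iff_diff_eq_0 euclidean_all_zero_iff)
qed

text \<open>The choice in \<open>weak_gradient\<close> asks for measurability only; square
  integrability is transferred from \<open>g\<close> by almost everywhere uniqueness.\<close>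

lemma weak_gradient_props:
 assumes "sob u g"
 shows "weak_gradient u \<in> borel_measurable borel" "AE x in lborel. weak_gradient u x = g x" "sob u (weak_gradient u)"
proof -
 let ?P = "\<lambda>g. g \<in> borel_measurable lborel \<and> is_weak_gradient u g"
 have "?P g" using sobD[OF assms] by simp
 then have p: "?P (weak_gradient u)" unfolding weak_gradient_def by (rule someI[of ?P])
 then show m: "weak_gradient u \<in> borel_measurable borel" by simp
 show ae: "AE x in lborel. weak_gradient u x = g x"
  using p sobD(3)[OF assms] by (intro weak_gradient_unique) auto
 have "weak_gradient u \<in> Lq 2"
  unfolding Lq2_iff
 proof
  show "integrable lborel (\<lambda>x. (norm (weak_gradient u x))^2)"
   by (rule integrable_cong_AE_imp[OF sobD(7)[OF assms]]) (use m ae in auto)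
 qed (rule m)
 then show "sob u (weak_gradient u)" using p sobD(1)[OF assms] by (simp add: sob_def)
qed

lemma sob_add:
 fixes u v :: "'a::euclidean_space \<Rightarrow> real"
 assumes u: "sob u g" and v: "sob v h"
 shows "sob (\<lambda>x. u x + v x) (\<lambda>x. g x + h x)"
proof (rule sobI)
 fix \<phi> :: "'a \<Rightarrow> real" and i :: 'a assume \<phi>: "test_function \<phi>" and i: "i \<in> Basis"
 have "(LBINT x. (u x + v x) * fd \<phi> x i)
  = (LBINT x. u x * fd \<phi> x i) + (LBINT x. v x * fd \<phi> x i)"
  unfolding distrib_right by (intro lint_add integrable_test(2)[OF _ \<phi> i] sobD(8)[OF u] sobD(8)[OF v])
 moreover have "(LBINT x. ((g x + h x) \<bullet> i) * \<phi> x) = (LBINT x. (g x \<bullet> i) * \<phi> x) + (LBINT x. (h x \<bullet> i) * \<phi> x)"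
  unfolding distrib_right inner_add_left
  by (intro lint_add integrable_test(1)[OF _ \<phi>] locally_integrable_comp sobD(9)[OF u] sobD(9)[OF v])
 ultimately show "(LBINT x. (u x + v x) * fd \<phi> x i) = - (LBINT x. ((g x + h x) \<bullet> i) * \<phi> x)"
  using sob_test[OF u \<phi> i] sob_test[OF v \<phi> i] by simp
qed (intro Lq2_add sobD[OF u] sobD[OF v])+

lemma sob_scale:
 fixes u :: "'a::euclidean_space \<Rightarrow> real"
 assumes u: "sob u g"
 shows "sob (\<lambda>x. c * u x) (\<lambda>x. c *\<^sub>R g x)"
proof (rule sobI)
 fix \<phi> :: "'a \<Rightarrow> real" and i :: 'a assume \<phi>: "test_function \<phi>" and i: "i \<in> Basis"
 show "(LBINT x. c * u x * fd \<phi> x i) = - (LBINT x. (c *\<^sub>R g x \<bullet> i) * \<phi> x)"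
  using sob_test[OF u \<phi> i] by (simp add: mult.assoc)
qed (use Lq2_scale[OF sobD(1)[OF u], of c] Lq2_scale[OF sobD(2)[OF u], of c] in auto)

lemma sob_diff: assumes u: "sob u g" and v: "sob v h" shows "sob (\<lambda>x. u x - v x) (\<lambda>x. g x - h x)"
 using sob_add[OF u sob_scale[OF v, of "-1"]] by simp

section \<open>Affine changes of variable and cutoffs\<close>

lemma nn_integral_affine:
 fixes F :: "'a::euclidean_space \<Rightarrow> ennreal"
 assumes [measurable]: "F \<in> borel_measurable borel" and t: "t > 0"
 shows "(NINT x. F (t *\<^sub>R x + y)) = ennreal ((1 / t) ^ DIM('a)) * (NINT x. F x)"
proof -
 have "(NINT x. F x) = (\<integral>\<^sup>+x. F x \<partial>density (distr lborel borel (\<lambda>x. y + t *\<^sub>R x)) (\<lambda>_. \<bar>t\<bar> ^ DIM('a)))"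
  using lborel_affine[of t y] t by simp
 also have "\<dots> = ennreal (t ^ DIM('a)) * (NINT x. F (t *\<^sub>R x + y))"
  using t by (simp add: nn_integral_density nn_integral_distr nn_integral_cmult add.commute)
 finally have "ennreal ((1 / t) ^ DIM('a)) * (NINT x. F x)
  = (ennreal ((1 / t) ^ DIM('a)) * ennreal (t ^ DIM('a))) * (NINT x. F (t *\<^sub>R x + y))"
  by (simp add: mult.assoc)
 also have "ennreal ((1 / t) ^ DIM('a)) * ennreal (t ^ DIM('a)) = 1"
  using t by (subst ennreal_mult[symmetric]) (auto simp: power_mult_distrib[symmetric])
 finally show ?thesis by simp
qed

lemma integrable_affine:
 fixes F :: "'a::euclidean_space \<Rightarrow> 'b::{banach, second_countable_topology}"
 assumes F: "integrable lborel F" and t: "t > 0"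
 shows "integrable lborel (\<lambda>x. F (t *\<^sub>R x + y))"
proof -
 have [measurable]: "F \<in> borel_measurable borel" using borel_measurable_integrable[OF F] by simp
 show ?thesis
  using F t unfolding integrable_iff_bounded
  by (auto simp: nn_integral_affine[of "\<lambda>x. ennreal (norm (F x))"] ennreal_mult_less_top)
qed

lemma integral_affine:
 fixes F :: "'a::euclidean_space \<Rightarrow> real"
 assumes F: "F \<in> borel_measurable borel" and t: "t > 0"
 shows "(LBINT x. F (t *\<^sub>R x + y)) = (1 / t) ^ DIM('a) * (LBINT x. F x)"
proof -
 have "(LBINT x. F x) = (LINT x|density (distr lborel borel (\<lambda>x. y + t *\<^sub>R x)) (\<lambda>_. \<bar>t\<bar> ^ DIM('a)). F x)"
  using lborel_affine[of t y] t by simp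
 also have "\<dots> = t ^ DIM('a) * (LBINT x. F (t *\<^sub>R x + y))"
  using t F by (subst integral_density) (auto simp: integral_distr add.commute)
 finally show ?thesis using t by (simp add: power_divide)
qed

lemma sob_affine:
 fixes u :: "'a::euclidean_space \<Rightarrow> real"
 assumes u: "sob u g" and t: "t > 0"
 shows "sob (\<lambda>x. u (t *\<^sub>R x + y)) (\<lambda>x. t *\<^sub>R g (t *\<^sub>R x + y))"
proof (rule sobI)
 have m: "(\<lambda>x. t *\<^sub>R x + y) \<in> borel_measurable borel" by simp
 show "(\<lambda>x. u (t *\<^sub>R x + y)) \<in> Lq 2"
  unfolding Lq2_real_iff using integrable_affine[OF sobD(6)[OF u] t, of y] measurable_compose[OF m sobD(4)[OF u]] by simp
 have "(\<lambda>x. g (t *\<^sub>R x + y)) \<in> Lq 2"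
  unfolding Lq2_iff using integrable_affine[OF sobD(7)[OF u] t, of y] measurable_compose[OF m sobD(5)[OF u]] by simp
 then show "(\<lambda>x. t *\<^sub>R g (t *\<^sub>R x + y)) \<in> Lq 2" by (rule Lq2_scale)
 fix \<phi> :: "'a \<Rightarrow> real" and i :: 'a assume \<phi>: "test_function \<phi>" and i: "i \<in> Basis"
 \<comment> \<open>The test function is pulled back by the inverse affine map, so that the weak
   gradient identity of the original u applies to it.\<close>
 define \<psi> where "\<psi> x = \<phi> ((1/t) *\<^sub>R x + (- (1/t)) *\<^sub>R y)" for x
 have \<psi>: "test_function \<psi>" unfolding \<psi>_def using t by (intro test_function_affine[OF \<phi>]) simp
 have d\<psi>: "fd \<psi> x i = (1/t) * frechet_derivative \<phi> (at ((1/t) *\<^sub>R x + (- (1/t)) *\<^sub>R y)) i" for x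
  unfolding \<psi>_def by (rule frechet_affine[OF \<phi>])
 have inv: "(1 / t) *\<^sub>R (t *\<^sub>R x + y) + (- (1 / t)) *\<^sub>R y = x" for x
  using t by (simp add: scaleR_add_right)
 have b: "(\<lambda>x. u x * fd \<psi> x i) \<in> borel_measurable borel" "(\<lambda>x. (g x \<bullet> i) * \<psi> x) \<in> borel_measurable borel"
  using sobD[OF u] measurable_cont[OF test_function_deriv_cont[OF \<psi> i]] measurable_cont[OF test_function_continuous[OF \<psi>]]
  by auto
 have "(LBINT x. u (t *\<^sub>R x + y) * fd \<phi> x i)
   = (LBINT x. t * (u (t *\<^sub>R x + y) * fd \<psi> (t *\<^sub>R x + y) i))"
  unfolding d\<psi> inv using t by simp
 also have "\<dots> = t * ((1 / t) ^ DIM('a) * (LBINT x. u x * fd \<psi> x i))"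
  using integral_affine[OF b(1) t, of y] by simp
 also have "\<dots> = - (t * ((1 / t) ^ DIM('a) * (LBINT x. (g x \<bullet> i) * \<psi> x)))"
  unfolding sob_test[OF u \<psi> i] by simp
 also have "\<dots> = - (LBINT x. t * ((g (t *\<^sub>R x + y) \<bullet> i) * \<psi> (t *\<^sub>R x + y)))"
  using integral_affine[OF b(2) t, of y] by simp
 also have "\<dots> = - (LBINT x. ((t *\<^sub>R g (t *\<^sub>R x + y)) \<bullet> i) * \<phi> x)"
  unfolding \<psi>_def inv by (simp add: mult.assoc)
 finally show "(LBINT x. u (t *\<^sub>R x + y) * fd \<phi> x i) = - (LBINT x. ((t *\<^sub>R g (t *\<^sub>R x + y)) \<bullet> i) * \<phi> x)" .
qed

definition grad :: "('a::euclidean_space \<Rightarrow> real) \<Rightarrow> 'a \<Rightarrow> 'a" where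
 "grad f x = (\<Sum>i\<in>Basis. fd f x i *\<^sub>R i)"

lemma grad_inner: "i \<in> Basis \<Longrightarrow> grad f x \<bullet> i = fd f x i"
 by (simp add: grad_def)

text \<open>Product rule: test the weak gradient of u with \<zeta> * \<phi>, and count the term in
  which the derivative falls on \<zeta> as part of the new gradient.\<close>

lemma sob_cutoff:
 fixes u :: "'a::euclidean_space \<Rightarrow> real"
 assumes u: "sob u g" and \<zeta>: "test_function \<zeta>"
 shows "sob (\<lambda>x. \<zeta> x * u x) (\<lambda>x. \<zeta> x *\<^sub>R g x + u x *\<^sub>R grad \<zeta> x)"
proof (rule sobI)
 have \<zeta>m: "\<zeta> \<in> borel_measurable borel" by (rule measurable_cont[OF test_function_continuous[OF \<zeta>]])
 have gm: "grad \<zeta> \<in> borel_measurable borel" unfolding grad_def[abs_def]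
  by (intro borel_measurable_sum borel_measurable_scaleR measurable_cont[OF test_function_deriv_cont[OF \<zeta>]]) auto
 obtain K B where b: "compact K" "B > 0" "\<And>x. \<bar>\<zeta> x\<bar> \<le> B * indicator K x" "\<And>x i. i \<in> Basis \<Longrightarrow> \<bar>fd \<zeta> x i\<bar> \<le> B * indicator K x"
  by (rule test_function_bounds[OF \<zeta>]) blast
 have zB: "\<bar>\<zeta> x\<bar> \<le> B" for x using b(3)[of x] b(2) by (cases "x \<in> K") auto
 have dB: "\<bar>fd \<zeta> x i\<bar> \<le> B" if "i \<in> Basis" for x i using b(4)[OF that, of x] b(2) by (cases "x \<in> K") auto
 have gB: "norm (grad \<zeta> x) \<le> real DIM('a) * B" for x
 proof -
  have "norm (grad \<zeta> x) \<le> (\<Sum>i\<in>Basis. norm (fd \<zeta> x i *\<^sub>R (i::'a)))" unfolding grad_def by (rule norm_sum)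
  also have "\<dots> \<le> (\<Sum>i\<in>(Basis::'a set). B)" by (rule sum_mono) (simp add: dB)
  finally show ?thesis by simp
 qed
 have L: "(\<lambda>x. k x *\<^sub>R f x) \<in> Lq 2" if "f \<in> Lq 2" "k \<in> borel_measurable borel" "\<And>x. \<bar>k x\<bar> \<le> C"
  for f :: "'a \<Rightarrow> 'c::euclidean_space" and k C
  unfolding Lq2_iff
 proof
  show "integrable lborel (\<lambda>x. (norm (k x *\<^sub>R f x))^2)"
  proof (rule lintegrable_bound[OF integrable_mult_right[OF Lq2D(2)[OF that(1)], of "C^2"]])
   have "(k x)^2 \<le> C^2" for x using power_mono[OF that(3)[of x] abs_ge_zero, of 2] by simp
   then have "(k x)^2 * (norm (f x))^2 \<le> C^2 * (norm (f x))^2" for x by (intro mult_right_mono) auto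
   then show "AE x in lborel. norm ((norm (k x *\<^sub>R f x))^2) \<le> norm (C^2 * (norm (f x))^2)"
    by (simp add: power_mult_distrib)
   show "(\<lambda>x. (norm (k x *\<^sub>R f x))^2) \<in> borel_measurable lborel" using that(2) Lq2D(1)[OF that(1)] by simp
  qed
 qed (use that Lq2D[OF that(1)] in auto)
 show "(\<lambda>x. \<zeta> x * u x) \<in> Lq 2" using L[OF sobD(1)[OF u] \<zeta>m zB] by simp
 have "(\<lambda>x. u x *\<^sub>R grad \<zeta> x) \<in> Lq 2"
  unfolding Lq2_iff
 proof
  show "integrable lborel (\<lambda>x. (norm (u x *\<^sub>R grad \<zeta> x))^2)"
  proof (rule lintegrable_bound[OF integrable_mult_right[OF sobD(6)[OF u], of "(real DIM('a) * B)^2"]])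
   have "(norm (grad \<zeta> x))^2 * (u x)^2 \<le> (real DIM('a) * B)^2 * (u x)^2" for x
    by (rule mult_right_mono[OF power_mono[OF gB norm_ge_zero]]) simp
   then show "AE x in lborel. norm ((norm (u x *\<^sub>R grad \<zeta> x))^2) \<le> norm ((real DIM('a) * B)^2 * (u x)^2)"
    by (simp add: power_mult_distrib mult.commute)
   show "(\<lambda>x. (norm (u x *\<^sub>R grad \<zeta> x))^2) \<in> borel_measurable lborel" using gm sobD(4)[OF u] by simp
  qed
 qed (use gm sobD(4)[OF u] in auto)
 then show "(\<lambda>x. \<zeta> x *\<^sub>R g x + u x *\<^sub>R grad \<zeta> x) \<in> Lq 2" by (rule Lq2_add[OF L[OF sobD(2)[OF u] \<zeta>m zB]])
 fix \<phi> :: "'a \<Rightarrow> real" and i :: 'a assume \<phi>: "test_function \<phi>" and i: "i \<in> Basis"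
 have p: "test_function (\<lambda>x. \<zeta> x * \<phi> x)" by (rule test_function_mult[OF \<phi> test_function_C_k[OF \<zeta>]])
 have dp: "fd (\<lambda>x. \<zeta> x * \<phi> x) x i = \<zeta> x * fd \<phi> x i + fd \<zeta> x i * \<phi> x" for x
  by (subst frechet_derivative_eqI[OF has_derivative_mult[OF test_function_deriv[OF \<zeta>] test_function_deriv[OF \<phi>]]]) simp
 have i1: "integrable lborel (\<lambda>x. u x * fd (\<lambda>x. \<zeta> x * \<phi> x) x i)"
  by (rule integrable_test(2)[OF sobD(8)[OF u] p i])
 obtain K' B' where b': "B' > 0" "\<And>x. \<bar>\<phi> x\<bar> \<le> B' * indicator K' x" by (rule test_function_bounds[OF \<phi>]) blast
 have i2: "integrable lborel (\<lambda>x. u x * (fd \<zeta> x i * \<phi> x))"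
 proof (rule integrable_loc_mult[OF sobD(8)[OF u] _ b(1)])
  show "\<bar>fd \<zeta> x i * \<phi> x\<bar> \<le> (B * B') * indicator K x" for x
  proof -
   have "\<bar>\<phi> x\<bar> \<le> B'" using b'(2)[of x] b'(1) by (cases "x \<in> K'") auto
   then have "\<bar>fd \<zeta> x i\<bar> * \<bar>\<phi> x\<bar> \<le> (B * indicator K x) * B'"
    using b(2) by (intro mult_mono b(4)[OF i]) (auto simp: indicator_def)
   then show ?thesis by (simp add: abs_mult ac_simps)
  qed
 qed (intro borel_measurable_times measurable_cont[OF test_function_deriv_cont[OF \<zeta> i]] measurable_cont[OF test_function_continuous[OF \<phi>]])
 have e: "\<zeta> x * u x * fd \<phi> x i = u x * fd (\<lambda>x. \<zeta> x * \<phi> x) x i - u x * (fd \<zeta> x i * \<phi> x)" for x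
  unfolding dp by (simp add: algebra_simps)
 have i3: "integrable lborel (\<lambda>x. (g x \<bullet> i) * (\<zeta> x * \<phi> x))"
  by (rule integrable_test(1)[OF locally_integrable_comp[OF sobD(9)[OF u]] p])
 have "(LBINT x. \<zeta> x * u x * fd \<phi> x i) = - (LBINT x. (g x \<bullet> i) * (\<zeta> x * \<phi> x)) - (LBINT x. u x * (fd \<zeta> x i * \<phi> x))"
  unfolding e using sob_test[OF u p i] by (simp add: lint_diff[OF i1 i2])
 also have "\<dots> = - (LBINT x. (g x \<bullet> i) * (\<zeta> x * \<phi> x) + u x * (fd \<zeta> x i * \<phi> x))"
  by (simp add: lint_add[OF i3 i2])
 also have "\<dots> = - (LBINT x. ((\<zeta> x *\<^sub>R g x + u x *\<^sub>R grad \<zeta> x) \<bullet> i) * \<phi> x)"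
  using i by (simp add: inner_add_left grad_inner algebra_simps)
 finally show "(LBINT x. \<zeta> x * u x * fd \<phi> x i) = - (LBINT x. ((\<zeta> x *\<^sub>R g x + u x *\<^sub>R grad \<zeta> x) \<bullet> i) * \<phi> x)" .
qed

section \<open>Translation estimate in L^2\<close>

lemma measurable_test[measurable_dest]: "test_function \<phi> \<Longrightarrow> \<phi> \<in> borel_measurable borel"
 by (rule measurable_cont[OF test_function_continuous])

text \<open>Cauchy-Schwarz for sqrt \<eta> and sqrt \<eta> * k. In this form the right-hand side may
  be infinite, so applications under an outer integral carry no integrability condition on
  k.\<close>

lemma nn_jensen:
 fixes \<eta> k :: "'c \<Rightarrow> real"
 assumes \<eta>: "\<And>z. \<eta> z \<ge> 0" "integrable M \<eta>" "(LINT z|M. \<eta> z) = 1" and k: "k \<in> borel_measurable M"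
 shows "ennreal ((LINT z|M. \<eta> z * k z)^2) \<le> (\<integral>\<^sup>+z. ennreal (\<eta> z * (k z)^2) \<partial>M)"
proof (cases "(\<integral>\<^sup>+z. ennreal (\<eta> z * (k z)^2) \<partial>M) = \<infinity>")
 case False
 have m[measurable]: "\<eta> \<in> borel_measurable M" "k \<in> borel_measurable M" using \<eta>(2) k by auto
 have i2: "integrable M (\<lambda>z. \<eta> z * (k z)^2)"
  using False \<eta>(1) by (intro integrableI_nonneg) (auto simp: top.not_eq_extremum)
 have i1: "integrable M (\<lambda>z. \<eta> z * k z)"
 proof (rule lintegrable_bound[OF lintegrable_add[OF \<eta>(2) i2]])
  show "AE z in M. norm (\<eta> z * k z) \<le> norm (\<eta> z + \<eta> z * (k z)^2)"
  proof (rule AE_I2)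
   fix z
   have "\<bar>k z\<bar> \<le> 1 + (k z)^2"
    using sum_squares_bound[of 1 "\<bar>k z\<bar>"] abs_ge_zero[of "k z"] by (simp del: abs_ge_zero)
   from mult_left_mono[OF this \<eta>(1)[of z]] show "norm (\<eta> z * k z) \<le> norm (\<eta> z + \<eta> z * (k z)^2)"
    using \<eta>(1)[of z] by (simp add: abs_mult algebra_simps)
  qed
 qed simp
 have s: "sqrt (\<eta> z) * (sqrt (\<eta> z) * k z) = \<eta> z * k z" "(sqrt (\<eta> z))^2 = \<eta> z" "(sqrt (\<eta> z) * k z)^2 = \<eta> z * (k z)^2" for z
  using \<eta>(1)[of z] by (simp_all add: power_mult_distrib mult.assoc[symmetric])
 have "(LINT z|M. \<eta> z * k z)^2 \<le> (LINT z|M. \<eta> z) * (LINT z|M. \<eta> z * (k z)^2)"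
  using cauchy_schwarz_integral[of M "\<lambda>z. sqrt (\<eta> z)" "\<lambda>z. sqrt (\<eta> z) * k z"] \<eta>(2) i1 i2 unfolding s by simp
 then have "ennreal ((LINT z|M. \<eta> z * k z)^2) \<le> ennreal (LINT z|M. \<eta> z * (k z)^2)"
  using \<eta>(3) by (intro ennreal_leI) simp
 also have "\<dots> = (\<integral>\<^sup>+z. ennreal (\<eta> z * (k z)^2) \<partial>M)"
  by (rule nn_integral_eq_integral[symmetric]) (use i2 \<eta>(1) in auto)
 finally show ?thesis .
qed simp

text \<open>Integrability jointly in the segment parameter and in space; it licenses the
  interchanges of integrals in \<open>sob_ftc\<close>.\<close>

lemma pair_int:
 fixes f k :: "'a::euclidean_space \<Rightarrow> real" and h :: 'a
 assumes f: "f \<in> Lq 2" and k: "k \<in> Lq 2"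
 shows "integrable (lborel \<Otimes>\<^sub>M lborel) (\<lambda>(s::real, x). indicator {0..1} s * (f (x + s *\<^sub>R h) * k x))"
proof -
 have [measurable]: "f \<in> borel_measurable borel" "k \<in> borel_measurable borel"
  using Lq2D[OF f] Lq2D[OF k] by auto
 have fi: "(NINT x. ennreal ((f (x + y))^2)) = ennreal (LBINT x. (f x)^2)" for y
  using nn_integral_affine[of "\<lambda>x. ennreal ((f x)^2)" 1 y] Lq2D[OF f]
  by (simp add: nn_integral_eq_integral)
 have ki: "(NINT x. ennreal ((k x)^2)) = ennreal (LBINT x. (k x)^2)"
  using Lq2D[OF k] by (simp add: nn_integral_eq_integral)
 have "(NINT x. ennreal (norm (indicator {0..1} s * (f (x + s *\<^sub>R h) * k x))))
  \<le> indicator {0..1} s * ennreal ((LBINT x. (f x)^2) + (LBINT x. (k x)^2))" for s :: real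
 proof -
  have "(NINT x. ennreal (norm (indicator {0..1} s * (f (x + s *\<^sub>R h) * k x))))
   \<le> (NINT x. indicator {0..1} s * (ennreal ((f (x + s *\<^sub>R h))^2) + ennreal ((k x)^2)))"
  proof (rule nn_integral_mono)
   fix x
   have "\<bar>f (x + s *\<^sub>R h) * k x\<bar> \<le> (f (x + s *\<^sub>R h))^2 + (k x)^2"
    using inner_le_sq[of "f (x + s *\<^sub>R h)" "k x"] by simp
   then show "ennreal (norm (indicator {0..1} s * (f (x + s *\<^sub>R h) * k x))) \<le> indicator {0..1} s * (ennreal ((f (x + s *\<^sub>R h))^2) + ennreal ((k x)^2))"
    by (cases "s \<in> {0..1}") (auto simp: ennreal_plus[symmetric] simp del: ennreal_plus intro!: ennreal_leI)
  qed
  also have "\<dots> = indicator {0..1} s * ((NINT x. ennreal ((f (x + s *\<^sub>R h))^2)) + (NINT x. ennreal ((k x)^2)))"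
   by (subst nn_integral_cmult, simp, subst nn_integral_add) auto
  also have "\<dots> = indicator {0..1} s * ennreal ((LBINT x. (f x)^2) + (LBINT x. (k x)^2))"
   unfolding fi ki by (subst ennreal_plus) auto
  finally show ?thesis .
 qed
 then have "(NINT s. NINT x. ennreal (norm (indicator {0..1} s * (f (x + s *\<^sub>R h) * k x))))
  \<le> (\<integral>\<^sup>+s. indicator {0..1} s * ennreal ((LBINT x. (f x)^2) + (LBINT x. (k x)^2)) \<partial>(lborel :: real measure))"
  by (intro nn_integral_mono)
 also have "\<dots> < \<infinity>" by (subst nn_integral_multc) (auto simp: ennreal_mult_less_top)
 finally have fin: "(NINT s. NINT x. ennreal (norm (indicator {0..1} s * (f (x + s *\<^sub>R h) * k x)))) < \<infinity>" .
 have m: "(\<lambda>(s::real, x). indicator {0..1} s * (f (x + s *\<^sub>R h) * k x)) \<in> borel_measurable (lborel \<Otimes>\<^sub>M lborel)"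
  by measurable
 show ?thesis
  unfolding integrable_iff_bounded
 proof
  have "(\<integral>\<^sup>+p. ennreal (norm (case p of (s, x) \<Rightarrow> indicator {0..1} s * (f (x + s *\<^sub>R h) * k x))) \<partial>(lborel \<Otimes>\<^sub>M lborel))
   = (\<integral>\<^sup>+s. (NINT x. ennreal (norm (indicator {0..1} s * (f (x + s *\<^sub>R h) * k x)))) \<partial>(lborel :: real measure))"
   by (subst lborel.nn_integral_fst[symmetric]) (use m in \<open>auto simp: case_prod_unfold\<close>)
  then show "(\<integral>\<^sup>+p. ennreal (norm (case p of (s, x) \<Rightarrow> indicator {0..1} s * (f (x + s *\<^sub>R h) * k x))) \<partial>(lborel \<Otimes>\<^sub>M lborel)) < \<infinity>"
   using fin by simp
 qed (rule m)
qed

lemma test_Lq2: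
 assumes \<phi>: "test_function \<phi>"
 shows "\<phi> \<in> Lq 2" "i \<in> Basis \<Longrightarrow> (\<lambda>x. fd \<phi> x i) \<in> Lq 2"
proof -
 obtain K B where b: "compact K" "B > 0" "\<And>x. \<bar>\<phi> x\<bar> \<le> B * indicator K x" "\<And>x i. i \<in> Basis \<Longrightarrow> \<bar>fd \<phi> x i\<bar> \<le> B * indicator K x"
  by (rule test_function_bounds[OF \<phi>]) blast
 have iK: "integrable lborel (\<lambda>x. B^2 * indicator K x)"
  using b(1) by (auto intro!: integrable_real_indicator emeasure_bounded_finite simp: compact_imp_bounded borel_compact)
 have L: "f \<in> Lq 2" if "\<And>x. \<bar>f x\<bar> \<le> B * indicator K x" "f \<in> borel_measurable borel" for f :: "'a \<Rightarrow> real"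
  unfolding Lq2_real_iff
 proof
  have "(f x)^2 \<le> B^2 * indicator K x" for x
   using power_mono[OF that(1)[of x] abs_ge_zero, of 2] by (cases "x \<in> K") auto
  then show "integrable lborel (\<lambda>x. (f x)^2)"
   using that(2) by (intro lintegrable_bound[OF iK]) (auto simp: abs_of_nonneg)
 qed (rule that(2))
 show "\<phi> \<in> Lq 2" by (rule L[OF b(3) measurable_test[OF \<phi>]])
 show "(\<lambda>x. fd \<phi> x i) \<in> Lq 2" if "i \<in> Basis"
  by (rule L[OF b(4)[OF that] measurable_cont[OF test_function_deriv_cont[OF \<phi> that]]])
qed

lemma frechet_dir:
 assumes "f differentiable (at x)"
 shows "fd f x h = (\<Sum>i\<in>Basis. (h \<bullet> i) * fd f x i)"
proof -
 have l: "linear (fd f x)" using assms frechet_has_derivative has_derivative_linear by blast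
 have "fd f x h = fd f x (\<Sum>i\<in>Basis. (h \<bullet> i) *\<^sub>R i)"
  by (simp add: euclidean_representation)
 also have "\<dots> = (\<Sum>i\<in>Basis. (h \<bullet> i) * fd f x i)"
  using l by (simp add: linear_sum linear_scale)
 finally show ?thesis .
qed

lemma Lq2_sum:
 fixes f :: "'i \<Rightarrow> 'a::euclidean_space \<Rightarrow> 'b::euclidean_space"
 assumes "finite I" "\<And>i. i \<in> I \<Longrightarrow> f i \<in> Lq 2" shows "(\<lambda>x. \<Sum>i\<in>I. f i x) \<in> Lq 2"
 using assms
proof (induction I rule: finite_induct)
 case empty show ?case by (simp add: Lq2_iff)
next
 case (insert i I)
 then show ?case using Lq2_add[of "f i" "\<lambda>x. \<Sum>i\<in>I. f i x"] by simp
qed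

lemma test_differentiable: "test_function \<phi> \<Longrightarrow> \<phi> differentiable (at x)"
 using test_function_deriv differentiable_def by blast

lemma test_dir_Lq2:
 fixes \<phi> :: "'a::euclidean_space \<Rightarrow> real"
 assumes \<phi>: "test_function \<phi>" shows "(\<lambda>x. fd \<phi> x h) \<in> Lq 2"
 unfolding frechet_dir[OF test_differentiable[OF \<phi>], of _ h]
 by (rule Lq2_sum) (use Lq2_scale[OF test_Lq2(2)[OF \<phi>]] in auto)

lemma test_dir_cont:
 fixes \<phi> :: "'a::euclidean_space \<Rightarrow> real"
 assumes \<phi>: "test_function \<phi>" shows "continuous_on UNIV (\<lambda>x. fd \<phi> x h)"
 unfolding frechet_dir[OF test_differentiable[OF \<phi>], of _ h]
 by (intro continuous_on_sum continuous_on_mult continuous_on_const test_function_deriv_cont[OF \<phi>])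

lemma sob_test_dir:
 fixes u :: "'a::euclidean_space \<Rightarrow> real"
 assumes u: "sob u g" and \<phi>: "test_function \<phi>"
 shows "(LBINT x. u x * fd \<phi> x h) = - (LBINT x. (g x \<bullet> h) * \<phi> x)"
proof -
 have "(LBINT x. u x * fd \<phi> x h) = (LBINT x. (\<Sum>i\<in>Basis. (h \<bullet> i) * (u x * fd \<phi> x i)))"
  unfolding frechet_dir[OF test_differentiable[OF \<phi>], of _ h] by (simp add: sum_distrib_left ac_simps)
 also have "\<dots> = (\<Sum>i\<in>Basis. (h \<bullet> i) * (LBINT x. u x * fd \<phi> x i))"
  by (subst lint_sum) (auto intro!: integrable_mult_right integrable_test(2)[OF sobD(8)[OF u] \<phi>])
 also have "\<dots> = - (\<Sum>i\<in>Basis. (h \<bullet> i) * (LBINT x. (g x \<bullet> i) * \<phi> x))"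
  by (simp add: sob_test[OF u \<phi>] sum_negf)
 also have "(\<Sum>i\<in>Basis. (h \<bullet> i) * (LBINT x. (g x \<bullet> i) * \<phi> x)) = (LBINT x. (\<Sum>i\<in>Basis. (h \<bullet> i) * ((g x \<bullet> i) * \<phi> x)))"
  by (subst lint_sum) (auto intro!: integrable_mult_right integrable_test(1)[OF locally_integrable_comp[OF sobD(9)[OF u]] \<phi>])
 also have "\<dots> = (LBINT x. (g x \<bullet> h) * \<phi> x)"
  by (subst (2) euclidean_inner) (simp add: sum_distrib_left sum_distrib_right ac_simps)
 finally show ?thesis .
qed

lemma Lq2_shift:
 fixes f :: "'a::euclidean_space \<Rightarrow> 'b::euclidean_space"
 assumes "f \<in> Lq 2" shows "(\<lambda>x. f (x + y)) \<in> Lq 2"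
 using integrable_affine[OF Lq2D(2)[OF assms], of 1 y] measurable_compose[of "\<lambda>x. x + y" borel borel f] Lq2D(1)[OF assms]
 unfolding Lq2_iff by simp

lemma integral_shift:
 fixes F :: "'a::euclidean_space \<Rightarrow> real"
 assumes "F \<in> borel_measurable borel"
 shows "(LBINT x. F (x + y)) = (LBINT x. F x)"
 using integral_affine[OF assms, of 1 y] by simp

text \<open>Both sides are paired with a test function. Fubini and a shift of variables put the
  translation on the test function, the weak gradient moves the derivative there, and the classical
  fundamental theorem on the segment finishes. The exceptional null set may depend on h.\<close>

lemma sob_ftc:
 fixes u :: "'a::euclidean_space \<Rightarrow> real"
 assumes u: "sob u g"
 shows "AE x in lborel. u (x + h) - u x = (LBINT s. indicator {0..1} s * (g (x + s *\<^sub>R h) \<bullet> h))"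
proof -
 let ?G = "\<lambda>x. LBINT s. indicator {0..1} s * (g (x + s *\<^sub>R h) \<bullet> h)"
 have gh: "(\<lambda>x. g x \<bullet> h) \<in> Lq 2" by (rule Lq2_comp[OF sobD(2)[OF u]])
 have [measurable]: "u \<in> borel_measurable borel" "g \<in> borel_measurable borel" using sobD[OF u] by auto
 have Gm[measurable]: "?G \<in> borel_measurable borel" by measurable
 have uh: "(\<lambda>x. u (x + h) - u x) \<in> Lq 2" by (intro Lq2_diff Lq2_shift sobD(1)[OF u])
 have ind: "(indicator K :: 'a \<Rightarrow> real) \<in> Lq 2" if K: "compact K" for K :: "'a set"
 proof -
  have "(indicator K x)^2 = (indicator K x :: real)" for x by (simp add: indicator_def)
  then show ?thesis
   unfolding Lq2_real_iff using borel_compact[OF K] emeasure_bounded_finite[OF compact_imp_bounded[OF K]]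
   by (simp add: integrable_real_indicator)
 qed
 have Gloc: "locally_integrable ?G"
  unfolding locally_integrable_def set_integrable_def
 proof (intro allI impI)
  fix K :: "'a set" assume K: "compact K"
  have "integrable lborel (\<lambda>x. LBINT s. indicator {0..1} s * ((g (x + s *\<^sub>R h) \<bullet> h) * indicator K x))"
   by (rule lborel_pair.integrable_snd[OF pair_int[OF gh ind[OF K], of h]])
  then have "integrable lborel (\<lambda>x. ?G x * indicator K x)"
   by (simp only: mult.assoc[symmetric] integral_mult_left_zero)
  then show "integrable lborel (\<lambda>x. indicator K x *\<^sub>R ?G x)"
   by (simp only: real_scaleR_def mult.commute)
 qed
 have "AE x in lborel. (u (x + h) - u x) - ?G x = 0"
 proof (rule AE_0_of_test_integrals)
  show "locally_integrable (\<lambda>x. (u (x + h) - u x) - ?G x)"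
   using locally_integrable_Lq2[OF uh] Gloc unfolding locally_integrable_def by (auto intro: set_integral_diff)
  fix \<psi> :: "'a \<Rightarrow> real" assume \<psi>: "test_function \<psi>"
  note [measurable] = measurable_test[OF \<psi>] measurable_cont[OF test_dir_cont[OF \<psi>]]
  have \<psi>h: "test_function (\<lambda>x. \<psi> (x + y))" for y using test_function_affine[OF \<psi>, of 1 y] by simp
  have d\<psi>h: "frechet_derivative (\<lambda>x. \<psi> (x + y)) (at x) h = fd \<psi> (x + y) h" for x y
  proof -
   have "(\<psi> has_derivative fd \<psi> (x + y)) (at (x + y))" by (rule test_function_deriv[OF \<psi>])
   then have "((\<lambda>x. \<psi> (x + y)) has_derivative fd \<psi> (x + y)) (at x)"
    by (rule has_derivative_compose[rotated]) (auto intro!: derivative_eq_intros)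
   then show ?thesis by (simp add: frechet_derivative_eqI)
  qed
  have i1: "integrable lborel (\<lambda>x. (u (x + h) - u x) * \<psi> x)" by (rule integrable_test(1)[OF locally_integrable_Lq2[OF uh] \<psi>])
  have i2: "integrable lborel (\<lambda>x. ?G x * \<psi> x)" by (rule integrable_test(1)[OF Gloc \<psi>])
  have "(LBINT x. ?G x * \<psi> x) = (LBINT x. LBINT s. indicator {0..1} s * ((g (x + s *\<^sub>R h) \<bullet> h) * \<psi> x))"
   by (simp only: mult.assoc[symmetric] integral_mult_left_zero)
  also have "\<dots> = (LBINT s. LBINT x. indicator {0..1} s * ((g (x + s *\<^sub>R h) \<bullet> h) * \<psi> x))"
   by (rule lborel_pair.Fubini_integral) (use pair_int[OF gh test_Lq2(1)[OF \<psi>], of h] in simp)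
  also have "\<dots> = (LBINT s. LBINT x. - (indicator {0..1} s * (fd \<psi> (x + s *\<^sub>R (- h)) h * u x)))"
  proof (rule lint_cong[OF refl])
   fix s :: real
   have "(LBINT x. (g (x + s *\<^sub>R h) \<bullet> h) * \<psi> x) = (LBINT x. (g x \<bullet> h) * \<psi> (x + s *\<^sub>R (- h)))"
    using integral_shift[of "\<lambda>x. (g x \<bullet> h) * \<psi> (x + s *\<^sub>R (- h))" "s *\<^sub>R h"] by simp
   also have "\<dots> = - (LBINT x. u x * fd \<psi> (x + s *\<^sub>R (- h)) h)"
    using sob_test_dir[OF u \<psi>h, of "s *\<^sub>R (- h)" h] unfolding d\<psi>h by simp
   finally have e: "(LBINT x. (g (x + s *\<^sub>R h) \<bullet> h) * \<psi> x) = - (LBINT x. u x * fd \<psi> (x + s *\<^sub>R (- h)) h)" .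
   show "(LBINT x. indicator {0..1} s * ((g (x + s *\<^sub>R h) \<bullet> h) * \<psi> x)) = (LBINT x. - (indicator {0..1} s * (fd \<psi> (x + s *\<^sub>R (- h)) h * u x)))"
    using e by (simp add: mult.commute)
  qed
  also have "\<dots> = (LBINT x. LBINT s. - (indicator {0..1} s * (fd \<psi> (x + s *\<^sub>R (- h)) h * u x)))"
   by (rule lborel_pair.Fubini_integral[symmetric]) (use pair_int[OF test_dir_Lq2[OF \<psi>, of h] sobD(1)[OF u], of "- h"] in \<open>simp add: case_prod_unfold\<close>)
  also have "\<dots> = (LBINT x. u x * \<psi> (x - h) - u x * \<psi> x)"
  proof (rule lint_cong[OF refl])
   fix x
   have d: "((\<lambda>s. - \<psi> (x + s *\<^sub>R (- h))) has_real_derivative fd \<psi> (x + s *\<^sub>R (- h)) h) (at s)" for s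
   proof -
    have "((\<lambda>s. x + s *\<^sub>R (- h)) has_derivative (\<lambda>t. t *\<^sub>R (- h))) (at s)" by (auto intro!: derivative_eq_intros)
    from has_derivative_compose[OF this test_function_deriv[OF \<psi>]]
    have "((\<lambda>s. \<psi> (x + s *\<^sub>R (- h))) has_derivative (\<lambda>t. fd \<psi> (x + s *\<^sub>R (- h)) (t *\<^sub>R (- h)))) (at s)" .
    moreover have "linear (fd \<psi> (x + s *\<^sub>R (- h)))"
     using test_function_deriv[OF \<psi>] has_derivative_linear by blast
    then have "fd \<psi> (x + s *\<^sub>R (- h)) (t *\<^sub>R (- h)) = (- fd \<psi> (x + s *\<^sub>R (- h)) h) * t" for t
     by (simp add: linear_scale linear_neg)
    ultimately have "((\<lambda>s. \<psi> (x + s *\<^sub>R (- h))) has_real_derivative - fd \<psi> (x + s *\<^sub>R (- h)) h) (at s)"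
     unfolding has_field_derivative_def by (simp only:)
    from DERIV_minus[OF this] show ?thesis by simp
   qed
   have "(LBINT s. fd \<psi> (x + s *\<^sub>R (- h)) h * indicator {0..1} s) = - \<psi> (x + 1 *\<^sub>R (- h)) - (- \<psi> (x + 0 *\<^sub>R (- h)))"
   proof (rule integral_FTC_Icc_real[of 0 1 "\<lambda>s. - \<psi> (x + s *\<^sub>R (- h))", OF _ d])
    fix s :: real
    have "continuous_on UNIV (\<lambda>s. fd \<psi> (x + s *\<^sub>R (- h)) h)"
     by (rule continuous_on_compose2[OF test_dir_cont[OF \<psi>]]) (auto intro!: continuous_intros)
    then show "isCont (\<lambda>s. fd \<psi> (x + s *\<^sub>R (- h)) h) s"
     by (simp add: continuous_on_eq_continuous_at)
   qed simp
   then have e: "(LBINT s. fd \<psi> (x + s *\<^sub>R (- h)) h * indicator {0..1} s) = \<psi> x - \<psi> (x - h)" by simp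
   have "(LBINT s. - (indicator {0..1} s * (fd \<psi> (x + s *\<^sub>R (- h)) h * u x)))
    = (LBINT s. (fd \<psi> (x + s *\<^sub>R (- h)) h * indicator {0..1} s) * (- u x))"
    by (rule lint_cong) auto
   also have "\<dots> = (\<psi> x - \<psi> (x - h)) * (- u x)" unfolding integral_mult_left_zero e ..
   finally show "(LBINT s. - (indicator {0..1} s * (fd \<psi> (x + s *\<^sub>R (- h)) h * u x))) = u x * \<psi> (x - h) - u x * \<psi> x"
    by (simp add: algebra_simps)
  qed
  also have "\<dots> = (LBINT x. u x * \<psi> (x + (- h))) - (LBINT x. u x * \<psi> x)"
   unfolding diff_conv_add_uminus[of _ h]
   by (rule lint_diff) (intro integrable_test(1)[OF sobD(8)[OF u]] \<psi>h \<psi>)+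
  also have "(LBINT x. u x * \<psi> (x + (- h))) = (LBINT x. u (x + h) * \<psi> x)"
   using integral_shift[of "\<lambda>x. u x * \<psi> (x + (- h))" h] by simp
  also have "\<dots> - (LBINT x. u x * \<psi> x) = (LBINT x. (u (x + h) - u x) * \<psi> x)"
   unfolding left_diff_distrib
   by (rule lint_diff[symmetric])
     (intro integrable_test(1)[OF locally_integrable_Lq2] Lq2_shift sobD(1)[OF u] \<psi>)+
  finally have "(LBINT x. ?G x * \<psi> x) = (LBINT x. (u (x + h) - u x) * \<psi> x)" .
  then show "(LBINT x. ((u (x + h) - u x) - ?G x) * \<psi> x) = 0"
   using lint_diff[OF i1 i2] by (simp add: left_diff_distrib)
 qed
 then show ?thesis by simp
qed

lemma nn_integral_sq: "f \<in> Lq 2 \<Longrightarrow> (NINT x. ennreal ((norm (f x))^2)) = ennreal (nsq f)"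
 for f :: "'a::euclidean_space \<Rightarrow> 'b::euclidean_space"
 by (rule nn_integral_eq_integral[OF Lq2D(2)]) auto

text \<open>Jensen on the segment from x to x + h, then translation invariance of the integral. The
  mollifier estimates, and through them the Rellich theorem, rest on this bound.\<close>

lemma sob_translation:
 fixes u :: "'a::euclidean_space \<Rightarrow> real"
 assumes u: "sob u g"
 shows "(NINT x. ennreal ((u (x + h) - u x)^2)) \<le> ennreal ((norm h)^2 * nsq g)"
proof -
 have [measurable]: "u \<in> borel_measurable borel" "g \<in> borel_measurable borel" using sobD[OF u] by auto
 let ?I = "indicator {0..1} :: real \<Rightarrow> real"
 have "(NINT x. ennreal ((u (x + h) - u x)^2)) = (NINT x. ennreal ((LBINT s. ?I s * (g (x + s *\<^sub>R h) \<bullet> h))^2))"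
  using sob_ftc[OF u, of h] by (intro nn_integral_cong_AE) (auto elim!: eventually_mono)
 also have "\<dots> \<le> (NINT x. NINT s. ennreal (?I s * (g (x + s *\<^sub>R h) \<bullet> h)^2))"
  by (intro nn_integral_mono nn_jensen) (auto simp: integrable_real_indicator)
 also have "\<dots> \<le> (NINT x. NINT s. ennreal (?I s * ((norm h)^2 * (norm (g (x + s *\<^sub>R h)))^2)))"
 proof (intro nn_integral_mono ennreal_leI mult_left_mono)
  fix x s
  show "(g (x + s *\<^sub>R h) \<bullet> h)^2 \<le> (norm h)^2 * (norm (g (x + s *\<^sub>R h)))^2"
   using power_mono[OF Cauchy_Schwarz_ineq2[of "g (x + s *\<^sub>R h)" h], of 2] by (simp add: power_mult_distrib mult.commute)
 qed auto
 also have "\<dots> = (NINT s. NINT x. ennreal (?I s * ((norm h)^2 * (norm (g (x + s *\<^sub>R h)))^2)))"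
  by (rule lborel_pair.Fubini') measurable
 also have "\<dots> = (NINT s. ennreal (?I s) * ennreal ((norm h)^2 * nsq g))"
 proof (rule nn_integral_cong)
  fix s :: real
  have "(NINT x. ennreal (?I s * ((norm h)^2 * (norm (g (x + s *\<^sub>R h)))^2)))
   = (NINT x. ennreal (?I s * (norm h)^2) * ennreal ((norm (g (x + s *\<^sub>R h)))^2))"
   by (intro nn_integral_cong) (simp add: ennreal_mult[symmetric] mult.assoc)
  also have "\<dots> = ennreal (?I s * (norm h)^2) * (NINT x. ennreal ((norm (g (x + s *\<^sub>R h)))^2))"
   by (rule nn_integral_cmult) measurable
  also have "(NINT x. ennreal ((norm (g (x + s *\<^sub>R h)))^2)) = (NINT x. ennreal ((norm (g x))^2))"
   using nn_integral_affine[of "\<lambda>x. ennreal ((norm (g x))^2)" 1 "s *\<^sub>R h"] by simp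
  also have "\<dots> = ennreal (nsq g)" by (rule nn_integral_sq[OF sobD(2)[OF u]])
  finally show "(NINT x. ennreal (?I s * ((norm h)^2 * (norm (g (x + s *\<^sub>R h)))^2)))
   = ennreal (?I s) * ennreal ((norm h)^2 * nsq g)"
   by (simp add: ennreal_mult[symmetric] mult.assoc)
 qed
 also have "\<dots> = ennreal ((norm h)^2 * nsq g)"
  by (subst nn_integral_multc) (auto simp: ennreal_indicator)
 finally show ?thesis .
qed

section \<open>Mollification\<close>

text \<open>Majorant for dominated convergence of difference quotients: the mean value theorem
  bounds them by the supremum of D, and for |t| at most 1 the increment vanishes off K thickened
  along e.\<close>

lemma diff_quotient_bound:
 fixes \<theta> D :: "'a::euclidean_space \<Rightarrow> real" and e :: 'a
 assumes d: "\<And>x t. ((\<lambda>t. \<theta> (x + t *\<^sub>R e)) has_real_derivative D (x + t *\<^sub>R e)) (at t)"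
  and D: "continuous_on UNIV D" and K: "compact K" "\<And>x. x \<notin> K \<Longrightarrow> \<theta> x = 0" "\<And>x. x \<notin> K \<Longrightarrow> D x = 0"
 obtains K' B where "compact K'" "\<And>x t. \<bar>t\<bar> \<le> 1 \<Longrightarrow> \<bar>\<theta> (x + t *\<^sub>R e) - \<theta> x\<bar> \<le> \<bar>t\<bar> * (B * indicator K' x)"
proof -
 obtain B where B: "B > 0" "\<And>x. \<bar>D x\<bar> \<le> B * indicator K x"
  using bounded_of_compact_support[OF D K(1) K(3)] by blast
 have DB: "\<bar>D x\<bar> \<le> B" for x using B(2)[of x] B(1) by (cases "x \<in> K") auto
 let ?K = "(\<lambda>p. fst p - snd p *\<^sub>R e) ` (K \<times> {-1..1::real})"
 have "compact ?K" by (intro compact_continuous_image continuous_intros compact_Times K) auto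
 moreover have "\<bar>\<theta> (x + t *\<^sub>R e) - \<theta> x\<bar> \<le> \<bar>t\<bar> * (B * indicator ?K x)" if t: "\<bar>t\<bar> \<le> 1" for x t
 proof (cases "x \<in> ?K")
  case False
  have "x \<notin> K" using False by (auto intro: rev_image_eqI[of "(x, 0)"])
  moreover have "x + t *\<^sub>R e \<notin> K"
  proof
   assume "x + t *\<^sub>R e \<in> K"
   then have "(x + t *\<^sub>R e, t) \<in> K \<times> {-1..1}" using t by auto
   then have "fst (x + t *\<^sub>R e, t) - snd (x + t *\<^sub>R e, t) *\<^sub>R e \<in> ?K" by (rule imageI)
   then show False using False by simp
  qed
  ultimately show ?thesis using K(2) False by simp
 next
  case True
  have "norm (\<theta> (x + t *\<^sub>R e) - \<theta> (x + 0 *\<^sub>R e)) \<le> B * norm (t - 0)"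
  proof (rule field_differentiable_bound[of UNIV "\<lambda>t. \<theta> (x + t *\<^sub>R e)" "\<lambda>t. D (x + t *\<^sub>R e)"])
   show "((\<lambda>t. \<theta> (x + t *\<^sub>R e)) has_field_derivative D (x + t *\<^sub>R e)) (at t within UNIV)" for t by (rule d)
   show "norm (D (x + t *\<^sub>R e)) \<le> B" for t using DB by simp
  qed auto
  then show ?thesis using True by (simp add: mult.commute)
 qed
 ultimately show ?thesis by (rule that)
qed

lemma integrable_indicator_compact: "compact K \<Longrightarrow> integrable lborel (\<lambda>x. c * indicator K x :: real)"
 for K :: "'a::euclidean_space set"
 by (auto intro!: integrable_real_indicator emeasure_bounded_finite simp: compact_imp_bounded borel_compact)

lemma integrable_bounded_support:
 fixes f :: "'a::euclidean_space \<Rightarrow> real"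
 assumes "f \<in> borel_measurable borel" "compact K" "\<And>x. \<bar>f x\<bar> \<le> B * indicator K x"
 shows "integrable lborel f"
 by (rule lintegrable_bound[OF integrable_indicator_compact[OF assms(2), of B]])
   (use assms(1,3) order_trans[OF assms(3) abs_ge_self] in auto)

text \<open>Every difference quotient has integral 0 by translation invariance, and the quotients
  converge dominatedly to D.\<close>

lemma integral_partial_derivative_0:
 fixes \<theta> D :: "'a::euclidean_space \<Rightarrow> real" and e :: 'a
 assumes d: "\<And>x t. ((\<lambda>t. \<theta> (x + t *\<^sub>R e)) has_real_derivative D (x + t *\<^sub>R e)) (at t)"
  and \<theta>: "continuous_on UNIV \<theta>"
  and D: "continuous_on UNIV D" and K: "compact K" "\<And>x. x \<notin> K \<Longrightarrow> \<theta> x = 0" "\<And>x. x \<notin> K \<Longrightarrow> D x = 0"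
 shows "(LBINT x. D x) = 0"
proof -
 obtain K' B where K': "compact K'" "\<And>x t. \<bar>t\<bar> \<le> 1 \<Longrightarrow> \<bar>\<theta> (x + t *\<^sub>R e) - \<theta> x\<bar> \<le> \<bar>t\<bar> * (B * indicator K' x)"
  using diff_quotient_bound[OF d D K] by blast
 note [measurable] = measurable_cont[OF \<theta>] measurable_cont[OF D]
 define t where "t n = inverse (real (Suc n))" for n
 have t: "t n > 0" "\<bar>t n\<bar> \<le> 1" for n by (auto simp: t_def field_simps)
 have t0: "t \<longlonglongrightarrow> 0" unfolding t_def by (rule LIMSEQ_inverse_real_of_nat)
 let ?f = "\<lambda>n x. (\<theta> (x + t n *\<^sub>R e) - \<theta> x) / t n"
 obtain B0 where B0: "\<And>x. \<bar>\<theta> x\<bar> \<le> B0 * indicator K x" using bounded_of_compact_support[OF \<theta> K(1,2)] by blast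
 have \<theta>i: "integrable lborel \<theta>" by (rule integrable_bounded_support[OF _ K(1) B0]) measurable
 have "(\<lambda>n. LBINT x. ?f n x) \<longlonglongrightarrow> (LBINT x. D x)"
 proof (rule integral_dominated_convergence[where w="\<lambda>x. B * indicator K' x"])
  show "integrable lborel (\<lambda>x. B * indicator K' x)" by (rule integrable_indicator_compact[OF K'(1)])
  show "AE x in lborel. (\<lambda>n. ?f n x) \<longlonglongrightarrow> D x"
  proof (rule AE_I2)
   fix x
   have "((\<lambda>h. (\<theta> (x + (0 + h) *\<^sub>R e) - \<theta> (x + 0 *\<^sub>R e)) / h) \<longlongrightarrow> D (x + 0 *\<^sub>R e)) (at 0)"
    using d[of x 0] unfolding DERIV_def .
   then have l: "((\<lambda>h. (\<theta> (x + h *\<^sub>R e) - \<theta> x) / h) \<longlongrightarrow> D x) (at 0)" by simp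
   show "(\<lambda>n. ?f n x) \<longlonglongrightarrow> D x"
    by (rule filterlim_compose[OF l]) (use t0 t(1) in \<open>auto simp: filterlim_at less_imp_neq[symmetric]\<close>)
  qed
  show "AE x in lborel. norm (?f n x) \<le> B * indicator K' x" for n
  proof (rule AE_I2)
   fix x
   have "\<bar>\<theta> (x + t n *\<^sub>R e) - \<theta> x\<bar> \<le> t n * (B * indicator K' x)" using K'(2)[OF t(2), of x n] t(1)[of n] by simp
   then show "norm (?f n x) \<le> B * indicator K' x" using t(1)[of n] by (simp add: pos_divide_le_eq mult.commute)
  qed
 qed measurable
 moreover have "(LBINT x. ?f n x) = 0" for n
 proof -
  have i: "integrable lborel (\<lambda>x. \<theta> (x + t n *\<^sub>R e))" using integrable_affine[OF \<theta>i, of 1] by simp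
  have "(LBINT x. \<theta> (x + t n *\<^sub>R e) - \<theta> x) = 0"
   using integral_shift[of \<theta> "t n *\<^sub>R e"] i \<theta>i by (subst lint_diff) auto
  then show ?thesis by simp
 qed
 ultimately show ?thesis by (simp only: LIMSEQ_const_iff)
qed

lemma has_derivative_line:
 assumes "(f has_derivative f') (at (x + t *\<^sub>R e))"
 shows "((\<lambda>t. f (x + t *\<^sub>R e)) has_real_derivative f' e) (at t)"
proof -
 have "((\<lambda>t. x + t *\<^sub>R e) has_derivative (\<lambda>s. s *\<^sub>R e)) (at t)" by (auto intro!: derivative_eq_intros)
 from has_derivative_compose[OF this assms]
 have "((\<lambda>t. f (x + t *\<^sub>R e)) has_derivative (\<lambda>s. f' (s *\<^sub>R e))) (at t)" .
 moreover have "f' (s *\<^sub>R e) = f' e * s" for s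
  using linear_scale[OF has_derivative_linear[OF assms], of s e] by simp
 ultimately show ?thesis unfolding has_field_derivative_def by (simp only:)
qed

text \<open>The product with a test function is C1 with compact support, so its partial derivatives
  integrate to 0. Only C1 regularity is asked for, because the truncated bubbles are built from the
  square of a positive part.\<close>

lemma C1_compact_sob:
 fixes v :: "'a::euclidean_space \<Rightarrow> real" and G :: "'a \<Rightarrow> 'a"
 assumes d: "\<And>x. (v has_derivative (\<lambda>h. G x \<bullet> h)) (at x)" and G: "continuous_on UNIV G"
  and K: "compact K" "\<And>x. x \<notin> K \<Longrightarrow> v x = 0" "\<And>x. x \<notin> K \<Longrightarrow> G x = 0"
 shows "sob v G"
proof (rule sobI)
 have v: "continuous_on UNIV v" using has_derivative_continuous[OF d] by (simp add: continuous_on_eq_continuous_at)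
 note [measurable] = measurable_cont[OF v] measurable_cont[OF G]
 show "v \<in> Lq 2"
  unfolding Lq2_real_iff
 proof
  have "continuous_on UNIV (\<lambda>x. (v x)^2)" by (intro continuous_intros v)
  moreover have "(v x)^2 = 0" if "x \<notin> K" for x using K(2)[OF that] by simp
  ultimately obtain B where B: "\<And>x. \<bar>(v x)^2\<bar> \<le> B * indicator K x"
   using bounded_of_compact_support[OF _ K(1), of "\<lambda>x. (v x)^2"] by blast
  show "integrable lborel (\<lambda>x. (v x)^2)" by (rule integrable_bounded_support[OF _ K(1) B]) measurable
 qed measurable
 show "G \<in> Lq 2"
  unfolding Lq2_iff
 proof
  have "continuous_on UNIV (\<lambda>x. (norm (G x))^2)" by (intro continuous_intros G)
  moreover have "(norm (G x))^2 = 0" if "x \<notin> K" for x using K(3)[OF that] by simp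
  ultimately obtain B where B: "\<And>x. \<bar>(norm (G x))^2\<bar> \<le> B * indicator K x"
   using bounded_of_compact_support[OF _ K(1), of "\<lambda>x. (norm (G x))^2"] by blast
  show "integrable lborel (\<lambda>x. (norm (G x))^2)" by (rule integrable_bounded_support[OF _ K(1) B]) measurable
 qed measurable
 fix \<phi> :: "'a \<Rightarrow> real" and i :: 'a assume \<phi>: "test_function \<phi>" and i: "i \<in> Basis"
 let ?D\<phi> = "\<lambda>x. fd \<phi> x i"
 have "(LBINT x. v x * ?D\<phi> x + (G x \<bullet> i) * \<phi> x) = 0"
 proof (rule integral_partial_derivative_0[of "\<lambda>x. v x * \<phi> x" i])
  show "((\<lambda>t. v (x + t *\<^sub>R i) * \<phi> (x + t *\<^sub>R i)) has_real_derivative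
   v (x + t *\<^sub>R i) * ?D\<phi> (x + t *\<^sub>R i) + (G (x + t *\<^sub>R i) \<bullet> i) * \<phi> (x + t *\<^sub>R i)) (at t)" for x t
   using has_derivative_line[OF has_derivative_mult[OF d test_function_deriv[OF \<phi>]]] .
  show "continuous_on UNIV (\<lambda>x. v x * \<phi> x)" by (intro continuous_on_mult v test_function_continuous[OF \<phi>])
  show "continuous_on UNIV (\<lambda>x. v x * ?D\<phi> x + (G x \<bullet> i) * \<phi> x)"
   by (intro continuous_on_add continuous_on_mult continuous_on_inner continuous_on_const v G test_function_continuous[OF \<phi>] test_function_deriv_cont[OF \<phi> i])
 qed (use K in auto)
 moreover have "integrable lborel (\<lambda>x. v x * ?D\<phi> x)"
  by (rule integrable_test(2)[OF locally_integrable_Lq2[OF \<open>v \<in> Lq 2\<close>] \<phi> i])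
 moreover have "integrable lborel (\<lambda>x. (G x \<bullet> i) * \<phi> x)"
  by (rule integrable_test(1)[OF locally_integrable_comp[OF locally_integrable_Lq2[OF \<open>G \<in> Lq 2\<close>]] \<phi>])
 ultimately show "(LBINT x. v x * ?D\<phi> x) = - (LBINT x. (G x \<bullet> i) * \<phi> x)"
  by simp
qed

lemma grad_derivative:
 assumes "f differentiable (at x)"
 shows "(f has_derivative (\<lambda>h. grad f x \<bullet> h)) (at x)"
proof -
 have "fd f x = (\<lambda>h. grad f x \<bullet> h)"
 proof
  fix h
  have "grad f x \<bullet> h = (\<Sum>i\<in>Basis. fd f x i * (i \<bullet> h))" by (simp add: grad_def inner_sum_left)
  then show "fd f x h = grad f x \<bullet> h"
   unfolding frechet_dir[OF assms, of h] by (simp only: inner_commute[of _ h] mult.commute)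
 qed
 then show ?thesis using frechet_has_derivative[OF assms] by simp
qed

lemma grad_test_cont: "test_function \<phi> \<Longrightarrow> continuous_on UNIV (grad \<phi>)"
 unfolding grad_def[abs_def] by (intro continuous_on_sum continuous_on_scaleR test_function_deriv_cont continuous_on_const)

lemma test_sob:
 fixes \<phi> :: "'a::euclidean_space \<Rightarrow> real"
 assumes \<phi>: "test_function \<phi>" shows "sob \<phi> (grad \<phi>)"
proof -
 obtain K where K: "compact K" "\<And>x. x \<notin> K \<Longrightarrow> \<phi> x = 0" "\<And>x. x \<notin> K \<Longrightarrow> fd \<phi> x = (\<lambda>_. 0)"
  using test_function_support[OF \<phi>] by blast
 show ?thesis
  by (rule C1_compact_sob[OF grad_derivative[OF test_differentiable[OF \<phi>]] grad_test_cont[OF \<phi>] K(1,2)])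
    (simp_all add: grad_def K(3))
qed

text \<open>Mollification is written as a correlation: the kernel is not reflected.\<close>

definition moll :: "('a::euclidean_space \<Rightarrow> real) \<Rightarrow> ('a \<Rightarrow> real) \<Rightarrow> 'a \<Rightarrow> real" where
 "moll k f x = (LBINT y. f y * k (y - x))"

lemma test_shift: "test_function \<phi> \<Longrightarrow> test_function (\<lambda>x. \<phi> (x - y))"
 using test_function_affine[of \<phi> 1 "- y"] by simp

text \<open>The difference quotients fall on the kernel and converge dominatedly; the weak gradient
  identity, with the shifted kernel as test function, then moves the derivative back to u. The two
  minus signs cancel.\<close>

lemma moll_deriv:
 fixes u :: "'a::euclidean_space \<Rightarrow> real"
 assumes u: "sob u g" and k: "test_function k"
 shows "((\<lambda>t. moll k u (x + t *\<^sub>R e)) has_real_derivative moll k (\<lambda>y. g y \<bullet> e) (x + t *\<^sub>R e)) (at t)"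
proof -
 have main: "((\<lambda>h. (moll k u (x + h *\<^sub>R e) - moll k u x) / h) \<longlongrightarrow> moll k (\<lambda>y. g y \<bullet> e) x) (at 0)" for x
  unfolding tendsto_at_iff_sequentially
 proof (intro allI impI)
  fix X :: "nat \<Rightarrow> real" assume X: "\<forall>i. X i \<in> UNIV - {0}" "X \<longlonglongrightarrow> 0"
  let ?Dk = "\<lambda>z. fd k z e"
  obtain K where K: "compact K" "\<And>x. x \<notin> K \<Longrightarrow> k x = 0" "\<And>x. x \<notin> K \<Longrightarrow> fd k x = (\<lambda>_. 0)"
   using test_function_support[OF k] by blast
  obtain K' B where K': "compact K'" "\<And>x t. \<bar>t\<bar> \<le> 1 \<Longrightarrow> \<bar>k (x + t *\<^sub>R e) - k x\<bar> \<le> \<bar>t\<bar> * (B * indicator K' x)"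
   using diff_quotient_bound[OF has_derivative_line[OF test_function_deriv[OF k]] test_dir_cont[OF k] K(1,2), of e] K(3) by auto
  have "\<forall>\<^sub>F n in sequentially. \<bar>X n\<bar> \<le> 1"
   using X(2) by (auto simp: tendsto_iff dist_real_def dest!: spec[of _ 1] elim!: eventually_mono)
  then obtain N where N: "\<And>n. n \<ge> N \<Longrightarrow> \<bar>X n\<bar> \<le> 1" by (auto simp: eventually_sequentially)
  \<comment> \<open>The tail of the sequence on which |X n| is at most 1, the range in which the
    majorant holds.\<close>
  let ?Y = "\<lambda>n. X (n + N)"
  have Y: "\<bar>?Y n\<bar> \<le> 1" "?Y n \<noteq> 0" for n using N[of "n + N"] X(1) by auto
  have Y0: "?Y \<longlonglongrightarrow> 0" by (rule LIMSEQ_ignore_initial_segment[OF X(2)])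
  note [measurable] = sobD(4,5)[OF u] measurable_test[OF k] measurable_cont[OF test_dir_cont[OF k]]
  let ?f = "\<lambda>n y. u y * ((k (y - x + (- ?Y n) *\<^sub>R e) - k (y - x)) / ?Y n)"
  have "(\<lambda>n. LBINT y. ?f n y) \<longlonglongrightarrow> (LBINT y. u y * (- ?Dk (y - x)))"
  proof (rule integral_dominated_convergence[where w="\<lambda>y. \<bar>u y * (B * indicator K' (y - x))\<bar>"])
   have "(\<lambda>y. B * indicator K' (y - x)) \<in> borel_measurable borel" using borel_compact[OF K'(1)] by measurable
   moreover have "compact ((\<lambda>z. z + x) ` K')" by (intro compact_continuous_image continuous_intros K')
   moreover have "\<bar>B * indicator K' (y - x)\<bar> \<le> \<bar>B\<bar> * indicator ((\<lambda>z. z + x) ` K') y" for y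
    by (cases "y - x \<in> K'") (auto simp: indicator_def intro: rev_image_eqI[of "y - x"])
   ultimately show "integrable lborel (\<lambda>y. \<bar>u y * (B * indicator K' (y - x))\<bar>)"
    by (intro integrable_abs integrable_loc_mult[OF sobD(8)[OF u]])
   show "AE y in lborel. (\<lambda>n. ?f n y) \<longlonglongrightarrow> u y * (- ?Dk (y - x))"
   proof (rule AE_I2)
    fix y
    have "((\<lambda>h. k (y - x + h *\<^sub>R e)) has_real_derivative ?Dk (y - x + 0 *\<^sub>R e)) (at 0)"
     by (rule has_derivative_line[OF test_function_deriv[OF k]])
    then have l: "((\<lambda>h. (k (y - x + h *\<^sub>R e) - k (y - x)) / h) \<longlongrightarrow> ?Dk (y - x)) (at 0)"
     unfolding DERIV_def by simp
    have "(\<lambda>n. - ?Y n) \<longlonglongrightarrow> 0" using tendsto_minus[OF Y0] by simp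
    then have "filterlim (\<lambda>n. - ?Y n) (at 0) sequentially" using Y(2) by (simp add: filterlim_at)
    from tendsto_minus[OF filterlim_compose[OF l this]]
    have "(\<lambda>n. (k (y - x + (- ?Y n) *\<^sub>R e) - k (y - x)) / ?Y n) \<longlonglongrightarrow> - ?Dk (y - x)" by simp
    then show "(\<lambda>n. ?f n y) \<longlonglongrightarrow> u y * (- ?Dk (y - x))" by (rule tendsto_mult[OF tendsto_const])
   qed
   show "AE y in lborel. norm (?f n y) \<le> \<bar>u y * (B * indicator K' (y - x))\<bar>" for n
   proof (rule AE_I2)
    fix y
    have "\<bar>k (y - x + (- ?Y n) *\<^sub>R e) - k (y - x)\<bar> \<le> \<bar>?Y n\<bar> * (B * indicator K' (y - x))"
     using K'(2)[of "- ?Y n" "y - x"] Y(1)[of n] by simp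
    then have "\<bar>(k (y - x + (- ?Y n) *\<^sub>R e) - k (y - x)) / ?Y n\<bar> \<le> B * indicator K' (y - x)"
     using Y(2)[of n] by (simp add: divide_le_eq mult.commute)
    then have "\<bar>(k (y - x + (- ?Y n) *\<^sub>R e) - k (y - x)) / ?Y n\<bar> \<le> \<bar>B * indicator K' (y - x)\<bar>" by linarith
    then show "norm (?f n y) \<le> \<bar>u y * (B * indicator K' (y - x))\<bar>"
     unfolding real_norm_def abs_mult[of "u y"] by (rule mult_left_mono) simp
   qed
  qed measurable
  moreover have "(LBINT y. ?f n y) = (moll k u (x + ?Y n *\<^sub>R e) - moll k u x) / ?Y n" for n
  proof -
   have "(LBINT y. ?f n y) = (LBINT y. (u y * k (y - (x + ?Y n *\<^sub>R e)) - u y * k (y - x)) / ?Y n)"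
    by (rule lint_cong) (auto simp: algebra_simps diff_divide_distrib)
   also have "\<dots> = (moll k u (x + ?Y n *\<^sub>R e) - moll k u x) / ?Y n"
    unfolding moll_def integral_divide_zero
    by (subst lint_diff) (auto intro!: integrable_test(1)[OF sobD(8)[OF u]] test_shift k)
   finally show ?thesis .
  qed
  moreover have "(LBINT y. u y * (- ?Dk (y - x))) = moll k (\<lambda>y. g y \<bullet> e) x"
  proof -
   have "frechet_derivative (\<lambda>y. k (y - x)) (at y) e = ?Dk (y - x)" for y
   proof -
    have "((\<lambda>y. k (y - x)) has_derivative fd k (y - x)) (at y)"
     by (rule has_derivative_compose[OF _ test_function_deriv[OF k]]) (auto intro!: derivative_eq_intros)
    then show ?thesis by (simp add: frechet_derivative_eqI)
   qed
   then show ?thesis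
    using sob_test_dir[OF u test_shift[OF k], of x e] by (simp add: moll_def)
  qed
  ultimately have "(\<lambda>n. (moll k u (x + ?Y n *\<^sub>R e) - moll k u x) / ?Y n) \<longlonglongrightarrow> moll k (\<lambda>y. g y \<bullet> e) x" by (simp only:)
  then show "((\<lambda>h. (moll k u (x + h *\<^sub>R e) - moll k u x) / h) \<circ> X) \<longlonglongrightarrow> moll k (\<lambda>y. g y \<bullet> e) x"
   unfolding o_def by (rule LIMSEQ_offset)
 qed
 have "((\<lambda>h. (moll k u (x + (t + h) *\<^sub>R e) - moll k u (x + t *\<^sub>R e)) / h) \<longlongrightarrow> moll k (\<lambda>y. g y \<bullet> e) (x + t *\<^sub>R e)) (at 0)"
  using main[of "x + t *\<^sub>R e"] by (simp add: algebra_simps)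
 then show ?thesis unfolding DERIV_def .
qed

text \<open>Cauchy-Schwarz and the translation estimate for the kernel itself. The constant depends
  on f only through its L^2 norm; this is the equicontinuity used in \<open>rellich\<close>.\<close>

lemma moll_lipschitz:
 fixes f :: "'a::euclidean_space \<Rightarrow> real"
 assumes f: "f \<in> Lq 2" and k: "test_function k"
 shows "(moll k f x - moll k f x')^2 \<le> (LBINT y. (f y)^2) * ((norm (x - x'))^2 * nsq (grad k))"
proof -
 have k1: "(\<lambda>y. k (y - x)) \<in> Lq 2" for x using Lq2_shift[OF test_Lq2(1)[OF k], of "- x"] by simp
 have kd: "(\<lambda>y. k (y - x) - k (y - x')) \<in> Lq 2" by (rule Lq2_diff[OF k1 k1])
 have "moll k f x - moll k f x' = (LBINT y. f y * (k (y - x) - k (y - x')))"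
  unfolding moll_def right_diff_distrib
  by (rule lint_diff[symmetric]) (use Lq2_inner[OF f k1] in auto)
 also have "\<dots>^2 \<le> (LBINT y. (f y)^2) * (LBINT y. (k (y - x) - k (y - x'))^2)"
  by (rule cauchy_schwarz_integral) (use Lq2D(2)[OF f] Lq2D(2)[OF kd] Lq2_inner[OF f kd] in auto)
 also have "(LBINT y. (k (y - x) - k (y - x'))^2) \<le> (norm (x - x'))^2 * nsq (grad k)"
 proof -
  note [measurable] = measurable_test[OF k]
  have "(LBINT y. (k (y - x) - k (y - x'))^2) = (LBINT y. (k (y + (x' - x)) - k y)^2)"
   using integral_shift[of "\<lambda>y. (k (y - x) - k (y - x'))^2" "x'"] by (simp add: algebra_simps)
  moreover have "ennreal (LBINT y. (k (y + (x' - x)) - k y)^2) \<le> ennreal ((norm (x' - x))^2 * nsq (grad k))"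
  proof -
   have "(\<lambda>y. k (y + (x' - x)) - k y) \<in> Lq 2" by (intro Lq2_diff Lq2_shift test_Lq2(1)[OF k])
   from nn_integral_sq[OF this] show ?thesis using sob_translation[OF test_sob[OF k], of "x' - x"] by simp
  qed
  ultimately show ?thesis by (simp add: norm_minus_commute)
 qed
 finally show ?thesis by (simp add: mult_left_mono)
qed

lemma moll_continuous:
 fixes f :: "'a::euclidean_space \<Rightarrow> real"
 assumes f: "f \<in> Lq 2" and k: "test_function k"
 shows "continuous_on UNIV (moll k f)"
proof -
 let ?C = "sqrt ((LBINT y. (f y)^2) * nsq (grad k))"
 have "dist (moll k f x) (moll k f x') \<le> ?C * dist x x'" for x x'
 proof -
  have "\<bar>moll k f x - moll k f x'\<bar> = sqrt ((moll k f x - moll k f x')^2)" by simp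
  also have "\<dots> \<le> sqrt ((LBINT y. (f y)^2) * ((norm (x - x'))^2 * nsq (grad k)))"
   by (rule real_sqrt_le_mono[OF moll_lipschitz[OF f k]])
  also have "\<dots> = ?C * norm (x - x')" by (simp add: real_sqrt_mult mult.commute mult.left_commute)
  finally show ?thesis by (simp add: dist_norm)
 qed
 then have "?C-lipschitz_on UNIV (moll k f)" by (intro lipschitz_onI) (auto intro!: mult_nonneg_nonneg lint_nonneg)
 then show ?thesis by (rule lipschitz_on_continuous_on)
qed

lemma moll_bound:
 fixes f :: "'a::euclidean_space \<Rightarrow> real"
 assumes f: "f \<in> Lq 2" and k: "test_function k"
 shows "(moll k f x)^2 \<le> (LBINT y. (f y)^2) * (LBINT y. (k y)^2)"
proof -
 have k1: "(\<lambda>y. k (y - x)) \<in> Lq 2" using Lq2_shift[OF test_Lq2(1)[OF k], of "- x"] by simp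
 have "(moll k f x)^2 \<le> (LBINT y. (f y)^2) * (LBINT y. (k (y - x))^2)"
  unfolding moll_def by (rule cauchy_schwarz_integral) (use Lq2D(2)[OF f] Lq2D(2)[OF k1] Lq2_inner[OF f k1] in auto)
 also have "(LBINT y. (k (y - x))^2) = (LBINT y. (k y)^2)"
  using integral_shift[of "\<lambda>y. (k y)^2" "- x"] measurable_test[OF k] by simp
 finally show ?thesis .
qed

lemma moll_shift:
 assumes [measurable]: "f \<in> borel_measurable borel" "k \<in> borel_measurable borel"
 shows "moll k f x = (LBINT z. k z * f (z + x))"
 unfolding moll_def using integral_shift[of "\<lambda>y. f y * k (y - x)" x] by (simp add: mult.commute)

lemma moll_measurable[measurable]:
 assumes [measurable]: "f \<in> borel_measurable borel" "k \<in> borel_measurable borel"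
 shows "moll k f \<in> borel_measurable borel"
 unfolding moll_def[abs_def] by measurable

lemma moll_L2:
 fixes f :: "'a::euclidean_space \<Rightarrow> real"
 assumes f: "f \<in> Lq 2" and k: "test_function k" "\<And>z. k z \<ge> 0" "(LBINT z. k z) = 1"
 shows "moll k f \<in> Lq 2" "(LBINT x. (moll k f x)^2) \<le> (LBINT x. (f x)^2)"
proof -
 note [measurable] = measurable_test[OF k(1)] Lq2D(1)[OF f]
 have ki: "integrable lborel k" using k(3) not_integrable_integral_eq by fastforce
 have "(NINT x. ennreal ((moll k f x)^2)) \<le> (NINT x. NINT z. ennreal (k z * (f (z + x))^2))"
  by (intro nn_integral_mono, subst moll_shift, measurable) (intro nn_jensen k ki, measurable)
 also have "\<dots> = (NINT z. NINT x. ennreal (k z * (f (z + x))^2))"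
  by (rule lborel_pair.Fubini') measurable
 also have "\<dots> = (NINT z. ennreal (k z) * ennreal (LBINT x. (f x)^2))"
 proof (rule nn_integral_cong)
  fix z
  have "(NINT x. ennreal (k z * (f (z + x))^2)) = ennreal (k z) * (NINT x. ennreal ((f (x + z))^2))"
   using k(2)[of z] by (subst nn_integral_cmult[symmetric]) (auto simp: ennreal_mult add.commute)
  also have "(NINT x. ennreal ((f (x + z))^2)) = (NINT x. ennreal ((f x)^2))"
   using nn_integral_affine[of "\<lambda>x. ennreal ((f x)^2)" 1 z] by simp
  also have "\<dots> = ennreal (LBINT x. (f x)^2)" using nn_integral_sq[OF f] by simp
  finally show "(NINT x. ennreal (k z * (f (z + x))^2)) = ennreal (k z) * ennreal (LBINT x. (f x)^2)" .
 qed
 also have "\<dots> = (NINT z. ennreal (k z)) * ennreal (LBINT x. (f x)^2)" by (rule nn_integral_multc) measurable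
 also have "(NINT z. ennreal (k z)) = 1" using nn_integral_eq_integral[OF ki] k by simp
 finally have le: "(NINT x. ennreal ((moll k f x)^2)) \<le> ennreal (LBINT x. (f x)^2)" by simp
 have i: "integrable lborel (\<lambda>x. (moll k f x)^2)"
  by (rule integrableI_nonneg) (use le in \<open>auto simp: top.extremum_strict order_le_less_trans\<close>)
 then show "moll k f \<in> Lq 2" unfolding Lq2_real_iff by simp
 have "ennreal (LBINT x. (moll k f x)^2) \<le> ennreal (LBINT x. (f x)^2)"
  using le nn_integral_eq_integral[OF i] by simp
 then show "(LBINT x. (moll k f x)^2) \<le> (LBINT x. (f x)^2)"
  by (subst (asm) ennreal_le_iff) (auto intro: lint_nonneg)
qed

text \<open>As the kernel is a probability density supported in the ball of radius R, Jensen reduces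
  the error to translations of u by vectors of length at most R. The bound is uniform over functions
  with a common gradient bound.\<close>

lemma moll_approx:
 fixes u :: "'a::euclidean_space \<Rightarrow> real"
 assumes u: "sob u g" and k: "test_function k" "\<And>z. k z \<ge> 0" "(LBINT z. k z) = 1" "\<And>z. k z \<noteq> 0 \<Longrightarrow> norm z \<le> R"
 shows "(LBINT x. (moll k u x - u x)^2) \<le> R^2 * nsq g"
proof -
 note [measurable] = measurable_test[OF k(1)] sobD(4)[OF u]
 have ki: "integrable lborel k" using k(3) not_integrable_integral_eq by fastforce
 have m: "moll k u x - u x = (LBINT z. k z * (u (x + z) - u x))" for x
 proof -
  have "integrable lborel (\<lambda>y. u y * k (y - x))" by (rule integrable_test(1)[OF sobD(8)[OF u] test_shift[OF k(1)]])
  then have "integrable lborel (\<lambda>z. k z * u (x + z))"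
   using integrable_affine[of "\<lambda>y. u y * k (y - x)" 1 x] by (simp add: mult.commute add.commute)
  then have "(LBINT z. k z * (u (x + z) - u x)) = (LBINT z. k z * u (x + z)) - (LBINT z. k z * u x)"
   unfolding right_diff_distrib by (intro lint_diff integrable_mult_left ki)
  then show ?thesis using k(3) by (simp add: moll_shift add.commute)
 qed
 let ?C = "R^2 * nsq g"
 have "(NINT x. ennreal ((moll k u x - u x)^2)) \<le> (NINT x. NINT z. ennreal (k z * (u (x + z) - u x)^2))"
  unfolding m by (intro nn_integral_mono nn_jensen k ki) measurable
 also have "\<dots> = (NINT z. NINT x. ennreal (k z * (u (x + z) - u x)^2))"
  by (rule lborel_pair.Fubini') measurable
 also have "\<dots> \<le> (NINT z. ennreal (k z) * ennreal ?C)"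
 proof (rule nn_integral_mono)
  fix z
  have "(NINT x. ennreal (k z * (u (x + z) - u x)^2)) = ennreal (k z) * (NINT x. ennreal ((u (x + z) - u x)^2))"
   using k(2)[of z] by (subst nn_integral_cmult[symmetric]) (auto simp: ennreal_mult)
  also have "\<dots> \<le> ennreal (k z) * ennreal ?C"
  proof (cases "k z = 0")
   case False
   have "(norm z)^2 \<le> R^2" using k(4)[OF False] by (intro power_mono) auto
   then have "ennreal ((norm z)^2 * nsq g) \<le> ennreal ?C"
    by (intro ennreal_leI mult_right_mono) (auto intro: lint_nonneg)
   then show ?thesis by (intro mult_left_mono order_trans[OF sob_translation[OF u, of z]]) auto
  qed simp
  finally show "(NINT x. ennreal (k z * (u (x + z) - u x)^2)) \<le> ennreal (k z) * ennreal ?C" .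
 qed
 also have "\<dots> = (NINT z. ennreal (k z)) * ennreal ?C" by (rule nn_integral_multc) measurable
 also have "(NINT z. ennreal (k z)) = 1" using nn_integral_eq_integral[OF ki] k by simp
 finally have le: "(NINT x. ennreal ((moll k u x - u x)^2)) \<le> ennreal ?C" by simp
 have "(\<lambda>x. moll k u x - u x) \<in> Lq 2" by (intro Lq2_diff moll_L2(1) sobD(1)[OF u] k)
 from nn_integral_sq[OF this] le have "ennreal (LBINT x. (moll k u x - u x)^2) \<le> ennreal ?C" by simp
 then show ?thesis
  by (subst (asm) ennreal_le_iff) (auto intro!: mult_nonneg_nonneg lint_nonneg)
qed

lemma mollifier_exists:
 assumes R: "R > 0"
 obtains k :: "'a::euclidean_space \<Rightarrow> real" where "test_function k" "\<And>z. k z \<ge> 0" "(LBINT z. k z) = 1" "\<And>z. k z \<noteq> 0 \<Longrightarrow> norm z \<le> R"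
proof -
 \<comment> \<open>The box of half-width R / DIM lies in the ball of radius R, because the norm is
   at most the sum of the absolute coordinates.\<close>
 define d where "d = R / real DIM('a)"
 have d: "d > 0" using R by (simp add: d_def)
 let ?b = "bump 1 (- d *\<^sub>R One) (d *\<^sub>R One) :: 'a \<Rightarrow> real"
 have t: "test_function ?b" by (rule test_function_bump) simp
 obtain K B where b: "compact K" "\<And>x. \<bar>?b x\<bar> \<le> B * indicator K x" by (rule test_function_bounds[OF t]) blast
 have i: "integrable lborel ?b" by (rule integrable_bounded_support[OF measurable_test[OF t] b])
 have I: "(LBINT z. ?b z) > 0"
 proof -
  have "(LBINT z. ?b z) \<noteq> 0"
  proof
   assume "(LBINT z. ?b z) = 0"
   then have "AE z in lborel. ?b z = 0"
    using integral_nonneg_eq_0_iff_AE[OF i] bump_nonneg[of 1] by auto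
   then have "AE z in lborel. z \<notin> box (- d *\<^sub>R One) (d *\<^sub>R One :: 'a)"
    by eventually_elim (metis bump_pos_iff less_irrefl zero_less_one)
   then have "emeasure lborel (box (- d *\<^sub>R One) (d *\<^sub>R One :: 'a)) = 0"
    using emeasure_eq_0_AE by fastforce
   then show False using d by (simp add: emeasure_lborel_box_eq prod_pos inner_simps)
  qed
  moreover have "(LBINT z. ?b z) \<ge> 0" by (intro lint_nonneg bump_nonneg) simp
  ultimately show ?thesis by linarith
 qed
 let ?k = "\<lambda>z. inverse (LBINT z. ?b z) * ?b z"
 show ?thesis
 proof (rule that[of ?k])
  show "test_function ?k" by (rule test_function_mult[OF t C_k_const])
  show "?k z \<ge> 0" for z by (intro mult_nonneg_nonneg bump_nonneg) (use I in auto)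
  show "(LBINT z. ?k z) = 1" using I by simp
  fix z assume "?k z \<noteq> 0"
  then have "?b z \<noteq> 0" by auto
  then have z: "z \<in> box (- d *\<^sub>R One) (d *\<^sub>R One)" using bump_support[of 1 z] by force
  have "norm z \<le> (\<Sum>i\<in>Basis. \<bar>z \<bullet> i\<bar>)" by (rule norm_le_l1)
  also have "\<dots> \<le> (\<Sum>i\<in>(Basis::'a set). d)" by (rule sum_mono) (use z in \<open>force simp: mem_box abs_le_iff\<close>)
  also have "\<dots> = R" by (simp add: d_def)
  finally show "norm z \<le> R" .
 qed
qed

section \<open>Sharp Sobolev inequality for Sobolev functions on R^3\<close>

definition v3 :: "real \<Rightarrow> real \<Rightarrow> real \<Rightarrow> real^3" where
 "v3 x y z = x *\<^sub>R axis 1 1 + y *\<^sub>R axis 2 1 + z *\<^sub>R axis 3 1"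

lemma v3_nth[simp]: "v3 x y z $ 1 = x" "v3 x y z $ 2 = y" "v3 x y z $ 3 = z"
 by (simp_all add: v3_def axis_def)

lemma Basis3: "(Basis :: (real^3) set) = {axis 1 1, axis 2 1, axis 3 1}"
 by (auto simp: Basis_vec_def UNIV_3)

lemma axis3_distinct: "(axis 1 1 :: real^3) \<noteq> axis 2 1" "(axis 1 1 :: real^3) \<noteq> axis 3 1" "(axis 2 1 :: real^3) \<noteq> axis 3 1"
 by (simp_all add: axis_eq_axis)

lemma sum_Basis3: "(\<Sum>i\<in>(Basis :: (real^3) set). f i) = f (axis 1 1) + f (axis 2 1) + f (axis 3 1)"
 unfolding Basis3 using axis3_distinct by (simp add: add.assoc)

lemma prod_Basis3: "(\<Prod>i\<in>(Basis :: (real^3) set). f i) = f (axis 1 1) * f (axis 2 1) * f (axis 3 1)"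
 unfolding Basis3 using axis3_distinct by (simp add: mult.assoc)

lemma v3_cont: "continuous_on UNIV (\<lambda>(x, y, z). v3 x y z)"
 unfolding v3_def case_prod_unfold by (intro continuous_intros)

lemma v3_measurable[measurable]: "(\<lambda>(x, y, z). v3 x y z) \<in> borel_measurable borel"
 by (rule measurable_cont[OF v3_cont])

lemma lborel_v3: "(lborel :: (real^3) measure) = distr lborel borel (\<lambda>(x, y, z). v3 x y z)"
proof (rule lborel_eqI)
 fix l u :: "real^3" assume le: "\<And>b. b \<in> Basis \<Longrightarrow> l \<bullet> b \<le> u \<bullet> b"
 have le': "l $ i \<le> u $ i" for i using le[of "axis i 1"] by (simp add: inner_axis axis_in_Basis_iff)
 have "(\<lambda>(x, y, z). v3 x y z) -` box l u = {l $ 1<..<u $ 1} \<times> {l $ 2<..<u $ 2} \<times> {l $ 3<..<u $ 3}"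
  by (auto simp: mem_box_cart forall_3)
 then have "emeasure (distr lborel borel (\<lambda>(x, y, z). v3 x y z)) (box l u)
  = emeasure (lborel \<Otimes>\<^sub>M lborel \<Otimes>\<^sub>M lborel) ({l $ 1<..<u $ 1} \<times> {l $ 2<..<u $ 2} \<times> {l $ 3<..<u $ 3})"
  by (simp add: emeasure_distr lborel_prod)
 also have "\<dots> = ennreal (u $ 1 - l $ 1) * (ennreal (u $ 2 - l $ 2) * ennreal (u $ 3 - l $ 3))"
 proof -
  have "sigma_finite_measure (lborel \<Otimes>\<^sub>M lborel :: (real \<times> real) measure)"
   unfolding lborel_prod by (rule sigma_finite_lborel)
  then show ?thesis
   by (subst sigma_finite_measure.emeasure_pair_measure_Times)
     (use le' in \<open>auto simp: lborel.emeasure_pair_measure_Times intro!: pair_measureI\<close>)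
 qed
 also have "\<dots> = ennreal (\<Prod>b\<in>Basis. (u - l) \<bullet> b)"
  using le' by (simp add: prod_Basis3 inner_axis ennreal_mult[symmetric] mult.assoc)
 finally show "emeasure (distr lborel borel (\<lambda>(x, y, z). v3 x y z)) (box l u) = ennreal (\<Prod>b\<in>Basis. (u - l) \<bullet> b)" .
qed simp

lemma nn_integral_v3:
 assumes [measurable]: "F \<in> borel_measurable borel"
 shows "(\<integral>\<^sup>+p. F p \<partial>(lborel :: (real^3) measure)) = (NINT p. (case p of (x, y, z) \<Rightarrow> F (v3 x y z)))"
 by (subst lborel_v3, subst nn_integral_distr) (use v3_measurable in \<open>auto simp: case_prod_unfold\<close>)

text \<open>The integral of (1 + |x|^2)^(-3) over R^3, as \<open>bubble_2_3\<close> shows; its value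
  is pi^2 / 4. The cube of the best Sobolev constant is 27 * SN^2.\<close>

definition SN :: real where "SN = Kq 2 * Kq (5/2) * Kq 3"

lemma SN_pos: "SN > 0"
 unfolding SN_def using Kq_pos[of 2] Kq_pos[of "5/2"] Kq_pos[of 3] by simp

text \<open>A positive profile that dominates the absolute values of its own partial derivatives and
  factorises like the majorant in \<open>knothe_sobolev\<close>; it is used to make functions
  positive.\<close>

definition kk :: "real \<Rightarrow> real \<Rightarrow> real \<Rightarrow> real" where "kk x y z = lz x * lz y * lz z"
definition dlz :: "real \<Rightarrow> real" where "dlz x = - 2 * x * (lz x)^2"

lemma lz_deriv: "(lz has_real_derivative dlz x) (at x)"
 unfolding lz_def dlz_def using one_plus_sq_pos[of x]
 by (auto intro!: derivative_eq_intros simp: power2_eq_square)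

lemma dlz_cont: "continuous_on A dlz"
 unfolding dlz_def by (intro continuous_intros lz_cont)

lemma dlz_le: "\<bar>dlz x\<bar> \<le> lz x"
proof -
 have "2 * \<bar>x\<bar> \<le> 1 + x^2" using sum_squares_bound[of 1 "\<bar>x\<bar>"] by simp
 from mult_right_mono[OF this, of "(lz x)^2"]
 have "2 * \<bar>x\<bar> * (lz x)^2 \<le> (1 + x^2) * (lz x)^2" by simp
 also have "\<dots> = lz x" using one_plus_sq_pos[of x] unfolding lz_def by (simp add: power2_eq_square)
 finally show ?thesis unfolding dlz_def by (simp add: abs_mult)
qed

lemma kk_pos: "kk x y z > 0" unfolding kk_def by (intro mult_pos_pos lz_pos)

lemma kk_le1: "kk x y z \<le> 1"
 unfolding kk_def using lz_le1 lz_pos by (intro mult_le_one) (auto simp: less_imp_le)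

lemma nn_kk: "(NINT p. (case p of (x, y, z) \<Rightarrow> ennreal (kk x y z))) < \<infinity>"
proof -
 have [measurable]: "lz \<in> borel_measurable borel" by (rule measurable_cont[OF lz_cont])
 have [measurable]: "(\<lambda>(x,y,z). ennreal (kk x y z)) \<in> borel_measurable borel"
  unfolding borel_prod[symmetric] kk_def by measurable
 have I: "(NINT z. ennreal (lz z)) = ennreal (integral\<^sup>L lborel lz)"
  by (rule nn_integral_eq_integral[OF lz_int]) (simp add: less_imp_le lz_pos)
 have e: "ennreal (kk x y z) = ennreal (lz x) * (ennreal (lz y) * ennreal (lz z))" for x y z
  unfolding kk_def by (simp add: ennreal_mult[symmetric] less_imp_le lz_pos mult.assoc)
 show ?thesis
  by (subst nn_integral_real3(1), measurable) (simp add: e nn_integral_cmult nn_integral_multc I ennreal_mult_less_top)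
qed

text \<open>Plane Cauchy-Schwarz; it bounds the squared derivative of sqrt (f^2 + g^2) by the sum of
  those of f and g.\<close>

lemma sq_mix: "(a * b + c * d)^2 \<le> (a^2 + c^2) * (b^2 + d^2)" for a b c d :: real
proof -
 have "(a^2 + c^2) * (b^2 + d^2) - (a * b + c * d)^2 = (a * d - b * c)^2" by (simp add: power2_eq_square algebra_simps)
 then show ?thesis by (metis diff_ge_0_iff_ge zero_le_power2)
qed

text \<open>Transport wants a positive function, so \<open>f0\<close> is replaced by the square root
  of \<open>f0\<close>^2 + (\<delta> * kk)^2. This is C1, dominates |\<open>f0\<close>|, and its
  Dirichlet integral exceeds that of \<open>f0\<close> by at most a multiple of \<delta>^2; then
  \<delta> tends to 0.\<close>

lemma sobolev_C1_compact:
 fixes f0 :: "real^3 \<Rightarrow> real" and G :: "real^3 \<Rightarrow> real^3"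
 assumes d: "\<And>x t i. i \<in> Basis \<Longrightarrow> ((\<lambda>t. f0 (x + t *\<^sub>R i)) has_real_derivative G (x + t *\<^sub>R i) \<bullet> i) (at t)"
  and c: "continuous_on UNIV f0" "continuous_on UNIV G"
  and K: "compact K" "\<And>x. x \<notin> K \<Longrightarrow> f0 x = 0"
  and A: "(NINT x. ennreal ((norm (G x))^2)) \<le> ennreal A" "A \<ge> 0"
  and I: "ennreal I \<le> (NINT x. ennreal (f0 x^6))"
 shows "27 * SN^2 * I \<le> A^3"
proof -
 define F where "F x y z = f0 (v3 x y z)" for x y z
 define Gi where "Gi i x y z = G (v3 x y z) \<bullet> axis i 1" for i :: 3 and x y z
 have cF: "continuous_on UNIV (\<lambda>(x,y,z). F x y z)"
  using continuous_on_compose2[OF c(1) v3_cont] by (simp add: F_def case_prod_unfold)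
 have cG: "continuous_on UNIV (\<lambda>(x,y,z). Gi i x y z)" for i
  using continuous_on_inner[OF continuous_on_compose2[OF c(2) v3_cont] continuous_on_const, of "axis i 1"]
  by (simp add: Gi_def case_prod_unfold)
 have sh: "v3 (x + t) y z = v3 x y z + t *\<^sub>R axis 1 1" "v3 x (y + t) z = v3 x y z + t *\<^sub>R axis 2 1" "v3 x y (z + t) = v3 x y z + t *\<^sub>R axis 3 1" for x y z t
  by (simp_all add: v3_def algebra_simps)
 have dF: "((\<lambda>t. F t y z) has_real_derivative Gi 1 x y z) (at x)" "((\<lambda>t. F x t z) has_real_derivative Gi 2 x y z) (at y)"
   "((\<lambda>t. F x y t) has_real_derivative Gi 3 x y z) (at z)" for x y z
  using d[of "axis 1 1" "v3 0 y z" x] d[of "axis 2 1" "v3 x 0 z" y] d[of "axis 3 1" "v3 x y 0" z]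
  by (simp_all add: sh[symmetric] F_def Gi_def axis_in_Basis_iff)
 obtain B where B: "B > 0" "\<And>x y z. \<bar>F x y z\<bar> \<le> B * kk x y z"
 proof -
  let ?q = "\<lambda>p. f0 p / kk (p $ 1) (p $ 2) (p $ 3)"
  have "continuous_on UNIV (\<lambda>p :: real^3. kk (p $ 1) (p $ 2) (p $ 3))"
   unfolding kk_def by (intro continuous_on_mult continuous_on_compose2[OF lz_cont[of UNIV]] continuous_intros) auto
  then have "continuous_on UNIV ?q" using c(1) kk_pos by (intro continuous_on_divide) (auto simp: less_imp_neq[symmetric])
  then obtain B where B: "B > 0" "\<And>x. \<bar>?q x\<bar> \<le> B * indicator K x"
   using bounded_of_compact_support[OF _ K(1), of ?q] K(2) by auto
  have "\<bar>F x y z\<bar> \<le> B * kk x y z" for x y z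
  proof -
   have "\<bar>?q (v3 x y z)\<bar> \<le> B" using B(2)[of "v3 x y z"] B(1) by (cases "v3 x y z \<in> K") auto
   then show ?thesis using kk_pos[of x y z] by (simp add: F_def abs_div divide_le_eq)
  qed
  then show ?thesis using B(1) that by blast
 qed
 define X where "X = enn2real (NINT p. (case p of (x, y, z) \<Rightarrow> ennreal (kk x y z)))"
 have X: "(NINT p. (case p of (x, y, z) \<Rightarrow> ennreal (kk x y z))) = ennreal X" "X \<ge> 0"
  unfolding X_def using nn_kk by (auto simp: less_top)
 \<comment> \<open>3 * X pays for the three partial derivatives of \<open>kk\<close>; the extra 1
   keeps the bound positive when A = 0, as \<open>knothe_sobolev\<close> demands.\<close>
 have main: "27 * SN^2 * I \<le> (A + \<delta>^2 * (3 * X + 1))^3" if \<delta>: "\<delta> > 0" for \<delta>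
  unfolding SN_def
 proof (rule knothe_sobolev)
  let ?f = "\<lambda>x y z. sqrt ((F x y z)^2 + (\<delta> * kk x y z)^2)"
  let ?g = "\<lambda>i dk x y z. (F x y z * Gi i x y z + (\<delta> * kk x y z) * (\<delta> * dk x y z)) / ?f x y z"
  let ?d1 = "\<lambda>x y z. dlz x * lz y * lz z" and ?d2 = "\<lambda>x y z. lz x * dlz y * lz z" and ?d3 = "\<lambda>x y z. lz x * lz y * dlz z"
  have fp: "(F x y z)^2 + (\<delta> * kk x y z)^2 > 0" for x y z
   using kk_pos[of x y z] \<delta> by (intro add_nonneg_pos) auto
  have l1: "continuous_on UNIV (\<lambda>p::real\<times>real\<times>real. lz (fst p))" "continuous_on UNIV (\<lambda>p::real\<times>real\<times>real. lz (fst (snd p)))" "continuous_on UNIV (\<lambda>p::real\<times>real\<times>real. lz (snd (snd p)))"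
   by (auto intro!: continuous_on_compose2[OF lz_cont[of UNIV]] continuous_intros)
  have l2: "continuous_on UNIV (\<lambda>p::real\<times>real\<times>real. dlz (fst p))" "continuous_on UNIV (\<lambda>p::real\<times>real\<times>real. dlz (fst (snd p)))" "continuous_on UNIV (\<lambda>p::real\<times>real\<times>real. dlz (snd (snd p)))"
   by (auto intro!: continuous_on_compose2[OF dlz_cont[of UNIV]] continuous_intros)
  have ck: "continuous_on UNIV (\<lambda>p::real\<times>real\<times>real. kk (fst p) (fst (snd p)) (snd (snd p)))"
   unfolding kk_def by (intro continuous_on_mult l1)
  have cF': "continuous_on UNIV (\<lambda>p::real\<times>real\<times>real. F (fst p) (fst (snd p)) (snd (snd p)))" using cF by (simp add: case_prod_unfold)
  have cG': "continuous_on UNIV (\<lambda>p::real\<times>real\<times>real. Gi i (fst p) (fst (snd p)) (snd (snd p)))" for i using cG[of i] by (simp add: case_prod_unfold)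
  have cf: "continuous_on UNIV (\<lambda>p::real\<times>real\<times>real. ?f (fst p) (fst (snd p)) (snd (snd p)))"
   by (intro continuous_on_real_sqrt continuous_on_add continuous_on_power continuous_on_mult continuous_on_const ck cF')
  then show "continuous_on UNIV (\<lambda>(x, y, z). ?f x y z)" by (simp add: case_prod_unfold)
  have cg: "continuous_on UNIV (\<lambda>(x, y, z). ?g i dk x y z)" if "continuous_on UNIV (\<lambda>p::real\<times>real\<times>real. dk (fst p) (fst (snd p)) (snd (snd p)))" for i dk
   unfolding case_prod_unfold
   by (intro continuous_on_divide continuous_on_add continuous_on_mult continuous_on_const that ck cF' cG' cf)
     (intro ballI, rule not_sym, rule less_imp_neq, rule real_sqrt_gt_zero[OF fp])
  show "continuous_on UNIV (\<lambda>(x, y, z). ?g 1 ?d1 x y z)" by (rule cg) (intro continuous_on_mult l1 l2)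
  show "continuous_on UNIV (\<lambda>(x, y, z). ?g 2 ?d2 x y z)" by (rule cg) (intro continuous_on_mult l1 l2)
  show "continuous_on UNIV (\<lambda>(x, y, z). ?g 3 ?d3 x y z)" by (rule cg) (intro continuous_on_mult l1 l2)
  have ds: "((\<lambda>t. sqrt ((p t)^2 + (\<delta> * q t)^2)) has_real_derivative (p t * p' + (\<delta> * q t) * (\<delta> * q')) / sqrt ((p t)^2 + (\<delta> * q t)^2)) (at t)"
   if "(p has_real_derivative p') (at t)" "(q has_real_derivative q') (at t)" "(p t)^2 + (\<delta> * q t)^2 > 0" for p q p' q' t
  proof -
   have "((\<lambda>t. (p t)^2 + (\<delta> * q t)^2) has_real_derivative (2 * (p t * p') + 2 * ((\<delta> * q t) * (\<delta> * q')))) (at t)"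
    by (auto intro!: derivative_eq_intros that(1,2))
   have E: "inverse s / 2 * (2 * a + 2 * b) = (a + b) / s" for s a b :: real
   proof -
    have "2 * a + 2 * b = 2 * (a + b)" by simp
    then show ?thesis by (simp only: divide_inverse) simp
   qed
   from DERIV_chain2[OF DERIV_real_sqrt[OF that(3)] \<open>((\<lambda>t. (p t)^2 + (\<delta> * q t)^2) has_real_derivative _) (at t)\<close>]
   show ?thesis unfolding E .
  qed
  show "((\<lambda>t. ?f t y z) has_real_derivative ?g 1 ?d1 x y z) (at x)" for x y z
   by (rule ds[OF dF(1) _ fp]) (auto intro!: derivative_eq_intros lz_deriv simp: kk_def)
  show "((\<lambda>t. ?f x t z) has_real_derivative ?g 2 ?d2 x y z) (at y)" for x y z
   by (rule ds[OF dF(2) _ fp]) (auto intro!: derivative_eq_intros lz_deriv simp: kk_def)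
  show "((\<lambda>t. ?f x y t) has_real_derivative ?g 3 ?d3 x y z) (at z)" for x y z
   by (rule ds[OF dF(3) _ fp]) (auto intro!: derivative_eq_intros lz_deriv simp: kk_def)
  show "?f x y z > 0" for x y z using fp by simp
  show "?f x y z \<le> (B + \<delta>) * (lz x * lz y * lz z)" for x y z
  proof -
   have "?f x y z \<le> \<bar>F x y z\<bar> + \<bar>\<delta> * kk x y z\<bar>" by (rule sqrt_sum_squares_le_sum_abs)
   also have "\<dots> \<le> (B + \<delta>) * kk x y z" using B(2)[of x y z] kk_pos[of x y z] \<delta> by (simp add: abs_mult algebra_simps)
   finally show ?thesis by (simp add: kk_def)
  qed
  have gle: "(?g i dk x y z)^2 \<le> (Gi i x y z)^2 + \<delta>^2 * kk x y z" if "\<bar>dk x y z\<bar> \<le> kk x y z" for i dk x y z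
  proof -
   have "(F x y z * Gi i x y z + (\<delta> * kk x y z) * (\<delta> * dk x y z))^2 \<le> ((F x y z)^2 + (\<delta> * kk x y z)^2) * ((Gi i x y z)^2 + (\<delta> * dk x y z)^2)"
    by (rule sq_mix)
   then have "(?g i dk x y z)^2 \<le> (Gi i x y z)^2 + (\<delta> * dk x y z)^2"
    using fp[of x y z] by (simp add: power_divide divide_le_eq mult.commute)
   also have "(dk x y z)^2 \<le> kk x y z"
   proof -
    have "(dk x y z)^2 \<le> (kk x y z)^2" using power_mono[OF that abs_ge_zero, of 2] by simp
    also have "\<dots> \<le> kk x y z" using kk_le1[of x y z] kk_pos[of x y z] by (simp add: power2_eq_square mult_left_le)
    finally show ?thesis .
   qed
   then have "(\<delta> * dk x y z)^2 \<le> \<delta>^2 * kk x y z" by (simp add: power_mult_distrib mult_left_mono)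
   finally show ?thesis by simp
  qed
  have dk: "\<bar>?d1 x y z\<bar> \<le> kk x y z" "\<bar>?d2 x y z\<bar> \<le> kk x y z" "\<bar>?d3 x y z\<bar> \<le> kk x y z" for x y z
   unfolding kk_def abs_mult using lz_pos[of x] lz_pos[of y] lz_pos[of z] dlz_le by (auto intro!: mult_mono simp: abs_of_pos less_imp_le)
  have nG: "(Gi 1 x y z)^2 + (Gi 2 x y z)^2 + (Gi 3 x y z)^2 = (norm (G (v3 x y z)))^2" for x y z
   unfolding Gi_def power2_norm_eq_inner by (subst (4) euclidean_inner) (simp add: sum_Basis3 power2_eq_square)
  note [measurable] = measurable_cont[OF c(2)] measurable_cont[OF c(1)] measurable_cont[OF ck]
  have m1: "(\<lambda>p. ennreal ((norm (G (case p of (x, y, z) \<Rightarrow> v3 x y z)))^2)) \<in> borel_measurable borel" by measurable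
  have "(NINT p. (case p of (x,y,z) \<Rightarrow> ennreal ((?g 1 ?d1 x y z)^2 + (?g 2 ?d2 x y z)^2 + (?g 3 ?d3 x y z)^2)))
   \<le> (NINT p. ennreal ((norm (G (case p of (x, y, z) \<Rightarrow> v3 x y z)))^2) + ennreal (3 * \<delta>^2) * (case p of (x, y, z) \<Rightarrow> ennreal (kk x y z)))"
  proof (rule nn_integral_mono, clarify)
   fix x y z
   have "(?g 1 ?d1 x y z)^2 + (?g 2 ?d2 x y z)^2 + (?g 3 ?d3 x y z)^2 \<le> (norm (G (v3 x y z)))^2 + 3 * \<delta>^2 * kk x y z"
    using gle[of ?d1 x y z 1, OF dk(1)] gle[of ?d2 x y z 2, OF dk(2)] gle[of ?d3 x y z 3, OF dk(3)] nG[of x y z] by linarith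
   then have "ennreal ((?g 1 ?d1 x y z)^2 + (?g 2 ?d2 x y z)^2 + (?g 3 ?d3 x y z)^2) \<le> ennreal ((norm (G (v3 x y z)))^2 + 3 * \<delta>^2 * kk x y z)"
    by (rule ennreal_leI)
   also have "\<dots> = ennreal ((norm (G (v3 x y z)))^2) + ennreal (3 * \<delta>^2) * ennreal (kk x y z)"
    using kk_pos[of x y z] by (subst ennreal_plus) (auto simp: ennreal_mult less_imp_le)
   finally show "ennreal ((?g 1 ?d1 x y z)^2 + (?g 2 ?d2 x y z)^2 + (?g 3 ?d3 x y z)^2) \<le> ennreal ((norm (G (v3 x y z)))^2) + ennreal (3 * \<delta>^2) * ennreal (kk x y z)" .
  qed
  also have "\<dots> = (NINT p. ennreal ((norm (G (case p of (x, y, z) \<Rightarrow> v3 x y z)))^2)) + ennreal (3 * \<delta>^2) * ennreal X"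
   unfolding X(1)[symmetric] using m1 by (subst nn_integral_add) (auto simp: case_prod_unfold nn_integral_cmult)
  also have "(NINT p. ennreal ((norm (G (case p of (x, y, z) \<Rightarrow> v3 x y z)))^2)) = (NINT x. ennreal ((norm (G x))^2))"
   by (subst nn_integral_v3) (auto simp: case_prod_unfold)
  also have "\<dots> + ennreal (3 * \<delta>^2) * ennreal X \<le> ennreal A + ennreal (3 * \<delta>^2) * ennreal X" by (intro add_mono A) simp
  also have "\<dots> = ennreal (A + 3 * \<delta>^2 * X)" using A(2) X(2) by (subst ennreal_plus) (auto simp: ennreal_mult)
  also have "\<dots> \<le> ennreal (A + \<delta>^2 * (3 * X + 1))" by (intro ennreal_leI) (simp add: algebra_simps)
  finally show "(NINT p. (case p of (x,y,z) \<Rightarrow> ennreal ((?g 1 ?d1 x y z)^2 + (?g 2 ?d2 x y z)^2 + (?g 3 ?d3 x y z)^2))) \<le> ennreal (A + \<delta>^2 * (3 * X + 1))" .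
  show "A + \<delta>^2 * (3 * X + 1) > 0" using A(2) X(2) \<delta> by (intro add_nonneg_pos mult_pos_pos) auto
  have "ennreal I \<le> (NINT p. (case p of (x,y,z) \<Rightarrow> ennreal (f0 (v3 x y z)^6)))"
   using I by (subst (asm) nn_integral_v3) auto
  also have "\<dots> \<le> (NINT p. (case p of (x,y,z) \<Rightarrow> ennreal (?f x y z^6)))"
  proof (rule nn_integral_mono, clarify)
   fix x y z
   have "\<bar>F x y z\<bar> \<le> ?f x y z" by (rule real_le_rsqrt) simp
   from power_mono[OF this abs_ge_zero, of 6] have "F x y z^6 \<le> ?f x y z^6" by (simp add: power_even_abs)
   then show "ennreal (f0 (v3 x y z)^6) \<le> ennreal (?f x y z^6)" unfolding F_def by (rule ennreal_leI)
  qed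
  finally show "ennreal I \<le> (NINT p. (case p of (x,y,z) \<Rightarrow> ennreal (?f x y z^6)))" .
 qed
 have "((\<lambda>\<delta>. (A + \<delta>^2 * (3 * X + 1))^3) \<longlongrightarrow> (A + 0^2 * (3 * X + 1))^3) (at_right 0)"
  by (intro tendsto_intros)
 then have "27 * SN^2 * I \<le> (A + 0^2 * (3 * X + 1))^3"
  by (rule tendsto_lowerbound) (use main in \<open>auto simp: eventually_at_right_field intro: exI[of _ 1]\<close>)
 then show ?thesis by simp
qed

lemma grad_bound:
 fixes \<phi> :: "'a::euclidean_space \<Rightarrow> real"
 assumes \<phi>: "test_function \<phi>"
 obtains C where "C \<ge> 0" "\<And>x. norm (grad \<phi> x) \<le> C" "\<And>x. \<bar>\<phi> x\<bar> \<le> C"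
proof -
 obtain K B where b: "B > 0" "\<And>x. \<bar>\<phi> x\<bar> \<le> B * indicator K x" "\<And>x i. i \<in> Basis \<Longrightarrow> \<bar>fd \<phi> x i\<bar> \<le> B * indicator K x"
  by (rule test_function_bounds[OF \<phi>]) blast
 have d: "\<bar>fd \<phi> x i\<bar> \<le> B" if "i \<in> Basis" for x i
  using b(3)[OF that, of x] b(1) by (cases "x \<in> K") auto
 have "norm (grad \<phi> x) \<le> real DIM('a) * B" for x
 proof -
  have "norm (grad \<phi> x) \<le> (\<Sum>i\<in>Basis. norm (fd \<phi> x i *\<^sub>R (i::'a)))" unfolding grad_def by (rule norm_sum)
  also have "\<dots> \<le> (\<Sum>i\<in>(Basis::'a set). B)" by (rule sum_mono) (simp add: d)
  finally show ?thesis by simp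
 qed
 moreover have "\<bar>\<phi> x\<bar> \<le> real DIM('a) * B" for x
 proof -
  have "B \<le> real DIM('a) * B" using b(1) DIM_positive[where 'a='a] by (simp add: Suc_leI)
  moreover have "\<bar>\<phi> x\<bar> \<le> B" using b(2)[of x] b(1) by (cases "x \<in> K") auto
  ultimately show ?thesis by linarith
 qed
 ultimately show ?thesis using b(1) by (intro that[of "real DIM('a) * B"]) auto
qed

text \<open>The free parameter matters in \<open>sobolev\<close>: there t tends to 0, so the main
  term keeps the factor 1 in the limit while the gradient of the cutoff is small enough to absorb 1
  / t.\<close>

lemma norm_add_young:
 fixes x y :: "'b::real_inner"
 assumes t: "t > 0" shows "(norm (x + y))^2 \<le> (1 + t) * (norm x)^2 + (1 + 1 / t) * (norm y)^2"
proof -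
 have "0 \<le> (norm (t *\<^sub>R x - y))^2 / t" using t by simp
 also have "(norm (t *\<^sub>R x - y))^2 / t = t * (norm x)^2 - 2 * (x \<bullet> y) + (norm y)^2 / t"
 proof -
  have "(norm (t *\<^sub>R x - y))^2 = t * (t * (norm x)^2) - t * (2 * (x \<bullet> y)) + (norm y)^2"
   by (simp add: power2_norm_eq_inner inner_diff_left inner_diff_right inner_commute algebra_simps)
  then show ?thesis using t by (simp add: add_divide_distrib diff_divide_distrib)
 qed
 finally have "2 * (x \<bullet> y) \<le> t * (norm x)^2 + (norm y)^2 / t" by simp
 moreover have "(norm (x + y))^2 = (norm x)^2 + 2 * (x \<bullet> y) + (norm y)^2"
  by (simp add: power2_norm_eq_inner inner_add inner_commute)
 ultimately show ?thesis by (simp add: algebra_simps)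
qed

text \<open>The bump is translated to a maximum point and normalised there, so that its value at the
  origin is also its supremum.\<close>

lemma unit_cutoff:
 obtains Z :: "'a::euclidean_space \<Rightarrow> real" where "test_function Z" "Z 0 = 1" "\<And>x. \<bar>Z x\<bar> \<le> 1"
proof -
 let ?b = "bump 1 (- One) One :: 'a \<Rightarrow> real"
 have t: "test_function ?b" by (rule test_function_bump) simp
 obtain m where m: "\<And>y. y \<in> cbox (- One) One \<Longrightarrow> ?b y \<le> ?b m"
  using continuous_attains_sup[of "cbox (- One) One :: 'a set" ?b] continuous_on_subset[OF test_function_continuous[OF t]] by (auto simp: box_ne_empty inner_simps)
 have nn: "?b y \<ge> 0" for y by (rule bump_nonneg) simp
 have b0: "?b 0 > 0" by (subst bump_pos_iff) (auto simp: mem_box inner_simps)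
 then have bm: "?b m > 0" using m[of 0] by (auto simp: mem_box inner_simps)
 have le: "?b y \<le> ?b m" for y
  using m[of y] bm bump_support[of 1 y "- One" One] box_subset_cbox[of "- One" One] by (cases "y \<in> box (- One) One") (auto simp: less_imp_le)
 show ?thesis
 proof (rule that[of "\<lambda>x. inverse (?b m) * ?b (1 *\<^sub>R x + m)"])
  show "test_function (\<lambda>x. inverse (?b m) * ?b (1 *\<^sub>R x + m))" by (intro test_function_mult[OF test_function_affine[OF t]] C_k_const) simp
 qed (use bm le nn in \<open>auto simp: abs_mult abs_of_nonneg field_simps\<close>)
qed

lemma mollifier_sequence:
 obtains t and k :: "nat \<Rightarrow> 'a::euclidean_space \<Rightarrow> real" where "\<And>n. t n > 0" "t \<longlonglongrightarrow> 0"
  "\<And>n. test_function (k n)" "\<And>n z. k n z \<ge> 0" "\<And>n. (LBINT z. k n z) = 1" "\<And>n z. k n z \<noteq> 0 \<Longrightarrow> norm z \<le> t n"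
proof -
 define t where "t n = inverse (real (Suc n))" for n
 have t: "t n > 0" for n by (auto simp: t_def)
 have t0: "t \<longlonglongrightarrow> 0" unfolding t_def by (rule LIMSEQ_inverse_real_of_nat)
 have "\<exists>k. test_function k \<and> (\<forall>z. k z \<ge> 0) \<and> (LBINT z. k z) = 1 \<and> (\<forall>z::'a. k z \<noteq> 0 \<longrightarrow> norm z \<le> t n)" for n
  using mollifier_exists[OF t[of n]] by metis
 then obtain k :: "nat \<Rightarrow> 'a \<Rightarrow> real" where "\<And>n. test_function (k n)" "\<And>n z. k n z \<ge> 0" "\<And>n. (LBINT z. k n z) = 1" "\<And>n z. k n z \<noteq> 0 \<Longrightarrow> norm z \<le> t n"
  by metis
 then show ?thesis by (rule that[OF t t0]) blast+
qed

text \<open>Mollify and cut off at radius of order 1 / \<open>t n\<close>. Mollification does not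
  increase L^2 norms and the cutoff costs a vanishing amount, so the constant stays sharp; Fatou
  along an almost everywhere convergent subsequence transfers the inequality to u.\<close>

theorem sobolev:
 fixes u :: "real^3 \<Rightarrow> real"
 assumes u: "sob u g"
 shows "integrable lborel (\<lambda>x. u x^6)"
  and "27 * SN^2 * (LBINT x. u x^6) \<le> (nsq g)^3"
proof -
 define A where "A = nsq g"
 define M where "M = (LBINT x. (u x)^2)"
 have AM: "A \<ge> 0" "M \<ge> 0" unfolding A_def M_def by (auto intro!: lint_nonneg)
 note [measurable] = sobD(4,5)[OF u]
 obtain t k where t: "\<And>n. t n > 0" and t0: "t \<longlonglongrightarrow> 0" and k: "\<And>n. test_function (k n)" "\<And>n z. k n z \<ge> 0" "\<And>n. (LBINT z. k n z) = 1" "\<And>n (z :: real^3). k n z \<noteq> 0 \<Longrightarrow> norm z \<le> t n"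
  by (rule mollifier_sequence) blast
 note [measurable] = measurable_test[OF k(1)]
 obtain Z :: "real^3 \<Rightarrow> real" where Z: "test_function Z" and Z0: "Z 0 = 1" and Z1: "\<And>x. \<bar>Z x\<bar> \<le> 1"
  by (rule unit_cutoff) blast
 obtain C0 where C0: "C0 \<ge> 0" "\<And>x. norm (grad Z x) \<le> C0" "\<And>x. \<bar>Z x\<bar> \<le> C0" using grad_bound[OF Z] by blast
 define \<zeta> where "\<zeta> n x = Z (t n *\<^sub>R x + 0)" for n x
 have \<zeta>: "test_function (\<zeta> n)" for n unfolding \<zeta>_def by (rule test_function_affine[OF Z less_imp_neq[OF t, symmetric]])
 have \<zeta>1: "\<bar>\<zeta> n x\<bar> \<le> 1" for n x unfolding \<zeta>_def by (rule Z1)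
 have g\<zeta>: "norm (grad (\<zeta> n) x) \<le> t n * C0" for n x
 proof -
  have "grad (\<zeta> n) x = t n *\<^sub>R grad Z (t n *\<^sub>R x + 0)"
   unfolding grad_def \<zeta>_def[abs_def] frechet_affine[OF Z] by (simp add: scaleR_sum_right)
  then show ?thesis using C0(2)[of "t n *\<^sub>R x + 0"] t[of n] by (simp add: mult_left_mono)
 qed
 have \<zeta>lim: "(\<lambda>n. \<zeta> n x) \<longlonglongrightarrow> 1" for x
 proof -
  have "(\<lambda>n. t n *\<^sub>R x + 0) \<longlonglongrightarrow> 0 *\<^sub>R x + 0" by (intro tendsto_intros t0)
  then have "(\<lambda>n. t n *\<^sub>R x + 0) \<longlonglongrightarrow> 0" by simp
  from continuous_on_tendsto_compose[OF test_function_continuous[OF Z] this] show ?thesis by (simp add: \<zeta>_def Z0)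
 qed
 define f where "f n x = \<zeta> n x * moll (k n) u x" for n x
 define \<gamma> where "\<gamma> n x = (\<Sum>i\<in>Basis. moll (k n) (\<lambda>y. g y \<bullet> i) x *\<^sub>R i)" for n x
 define G where "G n x = \<zeta> n x *\<^sub>R \<gamma> n x + moll (k n) u x *\<^sub>R grad (\<zeta> n) x" for n x
 \<comment> \<open>The Young parameter is \<open>t n\<close> itself: the gradient of the cutoff has
   size \<open>t n\<close> * C0, so its contribution is (t^2 + t) * C0^2 * M and tends to 0.\<close>
 define E where "E n = (1 + t n) * A + (1 + 1 / t n) * ((t n * C0)^2 * M)" for n
 have gi: "(\<lambda>y. g y \<bullet> i) \<in> Lq 2" for i by (rule Lq2_comp[OF sobD(2)[OF u]])
 have mu: "moll (k n) u \<in> Lq 2" "(LBINT x. (moll (k n) u x)^2) \<le> M" for n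
  using moll_L2[OF sobD(1)[OF u] k(1-3)] by (auto simp: M_def)
 have mg: "moll (k n) (\<lambda>y. g y \<bullet> i) \<in> Lq 2" "(LBINT x. (moll (k n) (\<lambda>y. g y \<bullet> i) x)^2) \<le> (LBINT x. (g x \<bullet> i)^2)" for n i
  using moll_L2[OF gi k(1-3)] by auto
 have c\<gamma>: "continuous_on UNIV (\<gamma> n)" for n
  unfolding \<gamma>_def[abs_def] by (intro continuous_on_sum continuous_on_scaleR continuous_on_const moll_continuous[OF gi k(1)])
 have cu: "continuous_on UNIV (moll (k n) u)" for n by (rule moll_continuous[OF sobD(1)[OF u] k(1)])
 have cf: "continuous_on UNIV (f n)" for n
  unfolding f_def[abs_def] by (intro continuous_on_mult test_function_continuous[OF \<zeta>] cu)
 have cG: "continuous_on UNIV (G n)" for n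
  unfolding G_def[abs_def] by (intro continuous_on_add continuous_on_scaleR test_function_continuous[OF \<zeta>] c\<gamma> cu grad_test_cont[OF \<zeta>])
 note [measurable] = measurable_cont[OF cf] measurable_cont[OF cG]
 have n\<gamma>: "\<gamma> n \<in> Lq 2" "nsq (\<gamma> n) \<le> A" for n
 proof -
  have ns: "(norm (\<gamma> n x))^2 = (\<Sum>i\<in>Basis. (moll (k n) (\<lambda>y. g y \<bullet> i) x)^2)" for x
   unfolding power2_norm_eq_inner by (subst euclidean_inner) (simp add: \<gamma>_def power2_eq_square)
  show "\<gamma> n \<in> Lq 2"
   unfolding Lq2_iff ns using measurable_cont[OF c\<gamma>] Lq2D(2)[OF mg(1)] by auto
  have "nsq (\<gamma> n) = (\<Sum>i\<in>Basis. LBINT x. (moll (k n) (\<lambda>y. g y \<bullet> i) x)^2)"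
   unfolding ns by (rule lint_sum) (use Lq2D(2)[OF mg(1)] in auto)
  also have "\<dots> \<le> (\<Sum>i\<in>Basis. LBINT x. (g x \<bullet> i)^2)" by (rule sum_mono) (rule mg(2))
  also have "\<dots> = (LBINT x. (\<Sum>i\<in>Basis. (g x \<bullet> i)^2))"
   by (rule lint_sum[symmetric]) (use Lq2D(2)[OF gi] in auto)
  also have "\<dots> = A" unfolding A_def power2_norm_eq_inner by (subst (2) euclidean_inner) (simp add: power2_eq_square)
  finally show "nsq (\<gamma> n) \<le> A" .
 qed
 have Gn: "(NINT x. ennreal ((norm (G n x))^2)) \<le> ennreal (E n)" "E n \<ge> 0" for n
 proof -
  have i1: "integrable lborel (\<lambda>x. (norm (\<gamma> n x))^2)" by (rule Lq2D(2)[OF n\<gamma>(1)])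
  have i2: "integrable lborel (\<lambda>x. (moll (k n) u x)^2)" using Lq2D(2)[OF mu(1)] by simp
  have pw: "(norm (G n x))^2 \<le> (1 + t n) * (norm (\<gamma> n x))^2 + (1 + 1 / t n) * ((t n * C0)^2 * (moll (k n) u x)^2)" for x
  proof -
   have "(norm (G n x))^2 \<le> (1 + t n) * (norm (\<zeta> n x *\<^sub>R \<gamma> n x))^2 + (1 + 1 / t n) * (norm (moll (k n) u x *\<^sub>R grad (\<zeta> n) x))^2"
    unfolding G_def by (rule norm_add_young[OF t])
   also have "\<dots> \<le> (1 + t n) * (norm (\<gamma> n x))^2 + (1 + 1 / t n) * ((t n * C0)^2 * (moll (k n) u x)^2)"
   proof (intro add_mono mult_left_mono)
    show "(norm (\<zeta> n x *\<^sub>R \<gamma> n x))^2 \<le> (norm (\<gamma> n x))^2"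
     using mult_right_mono[OF \<zeta>1[of n x], of "norm (\<gamma> n x)"] by (intro power_mono) auto
    have "(norm (grad (\<zeta> n) x))^2 \<le> (t n * C0)^2" by (intro power_mono g\<zeta>) simp
    then have "(moll (k n) u x)^2 * (norm (grad (\<zeta> n) x))^2 \<le> (moll (k n) u x)^2 * (t n * C0)^2" by (rule mult_left_mono) simp
    then show "(norm (moll (k n) u x *\<^sub>R grad (\<zeta> n) x))^2 \<le> (t n * C0)^2 * (moll (k n) u x)^2"
     by (simp add: power_mult_distrib mult.commute)
   qed (use t[of n] in \<open>auto intro: add_nonneg_nonneg less_imp_le\<close>)
   finally show ?thesis .
  qed
  have "(NINT x. ennreal ((norm (G n x))^2)) \<le> (NINT x. ennreal ((1 + t n) * (norm (\<gamma> n x))^2 + (1 + 1 / t n) * ((t n * C0)^2 * (moll (k n) u x)^2)))"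
   by (intro nn_integral_mono ennreal_leI pw)
  also have "\<dots> = ennreal (LBINT x. (1 + t n) * (norm (\<gamma> n x))^2 + (1 + 1 / t n) * ((t n * C0)^2 * (moll (k n) u x)^2))"
   by (rule nn_integral_eq_integral) (use i1 i2 t[of n] in \<open>auto intro!: AE_I2 add_nonneg_nonneg mult_nonneg_nonneg less_imp_le\<close>)
  also have "(LBINT x. (1 + t n) * (norm (\<gamma> n x))^2 + (1 + 1 / t n) * ((t n * C0)^2 * (moll (k n) u x)^2))
   = (1 + t n) * nsq (\<gamma> n) + (1 + 1 / t n) * ((t n * C0)^2 * (LBINT x. (moll (k n) u x)^2))"
   using i1 i2 by (subst lint_add) (auto intro!: integrable_mult_right)
  also have "\<dots> \<le> E n" unfolding E_def
   using n\<gamma>(2)[of n] mu(2)[of n] t[of n] by (intro add_mono mult_left_mono) (auto intro: add_nonneg_nonneg less_imp_le)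
  finally show "(NINT x. ennreal ((norm (G n x))^2)) \<le> ennreal (E n)" by (simp add: ennreal_leI)
  show "E n \<ge> 0" unfolding E_def using AM t[of n] by (intro add_nonneg_nonneg mult_nonneg_nonneg) auto
 qed
 have fn: "(NINT x. ennreal (f n x^6)) \<le> ennreal (E n^3 / (27 * SN^2))" for n
 proof -
  obtain K where K: "compact K" "\<And>x. x \<notin> K \<Longrightarrow> \<zeta> n x = 0" by (rule test_function_support[OF \<zeta>[of n]]) blast
  have K0: "f n x = 0" if "x \<notin> K" for x using K(2)[OF that] by (simp add: f_def)
  have c6: "continuous_on UNIV (\<lambda>x. f n x^6)" by (intro continuous_on_power cf)
  have "f n x^6 = 0" if "x \<notin> K" for x using K0[OF that] by simp
  then obtain B where B: "\<And>x. \<bar>f n x^6\<bar> \<le> B * indicator K x" using bounded_of_compact_support[OF c6 K(1)] by blast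
  have i6: "integrable lborel (\<lambda>x. f n x^6)" by (rule integrable_bounded_support[OF _ K(1) B]) measurable
  have e: "(NINT x. ennreal (f n x^6)) = ennreal (LBINT x. f n x^6)" by (rule nn_integral_eq_integral[OF i6]) simp
  have "27 * SN^2 * (LBINT x. f n x^6) \<le> E n^3"
  proof (rule sobolev_C1_compact[OF _ cf cG K(1) K0 Gn])
   fix x :: "real^3" and s :: real and i :: "real^3" assume i: "i \<in> Basis"
   have "((\<lambda>s. \<zeta> n (x + s *\<^sub>R i) * moll (k n) u (x + s *\<^sub>R i)) has_real_derivative
    fd (\<zeta> n) (x + s *\<^sub>R i) i * moll (k n) u (x + s *\<^sub>R i) + moll (k n) (\<lambda>y. g y \<bullet> i) (x + s *\<^sub>R i) * \<zeta> n (x + s *\<^sub>R i)) (at s)"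
    by (rule DERIV_mult[OF has_derivative_line[OF test_function_deriv[OF \<zeta>]] moll_deriv[OF u k(1)]])
   moreover have "\<gamma> n y \<bullet> i = moll (k n) (\<lambda>y. g y \<bullet> i) y" for y
    using i by (simp add: \<gamma>_def)
   ultimately show "((\<lambda>s. f n (x + s *\<^sub>R i)) has_real_derivative G n (x + s *\<^sub>R i) \<bullet> i) (at s)"
    using i by (simp add: f_def G_def inner_add_left grad_inner algebra_simps)
  qed (simp_all add: e)
  then have "(LBINT x. f n x^6) \<le> E n^3 / (27 * SN^2)" using SN_pos by (simp add: pos_le_divide_eq mult.commute)
  then show ?thesis unfolding e by (rule ennreal_leI)
 qed
 have L1: "integrable lborel (\<lambda>x. (moll (k n) u x - u x)^2)" for n
  using Lq2D(2)[OF Lq2_diff[OF mu(1) sobD(1)[OF u]]] by simp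
 have L2: "(\<lambda>n. LBINT x. norm ((moll (k n) u x - u x)^2)) \<longlonglongrightarrow> 0"
 proof (rule tendsto_sandwich[of "\<lambda>_. 0" _ _ "\<lambda>n. (t n)^2 * A"])
  show "\<forall>\<^sub>F n in sequentially. (LBINT x. norm ((moll (k n) u x - u x)^2)) \<le> (t n)^2 * A"
   using moll_approx[OF u k] by (auto simp: A_def)
  have "(\<lambda>n. (t n)^2 * A) \<longlonglongrightarrow> 0^2 * A" by (intro tendsto_intros t0)
  then show "(\<lambda>n. (t n)^2 * A) \<longlonglongrightarrow> 0" by simp
 qed (auto intro!: always_eventually lint_nonneg)
 obtain r :: "nat \<Rightarrow> nat" where r: "strict_mono r" "AE x in lborel. (\<lambda>n. (moll (k (r n)) u x - u x)^2) \<longlonglongrightarrow> 0"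
  using tendsto_L1_AE_subseq[OF L1 L2] by blast
 have El: "(\<lambda>n. E (r n)^3 / (27 * SN^2)) \<longlonglongrightarrow> A^3 / (27 * SN^2)"
 proof -
  have "(1 + 1 / s) * ((s * C0)^2 * M) = (s^2 + s) * (C0^2 * M)" if "s \<noteq> 0" for s
   using that by (simp add: field_simps power2_eq_square)
  then have Eq: "E = (\<lambda>n. (1 + t n) * A + ((t n)^2 + t n) * (C0^2 * M))"
   unfolding E_def using less_imp_neq[OF t, symmetric] by presburger
  have "(\<lambda>n. (1 + t n) * A + ((t n)^2 + t n) * (C0^2 * M)) \<longlonglongrightarrow> (1 + 0) * A + (0^2 + 0) * (C0^2 * M)"
   by (intro tendsto_intros t0)
  then have "E \<longlonglongrightarrow> A" unfolding Eq by simp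
  from LIMSEQ_subseq_LIMSEQ[OF this r(1)] have "(\<lambda>n. E (r n)) \<longlonglongrightarrow> A" by (simp add: o_def)
  then show ?thesis by (intro tendsto_intros) (use SN_pos in auto)
 qed
 have "(NINT x. ennreal (u x^6)) = (NINT x. liminf (\<lambda>n. ennreal (f (r n) x^6)))"
 proof (rule nn_integral_cong_AE)
  show "AE x in lborel. ennreal (u x^6) = liminf (\<lambda>n. ennreal (f (r n) x^6))"
   using r(2)
  proof eventually_elim
   case (elim x)
   have "(\<lambda>n. \<bar>moll (k (r n)) u x - u x\<bar>) \<longlonglongrightarrow> 0" using tendsto_real_sqrt[OF elim] by simp
   then have "(\<lambda>n. moll (k (r n)) u x) \<longlonglongrightarrow> u x" by (simp add: tendsto_rabs_zero_iff LIM_zero_iff)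
   moreover have "(\<lambda>n. \<zeta> (r n) x) \<longlonglongrightarrow> 1" using LIMSEQ_subseq_LIMSEQ[OF \<zeta>lim[of x] r(1)] by (simp add: o_def)
   ultimately have "(\<lambda>n. f (r n) x) \<longlonglongrightarrow> 1 * u x" unfolding f_def by (intro tendsto_mult)
   then have "(\<lambda>n. ennreal (f (r n) x^6)) \<longlonglongrightarrow> ennreal (u x^6)" by (intro tendsto_ennrealI tendsto_power) simp
   from lim_imp_Liminf[OF trivial_limit_sequentially this] show ?case by (rule sym)
  qed
 qed
 also have "\<dots> \<le> liminf (\<lambda>n. NINT x. ennreal (f (r n) x^6))" by (rule nn_integral_liminf) measurable
 also have "\<dots> \<le> liminf (\<lambda>n. ennreal (E (r n)^3 / (27 * SN^2)))" by (intro Liminf_mono always_eventually allI fn)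
 also have "\<dots> = ennreal (A^3 / (27 * SN^2))" using tendsto_ennrealI[OF El] by (simp add: lim_imp_Liminf)
 finally have le: "(NINT x. ennreal (u x^6)) \<le> ennreal (A^3 / (27 * SN^2))" .
 show i: "integrable lborel (\<lambda>x. u x^6)"
  by (rule integrableI_nonneg) (use le in \<open>auto simp: order_le_less_trans\<close>)
 have "(LBINT x. u x^6) \<le> A^3 / (27 * SN^2)"
 proof -
  have "ennreal (LBINT x. u x^6) \<le> ennreal (A^3 / (27 * SN^2))" using le nn_integral_eq_integral[OF i] by simp
  then show ?thesis by (subst (asm) ennreal_le_iff) (use AM in auto)
 qed
 then show "27 * SN^2 * (LBINT x. u x^6) \<le> A^3" using SN_pos by (simp add: pos_le_divide_eq mult.commute)
qed

section \<open>Compactness\<close>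

lemma diagonal_convergent:
 fixes f :: "nat \<Rightarrow> 'i \<Rightarrow> real"
 assumes S: "countable S" and b: "\<And>n x. x \<in> S \<Longrightarrow> \<bar>f n x\<bar> \<le> B"
 obtains r where "strict_mono (r :: nat \<Rightarrow> nat)" "\<And>x. x \<in> S \<Longrightarrow> convergent (\<lambda>n. f (r n) x)"
proof (cases "S = {}")
 case True
 show ?thesis by (rule that[of id]) (use True in \<open>auto simp: strict_mono_def\<close>)
next
 case False
 define e where "e = from_nat_into S"
 have e: "e i \<in> S" for i unfolding e_def by (rule from_nat_into[OF False])
 interpret subseqs "\<lambda>i s. convergent (\<lambda>n. f (s n) (e i))"
 proof
  fix i and s :: "nat \<Rightarrow> nat"
  have "f (s n) (e i) \<in> {-B..B}" for n using b[OF e, of "s n" i] by (auto simp: abs_le_iff)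
  then obtain l r where "strict_mono r" "((\<lambda>n. f (s n) (e i)) \<circ> r) \<longlonglongrightarrow> l"
   using compact_Icc[of "-B" B] unfolding compact_def by metis
  then show "\<exists>r. strict_mono r \<and> convergent (\<lambda>n. f ((s \<circ> r) n) (e i))" by (auto simp: convergent_def o_def)
 qed
 show ?thesis
 proof (rule that[OF subseq_diagseq])
  fix x assume "x \<in> S"
  then obtain i where i: "x = e i" using from_nat_into_surj[OF S] by (metis e_def)
  have "convergent (\<lambda>n. f ((diagseq \<circ> (+) (Suc i)) n) (e i))"
  proof (rule diagseq_holds)
   fix r s :: "nat \<Rightarrow> nat" and n assume r: "strict_mono r" and "convergent (\<lambda>k. f (s k) (e n))"
   then obtain l where "(\<lambda>k. f (s k) (e n)) \<longlonglongrightarrow> l" by (auto simp: convergent_def)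
   from LIMSEQ_subseq_LIMSEQ[OF this r] show "convergent (\<lambda>k. f ((s \<circ> r) k) (e n))" by (auto simp: convergent_def o_def)
  qed
  then obtain l where "(\<lambda>n. f (diagseq (n + Suc i)) (e i)) \<longlonglongrightarrow> l" by (auto simp: convergent_def o_def add.commute)
  from LIMSEQ_offset[OF this] show "convergent (\<lambda>n. f (diagseq n) x)" using i by (auto simp: convergent_def)
 qed
qed

lemma norm_diff_sq_le: "(norm (a - b))^2 \<le> 2 * (norm (a - c))^2 + 2 * (norm (c - b))^2"
 for a b c :: "'b::real_inner"
 using norm_add_young[of 1 "a - c" "c - b"] by simp

text \<open>Along a subsequence with squared distances below (1/4)^n, the bound a \<le> (1/2)^n +
  2^n * a^2 and the finiteness of the measure make the increments summable almost everywhere.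
  Convergence in norm is recovered later by \<open>nn_fatou_sq\<close>.\<close>

lemma L2_complete:
 fixes f :: "nat \<Rightarrow> 'c \<Rightarrow> 'b::euclidean_space"
 assumes M: "emeasure M (space M) < \<infinity>"
  and [measurable]: "\<And>n. f n \<in> borel_measurable M"
  and cau: "\<And>e. e > 0 \<Longrightarrow> \<exists>N. \<forall>n\<ge>N. \<forall>l\<ge>N. (sqd M (f n) (f l)) \<le> ennreal e"
 obtains r F where "strict_mono (r :: nat \<Rightarrow> nat)" "F \<in> borel_measurable M" "AE x in M. (\<lambda>n. f (r n) x) \<longlonglongrightarrow> F x"
proof -
 have "\<exists>N. \<forall>n\<ge>N. \<forall>l\<ge>N. (sqd M (f n) (f l)) \<le> ennreal ((1/4) ^ j)" for j :: nat
  by (rule cau) simp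
 then obtain N where N: "\<And>j n l. n \<ge> N j \<Longrightarrow> l \<ge> N j \<Longrightarrow> (sqd M (f n) (f l)) \<le> ennreal ((1/4) ^ j)"
  by metis
 define r where "r n = (\<Sum>j\<le>n. N j) + n" for n
 have r: "strict_mono r" unfolding strict_mono_Suc_iff r_def by simp
 have rN: "N n \<le> r n" for n unfolding r_def by (simp add: member_le_sum trans_le_add1)
 have rS: "N n \<le> r (Suc n)" for n using rN[of n] strict_mono_less[OF r, of n "Suc n"] by simp
 let ?d = "\<lambda>n x. f (r (Suc n)) x - f (r n) x"
 have d: "(\<integral>\<^sup>+x. ennreal (norm (?d n x)) \<partial>M) \<le> ennreal ((1/2)^n) * (emeasure M (space M) + 1)" for n
 proof -
  have "(\<integral>\<^sup>+x. ennreal (norm (?d n x)) \<partial>M) \<le> (\<integral>\<^sup>+x. ennreal ((1/2)^n) + ennreal (2^n) * ennreal ((norm (?d n x))^2) \<partial>M)"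
  proof (rule nn_integral_mono)
   fix x
   let ?a = "norm (?d n x)"
   have p: "(1/2 :: real)^n * 2^n = 1" by (simp add: power_mult_distrib[symmetric])
   have "0 \<le> (1/2)^n * (1 - 2^n * ?a)^2" by simp
   also have "(1/2)^n * (1 - 2^n * ?a)^2 = (1/2)^n - 2 * ((1/2)^n * 2^n) * ?a + ((1/2)^n * 2^n) * 2^n * ?a^2"
    by (simp add: power2_eq_square algebra_simps)
   finally have "2 * ?a \<le> (1/2)^n + 2^n * ?a^2" unfolding p by simp
   then have "?a \<le> (1/2)^n + 2^n * ?a^2" using norm_ge_zero[of "?d n x"] by linarith
   then have "ennreal ?a \<le> ennreal ((1/2)^n + 2^n * ?a^2)" by (rule ennreal_leI)
   then show "ennreal ?a \<le> ennreal ((1/2)^n) + ennreal (2^n) * ennreal (?a^2)"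
    by (simp add: ennreal_mult[symmetric] del: ennreal_plus flip: ennreal_plus)
  qed
  also have "\<dots> = ennreal ((1/2)^n) * emeasure M (space M) + ennreal (2^n) * (\<integral>\<^sup>+x. ennreal ((norm (?d n x))^2) \<partial>M)"
   by (subst nn_integral_add) (auto simp: nn_integral_cmult)
  also have "\<dots> \<le> ennreal ((1/2)^n) * emeasure M (space M) + ennreal (2^n) * ennreal ((1/4)^n)"
   by (intro add_mono mult_left_mono N[OF rS rN]) auto
  also have "ennreal (2^n) * ennreal ((1/4)^n) = ennreal ((1/2)^n)"
   by (subst ennreal_mult[symmetric]) (auto simp: power_mult_distrib[symmetric])
  finally show ?thesis by (simp add: distrib_left)
 qed
 have "(\<integral>\<^sup>+x. (\<Sum>n. ennreal (norm (?d n x))) \<partial>M) = (\<Sum>n. \<integral>\<^sup>+x. ennreal (norm (?d n x)) \<partial>M)"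
  by (rule nn_integral_suminf) measurable
 also have "\<dots> \<le> (\<Sum>n. ennreal ((1/2)^n) * (emeasure M (space M) + 1))"
  by (intro suminf_le d) auto
 also have "\<dots> = (\<Sum>n. ennreal ((1/2)^n)) * (emeasure M (space M) + 1)" by (rule ennreal_suminf_multc)
 also have "(\<Sum>n. ennreal ((1/2)^n)) = ennreal (\<Sum>n. (1/2)^n)" by (rule suminf_ennreal2) (auto simp: summable_geometric)
 also have "ennreal (\<Sum>n. (1/2)^n) * (emeasure M (space M) + 1) < \<infinity>" using M by (auto simp: ennreal_mult_less_top)
 finally have "AE x in M. (\<Sum>n. ennreal (norm (?d n x))) \<noteq> \<infinity>"
  by (intro nn_integral_PInf_AE) auto
 then have ae: "AE x in M. convergent (\<lambda>n. f (r n) x)"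
 proof eventually_elim
  case (elim x)
  have "summable (\<lambda>n. norm (?d n x))" by (rule summable_suminf_not_top) (use elim in auto)
  then have "summable (\<lambda>n. ?d n x)" by (rule summable_norm_cancel)
  then have "convergent (\<lambda>n. \<Sum>j<n. ?d j x)" by (simp add: summable_iff_convergent)
  moreover have "(\<Sum>j<n. ?d j x) = f (r n) x - f (r 0) x" for n by (rule sum_lessThan_telescope)
  ultimately have "convergent (\<lambda>n. f (r n) x - f (r 0) x)" by simp
  from convergent_add[OF this convergent_const[of "f (r 0) x"]] show ?case by simp
 qed
 show ?thesis
 proof (rule that[OF r])
  show "(\<lambda>x. lim (\<lambda>n. f (r n) x)) \<in> borel_measurable M" by measurable
  show "AE x in M. (\<lambda>n. f (r n) x) \<longlonglongrightarrow> lim (\<lambda>n. f (r n) x)"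
   using ae by eventually_elim (simp add: convergent_LIMSEQ_iff)
 qed
qed

text \<open>Converts a Cauchy estimate for a sequence into the same estimate for the distance to its
  pointwise limit.\<close>

lemma nn_fatou_sq:
 fixes f :: "nat \<Rightarrow> 'c \<Rightarrow> 'b::euclidean_space"
 assumes [measurable]: "\<And>n. f n \<in> borel_measurable M" "h \<in> borel_measurable M"
  and ae: "AE x in M. (\<lambda>n. f n x) \<longlonglongrightarrow> F x"
  and le: "\<forall>\<^sub>F n in sequentially. (sqd M h (f n)) \<le> c"
 shows "sqd M h F \<le> c"
proof -
 have "sqd M h F = (\<integral>\<^sup>+x. liminf (\<lambda>n. ennreal ((norm (h x - f n x))^2)) \<partial>M)"
 proof (rule nn_integral_cong_AE)
  show "AE x in M. ennreal ((norm (h x - F x))^2) = liminf (\<lambda>n. ennreal ((norm (h x - f n x))^2))"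
   using ae
  proof eventually_elim
   case (elim x)
   then have "(\<lambda>n. ennreal ((norm (h x - f n x))^2)) \<longlonglongrightarrow> ennreal ((norm (h x - F x))^2)"
    by (intro tendsto_ennrealI tendsto_intros)
   from lim_imp_Liminf[OF trivial_limit_sequentially this] show ?case by (rule sym)
  qed
 qed
 also have "\<dots> \<le> liminf (\<lambda>n. \<integral>\<^sup>+x. ennreal ((norm (h x - f n x))^2) \<partial>M)" by (rule nn_integral_liminf) measurable
 also have "\<dots> \<le> liminf (\<lambda>n. c)" by (rule Liminf_mono[OF le])
 also have "\<dots> = c" by (simp add: Liminf_const)
 finally show ?thesis .
qed

text \<open>Compactness in \<open>L2\<close> of this finite weighted measure stands in for compactness on bounded sets.\<close>

definition wt :: "real^3 \<Rightarrow> real" where "wt p = kk (p $ 1) (p $ 2) (p $ 3)"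

lemma wt_pos: "wt p > 0" and wt_le1: "wt p \<le> 1"
 unfolding wt_def by (auto simp: kk_pos kk_le1)

lemma wt_cont: "continuous_on UNIV wt"
 unfolding wt_def kk_def by (intro continuous_on_mult continuous_on_compose2[OF lz_cont[of UNIV]] continuous_intros) auto

lemma wt_measurable[measurable]: "wt \<in> borel_measurable borel"
 by (rule measurable_cont[OF wt_cont])

lemma wt_int: "integrable lborel wt"
proof (rule integrableI_nonneg)
 have "(NINT p. ennreal (wt p)) = (NINT p. (case p of (x, y, z) \<Rightarrow> ennreal (kk x y z)))"
  by (subst nn_integral_v3, measurable) (simp add: wt_def)
 then show "(NINT p. ennreal (wt p)) < \<infinity>" using nn_kk by simp
qed (auto simp: wt_pos less_imp_le)

definition WM :: "(real^3) measure" where "WM = density lborel (\<lambda>x. ennreal (wt x))"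

lemma WM_simps[simp]: "sets WM = sets borel" "space WM = UNIV" "borel_measurable WM = borel_measurable borel"
 unfolding WM_def by (auto intro!: measurable_cong_sets)

lemma WM_finite: "emeasure WM (space WM) < \<infinity>"
proof -
 have "emeasure WM UNIV = (NINT x. ennreal (wt x))" unfolding WM_def by (subst emeasure_density) auto
 then show ?thesis using nn_integral_eq_integral[OF wt_int] by (simp add: wt_pos less_imp_le)
qed

lemma WM_AE: "(AE x in WM. P x) \<longleftrightarrow> (AE x in lborel. P x)"
 unfolding WM_def by (subst AE_density) (auto simp: wt_pos)

lemma WM_nn: "F \<in> borel_measurable borel \<Longrightarrow> (\<integral>\<^sup>+x. F x \<partial>WM) = (NINT x. ennreal (wt x) * F x)"
 unfolding WM_def by (rule nn_integral_density) auto

lemma WM_le: "F \<in> borel_measurable borel \<Longrightarrow> (\<integral>\<^sup>+x. F x \<partial>WM) \<le> (NINT x. F x)"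
proof -
 assume F: "F \<in> borel_measurable borel"
 have "ennreal (wt x) * F x \<le> 1 * F x" for x
  using wt_le1[of x] by (intro mult_right_mono) (auto simp: ennreal_le_1)
 then show ?thesis unfolding WM_nn[OF F] by (intro nn_integral_mono) simp
qed

section \<open>Rellich compactness\<close>

lemma nn_diff_sq_le:
 fixes a b c :: "'c \<Rightarrow> 'b::euclidean_space"
 assumes [measurable]: "a \<in> borel_measurable M" "b \<in> borel_measurable M" "c \<in> borel_measurable M"
 shows "sqd M a b \<le> 2 * sqd M a c + 2 * sqd M c b"
proof -
 have "sqd M a b \<le> (\<integral>\<^sup>+x. 2 * ennreal ((norm (a x - c x))^2) + 2 * ennreal ((norm (c x - b x))^2) \<partial>M)"
 proof (rule nn_integral_mono)
  fix x
  have "ennreal ((norm (a x - b x))^2) \<le> ennreal (2 * (norm (a x - c x))^2 + 2 * (norm (c x - b x))^2)"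
   by (rule ennreal_leI[OF norm_diff_sq_le])
  then show "ennreal ((norm (a x - b x))^2) \<le> 2 * ennreal ((norm (a x - c x))^2) + 2 * ennreal ((norm (c x - b x))^2)"
   by (simp add: ennreal_mult)
 qed
 also have "\<dots> = 2 * sqd M a c + 2 * sqd M c b"
  by (subst nn_integral_add) (auto simp: nn_integral_cmult)
 finally show ?thesis .
qed

text \<open>For a fixed kernel the mollified functions are uniformly bounded and equi-Lipschitz, so
  convergence on a countable dense set spreads to all points and, \<open>WM\<close> being finite, to
  L^2 of \<open>WM\<close>. The mollification error is small uniformly in n, hence u itself is
  Cauchy there.\<close>

theorem rellich:
 fixes u :: "nat \<Rightarrow> real^3 \<Rightarrow> real"
 assumes u: "\<And>n. sob (u n) (g n)" and M: "\<And>n. (LBINT x. (u n x)^2) \<le> M"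
  and A: "\<And>n. (nsq (g n)) \<le> A"
 obtains r U where "strict_mono (r :: nat \<Rightarrow> nat)" "U \<in> borel_measurable borel" "AE x in lborel. (\<lambda>n. u (r n) x) \<longlonglongrightarrow> U x"
  "(\<lambda>n. \<integral>\<^sup>+x. ennreal ((u (r n) x - U x)^2) \<partial>WM) \<longlonglongrightarrow> 0"
proof -
 have A0: "A \<ge> 0" and M0: "M \<ge> 0"
  using order_trans[OF lint_nonneg A[of 0]] order_trans[OF lint_nonneg M[of 0]] by auto
 note [measurable] = sobD(4)[OF u]
 obtain t k where t: "\<And>n. t n > 0" and t0: "t \<longlonglongrightarrow> 0" and k: "\<And>n. test_function (k n)" "\<And>n z. k n z \<ge> 0" "\<And>n. (LBINT z. k n z) = 1" "\<And>n (z :: real^3). k n z \<noteq> 0 \<Longrightarrow> norm z \<le> t n"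
  by (rule mollifier_sequence) blast
 note [measurable] = measurable_test[OF k(1)]
 define B where "B m = sqrt (M * (LBINT y. (k m y)^2))" for m
 define L where "L m = sqrt (M * nsq (grad (k m)))" for m
 have B0: "B m \<ge> 0" and L0: "L m \<ge> 0" for m unfolding B_def L_def by (auto intro!: mult_nonneg_nonneg M0 lint_nonneg)
 have Bb: "\<bar>moll (k m) (u n) x\<bar> \<le> B m" for m n x
  unfolding B_def
 proof (rule real_le_rsqrt)
  have "(moll (k m) (u n) x)^2 \<le> (LBINT y. (u n y)^2) * (LBINT y. (k m y)^2)"
   by (rule moll_bound[OF sobD(1)[OF u] k(1)])
  also have "\<dots> \<le> M * (LBINT y. (k m y)^2)" by (intro mult_right_mono M lint_nonneg) simp
  finally show "\<bar>moll (k m) (u n) x\<bar>^2 \<le> M * (LBINT y. (k m y)^2)" by simp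
 qed
 have Lb: "\<bar>moll (k m) (u n) x - moll (k m) (u n) y\<bar> \<le> L m * norm (x - y)" for m n x y
 proof -
  have "(moll (k m) (u n) x - moll (k m) (u n) y)^2 \<le> (LBINT y. (u n y)^2) * ((norm (x - y))^2 * nsq (grad (k m)))"
   by (rule moll_lipschitz[OF sobD(1)[OF u] k(1)])
  also have "\<dots> \<le> M * ((norm (x - y))^2 * nsq (grad (k m)))"
   by (intro mult_right_mono M mult_nonneg_nonneg lint_nonneg) auto
  also have "\<dots> = (L m * norm (x - y))^2"
   unfolding L_def power_mult_distrib by (subst real_sqrt_pow2) (auto intro!: mult_nonneg_nonneg M0 lint_nonneg)
  finally have "\<bar>moll (k m) (u n) x - moll (k m) (u n) y\<bar>^2 \<le> (L m * norm (x - y))^2" by simp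
  then show ?thesis by (rule power2_le_imp_le) (simp add: L0)
 qed
 obtain D :: "(real^3) set" where D: "countable D" "\<And>X. open X \<Longrightarrow> X \<noteq> {} \<Longrightarrow> \<exists>d\<in>D. d \<in> X"
  by (rule countable_dense_setE) blast
 \<comment> \<open>The diagonal lemma wants one bound for all indices; dividing by B + 1 normalises
   the kernel-dependent bounds.\<close>
 obtain r where r: "strict_mono (r :: nat \<Rightarrow> nat)" and rc: "\<And>p. p \<in> UNIV \<times> D \<Longrightarrow> convergent (\<lambda>n. moll (k (fst p)) (u (r n)) (snd p) / (B (fst p) + 1))"
 proof (rule diagonal_convergent[of "UNIV \<times> D" "\<lambda>n p. moll (k (fst p)) (u n) (snd p) / (B (fst p) + 1)" 1])
  show "countable (UNIV \<times> D :: (nat \<times> (real^3)) set)" using D(1) by auto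
  show "\<bar>moll (k (fst p)) (u n) (snd p) / (B (fst p) + 1)\<bar> \<le> 1" for n and p :: "nat \<times> (real^3)"
   using Bb[of "fst p" n "snd p"] B0[of "fst p"] by (simp add: divide_le_eq)
 qed blast
 have cD: "convergent (\<lambda>n. moll (k m) (u (r n)) x)" if xD: "x \<in> D" for m x
 proof -
  obtain l where "(\<lambda>n. moll (k m) (u (r n)) x / (B m + 1)) \<longlonglongrightarrow> l" using rc[of "(m, x)"] xD by (auto simp: convergent_def)
  from tendsto_mult_right[OF this, of "B m + 1"] show ?thesis using B0[of m] by (auto simp: convergent_def)
 qed
 have cv: "convergent (\<lambda>n. moll (k m) (u (r n)) x)" for m x
  unfolding Cauchy_convergent_iff[symmetric]
 proof (rule metric_CauchyI)
  fix e :: real assume e: "e > 0"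
  obtain d where d: "d \<in> D" "d \<in> ball x (e / (4 * (L m + 1)))"
  proof -
   have "e / (4 * (L m + 1)) > 0" using e L0[of m] by simp
   then have "ball x (e / (4 * (L m + 1))) \<noteq> {}" by (simp only: ball_eq_empty not_le)
   from D(2)[OF open_ball this] show ?thesis using that by blast
  qed
  have Ld: "L m * norm (x - d) < e / 4"
  proof -
   have "L m * norm (x - d) \<le> (L m + 1) * norm (x - d)" by (intro mult_right_mono) auto
   also have "\<dots> < e / 4" using d(2) L0[of m] by (simp add: dist_norm field_simps)
   finally show ?thesis .
  qed
  obtain N where N: "\<And>n l. n \<ge> N \<Longrightarrow> l \<ge> N \<Longrightarrow> dist (moll (k m) (u (r n)) d) (moll (k m) (u (r l)) d) < e / 2"
   using cD[OF d(1), of m] e unfolding Cauchy_convergent_iff[symmetric] Cauchy_def by (meson half_gt_zero)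
  show "\<exists>N. \<forall>n\<ge>N. \<forall>l\<ge>N. dist (moll (k m) (u (r n)) x) (moll (k m) (u (r l)) x) < e"
  proof (intro exI allI impI)
   fix n l assume "n \<ge> N" "l \<ge> N"
   from N[OF this] show "dist (moll (k m) (u (r n)) x) (moll (k m) (u (r l)) x) < e"
    using Lb[of m "r n" x d] Lb[of m "r l" x d] Ld unfolding dist_real_def by linarith
  qed
 qed
 define v where "v m x = lim (\<lambda>n. moll (k m) (u (r n)) x)" for m x
 have vl: "(\<lambda>n. moll (k m) (u (r n)) x) \<longlonglongrightarrow> v m x" for m x
  using cv[of m x] by (simp add: v_def convergent_LIMSEQ_iff)
 have [measurable]: "v m \<in> borel_measurable borel" for m unfolding v_def[abs_def] by measurable
 have mv: "(\<lambda>n. \<integral>\<^sup>+x. ennreal ((norm (moll (k m) (u (r n)) x - v m x))^2) \<partial>WM) \<longlonglongrightarrow> 0" for m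
 proof -
  have vb: "\<bar>v m x\<bar> \<le> B m" for x
   by (rule tendsto_upperbound[OF tendsto_rabs[OF vl]]) (auto simp: Bb)
  have "(\<lambda>n. \<integral>\<^sup>+x. ennreal ((norm (moll (k m) (u (r n)) x - v m x))^2) \<partial>WM) \<longlonglongrightarrow> (\<integral>\<^sup>+x. ennreal 0 \<partial>WM)"
  proof (rule nn_integral_dominated_convergence[where w="\<lambda>_. ennreal ((2 * B m)^2)"])
   show "AE x in WM. ennreal ((norm (moll (k m) (u (r n)) x - v m x))^2) \<le> ennreal ((2 * B m)^2)" for n
   proof (intro AE_I2 ennreal_leI power_mono)
    fix x show "norm (moll (k m) (u (r n)) x - v m x) \<le> 2 * B m" using Bb[of m "r n" x] vb[of x] by simp
   qed simp
   show "(\<integral>\<^sup>+x. ennreal ((2 * B m)^2) \<partial>WM) < \<infinity>" using WM_finite by (simp add: ennreal_mult_less_top)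
   show "AE x in WM. (\<lambda>n. ennreal ((norm (moll (k m) (u (r n)) x - v m x))^2)) \<longlonglongrightarrow> ennreal 0"
   proof (rule AE_I2)
    fix x
    have "(\<lambda>n. (norm (moll (k m) (u (r n)) x - v m x))^2) \<longlonglongrightarrow> (norm (v m x - v m x))^2" by (intro tendsto_intros vl)
    then show "(\<lambda>n. ennreal ((norm (moll (k m) (u (r n)) x - v m x))^2)) \<longlonglongrightarrow> ennreal 0" by (intro tendsto_ennrealI) simp
   qed
  qed auto
  then show ?thesis by simp
 qed
 have um: "sqd WM (u n) (moll (k m) (u n)) \<le> ennreal ((t m)^2 * A)" for n m
 proof -
  have "sqd WM (u n) (moll (k m) (u n)) \<le> sqd lborel (u n) (moll (k m) (u n))"
   by (rule WM_le) measurable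
  also have "\<dots> = ennreal (LBINT x. (norm (u n x - moll (k m) (u n) x))^2)"
   by (rule nn_integral_sq) (intro Lq2_diff sobD(1)[OF u] moll_L2(1)[OF sobD(1)[OF u] k(1-3)])
  also have "\<dots> \<le> ennreal ((t m)^2 * A)"
  proof (rule ennreal_leI)
   have "(LBINT x. (norm (u n x - moll (k m) (u n) x))^2) = (LBINT x. (moll (k m) (u n) x - u n x)^2)"
    by (simp add: power2_commute)
   also have "\<dots> \<le> (t m)^2 * nsq (g n)" by (rule moll_approx[OF u k])
   also have "\<dots> \<le> (t m)^2 * A" by (intro mult_left_mono A) simp
   finally show "(LBINT x. (norm (u n x - moll (k m) (u n) x))^2) \<le> (t m)^2 * A" .
  qed
  finally show ?thesis .
 qed
 have cau: "\<exists>N. \<forall>n\<ge>N. \<forall>l\<ge>N. (sqd WM (u (r n)) (u (r l))) \<le> ennreal e" if e: "e > 0" for e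
 proof -
  have "(\<lambda>m. (t m)^2 * A) \<longlonglongrightarrow> 0^2 * A" by (intro tendsto_intros t0)
  then have "\<forall>\<^sub>F m in sequentially. (t m)^2 * A < e / 16" using e by (intro order_tendstoD(2)) auto
  then obtain m where m: "(t m)^2 * A < e / 16" by (auto simp: eventually_sequentially)
  have "\<forall>\<^sub>F n in sequentially. (sqd WM (moll (k m) (u (r n))) (v m)) < ennreal (e / 16)"
   by (rule order_tendstoD(2)[OF mv]) (use e in auto)
  then obtain N where N: "\<And>n. n \<ge> N \<Longrightarrow> (sqd WM (moll (k m) (u (r n))) (v m)) < ennreal (e / 16)"
   by (auto simp: eventually_sequentially)
  have one: "sqd WM (u (r n)) (v m) \<le> ennreal (e / 4)" if "n \<ge> N" for n
  proof -
   have "sqd WM (u (r n)) (v m) \<le> 2 * sqd WM (u (r n)) (moll (k m) (u (r n))) + 2 * sqd WM (moll (k m) (u (r n))) (v m)"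
    by (rule nn_diff_sq_le) auto
   also have "\<dots> \<le> 2 * ennreal (e / 16) + 2 * ennreal (e / 16)"
    using N[OF that] m by (intro add_mono mult_left_mono order_trans[OF um] ennreal_leI) auto
   also have "\<dots> = ennreal (e / 4)" using e by (simp add: ennreal_mult[symmetric] flip: ennreal_plus ennreal_numeral)
   finally show ?thesis .
  qed
  show ?thesis
  proof (intro exI allI impI)
   fix n l assume n: "n \<ge> N" and l: "l \<ge> N"
   have "sqd WM (u (r n)) (u (r l)) \<le> 2 * sqd WM (u (r n)) (v m) + 2 * sqd WM (v m) (u (r l))"
    by (rule nn_diff_sq_le) auto
   also have "\<dots> \<le> 2 * ennreal (e / 4) + 2 * ennreal (e / 4)"
   proof -
    have "sqd WM (v m) (u (r l)) \<le> ennreal (e / 4)"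
     using one[OF l] by (simp only: norm_minus_commute)
    then show ?thesis using one[OF n] by (intro add_mono mult_left_mono) auto
   qed
   also have "\<dots> = ennreal e" using e by (simp add: ennreal_mult[symmetric] flip: ennreal_plus ennreal_numeral)
   finally show "sqd WM (u (r n)) (u (r l)) \<le> ennreal e" .
  qed
 qed
 obtain r' U where r': "strict_mono (r' :: nat \<Rightarrow> nat)" and Um: "U \<in> borel_measurable WM" and ae: "AE x in WM. (\<lambda>n. u (r (r' n)) x) \<longlonglongrightarrow> U x"
  by (rule L2_complete[OF WM_finite _ cau]) auto
 have [measurable]: "U \<in> borel_measurable borel" using Um by simp
 show ?thesis
 proof (rule that[of "r \<circ> r'" U])
  show "strict_mono (r \<circ> r')" by (rule strict_mono_o[OF r r'])
  show "AE x in lborel. (\<lambda>n. u ((r \<circ> r') n) x) \<longlonglongrightarrow> U x" using ae by (simp add: WM_AE)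
  show "(\<lambda>n. \<integral>\<^sup>+x. ennreal ((u ((r \<circ> r') n) x - U x)^2) \<partial>WM) \<longlonglongrightarrow> 0"
  proof (rule order_tendstoI)
   fix a :: ennreal assume "0 < a"
   then obtain b where b: "0 < b" "b < a" using dense by blast
   then obtain e where e: "e > 0" "ennreal e < a"
    by (cases b rule: ennreal_cases) auto
   obtain N where N: "\<And>n l. n \<ge> N \<Longrightarrow> l \<ge> N \<Longrightarrow> (sqd WM (u (r n)) (u (r l))) \<le> ennreal e"
    using cau[OF e(1)] by blast
   show "\<forall>\<^sub>F n in sequentially. (\<integral>\<^sup>+x. ennreal ((u ((r \<circ> r') n) x - U x)^2) \<partial>WM) < a"
    using eventually_ge_at_top[of N]
   proof eventually_elim
    case (elim n)
    have n: "r' n \<ge> N" using elim seq_suble[OF r', of n] by linarith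
    have "sqd WM (u (r (r' n))) U \<le> ennreal e"
    proof (rule nn_fatou_sq[OF _ _ ae])
     show "\<forall>\<^sub>F l in sequentially. (sqd WM (u (r (r' n))) (u (r (r' l)))) \<le> ennreal e"
      using eventually_ge_at_top[of N]
     proof eventually_elim
      case (elim l)
      then have "r' l \<ge> N" using seq_suble[OF r', of l] by linarith
      from N[OF n this] show ?case .
     qed
    qed auto
    then show ?case using e(2) by (simp add: order_le_less_trans)
   qed
  qed simp
 qed simp
qed

section \<open>Weak limits of gradients\<close>

lemma Lq2_CS:
 fixes f g :: "'a::euclidean_space \<Rightarrow> 'b::euclidean_space"
 assumes f: "f \<in> Lq 2" and g: "g \<in> Lq 2"
 shows "(LBINT x. f x \<bullet> g x)^2 \<le> nsq f * nsq g"
proof -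
 have n: "(\<lambda>x. norm (f x)) \<in> Lq 2" "(\<lambda>x. norm (g x)) \<in> Lq 2" using Lq2D[OF f] Lq2D[OF g] unfolding Lq2_real_iff by auto
 have i: "integrable lborel (\<lambda>x. norm (f x) * norm (g x))" using Lq2_inner[OF n] by simp
 have "\<bar>LBINT x. f x \<bullet> g x\<bar> \<le> (LBINT x. \<bar>f x \<bullet> g x\<bar>)" by (rule integral_abs_bound)
 also have "\<dots> \<le> (LBINT x. norm (f x) * norm (g x))"
  by (intro integral_mono integrable_abs Lq2_inner f g i Cauchy_Schwarz_ineq2)
 finally have "\<bar>LBINT x. f x \<bullet> g x\<bar>^2 \<le> (LBINT x. norm (f x) * norm (g x))^2"
  by (rule power_mono) simp
 then have "(LBINT x. f x \<bullet> g x)^2 \<le> (LBINT x. norm (f x) * norm (g x))^2" by simp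
 also have "\<dots> \<le> nsq f * nsq g"
  by (rule cauchy_schwarz_integral[OF Lq2D(2)[OF f] Lq2D(2)[OF g] i])
 finally show ?thesis .
qed

text \<open>Repeated midpoints of tail elements; they replace convex hulls in Mazur's argument.\<close>

inductive_set midset :: "(nat \<Rightarrow> 'a \<Rightarrow> 'b::real_vector) \<Rightarrow> nat \<Rightarrow> ('a \<Rightarrow> 'b) set" for g n where
 base: "k \<ge> n \<Longrightarrow> g k \<in> midset g n"
| mid: "p \<in> midset g n \<Longrightarrow> q \<in> midset g n \<Longrightarrow> (\<lambda>x. (1/2) *\<^sub>R p x + (1/2) *\<^sub>R q x) \<in> midset g n"

lemma midset_mono: "p \<in> midset g m \<Longrightarrow> n \<le> m \<Longrightarrow> p \<in> midset g n"
proof (induction rule: midset.induct)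
 case (base k)
 then show ?case by (intro midset.base) simp
next
 case (mid p q)
 show ?case by (rule midset.mid[OF mid.IH(1)[OF mid.prems] mid.IH(2)[OF mid.prems]])
qed

lemma midpoint_sq: "(norm ((1/2) *\<^sub>R a + (1/2) *\<^sub>R b))^2 \<le> 1/2 * (norm a)^2 + 1/2 * (norm b)^2" for a b :: "'b::real_inner"
proof -
 have "(norm ((1/2) *\<^sub>R a + (1/2) *\<^sub>R b))^2 \<le> 2 * (norm ((1/2) *\<^sub>R a))^2 + 2 * (norm ((1/2) *\<^sub>R b))^2"
  using norm_add_young[of 1 "(1/2) *\<^sub>R a" "(1/2) *\<^sub>R b"] by simp
 then show ?thesis by (simp add: power_divide)
qed

lemma parallelogram: "(norm (a - b))^2 = 2 * (norm a)^2 + 2 * (norm b)^2 - 4 * (norm ((1/2) *\<^sub>R a + (1/2) *\<^sub>R b))^2" for a b :: "'b::real_inner"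
 unfolding power2_norm_eq_inner by (simp add: inner_add_left inner_add_right inner_diff_left inner_diff_right inner_commute algebra_simps)

text \<open>G is the L^2 limit of almost norm-minimal midpoint combinations of tails. Such
  combinations inherit the norm bound and stay as close to a limit of pairings as the tail itself,
  so G represents every functional value that happens to converge.\<close>

theorem mazur_L2:
 fixes g :: "nat \<Rightarrow> real^3 \<Rightarrow> 'b::euclidean_space"
 assumes g: "\<And>n. g n \<in> Lq 2" and A: "\<And>n. (nsq (g n)) \<le> A"
 obtains G where "G \<in> Lq 2" "\<And>H l. H \<in> Lq 2 \<Longrightarrow> (\<lambda>n. LBINT x. g n x \<bullet> H x) \<longlonglongrightarrow> l \<Longrightarrow> (LBINT x. G x \<bullet> H x) = l"
proof -
 let ?E = "\<lambda>p. LBINT x. (norm (p x))^2"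
 have I1: "p \<in> Lq 2" if "p \<in> midset g n" for p n
  using that by (induction rule: midset.induct) (auto intro!: g Lq2_add Lq2_scale)
 have I2: "?E p \<le> A" if "p \<in> midset g n" for p n
  using that
 proof (induction rule: midset.induct)
  case (mid p q)
  have i: "integrable lborel (\<lambda>x. (norm (p x))^2)" "integrable lborel (\<lambda>x. (norm (q x))^2)"
   using Lq2D(2)[OF I1[OF mid(1)]] Lq2D(2)[OF I1[OF mid(2)]] by auto
  have "(LBINT x. (norm ((1/2) *\<^sub>R p x + (1/2) *\<^sub>R q x))^2) \<le> (LBINT x. 1/2 * (norm (p x))^2 + 1/2 * (norm (q x))^2)"
   by (intro integral_mono midpoint_sq Lq2D(2)[OF Lq2_add[OF Lq2_scale Lq2_scale]] I1[OF mid(1)] I1[OF mid(2)]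
     lintegrable_add integrable_mult_right i)
  also have "\<dots> = 1/2 * ?E p + 1/2 * ?E q" using i by (subst lint_add) auto
  also have "\<dots> \<le> A" using mid by linarith
  finally show ?case .
 qed (rule A)
 have I4: "\<bar>(LBINT x. p x \<bullet> H x) - l\<bar> \<le> e" if "p \<in> midset g n" "\<And>k. k \<ge> n \<Longrightarrow> \<bar>(LBINT x. g k x \<bullet> H x) - l\<bar> \<le> e" "H \<in> Lq 2" for p n e H l
  using that(1)
 proof (induction rule: midset.induct)
  case (mid p q)
  have "(LBINT x. ((1/2) *\<^sub>R p x + (1/2) *\<^sub>R q x) \<bullet> H x) = 1/2 * (LBINT x. p x \<bullet> H x) + 1/2 * (LBINT x. q x \<bullet> H x)"
   using Lq2_inner[OF I1[OF mid(1)] that(3)] Lq2_inner[OF I1[OF mid(2)] that(3)] by (simp add: inner_add_left)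
  then show ?case using mid.IH unfolding abs_le_iff by linarith
 qed (rule that(2))
 define d where "d n = Inf (?E ` midset g n)" for n
 have bb: "bdd_below (?E ` midset g n)" for n
  by (rule bdd_belowI[of _ 0]) (auto intro: lint_nonneg)
 have ne: "?E ` midset g n \<noteq> {}" for n using midset.base[of n n g] by blast
 have dle: "d n \<le> ?E p" if "p \<in> midset g n" for n p unfolding d_def by (rule cInf_lower[OF _ bb]) (use that in blast)
 have dmono: "d n \<le> d m" if "n \<le> m" for n m
  unfolding d_def by (rule cInf_superset_mono[OF ne bb]) (use midset_mono[OF _ that] in blast)
 have dA: "d n \<le> A" for n using dle[OF midset.base[of n n g]] A[of n] by simp
 have "convergent d"
 proof (rule Bseq_mono_convergent)
  have "norm (d n) \<le> max \<bar>d 0\<bar> \<bar>A\<bar>" for n using dmono[of 0 n] dA[of n] by auto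
  then show "Bseq d" by (rule BseqI')
 qed (use dmono in blast)
 then have dC: "Cauchy d" by (rule convergent_Cauchy)
 define t where "t n = inverse (real (Suc n))" for n
 have t: "t n > 0" for n by (auto simp: t_def)
 have t0: "t \<longlonglongrightarrow> 0" unfolding t_def by (rule LIMSEQ_inverse_real_of_nat)
 have "\<exists>p\<in>midset g n. ?E p < d n + t n" for n
  using cInf_lessD[OF ne, of n "d n + t n"] t[of n] unfolding d_def by auto
 then have "\<forall>n. \<exists>p. p \<in> midset g n \<and> ?E p < d n + t n" by blast
 then have "\<exists>p. \<forall>n. p n \<in> midset g n \<and> ?E (p n) < d n + t n" by (rule choice)
 then obtain h where p0: "\<forall>n. h n \<in> midset g n \<and> ?E (h n) < d n + t n" ..
 have h: "\<And>n. h n \<in> midset g n" "\<And>n. ?E (h n) < d n + t n" using p0 by blast+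
 note hL2 = I1[OF h(1)]
 note [measurable] = Lq2D(1)[OF hL2]
 \<comment> \<open>The midpoint of \<open>h n\<close> and \<open>h m\<close> still belongs to the
   n-th tail, so its squared norm is at least \<open>d n\<close>; as the infima converge, the
   parallelogram law makes h Cauchy.\<close>
 have par: "(LBINT x. (norm (h n x - h m x))^2) \<le> 2 * (d n + t n) + 2 * (d m + t m) - 4 * d n" if "n \<le> m" for n m
 proof -
  have q: "(\<lambda>x. (1/2) *\<^sub>R h n x + (1/2) *\<^sub>R h m x) \<in> midset g n"
   by (intro midset.mid h midset_mono[OF h(1) that])
  have "(LBINT x. (norm (h n x - h m x))^2) = 2 * ?E (h n) + 2 * ?E (h m) - 4 * (LBINT x. (norm ((1/2) *\<^sub>R h n x + (1/2) *\<^sub>R h m x))^2)"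
   unfolding parallelogram using Lq2D(2)[OF hL2] Lq2D(2)[OF I1[OF q]]
   by (subst lint_diff) (auto simp: lint_add)
  then show ?thesis using h(2)[of n] h(2)[of m] dle[OF q] by simp
 qed
 have hC: "\<exists>N. \<forall>n\<ge>N. \<forall>l\<ge>N. (LBINT x. (norm (h n x - h l x))^2) \<le> e" if e: "e > 0" for e
 proof -
  obtain N1 where N1: "\<And>n m. n \<ge> N1 \<Longrightarrow> m \<ge> N1 \<Longrightarrow> \<bar>d n - d m\<bar> < e / 8"
   using dC e unfolding Cauchy_def dist_real_def by (meson divide_pos_pos zero_less_numeral)
  have "\<forall>\<^sub>F n in sequentially. t n < e / 8" using order_tendstoD(2)[OF t0, of "e/8"] e by simp
  then obtain N2 where N2: "\<And>n. n \<ge> N2 \<Longrightarrow> t n < e / 8" by (auto simp: eventually_sequentially)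
  have ord: "(LBINT x. (norm (h n x - h l x))^2) \<le> e" if "n \<ge> max N1 N2" "n \<le> l" for n l
  proof -
   have "d l - d n < e / 8" using N1[of n l] that abs_ge_minus_self[of "d n - d l"] by simp
   moreover have "t n < e / 8" "t l < e / 8" using N2[of n] N2[of l] that by auto
   ultimately have "2 * (d n + t n) + 2 * (d l + t l) - 4 * d n \<le> e" using e by (simp add: field_simps)
   then show ?thesis using par[OF that(2)] by (rule order_trans[rotated])
  qed
  show ?thesis
  proof (intro exI allI impI)
   fix n l assume "n \<ge> max N1 N2" "l \<ge> max N1 N2"
   then show "(LBINT x. (norm (h n x - h l x))^2) \<le> e"
    using ord[of n l] ord[of l n] by (cases "n \<le> l") (auto simp: norm_minus_commute)
  qed
 qed
 have hn: "sqd lborel (h n) (h l) = ennreal (LBINT x. (norm (h n x - h l x))^2)" for n l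
  by (rule nn_integral_sq) (intro Lq2_diff hL2)
 have cau: "\<exists>N. \<forall>n\<ge>N. \<forall>l\<ge>N. (sqd WM (h n) (h l)) \<le> ennreal e" if e: "e > 0" for e
 proof -
  obtain N where N: "\<forall>n\<ge>N. \<forall>l\<ge>N. (LBINT x. (norm (h n x - h l x))^2) \<le> e" using hC[OF e] by blast
  have "sqd WM (h n) (h l) \<le> ennreal e" if "n \<ge> N" "l \<ge> N" for n l
  proof -
   have "sqd WM (h n) (h l) \<le> sqd lborel (h n) (h l)"
    by (rule WM_le) measurable
   then show ?thesis unfolding hn using N that by (meson ennreal_leI order_trans)
  qed
  then show ?thesis by blast
 qed
 obtain r G where r: "strict_mono (r :: nat \<Rightarrow> nat)" and Gm: "G \<in> borel_measurable WM" and ae: "AE x in WM. (\<lambda>n. h (r n) x) \<longlonglongrightarrow> G x"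
  by (rule L2_complete[OF WM_finite _ cau]) auto
 have [measurable]: "G \<in> borel_measurable borel" using Gm by simp
 have ae': "AE x in lborel. (\<lambda>n. h (r n) x) \<longlonglongrightarrow> G x" using ae by (simp add: WM_AE)
 have hG: "\<exists>N. \<forall>n\<ge>N. (sqd lborel (h (r n)) G) \<le> ennreal e" if e: "e > 0" for e
 proof -
  obtain N where N: "\<forall>n\<ge>N. \<forall>l\<ge>N. (LBINT x. (norm (h n x - h l x))^2) \<le> e" using hC[OF e] by blast
  have "sqd lborel (h (r n)) G \<le> ennreal e" if n: "n \<ge> N" for n
  proof (rule nn_fatou_sq[OF _ _ ae'])
   show "\<forall>\<^sub>F l in sequentially. (sqd lborel (h (r n)) (h (r l))) \<le> ennreal e"
    using eventually_ge_at_top[of N]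
   proof eventually_elim
    case (elim l)
    then have "r l \<ge> N" "r n \<ge> N" using seq_suble[OF r, of l] seq_suble[OF r, of n] n by linarith+
    then show ?case unfolding hn using N by (intro ennreal_leI) blast
   qed
  qed auto
  then show ?thesis by blast
 qed
 have GL: "G \<in> Lq 2"
 proof -
  have "(NINT x. ennreal ((norm (0 - G x))^2)) \<le> ennreal A"
  proof (rule nn_fatou_sq[OF _ _ ae'])
   show "\<forall>\<^sub>F n in sequentially. (NINT x. ennreal ((norm (0 - h (r n) x))^2)) \<le> ennreal A"
    using nn_integral_sq[OF hL2] I2[OF h(1)] by (auto intro!: always_eventually ennreal_leI)
  qed auto
  then have "integrable lborel (\<lambda>x. (norm (G x))^2)"
   by (intro integrableI_nonneg) (auto simp: order_le_less_trans)
  then show ?thesis unfolding Lq2_iff by simp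
 qed
 have hL: "(\<lambda>x. h (r n) x - G x) \<in> Lq 2" for n by (intro Lq2_diff hL2 GL)
 have hG0: "(\<lambda>n. LBINT x. (norm (h (r n) x - G x))^2) \<longlonglongrightarrow> 0"
 proof (rule LIMSEQ_I)
  fix e :: real assume e: "e > 0"
  obtain N where N: "\<forall>n\<ge>N. (sqd lborel (h (r n)) G) \<le> ennreal (e/2)" using hG[of "e/2"] e by auto
  have "norm ((LBINT x. (norm (h (r n) x - G x))^2) - 0) < e" if "n \<ge> N" for n
  proof -
   have "ennreal (LBINT x. (norm (h (r n) x - G x))^2) \<le> ennreal (e/2)" using N that unfolding nn_integral_sq[OF hL] by blast
   then have "(LBINT x. (norm (h (r n) x - G x))^2) \<le> e/2" using e by (subst (asm) ennreal_le_iff) auto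
   moreover have "(LBINT x. (norm (h (r n) x - G x))^2) \<ge> 0" by (rule lint_nonneg) simp
   ultimately show ?thesis using e by simp
  qed
  then show "\<exists>N. \<forall>n\<ge>N. norm ((LBINT x. (norm (h (r n) x - G x))^2) - 0) < e" by blast
 qed
 have pair: "(\<lambda>n. LBINT x. h (r n) x \<bullet> H x) \<longlonglongrightarrow> (LBINT x. G x \<bullet> H x)" if H: "H \<in> Lq 2" for H
 proof -
  have "(\<lambda>n. \<bar>LBINT x. (h (r n) x - G x) \<bullet> H x\<bar>) \<longlonglongrightarrow> 0"
  proof (rule tendsto_sandwich[of "\<lambda>_. 0"])
   show "\<forall>\<^sub>F n in sequentially. \<bar>LBINT x. (h (r n) x - G x) \<bullet> H x\<bar> \<le> sqrt ((LBINT x. (norm (h (r n) x - G x))^2) * nsq H)"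
    by (intro always_eventually allI real_le_rsqrt) (use Lq2_CS[OF hL H] in simp)
   have "(\<lambda>n. sqrt ((LBINT x. (norm (h (r n) x - G x))^2) * nsq H)) \<longlonglongrightarrow> sqrt (0 * nsq H)"
    by (intro tendsto_intros hG0)
   then show "(\<lambda>n. sqrt ((LBINT x. (norm (h (r n) x - G x))^2) * nsq H)) \<longlonglongrightarrow> 0" by simp
  qed auto
  then have "(\<lambda>n. LBINT x. (h (r n) x - G x) \<bullet> H x) \<longlonglongrightarrow> 0" by (simp add: tendsto_rabs_zero_iff)
  moreover have "(LBINT x. (h (r n) x - G x) \<bullet> H x) = (LBINT x. h (r n) x \<bullet> H x) - (LBINT x. G x \<bullet> H x)" for n
   unfolding inner_diff_left by (intro lint_diff Lq2_inner hL2 GL H)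
  ultimately show ?thesis by (simp add: LIM_zero_iff)
 qed
 have "(LBINT x. G x \<bullet> H x) = l" if H: "H \<in> Lq 2" and l: "(\<lambda>n. LBINT x. g n x \<bullet> H x) \<longlonglongrightarrow> l" for H l
 proof -
  have "(\<lambda>n. LBINT x. h n x \<bullet> H x) \<longlonglongrightarrow> l"
  proof (rule LIMSEQ_I)
   fix e :: real assume e: "e > 0"
   obtain N where N: "\<forall>n\<ge>N. norm ((LBINT x. g n x \<bullet> H x) - l) < e / 2" using LIMSEQ_D[OF l, of "e/2"] e by auto
   have "norm ((LBINT x. h n x \<bullet> H x) - l) < e" if "n \<ge> N" for n
   proof -
    have "\<bar>(LBINT x. h n x \<bullet> H x) - l\<bar> \<le> e / 2"
     by (rule I4[OF h(1) _ H]) (use N that in \<open>auto simp: less_imp_le\<close>)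
    then show ?thesis using e by simp
   qed
   then show "\<exists>N. \<forall>n\<ge>N. norm ((LBINT x. h n x \<bullet> H x) - l) < e" by blast
  qed
  from LIMSEQ_subseq_LIMSEQ[OF this r] have "(\<lambda>n. LBINT x. h (r n) x \<bullet> H x) \<longlonglongrightarrow> l" by (simp add: o_def)
  then show ?thesis using LIMSEQ_unique[OF pair[OF H]] by blast
 qed
 then show ?thesis using GL that by blast
qed

text \<open>Derivatives of test functions have compact support, so they may be divided by sqrt
  \<open>wt\<close>; weighted Cauchy-Schwarz then passes L^2(\<open>WM\<close>) convergence to the
  pairings with them. Those of the gradients converge as well, and \<open>mazur_L2\<close>
  identifies the limit.\<close>

theorem weak_gradient_limit:
 fixes u :: "nat \<Rightarrow> real^3 \<Rightarrow> real"
 assumes u: "\<And>n. sob (u n) (g n)" and A: "\<And>n. (nsq (g n)) \<le> A"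
  and U: "U \<in> Lq 2" and lim: "(\<lambda>n. \<integral>\<^sup>+x. ennreal ((u n x - U x)^2) \<partial>WM) \<longlonglongrightarrow> 0"
 obtains G where "sob U G" "\<And>H l. H \<in> Lq 2 \<Longrightarrow> (\<lambda>n. LBINT x. g n x \<bullet> H x) \<longlonglongrightarrow> l \<Longrightarrow> (LBINT x. G x \<bullet> H x) = l"
proof -
 obtain G where GL: "G \<in> Lq 2" and G: "\<And>H l. H \<in> Lq 2 \<Longrightarrow> (\<lambda>n. LBINT x. g n x \<bullet> H x) \<longlonglongrightarrow> l \<Longrightarrow> (LBINT x. G x \<bullet> H x) = l"
  by (rule mazur_L2[of g A, OF sobD(2)[OF u] A]) blast
 note [measurable] = Lq2D(1)[OF U] sobD(4)[OF u]
 have "sob U G"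
 proof (rule sobI[OF U GL])
  fix \<phi> :: "real^3 \<Rightarrow> real" and i :: "real^3" assume \<phi>: "test_function \<phi>" and i: "i \<in> Basis"
  let ?D = "\<lambda>x. fd \<phi> x i"
  note [measurable] = measurable_cont[OF test_function_deriv_cont[OF \<phi> i]]
  obtain K where K: "compact K" "\<And>x. x \<notin> K \<Longrightarrow> fd \<phi> x = (\<lambda>_. 0)"
   by (rule test_function_support[OF \<phi>]) blast
  have "continuous_on UNIV (\<lambda>x. (?D x)^2 / wt x)"
   by (intro continuous_on_divide continuous_on_power test_function_deriv_cont[OF \<phi> i] wt_cont) (use wt_pos in \<open>auto simp: less_imp_neq[symmetric]\<close>)
  moreover have "(?D x)^2 / wt x = 0" if "x \<notin> K" for x using K(2)[OF that] by simp
  ultimately obtain B where "\<And>x. \<bar>(?D x)^2 / wt x\<bar> \<le> B * indicator K x"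
   using bounded_of_compact_support[OF _ K(1), of "\<lambda>x. (?D x)^2 / wt x"] by blast
  then have iD: "integrable lborel (\<lambda>x. (?D x)^2 / wt x)" by (intro integrable_bounded_support[OF _ K(1)]) measurable
  have vUL: "(\<lambda>x. u n x - U x) \<in> Lq 2" for n by (intro Lq2_diff sobD(1)[OF u] U)
  have iW: "integrable lborel (\<lambda>x. wt x * (u n x - U x)^2)" for n
  proof (rule lintegrable_bound)
   show "integrable lborel (\<lambda>x. (u n x - U x)^2)" using Lq2D(2)[OF vUL] by simp
   show "AE x in lborel. norm (wt x * (u n x - U x)^2) \<le> norm ((u n x - U x)^2)"
   proof (rule AE_I2)
    fix x
    have "wt x * (u n x - U x)^2 \<le> 1 * (u n x - U x)^2" by (intro mult_right_mono wt_le1) simp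
    then show "norm (wt x * (u n x - U x)^2) \<le> norm ((u n x - U x)^2)" using wt_pos[of x] by (simp add: abs_mult)
   qed
  qed measurable
  have W0: "(\<lambda>n. LBINT x. wt x * (u n x - U x)^2) \<longlonglongrightarrow> 0"
  proof -
   have e: "(\<integral>\<^sup>+x. ennreal ((u n x - U x)^2) \<partial>WM) = ennreal (LBINT x. wt x * (u n x - U x)^2)" for n
   proof -
    have "(\<integral>\<^sup>+x. ennreal ((u n x - U x)^2) \<partial>WM) = (NINT x. ennreal (wt x * (u n x - U x)^2))"
     by (subst WM_nn) (auto simp: ennreal_mult less_imp_le wt_pos)
    also have "\<dots> = ennreal (LBINT x. wt x * (u n x - U x)^2)"
     by (rule nn_integral_eq_integral[OF iW]) (auto simp: less_imp_le wt_pos)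
    finally show ?thesis .
   qed
   have "(\<lambda>n. ennreal (LBINT x. wt x * (u n x - U x)^2)) \<longlonglongrightarrow> ennreal 0" using lim unfolding e by simp
   then show ?thesis by (rule tendsto_ennrealD) (intro always_eventually allI lint_nonneg mult_nonneg_nonneg zero_le_power2 less_imp_le[OF wt_pos] order_refl)+
  qed
  have CS: "\<bar>LBINT x. (u n x - U x) * ?D x\<bar> \<le> sqrt ((LBINT x. wt x * (u n x - U x)^2) * (LBINT x. (?D x)^2 / wt x))" for n
  proof (rule real_le_rsqrt)
   have s: "(sqrt (wt x) * (u n x - U x)) * (?D x / sqrt (wt x)) = (u n x - U x) * ?D x"
     "(sqrt (wt x) * (u n x - U x))^2 = wt x * (u n x - U x)^2" "(?D x / sqrt (wt x))^2 = (?D x)^2 / wt x" for x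
    using wt_pos[of x] by (simp_all add: power_mult_distrib power_divide less_imp_le)
   have "(LBINT x. (u n x - U x) * ?D x)^2 \<le> (LBINT x. wt x * (u n x - U x)^2) * (LBINT x. (?D x)^2 / wt x)"
    using cauchy_schwarz_integral[of lborel "\<lambda>x. sqrt (wt x) * (u n x - U x)" "\<lambda>x. ?D x / sqrt (wt x)"]
    unfolding s using iW iD integrable_test(2)[OF locally_integrable_Lq2[OF vUL] \<phi> i] by blast
   then show "\<bar>LBINT x. (u n x - U x) * ?D x\<bar>^2 \<le> (LBINT x. wt x * (u n x - U x)^2) * (LBINT x. (?D x)^2 / wt x)" by simp
  qed
  have "(\<lambda>n. \<bar>LBINT x. (u n x - U x) * ?D x\<bar>) \<longlonglongrightarrow> 0"
  proof (rule tendsto_sandwich[of "\<lambda>_. 0"])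
   have "(\<lambda>n. sqrt ((LBINT x. wt x * (u n x - U x)^2) * (LBINT x. (?D x)^2 / wt x))) \<longlonglongrightarrow> sqrt (0 * (LBINT x. (?D x)^2 / wt x))"
    by (intro tendsto_intros W0)
   then show "(\<lambda>n. sqrt ((LBINT x. wt x * (u n x - U x)^2) * (LBINT x. (?D x)^2 / wt x))) \<longlonglongrightarrow> 0" by simp
  qed (use CS in auto)
  then have "(\<lambda>n. LBINT x. (u n x - U x) * ?D x) \<longlonglongrightarrow> 0" by (simp add: tendsto_rabs_zero_iff)
  moreover have "(LBINT x. (u n x - U x) * ?D x) = (LBINT x. u n x * ?D x) - (LBINT x. U x * ?D x)" for n
   unfolding left_diff_distrib
   by (intro lint_diff integrable_test(2)[OF _ \<phi> i] sobD(8)[OF u] locally_integrable_Lq2[OF U])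
  ultimately have "(\<lambda>n. LBINT x. u n x * ?D x) \<longlonglongrightarrow> (LBINT x. U x * ?D x)" by (simp add: LIM_zero_iff)
  then have "(\<lambda>n. LBINT x. (g n x \<bullet> i) * \<phi> x) \<longlonglongrightarrow> - (LBINT x. U x * ?D x)"
   using tendsto_minus unfolding sob_test[OF u \<phi> i] by fastforce
  then have "(\<lambda>n. LBINT x. g n x \<bullet> (\<phi> x *\<^sub>R i)) \<longlonglongrightarrow> - (LBINT x. U x * ?D x)" by (simp add: mult.commute)
  moreover have "(\<lambda>x. \<phi> x *\<^sub>R i) \<in> Lq 2" using test_Lq2(1)[OF \<phi>] i unfolding Lq2_iff by auto
  ultimately have "(LBINT x. G x \<bullet> (\<phi> x *\<^sub>R i)) = - (LBINT x. U x * ?D x)" by (intro G)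
  then show "(LBINT x. U x * ?D x) = - (LBINT x. (G x \<bullet> i) * \<phi> x)" by (simp add: mult.commute)
 qed
 then show ?thesis using G that by blast
qed

section \<open>Concentration\<close>

lemma powr_le_sum:
 fixes x p :: real assumes "2 \<le> p" "p \<le> 6" shows "\<bar>x\<bar> powr p \<le> x^2 + x^6"
proof -
 have e6: "x^6 = \<bar>x\<bar>^6" by (rule power_even_abs[symmetric]) simp
 have e2: "x^2 = \<bar>x\<bar>^2" by simp
 show ?thesis
 proof (cases "x = 0")
  case False
  then have x: "\<bar>x\<bar> > 0" by simp
  show ?thesis
  proof (cases "\<bar>x\<bar> \<le> 1")
   case True
   have "\<bar>x\<bar> powr p \<le> \<bar>x\<bar> powr 2" by (rule powr_mono') (use assms x True in auto)
   also have "\<dots> = x^2" using x by (simp add: powr_numeral)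
   finally show ?thesis unfolding e6 by (smt (verit) zero_le_power abs_ge_zero)
  next
   case F: False
   have "\<bar>x\<bar> powr p \<le> \<bar>x\<bar> powr 6" by (rule powr_mono) (use assms F in auto)
   also have "\<dots> = x^6" using x by (simp add: powr_numeral)
   finally show ?thesis by (smt (verit) zero_le_power2)
  qed
 qed (use assms in simp)
qed

lemma integrable_powr:
 fixes u :: "'a::euclidean_space \<Rightarrow> real"
 assumes [measurable]: "u \<in> borel_measurable borel" and i: "integrable lborel (\<lambda>x. (u x)^2)" "integrable lborel (\<lambda>x. u x^6)"
  and p: "2 \<le> p" "p \<le> 6"
 shows "integrable lborel (\<lambda>x. \<bar>u x\<bar> powr p)"
 by (rule lintegrable_bound[OF lintegrable_add[OF i]])
   (use powr_le_sum[OF p] in \<open>auto intro!: order_trans[OF _ abs_ge_self]\<close>)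

text \<open>Pointwise weighted Young after normalising by the two integrals; the weights (6 - p) / 4
  and (p - 2) / 4 sum to 1 and satisfy 2 * (6 - p) / 4 + 6 * (p - 2) / 4 = p.\<close>

lemma holder_interp:
 fixes u :: "'a::euclidean_space \<Rightarrow> real"
 assumes m [measurable]: "u \<in> borel_measurable borel" and i: "integrable lborel (\<lambda>x. (u x)^2)" "integrable lborel (\<lambda>x. u x^6)"
  and p: "2 < p" "p < 6"
 shows "(LBINT x. \<bar>u x\<bar> powr p) \<le> (LBINT x. (u x)^2) powr ((6 - p) / 4) * (LBINT x. u x^6) powr ((p - 2) / 4)"
proof -
 let ?M = "LBINT x. (u x)^2" and ?C = "LBINT x. u x^6" and ?a = "(6 - p) / 4" and ?b = "(p - 2) / 4"
 have ev: "u x^6 \<ge> 0" for x by (rule zero_le_even_power) simp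
 have M0: "?M \<ge> 0" and C0: "?C \<ge> 0" using ev by (auto intro: lint_nonneg)
 show ?thesis
 proof (cases "?M = 0 \<or> ?C = 0")
  case True
  then have "AE x in lborel. u x = 0"
  proof
   assume "?M = 0"
   then show ?thesis using integral_nonneg_eq_0_iff_AE[OF i(1)] by simp
  next
   assume "?C = 0"
   then show ?thesis using integral_nonneg_eq_0_iff_AE[OF i(2)] ev by simp
  qed
  then have "AE x in lborel. \<bar>u x\<bar> powr p = 0" by eventually_elim (use p in simp)
  then have "(LBINT x. \<bar>u x\<bar> powr p) = 0" by (rule integral_eq_zero_AE)
  then show ?thesis by simp
 next
  case False
  then have M: "?M > 0" and C: "?C > 0" using M0 C0 by linarith+
  let ?N = "?M powr ?a * ?C powr ?b"
  have N: "?N > 0" using M C by simp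
  have pt: "\<bar>u x\<bar> powr p \<le> ?N * (?a * ((u x)^2 / ?M) + ?b * (u x^6 / ?C))" for x
  proof (cases "u x = 0")
   case F: False
   have u2: "(u x)^2 > 0" "u x^6 > 0" using F ev[of x] by (auto simp: order_less_le)
   have e2: "(u x)^2 = \<bar>u x\<bar> powr 2" using F by (simp add: powr_numeral)
   have e6: "u x^6 = \<bar>u x\<bar> powr 6" using F by (simp add: powr_numeral power_even_abs)
   have "((u x)^2 / ?M) powr ?a * (u x^6 / ?C) powr ?b \<le> ?a * ((u x)^2 / ?M) + ?b * (u x^6 / ?C)"
    by (rule Youngs_inequality_0) (use p u2 M C in \<open>auto simp: field_simps\<close>)
   moreover have "((u x)^2 / ?M) powr ?a * (u x^6 / ?C) powr ?b = \<bar>u x\<bar> powr p / ?N"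
   proof -
    have "2 * ?a + 6 * ?b = p" by (simp add: field_simps)
    then have "((u x)^2) powr ?a * (u x^6) powr ?b = \<bar>u x\<bar> powr p"
     unfolding e2 e6 powr_powr powr_add[symmetric] by simp
    then show ?thesis using u2 M C by (simp add: powr_divide less_imp_le)
   qed
   ultimately have "\<bar>u x\<bar> powr p / ?N \<le> ?a * ((u x)^2 / ?M) + ?b * (u x^6 / ?C)" by simp
   then show ?thesis using N by (simp add: pos_divide_le_eq mult.commute)
  qed (use p in simp)
  have "(LBINT x. \<bar>u x\<bar> powr p) \<le> (LBINT x. ?N * (?a * ((u x)^2 / ?M) + ?b * (u x^6 / ?C)))"
   by (intro integral_mono integrable_powr m i pt integrable_mult_right lintegrable_add lintegrable_divide) (use p in auto)
  also have "\<dots> = ?N * (?a * (?M / ?M) + ?b * (?C / ?C))"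
   using i by (simp add: lint_add)
  also have "\<dots> = ?N" using M C by (simp add: field_simps)
  finally show ?thesis .
 qed
qed

lemma sobolev':
 fixes u :: "real^3 \<Rightarrow> real"
 assumes u: "sob u g"
 shows "(LBINT x. u x^6) \<le> (nsq g)^3 / (27 * SN^2)"
 using sobolev(2)[OF u] SN_pos by (simp add: pos_le_divide_eq mult.commute)

section \<open>Lions' vanishing lemma\<close>

lemma nn_conv:
 fixes k f :: "'a::euclidean_space \<Rightarrow> ennreal"
 assumes [measurable]: "k \<in> borel_measurable borel" "f \<in> borel_measurable borel"
 shows "(NINT y. NINT x. k (x + y) * f x) = (NINT x. k x) * (NINT x. f x)"
proof -
 have "(NINT y. NINT x. k (x + y) * f x) = (NINT x. NINT y. k (x + y) * f x)"
  by (rule lborel_pair.Fubini'[symmetric]) measurable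
 also have "\<dots> = (NINT x. (NINT y. k y) * f x)"
 proof (rule nn_integral_cong)
  fix x
  have "(NINT y. k (x + y) * f x) = (NINT y. k (x + y)) * f x" by (rule nn_integral_multc) measurable
  also have "(NINT y. k (x + y)) = (NINT y. k y)"
   using nn_integral_affine[of k 1 x] by (simp add: add.commute)
  finally show "(NINT y. k (x + y) * f x) = (NINT y. k y) * f x" .
 qed
 also have "\<dots> = (NINT y. k y) * (NINT x. f x)" by (rule nn_integral_cmult) measurable
 finally show ?thesis .
qed

lemma nn_conv_real:
 fixes k f :: "'a::euclidean_space \<Rightarrow> real"
 assumes k: "integrable lborel k" "\<And>x. k x \<ge> 0" and f: "integrable lborel f" "\<And>x. f x \<ge> 0"
 shows "(NINT y. NINT x. ennreal (k (x + y) * f x)) = ennreal ((LBINT x. k x) * (LBINT x. f x))"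
proof -
 have [measurable]: "k \<in> borel_measurable borel" "f \<in> borel_measurable borel" using k f by auto
 have "(NINT y. NINT x. ennreal (k (x + y) * f x)) = (NINT x. ennreal (k x)) * (NINT x. ennreal (f x))"
  unfolding ennreal_mult[OF k(2) f(2)] by (rule nn_conv) measurable
 also have "\<dots> = ennreal ((LBINT x. k x) * (LBINT x. f x))"
  by (simp add: nn_integral_eq_integral k f ennreal_mult lint_nonneg)
 finally show ?thesis .
qed

lemma test_powr_integrable:
 fixes \<zeta> :: "'a::euclidean_space \<Rightarrow> real"
 assumes \<zeta>: "test_function \<zeta>" and p: "p > 0"
 shows "integrable lborel (\<lambda>x. \<bar>\<zeta> x\<bar> powr p)"
proof -
 obtain K where K: "compact K" "\<And>x. x \<notin> K \<Longrightarrow> \<zeta> x = 0"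
  by (rule test_function_support[OF \<zeta>]) blast
 have c: "continuous_on UNIV (\<lambda>x. \<bar>\<zeta> x\<bar> powr p)"
  by (intro continuous_on_powr' continuous_intros test_function_continuous[OF \<zeta>]) (use p in auto)
 obtain B where "\<And>x. \<bar>\<bar>\<zeta> x\<bar> powr p\<bar> \<le> B * indicator K x"
  by (rule bounded_of_compact_support[OF c K(1)]) (use K(2) in auto)
 then show ?thesis by (rule integrable_bounded_support[OF measurable_cont[OF c] K(1)])
qed

lemma test_sq_bound:
 fixes \<zeta> :: "'a::euclidean_space \<Rightarrow> real"
 assumes \<zeta>: "test_function \<zeta>"
 obtains z where "z > 0" "\<And>x. (\<zeta> x)^2 \<le> z" "\<And>x. (norm (grad \<zeta> x))^2 \<le> z"
proof -
 obtain K where K: "compact K" "\<And>x. x \<notin> K \<Longrightarrow> \<zeta> x = 0" "\<And>x. x \<notin> K \<Longrightarrow> fd \<zeta> x = (\<lambda>_. 0)"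
  by (rule test_function_support[OF \<zeta>]) blast
 have c1: "continuous_on UNIV (\<lambda>x. (\<zeta> x)^2)" by (intro continuous_intros test_function_continuous[OF \<zeta>])
 have c2: "continuous_on UNIV (\<lambda>x. (norm (grad \<zeta> x))^2)" by (intro continuous_intros grad_test_cont[OF \<zeta>])
 obtain B1 where B1: "B1 > 0" "\<And>x. \<bar>(\<zeta> x)^2\<bar> \<le> B1 * indicator K x"
  by (rule bounded_of_compact_support[OF c1 K(1)]) (use K(2) in auto)
 obtain B2 where B2: "B2 > 0" "\<And>x. \<bar>(norm (grad \<zeta> x))^2\<bar> \<le> B2 * indicator K x"
  by (rule bounded_of_compact_support[OF c2 K(1)]) (use K(3) in \<open>auto simp: grad_def\<close>)
 show ?thesis
 proof (rule that[of "max B1 B2"])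
  fix x
  show "(\<zeta> x)^2 \<le> max B1 B2" "(norm (grad \<zeta> x))^2 \<le> max B1 B2"
   using B1(1) B2(1) B1(2)[of x] B2(2)[of x] by (cases "x \<in> K"; simp)+
 qed (use B1 in simp)
qed

lemma grad_shift:
 assumes \<zeta>: "test_function \<zeta>" shows "grad (\<lambda>x. \<zeta> (x + y)) x = grad \<zeta> (x + y)"
proof -
 have "((\<lambda>x. \<zeta> (x + y)) has_derivative fd \<zeta> (x + y)) (at x)"
  by (rule has_derivative_compose[of "\<lambda>x. x + y" "\<lambda>h. h", OF _ test_function_deriv[OF \<zeta>]])
    (auto intro!: derivative_eq_intros)
 then have "frechet_derivative (\<lambda>x. \<zeta> (x + y)) (at x) = fd \<zeta> (x + y)"
  by (rule frechet_derivative_at[symmetric])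
 then show ?thesis by (simp add: grad_def)
qed

text \<open>A smooth window, translated over all of R^3, replaces a covering by balls. On each
  window interpolation and Sobolev give the power 3 * \<beta> of the local Dirichlet bound
  \<open>D y\<close>; p \<ge> 10/3 means 3 * \<beta> \<ge> 1, so one factor \<open>D y\<close> can
  be split off and integrated over y.\<close>

theorem lions_local:
 fixes \<zeta> :: "real^3 \<Rightarrow> real"
 assumes \<zeta>: "test_function \<zeta>" and p: "10/3 \<le> p" "p < 6" and Z: "(LBINT x. \<bar>\<zeta> x\<bar> powr p) > 0"
  and AM: "A0 \<ge> 0" "M0 \<ge> 0"
 obtains K where "K \<ge> 0" "\<And>u g \<sigma>. sob u g \<Longrightarrow> (LBINT x. (u x)^2) \<le> M0 \<Longrightarrow> (nsq g) \<le> A0 \<Longrightarrow>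
   (\<And>y. (LBINT x. (\<zeta> (x + y) * u x)^2) \<le> \<sigma>) \<Longrightarrow> (LBINT x. \<bar>u x\<bar> powr p) \<le> K * \<sigma> powr ((6 - p) / 4)"
proof -
 obtain z where z: "z > 0" "\<And>x. (\<zeta> x)^2 \<le> z" "\<And>x. (norm (grad \<zeta> x))^2 \<le> z" by (rule test_sq_bound[OF \<zeta>]) blast
 define Zp where "Zp = (LBINT x. \<bar>\<zeta> x\<bar> powr p)"
 define Z2 where "Z2 = (LBINT x. (\<zeta> x)^2)"
 define Z1 where "Z1 = nsq (grad \<zeta>)"
 \<comment> \<open>\<open>D0\<close> bounds the local Dirichlet bound for every window position, and
   \<open>D1\<close> bounds its integral over all positions.\<close>
 define D0 where "D0 = 2 * z * A0 + 2 * z * M0"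
 define D1 where "D1 = 2 * Z2 * A0 + 2 * Z1 * M0"
 define \<beta> where "\<beta> = (p - 2) / 4"
 define L where "L = (1 / (27 * SN^2)) powr \<beta> * D0 powr (3 * \<beta> - 1)"
 have \<beta>: "\<beta> \<ge> 1/3" using p by (simp add: \<beta>_def)
 have Z12: "Z1 \<ge> 0" "Z2 \<ge> 0" by (auto simp: Z1_def Z2_def intro: lint_nonneg)
 have D0: "D0 \<ge> 0" "D1 \<ge> 0" "L \<ge> 0" using z AM Z12 by (auto simp: D0_def D1_def L_def)
 note \<zeta>s = test_sob[OF \<zeta>]
 have cz: "continuous_on UNIV \<zeta>" "continuous_on UNIV (grad \<zeta>)" by (rule test_function_continuous[OF \<zeta>], rule grad_test_cont[OF \<zeta>])
 have [measurable]: "\<zeta> \<in> borel_measurable borel" "grad \<zeta> \<in> borel_measurable borel" using cz by (auto intro: measurable_cont)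
 show ?thesis
 proof (rule that[of "L * D1 / Zp"])
  show "L * D1 / Zp \<ge> 0" using D0 Z by (simp add: Zp_def)
  fix u g \<sigma> assume u: "sob u g" and M: "(LBINT x. (u x)^2) \<le> M0" and A: "nsq g \<le> A0"
   and \<sigma>: "\<And>y. (LBINT x. (\<zeta> (x + y) * u x)^2) \<le> \<sigma>"
  note [measurable] = sobD(4,5)[OF u]
  have ip: "integrable lborel (\<lambda>x. \<bar>u x\<bar> powr p)"
   by (rule integrable_powr[OF sobD(4)[OF u] sobD(6)[OF u] sobolev(1)[OF u]]) (use p in auto)
  define D where "D y = (LBINT x. 2 * ((\<zeta> (x + y))^2 * (norm (g x))^2) + 2 * ((norm (grad \<zeta> (x + y)))^2 * (u x)^2))" for y
  have i1: "integrable lborel (\<lambda>x. (\<zeta> (x + y))^2 * (norm (g x))^2)" for y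
   by (rule lintegrable_bound[OF integrable_mult_right[OF sobD(7)[OF u], of z]])
     (auto intro!: AE_I2 mult_right_mono z(2) simp: abs_mult z(1) less_imp_le)
  have i2: "integrable lborel (\<lambda>x. (norm (grad \<zeta> (x + y)))^2 * (u x)^2)" for y
   by (rule lintegrable_bound[OF integrable_mult_right[OF sobD(6)[OF u], of z]])
     (auto intro!: AE_I2 mult_right_mono z(3) simp: abs_mult z(1) less_imp_le)
  have iD: "integrable lborel (\<lambda>x. 2 * ((\<zeta> (x + y))^2 * (norm (g x))^2) + 2 * ((norm (grad \<zeta> (x + y)))^2 * (u x)^2))" for y
   by (intro lintegrable_add integrable_mult_right i1 i2)
  have Dp: "D y \<ge> 0" for y unfolding D_def by (rule lint_nonneg) simp
  have DD0: "D y \<le> D0" for y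
  proof -
   have "D y \<le> (LBINT x. 2 * (z * (norm (g x))^2) + 2 * (z * (u x)^2))" unfolding D_def
    by (intro integral_mono iD lintegrable_add integrable_mult_right sobD(6,7)[OF u] add_mono mult_left_mono mult_right_mono z) auto
   also have "\<dots> = 2 * z * nsq g + 2 * z * (LBINT x. (u x)^2)"
    using sobD(6,7)[OF u] by (simp add: lint_add)
   also have "\<dots> \<le> D0" unfolding D0_def using M A z(1) by (intro add_mono mult_left_mono) auto
   finally show ?thesis .
  qed
  have loc: "(LBINT x. \<bar>\<zeta> (x + y) * u x\<bar> powr p) \<le> \<sigma> powr ((6 - p) / 4) * L * D y" for y
  proof -
   have ty: "test_function (\<lambda>x. \<zeta> (x + y))" using test_shift[OF \<zeta>, of "- y"] by simp
   note w = sob_cutoff[OF u ty, unfolded grad_shift[OF \<zeta>]]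
   let ?w = "\<lambda>x. \<zeta> (x + y) * u x" and ?G = "\<lambda>x. \<zeta> (x + y) *\<^sub>R g x + u x *\<^sub>R grad \<zeta> (x + y)"
   have "nsq ?G \<le> D y" unfolding D_def
   proof (intro integral_mono sobD(7)[OF w] iD)
    fix x
    have "(norm (?G x))^2 \<le> 2 * (norm (\<zeta> (x + y) *\<^sub>R g x))^2 + 2 * (norm (u x *\<^sub>R grad \<zeta> (x + y)))^2"
    proof -
     have "(norm (?G x))^2 \<le> (norm (\<zeta> (x + y) *\<^sub>R g x) + norm (u x *\<^sub>R grad \<zeta> (x + y)))^2" by (intro power_mono norm_triangle_ineq) simp
     also have "\<dots> \<le> 2 * (norm (\<zeta> (x + y) *\<^sub>R g x))^2 + 2 * (norm (u x *\<^sub>R grad \<zeta> (x + y)))^2"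
      using sum_squares_bound[of "norm (\<zeta> (x + y) *\<^sub>R g x)" "norm (u x *\<^sub>R grad \<zeta> (x + y))"] by (simp add: power2_sum)
     finally show ?thesis .
    qed
    then show "(norm (?G x))^2 \<le> 2 * ((\<zeta> (x + y))^2 * (norm (g x))^2) + 2 * ((norm (grad \<zeta> (x + y)))^2 * (u x)^2)"
     by (simp add: power_mult_distrib mult.commute)
   qed
   then have "(nsq ?G)^3 / (27 * SN^2) \<le> D y^3 / (27 * SN^2)"
    by (intro divide_right_mono power_mono lint_nonneg) auto
   then have C: "(LBINT x. ?w x^6) \<le> 1 / (27 * SN^2) * D y^3" using sobolev'[OF w] by simp
   have C0: "0 \<le> (LBINT x. ?w x^6)" by (intro lint_nonneg zero_le_even_power) simp
   have "(LBINT x. \<bar>?w x\<bar> powr p) \<le> (LBINT x. (?w x)^2) powr ((6 - p) / 4) * (LBINT x. ?w x^6) powr ((p - 2) / 4)"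
    by (rule holder_interp[OF sobD(4)[OF w] sobD(6)[OF w] sobolev(1)[OF w]]) (use p in auto)
   also have "\<dots> \<le> \<sigma> powr ((6 - p) / 4) * (1 / (27 * SN^2) * D y^3) powr \<beta>" unfolding \<beta>_def
    by (intro mult_mono powr_mono2 \<sigma> C C0 lint_nonneg) (use p in auto)
   also have "(1 / (27 * SN^2) * D y^3) powr \<beta> = (1 / (27 * SN^2)) powr \<beta> * (D y^3) powr \<beta>"
    by (rule powr_mult)
   also have "(D y^3) powr \<beta> \<le> D0 powr (3 * \<beta> - 1) * D y"
   proof (cases "D y = 0")
    case False
    then have d: "D y > 0" using Dp[of y] by simp
    have "(D y^3) powr \<beta> = D y powr (3 * \<beta>)" using d by (simp add: powr_powr flip: powr_numeral)
    also have "\<dots> = D y powr (3 * \<beta> - 1) * D y" using d by (simp add: powr_diff)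
    also have "\<dots> \<le> D0 powr (3 * \<beta> - 1) * D y" by (intro mult_right_mono powr_mono2 DD0 Dp) (use \<beta> in auto)
    finally show ?thesis .
   qed simp
   finally show ?thesis by (simp add: L_def mult_left_mono mult.assoc)
  qed
  have pm: "\<bar>\<zeta> (x + y) * u x\<bar> powr p = \<bar>\<zeta> (x + y)\<bar> powr p * \<bar>u x\<bar> powr p" for x y by (simp add: abs_mult powr_mult)
  have iw: "integrable lborel (\<lambda>x. \<bar>\<zeta> (x + y) * u x\<bar> powr p)" for y
  proof -
   have ty: "test_function (\<lambda>x. \<zeta> (x + y))" using test_shift[OF \<zeta>, of "- y"] by simp
   note w = sob_cutoff[OF u ty]
   show ?thesis by (rule integrable_powr[OF sobD(4)[OF w] sobD(6)[OF w] sobolev(1)[OF w]]) (use p in auto)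
  qed
  have "ennreal (Zp * (LBINT x. \<bar>u x\<bar> powr p)) = (NINT y. NINT x. ennreal (\<bar>\<zeta> (x + y)\<bar> powr p * \<bar>u x\<bar> powr p))"
   unfolding Zp_def by (rule nn_conv_real[symmetric]) (use ip test_powr_integrable[OF \<zeta>, of p] p in auto)
  also have "\<dots> = (NINT y. ennreal (LBINT x. \<bar>\<zeta> (x + y) * u x\<bar> powr p))"
   unfolding pm[symmetric] by (intro nn_integral_cong nn_integral_eq_integral iw) simp
  also have "\<dots> \<le> (NINT y. ennreal (\<sigma> powr ((6 - p) / 4) * L) * ennreal (D y))"
   by (intro nn_integral_mono) (use loc D0(3) Dp in \<open>simp flip: ennreal_mult'\<close>)
  also have "\<dots> = ennreal (\<sigma> powr ((6 - p) / 4) * L) * (NINT y. ennreal (D y))"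
   unfolding D_def by (rule nn_integral_cmult) measurable
  also have "(NINT y. ennreal (D y)) = (NINT y. (NINT x. ennreal ((2 * (\<zeta> (x + y))^2) * (norm (g x))^2)) + (NINT x. ennreal ((2 * (norm (grad \<zeta> (x + y)))^2) * (u x)^2)))"
  proof (rule nn_integral_cong)
   fix y
   have "ennreal (D y) = (NINT x. ennreal (2 * ((\<zeta> (x + y))^2 * (norm (g x))^2) + 2 * ((norm (grad \<zeta> (x + y)))^2 * (u x)^2)))"
    unfolding D_def by (rule nn_integral_eq_integral[OF iD, symmetric]) simp
   also have "\<dots> = (NINT x. ennreal ((2 * (\<zeta> (x + y))^2) * (norm (g x))^2) + ennreal ((2 * (norm (grad \<zeta> (x + y)))^2) * (u x)^2))"
    by (intro nn_integral_cong) (simp flip: ennreal_plus add: mult.assoc)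
   also have "\<dots> = (NINT x. ennreal ((2 * (\<zeta> (x + y))^2) * (norm (g x))^2)) + (NINT x. ennreal ((2 * (norm (grad \<zeta> (x + y)))^2) * (u x)^2))"
    by (rule nn_integral_add) measurable
   finally show "ennreal (D y) = (NINT x. ennreal ((2 * (\<zeta> (x + y))^2) * (norm (g x))^2)) + (NINT x. ennreal ((2 * (norm (grad \<zeta> (x + y)))^2) * (u x)^2))" .
  qed
  also have "\<dots> = (NINT y. NINT x. ennreal ((2 * (\<zeta> (x + y))^2) * (norm (g x))^2)) + (NINT y. NINT x. ennreal ((2 * (norm (grad \<zeta> (x + y)))^2) * (u x)^2))"
   by (rule nn_integral_add) measurable
  also have "(NINT y. NINT x. ennreal ((2 * (\<zeta> (x + y))^2) * (norm (g x))^2)) = ennreal ((LBINT x. 2 * (\<zeta> x)^2) * nsq g)"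
   by (rule nn_conv_real) (use sobD(6,7)[OF u] sobD(6)[OF \<zeta>s] in auto)
  also have "(NINT y. NINT x. ennreal ((2 * (norm (grad \<zeta> (x + y)))^2) * (u x)^2)) = ennreal ((LBINT x. 2 * (norm (grad \<zeta> x))^2) * (LBINT x. (u x)^2))"
   by (rule nn_conv_real) (use sobD(6,7)[OF u] sobD(7)[OF \<zeta>s] in auto)
  also have "ennreal ((LBINT x. 2 * (\<zeta> x)^2) * nsq g) + ennreal ((LBINT x. 2 * (norm (grad \<zeta> x))^2) * (LBINT x. (u x)^2))
    = ennreal (2 * Z2 * nsq g + 2 * Z1 * (LBINT x. (u x)^2))"
   unfolding Z1_def Z2_def by (subst ennreal_plus[symmetric]) (auto intro!: mult_nonneg_nonneg lint_nonneg)
  also have "\<dots> \<le> ennreal D1" unfolding D1_def using M A Z12 by (intro ennreal_leI add_mono mult_left_mono) auto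
  also have "ennreal (\<sigma> powr ((6 - p) / 4) * L) * ennreal D1 = ennreal (\<sigma> powr ((6 - p) / 4) * L * D1)" using D0 by (simp flip: ennreal_mult')
  finally have "ennreal (Zp * (LBINT x. \<bar>u x\<bar> powr p)) \<le> ennreal (\<sigma> powr ((6 - p) / 4) * L * D1)" by (simp add: mult_left_mono)
  then have "Zp * (LBINT x. \<bar>u x\<bar> powr p) \<le> \<sigma> powr ((6 - p) / 4) * L * D1" using D0 by (subst (asm) ennreal_le_iff) auto
  then show "(LBINT x. \<bar>u x\<bar> powr p) \<le> L * D1 / Zp * \<sigma> powr ((6 - p) / 4)" using Z
   by (simp add: Zp_def pos_le_divide_eq mult_ac)
 qed
qed

section \<open>Brezis-Lieb splitting\<close>

lemma powr_add_diff_bound: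
 fixes q e :: real assumes q: "q > 0" and e: "e > 0"
 obtains K where "K \<ge> 0" "\<And>a b :: real. \<bar>\<bar>a + b\<bar> powr q - \<bar>a\<bar> powr q\<bar> \<le> e * \<bar>a\<bar> powr q + K * \<bar>b\<bar> powr q"
proof -
 have "((\<lambda>s. \<bar>1 + s\<bar> powr q) \<longlongrightarrow> \<bar>1 + 0\<bar> powr q) (at (0::real))"
  by (intro tendsto_intros) auto
 then have "\<exists>d>0. \<forall>s. s \<noteq> 0 \<and> norm (s - 0) < d \<longrightarrow> norm (\<bar>1 + s\<bar> powr q - \<bar>1 + 0\<bar> powr q) < e" using e by (rule LIM_D)
 then obtain d where d: "d > 0" "\<And>s. s \<noteq> 0 \<Longrightarrow> \<bar>s\<bar> < d \<Longrightarrow> \<bar>\<bar>1 + s\<bar> powr q - 1\<bar> < e" by auto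
 \<comment> \<open>Separates the regimes: if |a| \<le> ?N * |b|, everything is bounded by |b| powr
   q; otherwise |b / a| < d, and continuity of |1 + s| powr q at 0 supplies the factor e.\<close>
 let ?N = "2 / d"
 show ?thesis
 proof (rule that[of "(?N + 1) powr q + ?N powr q"])
  show "(?N + 1) powr q + ?N powr q \<ge> 0" by simp
  fix a b :: real
  show "\<bar>\<bar>a + b\<bar> powr q - \<bar>a\<bar> powr q\<bar> \<le> e * \<bar>a\<bar> powr q + ((?N + 1) powr q + ?N powr q) * \<bar>b\<bar> powr q"
  proof (cases "\<bar>a\<bar> \<le> ?N * \<bar>b\<bar>")
   case True
   have 1: "\<bar>a + b\<bar> powr q \<le> (?N + 1) powr q * \<bar>b\<bar> powr q"
   proof -
    have "\<bar>a + b\<bar> \<le> (?N + 1) * \<bar>b\<bar>" using True abs_triangle_ineq[of a b] by (simp add: distrib_right)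
    then have "\<bar>a + b\<bar> powr q \<le> ((?N + 1) * \<bar>b\<bar>) powr q" by (rule powr_mono2[rotated 2]) (use q in auto)
    then show ?thesis by (simp add: powr_mult)
   qed
   have 2: "\<bar>a\<bar> powr q \<le> ?N powr q * \<bar>b\<bar> powr q"
   proof -
    have "\<bar>a\<bar> powr q \<le> (?N * \<bar>b\<bar>) powr q" using True by (rule powr_mono2[rotated 2]) (use q in auto)
    then show ?thesis unfolding powr_mult .
   qed
   have "\<bar>\<bar>a + b\<bar> powr q - \<bar>a\<bar> powr q\<bar> \<le> \<bar>a + b\<bar> powr q + \<bar>a\<bar> powr q"
    using powr_ge_zero[of "\<bar>a + b\<bar>" q] powr_ge_zero[of "\<bar>a\<bar>" q] by linarith
   also have "\<dots> \<le> ((?N + 1) powr q + ?N powr q) * \<bar>b\<bar> powr q" using 1 2 by (simp add: distrib_right)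
   also have "\<dots> \<le> e * \<bar>a\<bar> powr q + ((?N + 1) powr q + ?N powr q) * \<bar>b\<bar> powr q" using e by simp
   finally show ?thesis .
  next
   case False
   have "?N * \<bar>b\<bar> \<ge> 0" using d by simp
   then have a: "\<bar>a\<bar> > 0" using False by linarith
   have r: "0 \<le> ((?N + 1) powr q + ?N powr q) * \<bar>b\<bar> powr q" by simp
   have "\<bar>\<bar>a + b\<bar> powr q - \<bar>a\<bar> powr q\<bar> \<le> e * \<bar>a\<bar> powr q"
   proof (cases "b = 0")
    case b: False
    have "\<bar>b / a\<bar> < d" using False a d(1) by (simp add: field_simps)
    then have "\<bar>\<bar>1 + b / a\<bar> powr q - 1\<bar> < e" by (intro d(2)) (use b a in auto)
    then have "\<bar>a\<bar> powr q * \<bar>\<bar>1 + b / a\<bar> powr q - 1\<bar> \<le> \<bar>a\<bar> powr q * e" by (intro mult_left_mono) auto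
    moreover have "\<bar>a\<bar> powr q * \<bar>\<bar>1 + b / a\<bar> powr q - 1\<bar> = \<bar>\<bar>a + b\<bar> powr q - \<bar>a\<bar> powr q\<bar>"
    proof -
     have "\<bar>a\<bar> * \<bar>1 + b / a\<bar> = \<bar>a + b\<bar>" using a by (simp flip: abs_mult add: field_simps)
     then have "\<bar>a\<bar> powr q * \<bar>1 + b / a\<bar> powr q = \<bar>a + b\<bar> powr q" by (simp flip: powr_mult)
     then have "\<bar>a + b\<bar> powr q - \<bar>a\<bar> powr q = \<bar>a\<bar> powr q * (\<bar>1 + b / a\<bar> powr q - 1)" by (simp add: right_diff_distrib)
     then show ?thesis by (simp add: abs_mult)
    qed
    ultimately show ?thesis by (simp add: mult.commute)
   qed (use e in simp)
   then show ?thesis using r by linarith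
  qed
 qed
qed

lemma powr_diff_le:
 fixes a b q :: real assumes q: "q > 0"
 shows "\<bar>a - b\<bar> powr q \<le> 2 powr q * (\<bar>a\<bar> powr q + \<bar>b\<bar> powr q)"
proof -
 have "\<bar>a - b\<bar> \<le> 2 * max \<bar>a\<bar> \<bar>b\<bar>" by linarith
 then have "\<bar>a - b\<bar> powr q \<le> (2 * max \<bar>a\<bar> \<bar>b\<bar>) powr q" by (rule powr_mono2[rotated 2]) (use q in auto)
 also have "\<dots> = 2 powr q * (max \<bar>a\<bar> \<bar>b\<bar>) powr q" by (simp add: powr_mult)
 also have "\<dots> \<le> 2 powr q * (\<bar>a\<bar> powr q + \<bar>b\<bar> powr q)" by (intro mult_left_mono) (auto simp: max_def)
 finally show ?thesis .
qed

lemma powr_fatou: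
 fixes u :: "nat \<Rightarrow> 'a \<Rightarrow> real"
 assumes [measurable]: "\<And>n. u n \<in> borel_measurable M" "U \<in> borel_measurable M" and q: "q > 0"
  and i: "\<And>n. integrable M (\<lambda>x. \<bar>u n x\<bar> powr q)" and C: "\<And>n. (LINT x|M. \<bar>u n x\<bar> powr q) \<le> C"
  and ae: "AE x in M. (\<lambda>n. u n x) \<longlonglongrightarrow> U x"
 shows "integrable M (\<lambda>x. \<bar>U x\<bar> powr q)"
proof -
 have ae': "AE x in M. ennreal (\<bar>U x\<bar> powr q) = liminf (\<lambda>n. ennreal (\<bar>u n x\<bar> powr q))"
  using ae
 proof eventually_elim
  case (elim x)
  have "(\<lambda>n. ennreal (\<bar>u n x\<bar> powr q)) \<longlonglongrightarrow> ennreal (\<bar>U x\<bar> powr q)"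
   by (intro tendsto_ennrealI tendsto_powr' tendsto_rabs elim tendsto_const) (use q in auto)
  from lim_imp_Liminf[OF trivial_limit_sequentially this] show ?case by (rule sym)
 qed
 have "(\<integral>\<^sup>+x. ennreal (\<bar>U x\<bar> powr q) \<partial>M) = (\<integral>\<^sup>+x. liminf (\<lambda>n. ennreal (\<bar>u n x\<bar> powr q)) \<partial>M)" by (rule nn_integral_cong_AE[OF ae'])
 also have "\<dots> \<le> liminf (\<lambda>n. \<integral>\<^sup>+x. ennreal (\<bar>u n x\<bar> powr q) \<partial>M)" by (rule nn_integral_liminf) measurable
 also have "\<dots> \<le> liminf (\<lambda>n. ennreal C)" by (intro Liminf_mono always_eventually allI) (simp add: nn_integral_eq_integral[OF i] C ennreal_leI)
 also have "\<dots> = ennreal C" by (simp add: Liminf_const)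
 finally have "(\<integral>\<^sup>+x. ennreal (\<bar>U x\<bar> powr q) \<partial>M) < \<infinity>" by (simp add: order_le_less_trans)
 then show ?thesis by (intro integrableI_nonneg) auto
qed

text \<open>The part of the error above e * |u n - U| powr q is dominated by a fixed multiple of |U|
  powr q, so its integral tends to 0; the remaining part is at most e times a uniform bound, and e
  is arbitrary.\<close>

theorem brezis_lieb:
 fixes u :: "nat \<Rightarrow> 'a \<Rightarrow> real"
 assumes m: "\<And>n. u n \<in> borel_measurable M" "U \<in> borel_measurable M" and q: "q > 0"
  and i: "\<And>n. integrable M (\<lambda>x. \<bar>u n x\<bar> powr q)" and C: "\<And>n. (LINT x|M. \<bar>u n x\<bar> powr q) \<le> C"
  and ae: "AE x in M. (\<lambda>n. u n x) \<longlonglongrightarrow> U x"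
 shows "(\<lambda>n. (LINT x|M. \<bar>u n x\<bar> powr q) - (LINT x|M. \<bar>u n x - U x\<bar> powr q)) \<longlonglongrightarrow> (LINT x|M. \<bar>U x\<bar> powr q)"
proof -
 note [measurable] = m
 have iU: "integrable M (\<lambda>x. \<bar>U x\<bar> powr q)" by (rule powr_fatou[OF m q i C ae])
 have ib: "integrable M (\<lambda>x. 2 powr q * (\<bar>u n x\<bar> powr q + \<bar>U x\<bar> powr q))" for n
  by (intro integrable_mult_right lintegrable_add i iU)
 have iw: "integrable M (\<lambda>x. \<bar>u n x - U x\<bar> powr q)" for n
  by (rule lintegrable_bound[OF ib[of n]]) (use powr_diff_le[OF q] in \<open>auto intro!: AE_I2 order_trans[OF _ abs_ge_self]\<close>)
 define CU where "CU = (LINT x|M. \<bar>U x\<bar> powr q)"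
 define C' where "C' = 2 powr q * (C + CU) + 1"
 have W: "(LINT x|M. \<bar>u n x - U x\<bar> powr q) \<le> C'" for n
 proof -
  have "(LINT x|M. \<bar>u n x - U x\<bar> powr q) \<le> (LINT x|M. 2 powr q * (\<bar>u n x\<bar> powr q + \<bar>U x\<bar> powr q))"
   by (intro integral_mono iw ib powr_diff_le q)
  also have "\<dots> = 2 powr q * ((LINT x|M. \<bar>u n x\<bar> powr q) + CU)" using i iU by (simp add: CU_def lint_add)
  also have "\<dots> \<le> 2 powr q * (C + CU)" by (intro mult_left_mono add_right_mono C) simp
  finally show ?thesis by (simp add: C'_def)
 qed
 have "(LINT x|M. \<bar>u 0 x - U x\<bar> powr q) \<ge> 0" by (rule lint_nonneg) simp
 then have "2 powr q * (C + CU) \<ge> 0"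
 proof -
  have "0 \<le> (LINT x|M. \<bar>u 0 x\<bar> powr q)" "0 \<le> CU" unfolding CU_def by (rule lint_nonneg; simp)+
  then have "0 \<le> C + CU" using C[of 0] by linarith
  then show ?thesis by simp
 qed
 then have C'p: "C' > 0" by (simp add: C'_def)
 define c where "c n x = \<bar>u n x\<bar> powr q - \<bar>u n x - U x\<bar> powr q - \<bar>U x\<bar> powr q" for n x
 have ic: "integrable M (c n)" for n unfolding c_def by (intro lintegrable_diff i iw iU)
 have cE: "(LINT x|M. c n x) = (LINT x|M. \<bar>u n x\<bar> powr q) - (LINT x|M. \<bar>u n x - U x\<bar> powr q) - CU" for n
  unfolding c_def CU_def using i iw iU by (simp add: lint_diff lintegrable_diff)
 have "(\<lambda>n. LINT x|M. c n x) \<longlonglongrightarrow> 0"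
 proof (rule LIMSEQ_I)
  fix r :: real assume r: "r > 0"
  define e where "e = r / (2 * C')"
  have e: "e > 0" using r C'p by (simp add: e_def)
  obtain K where K: "K \<ge> 0" "\<And>a b :: real. \<bar>\<bar>a + b\<bar> powr q - \<bar>a\<bar> powr q\<bar> \<le> e * \<bar>a\<bar> powr q + K * \<bar>b\<bar> powr q"
   by (rule powr_add_diff_bound[OF q e]) blast
  define f where "f n x = max 0 (\<bar>c n x\<bar> - e * \<bar>u n x - U x\<bar> powr q)" for n x
  have fb: "\<bar>f n x\<bar> \<le> (K + 1) * \<bar>U x\<bar> powr q" for n x
  proof -
   have "\<bar>\<bar>u n x\<bar> powr q - \<bar>u n x - U x\<bar> powr q\<bar> \<le> e * \<bar>u n x - U x\<bar> powr q + K * \<bar>U x\<bar> powr q"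
    using K(2)[of "u n x - U x" "U x"] by simp
   moreover have "\<bar>U x\<bar> powr q \<ge> 0" "K * \<bar>U x\<bar> powr q \<ge> 0" using K(1) by auto
   ultimately show ?thesis unfolding f_def c_def distrib_right by linarith
  qed
  have [measurable]: "f n \<in> borel_measurable M" for n unfolding f_def c_def by measurable
  have "(\<lambda>n. LINT x|M. f n x) \<longlonglongrightarrow> (LINT x|M. 0)"
  proof (rule integral_dominated_convergence[where w = "\<lambda>x. (K + 1) * \<bar>U x\<bar> powr q"])
   show "AE x in M. (\<lambda>n. f n x) \<longlonglongrightarrow> 0"
    using ae
   proof eventually_elim
    case (elim x)
    have w: "(\<lambda>n. \<bar>u n x - U x\<bar> powr q) \<longlonglongrightarrow> \<bar>U x - U x\<bar> powr q"
     by (intro tendsto_powr' tendsto_rabs tendsto_diff elim tendsto_const) (use q in auto)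
    have uq: "(\<lambda>n. \<bar>u n x\<bar> powr q) \<longlonglongrightarrow> \<bar>U x\<bar> powr q"
     by (intro tendsto_powr' tendsto_rabs tendsto_diff elim tendsto_const) (use q in auto)
    have "(\<lambda>n. f n x) \<longlonglongrightarrow> max 0 (\<bar>\<bar>U x\<bar> powr q - \<bar>U x - U x\<bar> powr q - \<bar>U x\<bar> powr q\<bar> - e * \<bar>U x - U x\<bar> powr q)"
     unfolding f_def c_def by (intro tendsto_max tendsto_diff tendsto_mult tendsto_rabs w uq tendsto_const)
    then show ?case by simp
   qed
   show "integrable M (\<lambda>x. (K + 1) * \<bar>U x\<bar> powr q)" using iU by simp
   show "AE x in M. norm (f n x) \<le> (K + 1) * \<bar>U x\<bar> powr q" for n using fb by simp
  qed measurable
  then have "(\<lambda>n. LINT x|M. f n x) \<longlonglongrightarrow> 0" by simp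
  from LIMSEQ_D[OF this, of "r/2"] obtain N where N: "\<And>n. n \<ge> N \<Longrightarrow> \<bar>LINT x|M. f n x\<bar> < r/2" using r by auto
  have "norm ((LINT x|M. c n x) - 0) < r" if n: "n \<ge> N" for n
  proof -
   have if': "integrable M (f n)"
    by (rule lintegrable_bound[OF integrable_mult_right[OF iU, of "K + 1"]]) (use fb K(1) in \<open>auto simp: abs_mult\<close>)
   have "\<bar>LINT x|M. c n x\<bar> \<le> (LINT x|M. \<bar>c n x\<bar>)" by (rule integral_abs_bound)
   also have "\<dots> \<le> (LINT x|M. f n x + e * \<bar>u n x - U x\<bar> powr q)"
    by (intro integral_mono integrable_abs ic lintegrable_add if' integrable_mult_right iw) (auto simp: f_def)
   also have "\<dots> = (LINT x|M. f n x) + e * (LINT x|M. \<bar>u n x - U x\<bar> powr q)" using if' iw by (simp add: lint_add)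
   also have "\<dots> \<le> (LINT x|M. f n x) + e * C'" by (intro add_left_mono mult_left_mono W) (use e in auto)
   also have "e * C' = r/2" using C'p by (simp add: e_def)
   finally have "\<bar>LINT x|M. c n x\<bar> \<le> (LINT x|M. f n x) + r / 2" .
   moreover have "(LINT x|M. f n x) < r / 2" using N[OF n] abs_ge_self order_le_less_trans by blast
   ultimately show ?thesis by (simp add: field_simps)
  qed
  then show "\<exists>N. \<forall>n\<ge>N. norm ((LINT x|M. c n x) - 0) < r" by blast
 qed
 then have "(\<lambda>n. ((LINT x|M. \<bar>u n x\<bar> powr q) - (LINT x|M. \<bar>u n x - U x\<bar> powr q)) - CU) \<longlonglongrightarrow> 0" unfolding cE .
 then show ?thesis unfolding CU_def[symmetric] by (rule LIM_zero_cancel)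
qed

text \<open>If no window carried mass above \<sigma>, \<open>lions_local\<close> would push the p-th
  power integral below b0. Translating such windows to the origin keeps local mass in the limit,
  whence U is not 0. The last conclusion is what the expansion of the kinetic integral of a
  difference requires.\<close>

theorem concentration_compactness:
 fixes u :: "nat \<Rightarrow> real^3 \<Rightarrow> real"
 assumes u: "\<And>n. sob (u n) (g n)" and M: "\<And>n. (LBINT x. (u n x)^2) \<le> M0" and A: "\<And>n. (nsq (g n)) \<le> A0"
  and p: "10/3 \<le> p" "p < 6" and b: "b0 > 0" "\<And>n. b0 \<le> (LBINT x. \<bar>u n x\<bar> powr p)"
 obtains r y U G where "strict_mono (r :: nat \<Rightarrow> nat)" "sob U G" "AE x in lborel. (\<lambda>n. u (r n) (x + y n)) \<longlonglongrightarrow> U x"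
  "(LBINT x. (U x)^2) > 0" "(\<lambda>n. LBINT x. g (r n) (x + y n) \<bullet> G x) \<longlonglongrightarrow> (nsq G)"
proof -
 have A0: "A0 \<ge> 0" and M0: "M0 \<ge> 0"
  using order_trans[OF lint_nonneg A[of 0]] order_trans[OF lint_nonneg M[of 0]] by auto
 obtain \<zeta> :: "real^3 \<Rightarrow> real" where \<zeta>: "test_function \<zeta>" "(LBINT z. \<zeta> z) = 1" using mollifier_exists[of 1] by (metis zero_less_one)
 have Z: "(LBINT x. \<bar>\<zeta> x\<bar> powr p) > 0"
 proof (rule ccontr)
  assume "\<not> ?thesis"
  then have "(LBINT x. \<bar>\<zeta> x\<bar> powr p) = 0" using lint_nonneg[of lborel "\<lambda>x. \<bar>\<zeta> x\<bar> powr p"] by (simp add: not_less order_antisym)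
  then have "AE x in lborel. \<bar>\<zeta> x\<bar> powr p = 0"
   using integral_nonneg_eq_0_iff_AE[OF test_powr_integrable[OF \<zeta>(1), of p]] p by simp
  then have "AE x in lborel. \<zeta> x = 0" by eventually_elim simp
  then have "(LBINT z. \<zeta> z) = 0" by (rule integral_eq_zero_AE)
  then show False using \<zeta> by simp
 qed
 obtain K where K: "K \<ge> 0" "\<And>u g \<sigma>. sob u g \<Longrightarrow> (LBINT x. (u x)^2) \<le> M0 \<Longrightarrow> (nsq g) \<le> A0 \<Longrightarrow>
   (\<And>y. (LBINT x. (\<zeta> (x + y) * u x)^2) \<le> \<sigma>) \<Longrightarrow> (LBINT x. \<bar>u x\<bar> powr p) \<le> K * \<sigma> powr ((6 - p) / 4)"
  by (rule lions_local[OF \<zeta>(1) p Z A0 M0]) blast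
 \<comment> \<open>Chosen so that K * \<sigma> powr ((6 - p) / 4) equals K * b0 / (2 * (K + 1)),
   which is below b0.\<close>
 define \<sigma> where "\<sigma> = (b0 / (2 * (K + 1))) powr (4 / (6 - p))"
 have \<sigma>: "\<sigma> > 0" using b(1) K(1) by (simp add: \<sigma>_def)
 have "\<sigma> powr ((6 - p) / 4) = b0 / (2 * (K + 1))"
 proof -
  have e: "4 / (6 - p) * ((6 - p) / 4) = 1" using p by simp
  show ?thesis unfolding \<sigma>_def powr_powr e using b(1) K(1) by simp
 qed
 moreover have "K * (b0 / (2 * (K + 1))) < b0"
 proof -
  have "K * b0 \<ge> 0" using b(1) K(1) by simp
  then have "K * b0 < b0 * (2 * (K + 1))" using b(1) by (simp add: distrib_left)
  then show ?thesis using K(1) by (simp add: pos_divide_less_eq)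
 qed
 ultimately have K\<sigma>: "K * \<sigma> powr ((6 - p) / 4) < b0" by simp
 have "\<exists>y. \<sigma> < (LBINT x. (\<zeta> (x + y) * u n x)^2)" for n
 proof (rule ccontr)
  assume "\<not> ?thesis"
  then have "\<And>y. (LBINT x. (\<zeta> (x + y) * u n x)^2) \<le> \<sigma>" by (simp add: not_less)
  then have "(LBINT x. \<bar>u n x\<bar> powr p) \<le> K * \<sigma> powr ((6 - p) / 4)" by (rule K(2)[OF u M A])
  then show False using K\<sigma> b(2)[of n] by simp
 qed
 then have "\<exists>y. \<forall>n. \<sigma> < (LBINT x. (\<zeta> (x + y n) * u n x)^2)" by (intro choice) blast
 then obtain y where y: "\<And>n. \<sigma> < (LBINT x. (\<zeta> (x + y n) * u n x)^2)" by blast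
 define v where "v n x = u n (x + - y n)" for n x
 define h where "h n x = g n (x + - y n)" for n x
 have vh: "sob (v n) (h n)" for n using sob_affine[OF u[of n], of 1 "- y n"] unfolding v_def h_def by simp
 note [measurable] = sobD(4,5)[OF vh] sobD(4,5)[OF u]
 have [measurable]: "\<zeta> \<in> borel_measurable borel" by (rule measurable_cont[OF test_function_continuous[OF \<zeta>(1)]])
 have vM: "(LBINT x. (v n x)^2) \<le> M0" for n unfolding v_def using integral_shift[of "\<lambda>x. (u n x)^2" "- y n"] M[of n] by simp
 have vA: "nsq (h n) \<le> A0" for n unfolding h_def using integral_shift[of "\<lambda>x. (norm (g n x))^2" "- y n"] A[of n] by simp
 have v\<sigma>: "\<sigma> < (LBINT x. (\<zeta> x * v n x)^2)" for n
  using y[of n] integral_shift[of "\<lambda>x. (\<zeta> (x + y n) * u n x)^2" "- y n"] by (simp add: v_def)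
 obtain r U where r: "strict_mono (r :: nat \<Rightarrow> nat)" and Um[measurable]: "U \<in> borel_measurable borel" and ae: "AE x in lborel. (\<lambda>n. v (r n) x) \<longlonglongrightarrow> U x"
  and lim: "(\<lambda>n. \<integral>\<^sup>+x. ennreal ((v (r n) x - U x)^2) \<partial>WM) \<longlonglongrightarrow> 0"
  by (rule rellich[where u = v, OF vh vM vA]) blast
 have UL: "U \<in> Lq 2"
 proof -
  have "(NINT x. ennreal ((norm (0 - U x))^2)) \<le> ennreal M0"
  proof (rule nn_fatou_sq[OF _ _ ae])
   show "\<forall>\<^sub>F n in sequentially. (NINT x. ennreal ((norm (0 - v (r n) x))^2)) \<le> ennreal M0"
    using nn_integral_sq[OF sobD(1)[OF vh]] vM by (auto intro!: always_eventually ennreal_leI)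
  qed auto
  then have le: "(NINT x. ennreal ((U x)^2)) \<le> ennreal M0" by simp
  have "integrable lborel (\<lambda>x. (U x)^2)" by (rule integrableI_nonneg) (use le in \<open>auto simp: order_le_less_trans\<close>)
  then show ?thesis unfolding Lq2_real_iff by simp
 qed
 have Upos: "(LBINT x. (U x)^2) > 0"
 proof (rule ccontr)
  assume "\<not> ?thesis"
  then have "(LBINT x. (U x)^2) = 0" using lint_nonneg[of lborel "\<lambda>x. (U x)^2"] by (simp add: not_less order_antisym)
  then have "AE x in lborel. (U x)^2 = 0" using UL integral_nonneg_eq_0_iff_AE[of lborel "\<lambda>x. (U x)^2"] unfolding Lq2_real_iff by simp
  then have U0: "AE x in lborel. U x = 0" by eventually_elim simp
  obtain Ks where Ks: "compact Ks" "\<And>x. x \<notin> Ks \<Longrightarrow> \<zeta> x = 0" by (rule test_function_support[OF \<zeta>(1)]) blast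
  have cz: "continuous_on UNIV (\<lambda>x. (\<zeta> x)^2 / wt x)"
   by (intro continuous_on_divide continuous_on_power test_function_continuous[OF \<zeta>(1)] wt_cont) (use wt_pos in \<open>auto simp: less_imp_neq[symmetric]\<close>)
  obtain B where B: "B > 0" "\<And>x. \<bar>(\<zeta> x)^2 / wt x\<bar> \<le> B * indicator Ks x"
   by (rule bounded_of_compact_support[OF cz Ks(1)]) (use Ks(2) in auto)
  \<comment> \<open>The squared window is dominated by the weight, so L^2(\<open>WM\<close>)
    convergence to an almost everywhere vanishing U would contradict the local mass
    \<sigma>.\<close>
  have zB: "(\<zeta> x)^2 \<le> B * wt x" for x
  proof -
   have "(\<zeta> x)^2 / wt x \<le> B * indicator Ks x" using B(2)[of x] by linarith
   also have "\<dots> \<le> B" using B(1) by (cases "x \<in> Ks") auto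
   finally show ?thesis using wt_pos[of x] by (simp add: pos_divide_le_eq)
  qed
  have "ennreal \<sigma> \<le> ennreal B * (\<integral>\<^sup>+x. ennreal ((v (r n) x - U x)^2) \<partial>WM)" for n
  proof -
   have iz: "integrable lborel (\<lambda>x. (\<zeta> x * v (r n) x)^2)" by (rule sobD(6)[OF sob_cutoff[OF vh \<zeta>(1)]])
   have "ennreal \<sigma> \<le> ennreal (LBINT x. (\<zeta> x * v (r n) x)^2)" by (intro ennreal_leI less_imp_le v\<sigma>)
   also have "\<dots> = (NINT x. ennreal ((\<zeta> x * v (r n) x)^2))" by (rule nn_integral_eq_integral[OF iz, symmetric]) simp
   also have "\<dots> \<le> (NINT x. ennreal B * (ennreal (wt x) * ennreal ((v (r n) x - U x)^2)))"
   proof (rule nn_integral_mono_AE)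
    show "AE x in lborel. ennreal ((\<zeta> x * v (r n) x)^2) \<le> ennreal B * (ennreal (wt x) * ennreal ((v (r n) x - U x)^2))"
     using U0
    proof eventually_elim
     case (elim x)
     have "(\<zeta> x * v (r n) x)^2 \<le> B * wt x * (v (r n) x - U x)^2" unfolding elim power_mult_distrib using zB[of x] by (simp add: mult_right_mono)
     then have "ennreal ((\<zeta> x * v (r n) x)^2) \<le> ennreal (B * wt x * (v (r n) x - U x)^2)" by (rule ennreal_leI)
     also have "\<dots> = ennreal B * (ennreal (wt x) * ennreal ((v (r n) x - U x)^2))"
      using B(1) wt_pos[of x] by (simp add: ennreal_mult less_imp_le mult.assoc)
     finally show ?case .
    qed
   qed
   also have "\<dots> = ennreal B * (NINT x. ennreal (wt x) * ennreal ((v (r n) x - U x)^2))" by (rule nn_integral_cmult) measurable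
   also have "(NINT x. ennreal (wt x) * ennreal ((v (r n) x - U x)^2)) = (\<integral>\<^sup>+x. ennreal ((v (r n) x - U x)^2) \<partial>WM)" by (rule WM_nn[symmetric]) measurable
   finally show ?thesis .
  qed
  moreover have "(\<lambda>n. ennreal B * (\<integral>\<^sup>+x. ennreal ((v (r n) x - U x)^2) \<partial>WM)) \<longlonglongrightarrow> ennreal B * 0"
   by (intro ennreal_tendsto_cmult lim) simp
  ultimately have "ennreal \<sigma> \<le> ennreal B * 0" by (intro LIMSEQ_le_const) auto
  then show False using \<sigma> by (simp add: ennreal_eq_0_iff)
 qed
 obtain G where G: "sob U G" by (rule weak_gradient_limit[where u = "\<lambda>n. v (r n)", OF vh vA UL lim]) blast
 \<comment> \<open>These pairings are bounded, so some subsequence converges. A second use of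
   \<open>weak_gradient_limit\<close> along it gives a gradient G1 whose pairing with G is that
   limit; uniqueness makes G1 equal to G almost everywhere and identifies the limit.\<close>
 define l where "l n = (LBINT x. h (r n) x \<bullet> G x)" for n
 have "\<bar>l n\<bar> \<le> sqrt (A0 * nsq G)" for n
 proof (rule real_le_rsqrt)
  have "(l n)^2 \<le> nsq (h (r n)) * nsq G" unfolding l_def by (rule Lq2_CS[OF sobD(2)[OF vh] sobD(2)[OF G]])
  also have "\<dots> \<le> A0 * nsq G" by (intro mult_right_mono vA lint_nonneg) simp
  finally show "\<bar>l n\<bar>^2 \<le> A0 * nsq G" by simp
 qed
 then have "bounded (range l)" by (auto simp: bounded_iff)
 then obtain L s where s: "strict_mono (s :: nat \<Rightarrow> nat)" and lL: "(l \<circ> s) \<longlonglongrightarrow> L"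
  using bounded_imp_convergent_subsequence[of l] by blast
 have lim': "(\<lambda>n. \<integral>\<^sup>+x. ennreal ((v (r (s n)) x - U x)^2) \<partial>WM) \<longlonglongrightarrow> 0" using LIMSEQ_subseq_LIMSEQ[OF lim s] by (simp add: o_def)
 obtain G1 where G1: "sob U G1" and G1l: "\<And>H l. H \<in> Lq 2 \<Longrightarrow> (\<lambda>n. LBINT x. h (r (s n)) x \<bullet> H x) \<longlonglongrightarrow> l \<Longrightarrow> (LBINT x. G1 x \<bullet> H x) = l"
  by (rule weak_gradient_limit[where u = "\<lambda>n. v (r (s n))", OF vh vA UL lim']) blast
 have "(LBINT x. G1 x \<bullet> G x) = L" by (rule G1l[OF sobD(2)[OF G]]) (use lL in \<open>simp add: l_def o_def\<close>)
 moreover have "AE x in lborel. G1 x = G x" by (rule weak_gradient_unique) (use sobD(3,5)[OF G] sobD(3,5)[OF G1] in auto)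
 then have "(LBINT x. G1 x \<bullet> G x) = nsq G"
  using sobD(5)[OF G] sobD(5)[OF G1] by (intro integral_cong_AE) (auto simp: power2_norm_eq_inner)
 ultimately have L: "L = nsq G" by simp
 show ?thesis
 proof (rule that[of "r \<circ> s" U G "\<lambda>n. - y (r (s n))"])
  show "strict_mono (r \<circ> s)" using r s by (rule strict_mono_o)
  show "AE x in lborel. (\<lambda>n. u ((r \<circ> s) n) (x + - y (r (s n)))) \<longlonglongrightarrow> U x"
   using ae
  proof eventually_elim
   case (elim x)
   from LIMSEQ_subseq_LIMSEQ[OF this s] show ?case by (simp add: v_def o_def)
  qed
  show "(\<lambda>n. LBINT x. g ((r \<circ> s) n) (x + - y (r (s n))) \<bullet> G x) \<longlonglongrightarrow> (nsq G)"
   using lL unfolding L l_def h_def by (simp add: o_def)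
 qed (use G Upos in auto)
qed

section \<open>Truncated bubbles\<close>

text \<open>Substitute a multiple sqrt D of the variable. The exponent of D drops by 1/2, so
  \<open>nn_bubble\<close> can integrate out the coordinates one at a time.\<close>

lemma nn_kern_scale:
 assumes q: "q \<ge> 1" and D: "D > 0"
 shows "(NINT z. ennreal ((D + z^2) powr (- q))) = ennreal (Kq q) * ennreal (D powr (1/2 - q))"
proof -
 have k: "(D + (sqrt D * z)^2) powr (- q) = D powr (- q) * kern q z" for z
 proof -
  have "D + (sqrt D * z)^2 = D * (1 + z^2)" using D by (simp add: power_mult_distrib distrib_left)
  then show ?thesis by (simp add: powr_mult kern_def)
 qed
 have [measurable]: "kern q \<in> borel_measurable borel" using kern_int[OF q] by auto
 have "(NINT z. ennreal ((D + z^2) powr (- q))) = ennreal \<bar>sqrt D\<bar> * (NINT z. ennreal ((D + (0 + sqrt D * z)^2) powr (- q)))"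
  by (rule nn_integral_real_affine) (use D in \<open>auto simp del: powr_minus\<close>)
 also have "\<dots> = ennreal (sqrt D) * (NINT z. ennreal (D powr (- q)) * ennreal (kern q z))"
  using D by (simp add: k ennreal_mult kern_pos less_imp_le)
 also have "(NINT z. ennreal (D powr (- q)) * ennreal (kern q z)) = ennreal (D powr (- q)) * ennreal (Kq q)"
  unfolding Kq_def by (subst nn_integral_cmult) (auto simp: nn_integral_eq_integral kern_int q kern_pos less_imp_le)
 also have "ennreal (sqrt D) * (ennreal (D powr (- q)) * ennreal (Kq q)) = ennreal (Kq q) * ennreal (sqrt D * D powr (- q))"
  using D by (simp add: ennreal_mult mult_ac)
 also have "sqrt D * D powr (- q) = D powr (1/2 - q)" using D by (simp add: powr_half_sqrt[symmetric] flip: powr_add)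
 finally show ?thesis .
qed

lemma norm_v3: "(norm (v3 x y z))^2 = x^2 + y^2 + z^2"
 unfolding power2_norm_eq_inner by (simp add: inner_vec_def sum_3 power2_eq_square)

lemma nn_bubble:
 assumes q: "q \<ge> 2"
 shows "(\<integral>\<^sup>+x. ennreal ((1 + (norm x)^2) powr (- q)) \<partial>(lborel :: (real^3) measure)) = ennreal (Kq q * Kq (q - 1/2) * Kq (q - 1))"
proof -
 have K: "Kq q \<ge> 0" "Kq (q - 1/2) \<ge> 0" "Kq (q - 1) \<ge> 0" using Kq_pos[of q] Kq_pos[of "q - 1/2"] Kq_pos[of "q - 1"] q by auto
 have p1: "1 + x^2 + y^2 > 0" for x y :: real by (intro add_pos_nonneg) auto
 have [measurable]: "fst \<in> borel_measurable (borel :: (real \<times> real \<times> real) measure)" "(\<lambda>p. fst (snd p)) \<in> borel_measurable (borel :: (real \<times> real \<times> real) measure)"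
   "(\<lambda>p. snd (snd p)) \<in> borel_measurable (borel :: (real \<times> real \<times> real) measure)"
  by (rule measurable_cont, intro continuous_intros)+
 have "(\<integral>\<^sup>+x. ennreal ((1 + (norm x)^2) powr (- q)) \<partial>(lborel :: (real^3) measure)) = (NINT p. (case p of (x, y, z) \<Rightarrow> ennreal ((1 + x^2 + y^2 + z^2) powr (- q))))"
  by (subst nn_integral_v3) (auto simp: norm_v3 add.assoc case_prod_unfold)
 also have "\<dots> = (NINT x. NINT y. NINT z. ennreal ((1 + x^2 + y^2 + z^2) powr (- q)))"
  by (subst nn_integral_real3(1)) (auto simp: case_prod_unfold)
 also have "\<dots> = (NINT x. NINT y. ennreal (Kq q) * ennreal ((1 + x^2 + y^2) powr (- (q - 1/2))))"
  using q by (intro nn_integral_cong) (simp add: nn_kern_scale p1)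
 also have "\<dots> = (NINT x. ennreal (Kq q) * (NINT y. ennreal (((1 + x^2) + y^2) powr (- (q - 1/2)))))"
  by (intro nn_integral_cong nn_integral_cmult) measurable
 also have "\<dots> = (NINT x. ennreal (Kq q) * (ennreal (Kq (q - 1/2)) * ennreal ((1 + x^2) powr (- (q - 1)))))"
  using q by (intro nn_integral_cong) (subst nn_kern_scale; simp add: one_plus_sq_pos)
 also have "\<dots> = ennreal (Kq q) * (ennreal (Kq (q - 1/2)) * (NINT x. ennreal ((1 + x^2) powr (- (q - 1)))))"
  by (simp add: nn_integral_cmult)
 also have "(NINT x. ennreal ((1 + x^2) powr (- (q - 1)))) = ennreal (Kq (q - 1))"
  using q by (subst nn_kern_scale) auto
 also have "ennreal (Kq q) * (ennreal (Kq (q - 1/2)) * ennreal (Kq (q - 1))) = ennreal (Kq q * Kq (q - 1/2) * Kq (q - 1))"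
  using K by (simp add: ennreal_mult mult_ac)
 finally show ?thesis .
qed

lemma bubble_power:
 assumes "k \<ge> 2"
 shows "integrable lborel (\<lambda>x::real^3. inverse ((1 + (norm x)^2) ^ k))" (is ?i)
  "(LBINT x. inverse ((1 + (norm (x::real^3))^2) ^ k)) = Kq (real k) * Kq (real k - 1/2) * Kq (real k - 1)" (is ?e)
proof -
 have e: "inverse ((1 + (norm x)^2) ^ k) = (1 + (norm x)^2) powr (- real k)" for x :: "real^3"
  by (simp add: powr_minus powr_realpow one_plus_sq_pos)
 have n: "(\<integral>\<^sup>+x. ennreal (inverse ((1 + (norm x)^2) ^ k)) \<partial>(lborel :: (real^3) measure)) = ennreal (Kq (real k) * Kq (real k - 1/2) * Kq (real k - 1))"
  unfolding e using nn_bubble[of "real k"] assms by simp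
 have pos: "inverse ((1 + (norm x)^2) ^ k) \<ge> 0" for x :: "real^3" by simp
 show i: ?i by (rule integrableI_nonneg) (use n pos in auto)
 have K: "Kq (real k) * Kq (real k - 1/2) * Kq (real k - 1) \<ge> 0" using Kq_pos[of "real k"] Kq_pos[of "real k - 1/2"] Kq_pos[of "real k - 1"] assms by simp
 have "ennreal (LBINT x. inverse ((1 + (norm (x::real^3))^2) ^ k)) = ennreal (Kq (real k) * Kq (real k - 1/2) * Kq (real k - 1))"
  using n nn_integral_eq_integral[OF i] pos by simp
 then show ?e using K by (subst (asm) ennreal_inj) (auto intro: lint_nonneg)
qed

text \<open>Three uses of \<open>Kq_rec\<close> relate the two integrals. Their difference 3 * SN is
  the Dirichlet integral of the bubble (1 + |x|^2)^(-1/2), and \<open>SN\<close> is its sixth power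
  integral.\<close>

lemma bubble_2_3:
 shows "(LBINT x. inverse ((1 + (norm (x::real^3))^2)^3)) = SN" "(LBINT x. inverse ((1 + (norm (x::real^3))^2)^2)) = 4 * SN"
proof -
 show "(LBINT x. inverse ((1 + (norm (x::real^3))^2)^3)) = SN" using bubble_power(2)[of 3] by (simp add: SN_def)
 have "Kq 1 = 2 * Kq 2" "2 * Kq (3/2) = 3 * Kq (5/2)" "3 * Kq 2 = 4 * Kq 3" using Kq_rec[of 2] Kq_rec[of "5/2"] Kq_rec[of 3] by auto
 then have "Kq 2 * Kq (3/2) * Kq 1 = 4 * SN" unfolding SN_def by algebra
 then show "(LBINT x. inverse ((1 + (norm (x::real^3))^2)^2)) = 4 * SN" using bubble_power(2)[of 2] by simp
qed

lemma max0_sq_deriv: "((\<lambda>y::real. (max 0 y)^2) has_real_derivative 2 * max 0 y) (at y)"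
proof (cases y "0::real" rule: linorder_cases)
 case less
 have "((\<lambda>y::real. 0) has_real_derivative 0) (at y)" by simp
 moreover have "\<forall>\<^sub>F y in nhds y. (max 0 y)^2 = (0::real)"
 proof -
  have "\<forall>\<^sub>F x in nhds y. x \<in> {..<0}" by (rule eventually_nhds_in_open) (use less in auto)
  then show ?thesis by eventually_elim simp
 qed
 ultimately show ?thesis using less by (subst DERIV_cong_ev[OF refl _ refl, of _ "\<lambda>_. 0"]) auto
next
 case greater
 have "((\<lambda>y::real. y^2) has_real_derivative 2 * y) (at y)" by (auto intro!: derivative_eq_intros)
 moreover have "\<forall>\<^sub>F y in nhds y. (max 0 y)^2 = y^2"
 proof -
  have "\<forall>\<^sub>F x in nhds y. x \<in> {0<..}" by (rule eventually_nhds_in_open) (use greater in auto)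
  then show ?thesis by eventually_elim simp
 qed
 ultimately show ?thesis using greater by (subst DERIV_cong_ev[OF refl _ refl, of _ "\<lambda>y. y^2"]) auto
next
 case equal
 have "((\<lambda>h. ((max 0 (0 + h))^2 - (max 0 0)^2) / h) \<longlongrightarrow> 0) (at (0::real))"
 proof (rule Lim_null_comparison)
  show "\<forall>\<^sub>F h in at (0::real). norm (((max 0 (0 + h))^2 - (max 0 0)^2) / h) \<le> \<bar>h\<bar>"
   by (intro always_eventually allI) (auto simp: max_def power2_eq_square)
  show "((\<lambda>h::real. \<bar>h\<bar>) \<longlongrightarrow> 0) (at 0)" by (rule tendsto_eq_intros) (auto intro: tendsto_eq_intros)
 qed
 then show ?thesis unfolding DERIV_def equal by simp
qed

text \<open>With s = sqrt (1 + |x|^2) the bubble is 1 / s, and v multiplies it by the squared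
  positive part of 1 - \<delta> * s: C1 with compact support. The radial derivative does not exceed
  that of 1 / s in absolute value, so the Dirichlet integral carries no truncation error; only the
  sixth power integral loses a multiple of \<delta>.\<close>

lemma truncated_bubble:
 assumes d: "0 < \<delta>" "\<delta> \<le> 1/4" and p: "p > 0"
 obtains v :: "real^3 \<Rightarrow> real" and G where "sob v G" "nsq G \<le> 3 * SN"
  "SN * (1 - 48 * \<delta>) \<le> (LBINT x. v x^6)" "(LBINT x. (v x)^2) \<le> 4 * SN / \<delta>^2"
  "(1/5) powr p * measure lborel (ball 0 1 :: (real^3) set) \<le> (LBINT x. \<bar>v x\<bar> powr p)"
proof -
 define s where "s x = sqrt (1 + (norm x)^2)" for x :: "real^3"
 define m where "m x = max 0 (1 - \<delta> * s x)" for x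
 define v where "v x = (m x)^2 / s x" for x
 define f where "f x = - 2 * \<delta> * m x / s x - (m x)^2 / (s x)^2" for x
 define G where "G x = (f x / s x) *\<^sub>R x" for x
 have s2: "(s x)^2 = 1 + (norm x)^2" for x unfolding s_def by simp
 have s1: "s x \<ge> 1" for x unfolding s_def by simp
 have sp: "s x > 0" for x using s1[of x] by linarith
 have m1: "0 \<le> m x" "m x \<le> 1" for x using sp[of x] d by (auto simp: m_def)
 have sd: "(s has_derivative (\<lambda>h. (x \<bullet> h) / s x)) (at x)" for x
 proof -
  have pos: "0 < 1 + x \<bullet> x" by (intro add_pos_nonneg) auto
  have "((\<lambda>x. sqrt (1 + x \<bullet> x)) has_derivative (\<lambda>h. (x \<bullet> h) / sqrt (1 + x \<bullet> x))) (at x)"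
   using pos by (auto intro!: derivative_eq_intros simp: inner_commute field_simps)
  then show ?thesis unfolding s_def[abs_def] power2_norm_eq_inner .
 qed
 have vd: "(v has_derivative (\<lambda>h. G x \<bullet> h)) (at x)" for x
 proof -
  have 1: "((\<lambda>t. (max 0 (1 - \<delta> * t))^2 / t) has_real_derivative f x) (at (s x))"
  proof -
   have "((\<lambda>t. (max 0 (1 - \<delta> * t))^2) has_real_derivative 2 * max 0 (1 - \<delta> * s x) * (- \<delta>)) (at (s x))"
    by (rule DERIV_chain2[OF max0_sq_deriv]) (auto intro!: derivative_eq_intros)
   from DERIV_divide[OF this DERIV_ident] show ?thesis using sp[of x]
    unfolding f_def m_def by (simp add: power2_eq_square field_simps)
  qed
  have "((\<lambda>x. (max 0 (1 - \<delta> * s x))^2 / s x) has_derivative (\<lambda>h. (x \<bullet> h) / s x * f x)) (at x)"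
   using has_derivative_compose[OF sd 1[unfolded has_field_derivative_def]] by (simp add: mult.commute)
  then show ?thesis unfolding v_def[abs_def] m_def G_def by (simp add: mult.commute)
 qed
 have sc: "continuous_on UNIV s" unfolding s_def by (intro continuous_intros)
 have fc: "continuous_on UNIV f" unfolding f_def m_def
  by (intro continuous_intros continuous_on_divide continuous_on_max sc) (use sp in \<open>auto simp: less_imp_neq[symmetric]\<close>)
 have Gc: "continuous_on UNIV G" unfolding G_def
  by (intro continuous_intros continuous_on_divide sc fc) (use sp in \<open>auto simp: less_imp_neq[symmetric]\<close>)
 have m0: "m x = 0" if "x \<notin> cball 0 (1/\<delta>)" for x
 proof -
  have "1/\<delta> < norm x" using that by simp
  also have "norm x \<le> s x" unfolding s_def by (rule real_le_rsqrt) simp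
  finally have "1 < \<delta> * s x" using d by (simp add: field_simps)
  then show ?thesis by (simp add: m_def)
 qed
 have S: "sob v G" by (rule C1_compact_sob[OF vd Gc compact_cball[of 0 "1/\<delta>"]]) (auto simp: v_def G_def f_def m0)
 note [measurable] = sobD(4,5)[OF S]
 have fle: "\<bar>f x\<bar> \<le> 1 / (s x)^2" for x
 proof -
  have "f x = - (m x * (2 * \<delta> * s x + m x)) / (s x)^2" using sp[of x] by (simp add: f_def power2_eq_square field_simps)
  moreover have "0 \<le> m x * (2 * \<delta> * s x + m x)" using m1(1)[of x] sp[of x] d by simp
  moreover have "m x * (2 * \<delta> * s x + m x) \<le> 1"
  proof (cases "1 - \<delta> * s x \<ge> 0")
   case True
   then have "m x * (2 * \<delta> * s x + m x) = 1 - (\<delta> * s x)^2" by (simp add: m_def power2_eq_square algebra_simps)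
   then show ?thesis by simp
  qed (simp add: m_def)
  ultimately show ?thesis by (simp add: divide_right_mono)
 qed
 have inv: "inverse ((1 + (norm x)^2) ^ k) = 1 / (s x^2) ^ k" for x k unfolding s2 by (simp add: inverse_eq_divide)
 note I = bubble_power(1)[of 2, unfolded inv] bubble_power(1)[of 3, unfolded inv] and E = bubble_2_3[unfolded inv]
 show ?thesis
 proof (rule that[OF S])
  have "nsq G \<le> (LBINT x. 1 / (s x^2)^2 - 1 / (s x^2)^3)"
  proof (intro integral_mono sobD(7)[OF S] lintegrable_diff)
   fix x
   have "(norm (G x))^2 = \<bar>f x\<bar>^2 / (s x)^2 * ((s x)^2 - 1)" by (simp add: s2 G_def power_mult_distrib power_divide)
   also have "\<dots> \<le> (1 / (s x)^2)^2 / (s x)^2 * ((s x)^2 - 1)"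
    by (intro mult_right_mono divide_right_mono power_mono fle) (auto simp: s2)
   also have "\<dots> = 1 / (s x^2)^2 - 1 / (s x^2)^3" using sp[of x] by (simp add: field_simps power2_eq_square power3_eq_cube)
   finally show "(norm (G x))^2 \<le> 1 / (s x^2)^2 - 1 / (s x^2)^3" .
  qed (use I in auto)
  also have "\<dots> = 3 * SN" using I E by (simp add: lint_diff)
  finally show "nsq G \<le> 3 * SN" .
  have "(LBINT x. 1 / (s x^2)^3 - 12 * \<delta> * (1 / (s x^2)^2)) \<le> (LBINT x. v x^6)"
  proof (intro integral_mono sobolev(1)[OF S] lintegrable_diff integrable_mult_right)
   fix x
   \<comment> \<open>Bernoulli for the twelfth power hidden in v^6. The loss 12 * \<delta> / s^5 is
     relaxed to 12 * \<delta> / s^4, whose integral is 12 * \<delta> * (4 * SN); hence the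
     48.\<close>
   have "1 - 12 * (\<delta> * s x) \<le> m x ^ 12"
   proof (cases "\<delta> * s x \<le> 1")
    case True
    have "1 + real 12 * (- (\<delta> * s x)) \<le> (1 + (- (\<delta> * s x))) ^ 12" by (rule Bernoulli_inequality) (use True in simp)
    then show ?thesis using True by (simp add: m_def)
   qed (use m1(1)[of x] in \<open>simp add: order_trans[OF _ zero_le_power]\<close>)
   then have "(1 - 12 * (\<delta> * s x)) / s x^6 \<le> m x ^ 12 / s x^6" using sp[of x] by (intro divide_right_mono) auto
   also have "m x ^ 12 / s x^6 = v x^6" by (simp add: v_def power_divide flip: power_mult)
   also have "(1 - 12 * (\<delta> * s x)) / s x^6 = 1 / s x^6 - 12 * \<delta> * (1 / s x^5)" using sp[of x] by (simp add: field_simps eval_nat_numeral)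
   finally have "1 / s x^6 - 12 * \<delta> * (1 / s x^5) \<le> v x^6" .
   moreover have "1 / s x^5 \<le> 1 / s x^4" using s1[of x] sp[of x] by (intro divide_left_mono power_increasing) auto
   then have "12 * \<delta> * (1 / s x^5) \<le> 12 * \<delta> * (1 / s x^4)" using d by (intro mult_left_mono) auto
   ultimately show "1 / (s x^2)^3 - 12 * \<delta> * (1 / (s x^2)^2) \<le> v x^6" by (simp flip: power_mult)
  qed (use I in auto)
  moreover have "(LBINT x. 1 / (s x^2)^3 - 12 * \<delta> * (1 / (s x^2)^2)) = SN - 12 * \<delta> * (4 * SN)"
   using I by (subst lint_diff) (simp_all only: integral_mult_right_zero integrable_mult_right E)
  ultimately show "SN * (1 - 48 * \<delta>) \<le> (LBINT x. v x^6)" by (simp add: algebra_simps)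
  have "(LBINT x. (v x)^2) \<le> (LBINT x. 1 / \<delta>^2 * (1 / (s x^2)^2))"
  proof (intro integral_mono sobD(6)[OF S] integrable_mult_right)
   fix x
   \<comment> \<open>1 / s^2 is not integrable on R^3; where v is not 0 one has \<delta> * s \<le>
     1, so a factor 1 / (\<delta> * s)^2 may be inserted.\<close>
   show "(v x)^2 \<le> 1 / \<delta>^2 * (1 / (s x^2)^2)"
   proof (cases "\<delta> * s x \<le> 1")
    case True
    have "(v x)^2 \<le> (1 / s x)^2" unfolding v_def using m1[of x] sp[of x] by (intro power_mono divide_right_mono) (auto intro: power_le_one)
    also have "\<dots> \<le> 1 / (\<delta> * s x)^2 * (1 / s x)^2"
    proof -
     have "(\<delta> * s x)^2 \<le> 1" "(\<delta> * s x)^2 > 0" using True d sp[of x] by (auto intro: power_le_one)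
     then have "1 \<le> 1 / (\<delta> * s x)^2" by simp
     from mult_right_mono[OF this, of "(1 / s x)^2"] show ?thesis by simp
    qed
    finally show ?thesis by (simp add: power_mult_distrib power_divide mult_ac flip: power_add power_mult)
   qed (simp add: v_def m_def)
  qed (use I in auto)
  also have "\<dots> = 1 / \<delta>^2 * (LBINT x. 1 / (s x^2)^2)" by (rule integral_mult_right_zero)
  also have "\<dots> = 4 * SN / \<delta>^2" unfolding E by simp
  finally show "(LBINT x. (v x)^2) \<le> 4 * SN / \<delta>^2" .
  have ib: "integrable lborel (\<lambda>x. (1/5) powr p * indicator (ball (0::real^3) 1) x :: real)"
   by (intro integrable_mult_right integrable_real_indicator) (auto simp: emeasure_lborel_ball_finite[unfolded infinity_ennreal_def])
  have cs: "continuous_on UNIV (\<lambda>x. \<bar>v x\<bar> powr p)"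
   using has_derivative_continuous[OF vd] p
   by (intro continuous_on_powr' continuous_intros) (auto simp: continuous_on_eq_continuous_at)
  obtain B where B: "\<And>x. \<bar>\<bar>v x\<bar> powr p\<bar> \<le> B * indicator (cball (0::real^3) (1/\<delta>)) x"
   by (rule bounded_of_compact_support[OF cs compact_cball[of 0 "1/\<delta>"]]) (auto simp: v_def m0)
  have iv: "integrable lborel (\<lambda>x. \<bar>v x\<bar> powr p)" by (rule integrable_bounded_support[OF _ compact_cball[of 0 "1/\<delta>"] B]) measurable
  have "(1/5) powr p * measure lborel (ball 0 1 :: (real^3) set) = (LBINT x. (1/5) powr p * indicator (ball (0::real^3) 1) x)" by simp
  also have "\<dots> \<le> (LBINT x. \<bar>v x\<bar> powr p)"
  proof (intro integral_mono ib iv)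
   fix x :: "real^3"
   show "(1/5) powr p * indicator (ball 0 1) x \<le> \<bar>v x\<bar> powr p"
   proof (cases "x \<in> ball 0 1")
    case True
    then have "(s x)^2 \<le> 1 + 1^2" unfolding s2 by (intro add_left_mono power_mono) auto
    then have "(s x)^2 < (3/2)^2" by (simp add: power2_eq_square)
    then have s32: "s x < 3/2" by (rule power_less_imp_less_base) simp
    have "\<delta> * s x \<le> 1/4 * (3/2)" using d s32 sp[of x] by (intro mult_mono) auto
    then have "5/8 \<le> m x" by (simp add: m_def)
    then have "(5/8)^2 \<le> (m x)^2" by (intro power_mono) auto
    then have "(25/64) / (3/2) \<le> (m x)^2 / s x" using s32 sp[of x] by (intro frac_le) (auto simp: power2_eq_square)
    then have "1/5 \<le> \<bar>v x\<bar>" using abs_ge_self[of "v x"] unfolding v_def by simp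
    then have "(1/5) powr p \<le> \<bar>v x\<bar> powr p" by (intro powr_mono2) (use p in auto)
    then show ?thesis using True by simp
   qed simp
  qed
  finally show "(1/5) powr p * measure lborel (ball 0 1 :: (real^3) set) \<le> (LBINT x. \<bar>v x\<bar> powr p)" .
 qed
qed

section \<open>Minimisation on the Pohozaev manifold\<close>

definition mass :: "(real^3 \<Rightarrow> real) \<Rightarrow> real" where "mass u = (LBINT x. (u x)^2)"
definition kin :: "(real^3 \<Rightarrow> real^3) \<Rightarrow> real" where "kin g = nsq g"
definition ppow :: "real \<Rightarrow> (real^3 \<Rightarrow> real) \<Rightarrow> real" where "ppow p u = (LBINT x. \<bar>u x\<bar> powr p)"
definition six :: "(real^3 \<Rightarrow> real) \<Rightarrow> real" where "six u = (LBINT x. u x^6)"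

text \<open>The reciprocal cube of the best Sobolev constant. The bubble attains it: SQ * (3 * SN)^3
  = SN, with 3 * SN its Dirichlet and \<open>SN\<close> its sixth power integral.\<close>

definition SQ :: real where "SQ = 1 / (27 * SN^2)"

lemma SQ_pos: "SQ > 0" using SN_pos by (simp add: SQ_def)

lemma even6: "0 \<le> (x::real)^6" by (rule zero_le_even_power) simp

lemma functionals_nonneg: "mass u \<ge> 0" "kin g \<ge> 0" "ppow p u \<ge> 0" "six u \<ge> 0"
 unfolding mass_def kin_def ppow_def six_def by (auto intro!: lint_nonneg simp: even6)

lemma six_le: "sob u g \<Longrightarrow> six u \<le> SQ * kin g^3"
 using sobolev'[of u g] by (simp add: six_def kin_def SQ_def)

lemma mass_0_AE: "sob u g \<Longrightarrow> mass u = 0 \<Longrightarrow> AE x in lborel. u x = 0"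
 using integral_nonneg_eq_0_iff_AE[OF sobD(6), of u g] by (simp add: mass_def)

lemma mass_pos_imp:
 assumes u: "sob u g" and m: "mass u > 0" shows "six u > 0" "kin g > 0"
proof -
 show s: "six u > 0"
 proof (rule ccontr)
  assume "\<not> ?thesis"
  then have "six u = 0" using functionals_nonneg(4)[of u] by simp
  then have "AE x in lborel. u x^6 = 0" using integral_nonneg_eq_0_iff_AE[OF sobolev(1)[OF u]] by (simp add: six_def even6)
  then have "AE x in lborel. (u x)^2 = 0" by eventually_elim simp
  then have "mass u = 0" unfolding mass_def by (rule integral_eq_zero_AE)
  then show False using m by simp
 qed
 show "kin g > 0"
 proof (rule ccontr)
  assume "\<not> ?thesis"
  then have "kin g = 0" using functionals_nonneg(2)[of g] by simp
  then show False using s six_le[OF u] by simp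
 qed
qed

lemma ppow_integrable: "sob u g \<Longrightarrow> 2 \<le> p \<Longrightarrow> p \<le> 6 \<Longrightarrow> integrable lborel (\<lambda>x. \<bar>u x\<bar> powr p)" for u :: "real^3 \<Rightarrow> real"
 by (rule integrable_powr[OF sobD(4) sobD(6) sobolev(1)])

lemma ppow_le:
 assumes "sob u g" "2 < p" "p < 6"
 shows "ppow p u \<le> mass u powr ((6 - p) / 4) * six u powr ((p - 2) / 4)"
 unfolding ppow_def mass_def six_def by (rule holder_interp[OF sobD(4) sobD(6) sobolev(1)]) (use assms in auto)

lemma rescale:
 fixes u :: "real^3 \<Rightarrow> real"
 assumes u: "sob u g" and k: "\<alpha> > 0" "\<beta> > 0"
 shows "sob (\<lambda>x. \<alpha> * u (\<beta> *\<^sub>R x)) (\<lambda>x. (\<alpha> * \<beta>) *\<^sub>R g (\<beta> *\<^sub>R x))"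
  "mass (\<lambda>x. \<alpha> * u (\<beta> *\<^sub>R x)) = \<alpha>^2 / \<beta>^3 * mass u"
  "kin (\<lambda>x. (\<alpha> * \<beta>) *\<^sub>R g (\<beta> *\<^sub>R x)) = \<alpha>^2 / \<beta> * kin g"
  "ppow p (\<lambda>x. \<alpha> * u (\<beta> *\<^sub>R x)) = \<alpha> powr p / \<beta>^3 * ppow p u"
  "six (\<lambda>x. \<alpha> * u (\<beta> *\<^sub>R x)) = \<alpha>^6 / \<beta>^3 * six u"
proof -
 note [measurable] = sobD(4,5)[OF u]
 have I: "(LBINT x. F (\<beta> *\<^sub>R x)) = 1 / \<beta>^3 * (LBINT x. F x)" if "F \<in> borel_measurable borel" for F :: "real^3 \<Rightarrow> real"
  using integral_affine[OF that k(2), of 0] by (simp add: power_one_over)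
 show "sob (\<lambda>x. \<alpha> * u (\<beta> *\<^sub>R x)) (\<lambda>x. (\<alpha> * \<beta>) *\<^sub>R g (\<beta> *\<^sub>R x))"
  using sob_scale[OF sob_affine[OF u k(2), of 0], of \<alpha>] by simp
 have "mass (\<lambda>x. \<alpha> * u (\<beta> *\<^sub>R x)) = \<alpha>^2 * (LBINT x. (u (\<beta> *\<^sub>R x))^2)" by (simp add: mass_def power_mult_distrib)
 then show "mass (\<lambda>x. \<alpha> * u (\<beta> *\<^sub>R x)) = \<alpha>^2 / \<beta>^3 * mass u" using I[of "\<lambda>x. (u x)^2"] by (simp add: mass_def)
 have "kin (\<lambda>x. (\<alpha> * \<beta>) *\<^sub>R g (\<beta> *\<^sub>R x)) = (\<alpha> * \<beta>)^2 * (LBINT x. (norm (g (\<beta> *\<^sub>R x)))^2)" by (simp add: kin_def power_mult_distrib)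
 then show "kin (\<lambda>x. (\<alpha> * \<beta>) *\<^sub>R g (\<beta> *\<^sub>R x)) = \<alpha>^2 / \<beta> * kin g" using I[of "\<lambda>x. (norm (g x))^2"] k
  by (simp add: kin_def power_mult_distrib power2_eq_square power3_eq_cube)
 have "ppow p (\<lambda>x. \<alpha> * u (\<beta> *\<^sub>R x)) = \<alpha> powr p * (LBINT x. \<bar>u (\<beta> *\<^sub>R x)\<bar> powr p)" using k by (simp add: ppow_def abs_mult powr_mult)
 then show "ppow p (\<lambda>x. \<alpha> * u (\<beta> *\<^sub>R x)) = \<alpha> powr p / \<beta>^3 * ppow p u" using I[of "\<lambda>x. \<bar>u x\<bar> powr p"] by (simp add: ppow_def)
 have "six (\<lambda>x. \<alpha> * u (\<beta> *\<^sub>R x)) = \<alpha>^6 * (LBINT x. (u (\<beta> *\<^sub>R x))^6)" by (simp add: six_def power_mult_distrib)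
 then show "six (\<lambda>x. \<alpha> * u (\<beta> *\<^sub>R x)) = \<alpha>^6 / \<beta>^3 * six u" using I[of "\<lambda>x. (u x)^6"] by (simp add: six_def)
qed

text \<open>The witness is t powr (3/2) * u (t x), the dilation that preserves the mass.\<close>

lemma dilate:
 fixes u :: "real^3 \<Rightarrow> real"
 assumes u: "sob u g" and t: "t > 0"
 obtains w h where "sob w h" "mass w = mass u" "kin h = t^2 * kin g" "ppow p w = t powr (3 * (p - 2) / 2) * ppow p u" "six w = t^6 * six u"
proof -
 have k: "t powr (3/2) > 0" using t by simp
 have e: "(t powr (3/2))^n = t powr (3/2 * n)" for n using t by (simp add: powr_powr flip: powr_realpow)
 have e': "t^n = t powr n" for n using t by (simp add: powr_realpow)
 note r = rescale[OF u k t]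
 show ?thesis
 proof (rule that[OF r(1)])
  show "mass (\<lambda>x. t powr (3/2) * u (t *\<^sub>R x)) = mass u" unfolding r(2) e using t by (simp add: powr_numeral)
  show "kin (\<lambda>x. (t powr (3/2) * t) *\<^sub>R g (t *\<^sub>R x)) = t^2 * kin g" unfolding r(3) e using t by (simp add: powr_numeral power2_eq_square power3_eq_cube)
  show "six (\<lambda>x. t powr (3/2) * u (t *\<^sub>R x)) = t^6 * six u"
  proof -
   have "(t powr (3/2))^6 / t^3 = t^6" unfolding e unfolding e' by (simp flip: powr_diff)
   then show ?thesis unfolding r(5) by simp
  qed
  show "ppow p (\<lambda>x. t powr (3/2) * u (t *\<^sub>R x)) = t powr (3 * (p - 2) / 2) * ppow p u"
  proof -
   have "(t powr (3/2)) powr p / t^3 = t powr (3/2 * p - 3)" unfolding e' powr_powr by (simp flip: powr_diff)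
   also have "3/2 * p - 3 = 3 * (p - 2) / 2" by (simp add: field_simps)
   finally show ?thesis unfolding r(4) by simp
  qed
 qed
qed

section \<open>Dilation fibres and the level of the infimum\<close>

locale kirchhoff =
 fixes a b p c :: real
 assumes a: "a > 0" and b: "b > 0" and p: "14/3 \<le> p" "p < 6" and c: "c > 0"
begin

definition s :: real where "s = 3 * (p - 2) / 2"

lemma s: "4 \<le> s" "s < 6" using p by (auto simp: s_def)

text \<open>Energy and Pohozaev functional as functions of the kinetic, \<open>p\<close>-th and sixth power integrals; in \<open>Jo\<close> the
 quadratic term of the energy cancels and every coefficient is nonnegative.\<close>

definition En :: "real \<Rightarrow> real \<Rightarrow> real \<Rightarrow> real" where "En A B C = a / 2 * A + b / 4 * A^2 - B / p - C / 6"
definition Po :: "real \<Rightarrow> real \<Rightarrow> real \<Rightarrow> real" where "Po A B C = a * A + b * A^2 - s / p * B - C"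
definition Jo :: "real \<Rightarrow> real \<Rightarrow> real \<Rightarrow> real" where "Jo A B C = a / 4 * A + (s - 4) / (4 * p) * B + C / 12"

lemma Jo_eq: "Jo A B C = En A B C - Po A B C / 4"
 using p unfolding Jo_def En_def Po_def by (simp add: field_simps)

text \<open>Dividing by t^2 leaves a continuous function of t that is positive at 0. At T the
  critical term wins, because T is chosen with C * T^2 \<ge> a * A + b * A^2 and T \<ge> 1.\<close>

lemma Po_root:
 assumes A: "A > 0" and B: "B \<ge> 0" and C: "C > 0"
 obtains t where "t > 0" "Po (t^2 * A) (t powr s * B) (t^6 * C) = 0"
proof -
 define f where "f t = a * A + b * A^2 * t^2 - s / p * B * t powr (s - 2) - C * t^4" for t
 define T where "T = max 1 ((a * A + b * A^2) / C)"
 have T1: "T \<ge> 1" by (simp add: T_def)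
 have f0: "f 0 > 0" using A a s by (simp add: f_def)
 have fT: "f T \<le> 0"
 proof -
  have "(a * A + b * A^2) / C \<le> T" by (simp add: T_def)
  also have "T \<le> T^2" using T1 by (simp add: power2_eq_square)
  finally have 1: "a * A + b * A^2 \<le> C * T^2" using C by (simp add: pos_divide_le_eq mult.commute)
  have "a * A * 1 + b * A^2 * T^2 \<le> a * A * T^2 + b * A^2 * T^2" using T1 a A by (intro add_right_mono mult_left_mono) auto
  also have "\<dots> = (a * A + b * A^2) * T^2" by (simp add: distrib_right)
  also have "\<dots> \<le> C * T^2 * T^2" by (intro mult_right_mono 1) simp
  also have "\<dots> = C * T^4" by (simp add: power_add[symmetric] mult.assoc)
  finally have "a * A + b * A^2 * T^2 \<le> C * T^4" by simp
  moreover have "s / p * B * T powr (s - 2) \<ge> 0" using s p B by simp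
  ultimately show ?thesis unfolding f_def by linarith
 qed
 have "continuous_on {0..T} f" unfolding f_def
  by (intro continuous_intros continuous_on_powr') (use s in auto)
 then obtain t where t: "0 \<le> t" "t \<le> T" "f t = 0" using IVT2'[of f T 0 0] f0 fT T1 by auto
 have tp: "t > 0" using t f0 by (cases "t = 0") auto
 show ?thesis
 proof (rule that[OF tp])
  have "t powr s = t powr (s - 2) * t^2" using tp by (simp add: powr_diff powr_numeral)
  then have "Po (t^2 * A) (t powr s * B) (t^6 * C) = t^2 * f t"
   unfolding Po_def f_def by (simp add: algebra_simps eval_nat_numeral)
  then show "Po (t^2 * A) (t powr s * B) (t^6 * C) = 0" using t by simp
 qed
qed

text \<open>The sign of P allows b * A^2 to be replaced by s / p * B + C - a * A. The coefficients
  of a * A, B and C are then maximised over t separately, each at t = 1; for B this is Young's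
  inequality and uses s \<ge> 4. When P = 0, \<open>Jo\<close> is the energy itself, which is thus
  maximal at t = 1 on its fibre.\<close>

lemma En_dilate_le_Jo:
 assumes A: "A \<ge> 0" and B: "B \<ge> 0" and C: "C \<ge> 0" and P: "Po A B C \<le> 0" and t: "t > 0"
 shows "En (t^2 * A) (t powr s * B) (t^6 * C) \<le> Jo A B C"
proof -
 have pp: "p > 0" using p by simp
 have 1: "t^2 / 2 - t^4 / 4 \<le> 1 / 4"
 proof -
  have "0 \<le> (t^2 - 1)^2" by simp
  also have "\<dots> = t^4 - 2 * t^2 + 1" by (simp add: power2_eq_square eval_nat_numeral algebra_simps)
  finally show ?thesis by simp
 qed
 have 3: "t^4 / 4 - t^6 / 6 \<le> 1 / 12"
 proof -
  have "0 \<le> (t^2 - 1)^2 * (2 * t^2 + 1)" by simp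
  also have "\<dots> = 2 * t^6 - 3 * t^4 + 1" by (simp add: power2_eq_square eval_nat_numeral algebra_simps)
  finally show ?thesis by simp
 qed
 have 2: "s * t^4 / 4 - t powr s \<le> s / 4 - 1"
 proof -
  have "(t powr s) powr (4/s) * 1 powr (1 - 4/s) \<le> 4/s * t powr s + (1 - 4/s) * 1"
   by (rule Youngs_inequality_0) (use s t in auto)
  moreover have "(t powr s) powr (4/s) = t^4" using s t by (simp add: powr_powr powr_numeral)
  ultimately have "t^4 \<le> 4/s * t powr s + (1 - 4/s)" by simp
  then have "s / 4 * t^4 \<le> s / 4 * (4/s * t powr s + (1 - 4/s))" using s by (intro mult_left_mono) auto
  also have "\<dots> = t powr s + s / 4 - 1" using s by (simp add: field_simps)
  finally show ?thesis by simp
 qed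
 have bA: "b * A^2 \<le> s / p * B + C - a * A" using P by (simp add: Po_def)
 have "En (t^2 * A) (t powr s * B) (t^6 * C) = a * A * (t^2 / 2) + t^4 / 4 * (b * A^2) - t powr s * (B / p) - t^6 / 6 * C"
  unfolding En_def by (simp add: power_mult_distrib eval_nat_numeral mult_ac)
 also have "\<dots> \<le> a * A * (t^2 / 2) + t^4 / 4 * (s / p * B + C - a * A) - t powr s * (B / p) - t^6 / 6 * C"
  by (intro diff_right_mono add_left_mono mult_left_mono bA) simp
 also have "\<dots> = a * A * (t^2 / 2 - t^4 / 4) + B / p * (s * t^4 / 4 - t powr s) + C * (t^4 / 4 - t^6 / 6)"
  by (simp add: algebra_simps diff_divide_distrib add_divide_distrib)
 also have "\<dots> \<le> a * A * (1 / 4) + B / p * (s / 4 - 1) + C * (1 / 12)"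
  by (intro add_mono mult_left_mono 1 2 3) (use A B C a pp in auto)
 also have "\<dots> = Jo A B C" using pp unfolding Jo_def by (simp add: field_simps)
 finally show ?thesis .
qed

definition EV :: "(real^3 \<Rightarrow> real) \<Rightarrow> (real^3 \<Rightarrow> real^3) \<Rightarrow> real" where "EV u g = En (kin g) (ppow p u) (six u)"
definition PV :: "(real^3 \<Rightarrow> real) \<Rightarrow> (real^3 \<Rightarrow> real^3) \<Rightarrow> real" where "PV u g = Po (kin g) (ppow p u) (six u)"
definition JV :: "(real^3 \<Rightarrow> real) \<Rightarrow> (real^3 \<Rightarrow> real^3) \<Rightarrow> real" where "JV u g = Jo (kin g) (ppow p u) (six u)"
definition VV :: "((real^3 \<Rightarrow> real) \<times> (real^3 \<Rightarrow> real^3)) set" where "VV = {(u, g). sob u g \<and> mass u = c^2 \<and> PV u g = 0}"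
definition mm :: real where "mm = Inf ((\<lambda>(u, g). EV u g) ` VV)"

lemma JV_nonneg: "JV u g \<ge> 0" and JV_ge_kin: "a / 4 * kin g \<le> JV u g" and JV_ge_six: "six u / 12 \<le> JV u g"
proof -
 have "a / 4 * kin g \<ge> 0" "(s - 4) / (4 * p) * ppow p u \<ge> 0" "six u / 12 \<ge> 0"
  using a s p functionals_nonneg by auto
 then show "JV u g \<ge> 0" "a / 4 * kin g \<le> JV u g" "six u / 12 \<le> JV u g" unfolding JV_def Jo_def by linarith+
qed

lemma VV_E: "(u, g) \<in> VV \<Longrightarrow> EV u g = JV u g"
 by (simp add: VV_def EV_def PV_def JV_def Jo_eq)

lemma mm_le: "(u, g) \<in> VV \<Longrightarrow> mm \<le> EV u g"
 unfolding mm_def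
proof (rule cInf_lower)
 assume "(u, g) \<in> VV"
 then show "EV u g \<in> (\<lambda>(u, g). EV u g) ` VV" by (rule rev_image_eqI) simp
 show "bdd_below ((\<lambda>(u, g). EV u g) ` VV)" by (rule bdd_belowI[of _ 0]) (auto simp: VV_E JV_nonneg)
qed

text \<open>Scaling \<open>u\<close> to \<open>\<alpha> * u (\<beta> x)\<close> with \<open>\<alpha>^2 = \<beta> < 1\<close> raises the mass, keeps the kinetic and sixth power integrals
 and raises the \<open>p\<close>-th power integral.\<close>

lemma VV_project:
 assumes u: "sob u g" and M: "0 < mass u" "mass u \<le> c^2" and P: "PV u g \<le> 0"
 obtains w h where "(w, h) \<in> VV" "EV w h \<le> JV u g"
proof -
 define \<beta> where "\<beta> = sqrt (mass u) / c"
 define \<alpha> where "\<alpha> = sqrt \<beta>"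
 have \<beta>: "0 < \<beta>" "\<beta> \<le> 1"
 proof -
  show "0 < \<beta>" using M c by (simp add: \<beta>_def)
  have "sqrt (mass u) \<le> c" using M(2) c by (simp add: real_le_lsqrt)
  then show "\<beta> \<le> 1" using c by (simp add: \<beta>_def)
 qed
 have \<alpha>: "\<alpha> > 0" "\<alpha>^2 = \<beta>" using \<beta> by (auto simp: \<alpha>_def)
 have "\<alpha>^6 = (\<alpha>^2)^3" by (simp flip: power_mult)
 then have \<alpha>6: "\<alpha>^6 = \<beta>^3" using \<alpha>(2) by simp
 note r = rescale[OF u \<alpha>(1) \<beta>(1)]
 let ?v = "\<lambda>x. \<alpha> * u (\<beta> *\<^sub>R x)" and ?g = "\<lambda>x. (\<alpha> * \<beta>) *\<^sub>R g (\<beta> *\<^sub>R x)"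
 have v2: "mass ?v = c^2"
 proof -
  have "\<beta>^2 = mass u / c^2" using M by (simp add: \<beta>_def power_divide)
  then have "mass u = \<beta>^2 * c^2" using c by simp
  then show ?thesis unfolding r(2) \<alpha>(2) using \<beta> by (simp add: eval_nat_numeral)
 qed
 have vA: "kin ?g = kin g" unfolding r(3) \<alpha>(2) using \<beta> by simp
 have vC: "six ?v = six u" unfolding r(5) \<alpha>6 using \<beta> by simp
 have vB: "ppow p u \<le> ppow p ?v"
 proof -
  have "\<beta> powr 0 \<le> \<beta> powr (p / 2 - 3)" by (rule powr_mono') (use \<beta> p in auto)
  then have "1 \<le> \<beta> powr (p / 2 - 3)" using \<beta> by simp
  also have "\<beta> powr (p / 2 - 3) = \<alpha> powr p / \<beta>^3"
   using \<beta> by (simp add: \<alpha>_def powr_half_sqrt[symmetric] powr_powr powr_diff powr_numeral mult.commute)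
  finally show ?thesis unfolding r(4) using mult_right_mono[OF _ functionals_nonneg(3)[of p u], of 1 "\<alpha> powr p / \<beta>^3"] by simp
 qed
 have A: "kin g > 0" "six u > 0" by (rule mass_pos_imp[OF u M(1)])+
 obtain t where t: "t > 0" "Po (t^2 * kin g) (t powr s * ppow p ?v) (t^6 * six u) = 0"
  by (rule Po_root[OF A(1) functionals_nonneg(3) A(2)])
 obtain w h where w: "sob w h" "mass w = mass ?v" "kin h = t^2 * kin ?g" "ppow p w = t powr (3 * (p - 2) / 2) * ppow p ?v" "six w = t^6 * six ?v"
  by (rule dilate[OF r(1) t(1)])
 show ?thesis
 proof (rule that[of w h])
  have "PV w h = 0" unfolding PV_def w(3-5) vA vC s_def[symmetric] by (rule t(2))
  then show "(w, h) \<in> VV" using w(1,2) v2 by (simp add: VV_def)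
  have "EV w h = En (t^2 * kin g) (t powr s * ppow p ?v) (t^6 * six u)" unfolding EV_def w(3-5) vA vC s_def[symmetric] ..
  also have "\<dots> \<le> En (t^2 * kin g) (t powr s * ppow p u) (t^6 * six u)"
   using vB p unfolding En_def by (simp add: divide_right_mono mult_left_mono)
  also have "\<dots> \<le> JV u g" unfolding JV_def
   by (rule En_dilate_le_Jo) (use functionals_nonneg P t in \<open>auto simp: PV_def\<close>)
  finally show "EV w h \<le> JV u g" .
 qed
qed

lemma mm_le_JV:
 assumes "sob u g" "0 < mass u" "mass u \<le> c^2" "PV u g \<le> 0"
 shows "mm \<le> JV u g"
proof -
 obtain w h where "(w, h) \<in> VV" "EV w h \<le> JV u g" by (rule VV_project[OF assms])
 then show ?thesis using mm_le by (rule_tac order_trans)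
qed

text \<open>The largest energy along dilations that is possible when only the critical term is present.\<close>

definition e0 :: "real \<Rightarrow> real" where "e0 \<tau> = a * \<tau> / 2 + b * \<tau>^2 / 4 - SQ * \<tau>^3 / 6"

lemma e0_max:
 obtains T where "T > 0" "\<And>\<tau>. \<tau> \<ge> 0 \<Longrightarrow> e0 \<tau> \<le> e0 T"
proof -
 \<comment> \<open>The positive root of SQ * T^2 = a + b * T, which is the critical point equation
   of \<open>e0\<close>.\<close>
 define T where "T = (b + sqrt (b^2 + 4 * SQ * a)) / (2 * SQ)"
 have sq: "sqrt (b^2 + 4 * SQ * a) \<ge> 0" "(sqrt (b^2 + 4 * SQ * a))^2 = b^2 + 4 * SQ * a" using SQ_pos a by auto
 have T: "T > 0" unfolding T_def using b SQ_pos sq(1) by (intro divide_pos_pos add_pos_nonneg) auto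
 have "2 * SQ * T - b = sqrt (b^2 + 4 * SQ * a)" using SQ_pos by (simp add: T_def)
 then have "(2 * SQ * T - b)^2 = b^2 + 4 * SQ * a" using sq(2) by simp
 then have "4 * SQ * (SQ * T^2) = 4 * SQ * (a + b * T)" by (simp add: power2_eq_square algebra_simps)
 then have root: "SQ * T^2 = a + b * T" using SQ_pos by simp
 show ?thesis
 proof (rule that[OF T])
  fix \<tau> :: real assume \<tau>: "\<tau> \<ge> 0"
  \<comment> \<open>The critical point gives a double root at T, and the remaining linear factor is
    non-negative because b \<le> SQ * T.\<close>
  have "12 * (e0 T - e0 \<tau>) = (T - \<tau>)^2 * (SQ * (4 * T + 2 * \<tau>) - 3 * b)"
  proof -
   have "12 * (e0 T - e0 \<tau>) - (T - \<tau>)^2 * (SQ * (4 * T + 2 * \<tau>) - 3 * b) = 6 * (T - \<tau>) * (a + b * T - SQ * T^2)"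
    unfolding e0_def by (simp add: field_simps power2_eq_square power3_eq_cube)
   then show ?thesis using root by simp
  qed
  moreover have "SQ * (4 * T + 2 * \<tau>) - 3 * b \<ge> 0"
  proof -
   have "SQ * T * T = a + b * T" using root by (simp add: power2_eq_square)
   then have "b * T \<le> SQ * T * T" using a by simp
   then have "b \<le> SQ * T" using T by simp
   moreover have "SQ * \<tau> \<ge> 0" using SQ_pos \<tau> by simp
   moreover have "SQ * (4 * T + 2 * \<tau>) = 4 * (SQ * T) + 2 * (SQ * \<tau>)" by (simp add: algebra_simps)
   ultimately show ?thesis using b by linarith
  qed
  ultimately have "12 * (e0 T - e0 \<tau>) \<ge> 0" by simp
  then show "e0 \<tau> \<le> e0 T" by simp
 qed
qed

text \<open>Dilate u until its kinetic integral is T, bound the sixth power integral by the Sobolev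
  inequality, and use that u maximises the energy on its fibre. An energy below \<open>e0 T\<close>
  therefore forces a definite p-th power integral.\<close>

lemma EV_ge_e0:
 assumes v: "(u, g) \<in> VV" and T: "T > 0"
 shows "e0 T - (T / kin g) powr (s / 2) * ppow p u / p \<le> EV u g"
proof -
 have u: "sob u g" "mass u = c^2" "PV u g = 0" using v by (auto simp: VV_def)
 have A: "kin g > 0" using mass_pos_imp[OF u(1)] u(2) c by simp
 define t where "t = sqrt (T / kin g)"
 have t: "t > 0" "t^2 = T / kin g" using T A by (auto simp: t_def)
 have ts: "t powr s = (T / kin g) powr (s / 2)" using T A by (simp add: t_def powr_half_sqrt[symmetric] powr_powr)
 have t6: "t^6 * six u \<le> SQ * T^3"
 proof -
  have "t^6 = (t^2)^3" by (simp flip: power_mult)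
  then have "t^6 * six u \<le> (T / kin g)^3 * (SQ * kin g^3)" unfolding t(2) using T A by (auto intro!: mult_left_mono six_le[OF u(1)])
  also have "\<dots> = SQ * T^3" using A by (simp add: power_divide)
  finally show ?thesis .
 qed
 have "e0 T - (T / kin g) powr (s / 2) * ppow p u / p \<le> En (t^2 * kin g) (t powr s * ppow p u) (t^6 * six u)"
  using t6 A unfolding En_def e0_def t(2) ts by simp
 also have "\<dots> \<le> JV u g" unfolding JV_def
  by (rule En_dilate_le_Jo) (use functionals_nonneg u(3) t in \<open>auto simp: PV_def\<close>)
 also have "\<dots> = EV u g" using VV_E[OF v] by simp
 finally show ?thesis .
qed

text \<open>When the kinetic integral is at most 1, interpolation and Sobolev bound the p-th and
  sixth power integrals by multiples of its square; the p-th one uses 3 * (p - 2) / 4 \<ge> 2, that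
  is p \<ge> 14/3. The linear term in P = 0 then cannot be small.\<close>

lemma kin_lower:
 obtains A0 where "A0 > 0" "\<And>u g. (u, g) \<in> VV \<Longrightarrow> A0 \<le> kin g"
proof -
 define K where "K = s / p * ((c^2) powr ((6 - p) / 4) * SQ powr ((p - 2) / 4)) + SQ"
 have K: "K > 0" using SQ_pos s p unfolding K_def by (intro add_nonneg_pos) auto
 show ?thesis
 proof (rule that[of "min 1 (a / K)"])
  show "min 1 (a / K) > 0" using a K by simp
  fix u g assume "(u, g) \<in> VV"
  then have u: "sob u g" "mass u = c^2" "PV u g = 0" by (auto simp: VV_def)
  have A: "kin g > 0" using mass_pos_imp[OF u(1)] u(2) c by simp
  show "min 1 (a / K) \<le> kin g"
  proof (cases "kin g \<le> 1")
   case True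
   have A3: "kin g^3 \<le> (kin g)^2" using A True by (intro power_decreasing) auto
   have C: "six u \<le> SQ * (kin g)^2" by (rule order_trans[OF six_le[OF u(1)] mult_left_mono[OF A3]]) (use SQ_pos in simp)
   have "ppow p u \<le> (c^2) powr ((6 - p) / 4) * six u powr ((p - 2) / 4)" using ppow_le[OF u(1), of p] p u(2) by simp
   also have "six u powr ((p - 2) / 4) \<le> (SQ * kin g^3) powr ((p - 2) / 4)"
    using p functionals_nonneg by (intro powr_mono2 six_le[OF u(1)]) auto
   also have "(SQ * kin g^3) powr ((p - 2) / 4) = SQ powr ((p - 2) / 4) * kin g powr (3 * ((p - 2) / 4))"
    using A SQ_pos by (simp add: powr_mult powr_powr flip: powr_numeral)
   also have "kin g powr (3 * ((p - 2) / 4)) \<le> kin g powr 2" by (rule powr_mono') (use A True p in auto)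
   also have "kin g powr 2 = (kin g)^2" using A by (simp add: powr_numeral)
   finally have B: "ppow p u \<le> (c^2) powr ((6 - p) / 4) * SQ powr ((p - 2) / 4) * (kin g)^2" by (simp add: mult_left_mono mult.assoc)
   have "0 \<le> b * (kin g)^2" using b by simp
   then have "a * kin g \<le> s / p * ppow p u + six u" using u(3) unfolding PV_def Po_def by linarith
   also have "\<dots> \<le> s / p * ((c^2) powr ((6 - p) / 4) * SQ powr ((p - 2) / 4) * (kin g)^2) + SQ * (kin g)^2"
    using s p by (intro add_mono C mult_left_mono B) auto
   also have "\<dots> = K * kin g * kin g" unfolding K_def by (simp add: power2_eq_square algebra_simps)
   finally have "a \<le> K * kin g" using A by simp
   then have "a / K \<le> kin g" using K by (simp add: pos_divide_le_eq mult.commute)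
   then show ?thesis by simp
  qed simp
 qed
qed

end

context kirchhoff
begin

text \<open>The subcritical term gains a multiple of \<open>\<delta> powr ((6 - p) / 2)\<close> on the truncated bubble,
 which beats the truncation error of order \<open>\<delta>\<close> because \<open>p > 4\<close>.\<close>

lemma VV_below:
 assumes T: "T > 0" "\<And>\<tau>. \<tau> \<ge> 0 \<Longrightarrow> e0 \<tau> \<le> e0 T"
 obtains w h where "(w, h) \<in> VV" "EV w h < e0 T"
proof -
 define b1 where "b1 = (1/5) powr p * measure lborel (ball 0 1 :: (real^3) set)"
 have b1: "b1 > 0" using content_ball_pos[of 1 "0::real^3"] by (simp add: b1_def)
 \<comment> \<open>Collects the constants of the lower bound \<open>B2\<close>. The power (6 - p) /
   2 of \<delta> there comes from normalising the mass, which is at most of order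
   \<delta>^(-2).\<close>
 define k where "k = (3 * SN) powr (- (s / 2)) * (c / (2 * sqrt SN)) powr ((6 - p) / 2) * b1"
 have k: "k > 0" using b1 SN_pos c by (simp add: k_def)
 \<comment> \<open>An upper bound for the kinetic integral \<tau> of the projected bubble, obtained
   below from P = 0 and independent of \<delta>; it allows \<delta> to be fixed before \<tau> is
   known.\<close>
 define tm where "tm = max 1 (2 * (a + b) / SQ)"
 have tm: "tm \<ge> 1" by (simp add: tm_def)
 \<comment> \<open>Solves 8 * SQ * tm powr (3 - s / 2) * \<eta> = k / p, the borderline of the
   comparison \<open>key\<close>.\<close>
 define \<eta> where "\<eta> = k / (8 * p * SQ * tm powr (3 - s / 2))"
 have \<eta>: "\<eta> > 0" using k SQ_pos tm p by (simp add: \<eta>_def)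
 define \<theta> where "\<theta> = (p - 4) / 2"
 have \<theta>: "\<theta> > 0" using p by (simp add: \<theta>_def)
 define \<delta> where "\<delta> = min (1/96) ((\<eta> / 2) powr (1 / \<theta>))"
 have \<delta>: "\<delta> > 0" "\<delta> \<le> 1/96" using \<eta> by (auto simp: \<delta>_def)
 have "\<delta> powr \<theta> \<le> ((\<eta> / 2) powr (1 / \<theta>)) powr \<theta>" by (rule powr_mono2) (use \<theta> \<delta> in \<open>auto simp: \<delta>_def\<close>)
 also have "\<dots> = \<eta> / 2" using \<eta> \<theta> by (simp add: powr_powr)
 finally have \<delta>\<eta>: "\<delta> powr \<theta> < \<eta>" using \<eta> by simp
 have \<delta>4: "\<delta> \<le> 1/4" and pp: "p > 0" using \<delta> p by auto
 obtain v G where v: "sob v G" and vA: "kin G \<le> 3 * SN" and vC: "SN * (1 - 48 * \<delta>) \<le> six v" and vM: "mass v \<le> 4 * SN / \<delta>^2" and vB: "b1 \<le> ppow p v"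
  unfolding kin_def six_def mass_def ppow_def b1_def using truncated_bubble[OF \<delta>(1) \<delta>4 pp] by blast
 have C: "six v > 0" using vC SN_pos \<delta> by (intro less_le_trans[OF _ vC] mult_pos_pos) auto
 have M: "mass v > 0"
 proof (rule ccontr)
  assume "\<not> ?thesis"
  then have "mass v = 0" using functionals_nonneg(1)[of v] by simp
  then have "AE x in lborel. v x = 0" by (rule mass_0_AE[OF v])
  then have "AE x in lborel. v x^6 = 0" by eventually_elim simp
  then have "six v = 0" unfolding six_def by (rule integral_eq_zero_AE)
  then show False using C by simp
 qed
 have A: "kin G > 0" by (rule mass_pos_imp(2)[OF v M])
 define \<alpha> where "\<alpha> = c / sqrt (mass v)"
 have \<alpha>: "\<alpha> > 0" using c M by (simp add: \<alpha>_def)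
 note r = rescale[OF v \<alpha> zero_less_one, simplified]
 have A1: "\<alpha>^2 * kin G > 0" "\<alpha>^6 * six v > 0" using \<alpha> A C by auto
 have B1: "\<alpha> powr p * ppow p v \<ge> 0" using functionals_nonneg by simp
 obtain t where t: "t > 0" "Po (t^2 * (\<alpha>^2 * kin G)) (t powr s * (\<alpha> powr p * ppow p v)) (t^6 * (\<alpha>^6 * six v)) = 0"
  by (rule Po_root[OF A1(1) B1 A1(2)])
 obtain w h where w: "sob w h" "mass w = \<alpha>^2 * mass v" "kin h = t^2 * (\<alpha>^2 * kin G)" "ppow p w = t powr s * (\<alpha> powr p * ppow p v)" "six w = t^6 * (\<alpha>^6 * six v)"
  by (rule dilate[where p = p, OF r(1) t(1), unfolded r(2-) s_def[symmetric]]) blast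
 have "PV w h = 0" unfolding PV_def w(3-5) by (rule t(2))
 moreover have "mass w = c^2" unfolding w(2) \<alpha>_def using M by (simp add: power_divide)
 ultimately have wV: "(w, h) \<in> VV" using w(1) by (simp add: VV_def)
 define \<tau> where "\<tau> = kin h"
 have \<tau>: "\<tau> > 0" using t(1) A1 unfolding \<tau>_def w(3) by simp
 have \<tau>e: "t * \<alpha> = sqrt (\<tau> / kin G)"
 proof -
  have "\<tau> / kin G = (t * \<alpha>)^2" unfolding \<tau>_def w(3) using A by (simp add: power_mult_distrib)
  then show ?thesis using t(1) \<alpha> by simp
 qed
 have C2: "SQ * (1 - 48 * \<delta>) * \<tau>^3 \<le> six w"
 proof -
  have "(t * \<alpha>)^6 = ((t * \<alpha>)^2)^3" by (simp flip: power_mult)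
  also have "(t * \<alpha>)^2 = \<tau> / kin G" unfolding \<tau>e using \<tau> A by simp
  finally have e: "six w = (\<tau> / kin G)^3 * six v" unfolding w(5) by (simp add: power_mult_distrib mult_ac)
  have "kin G^3 \<le> (3 * SN)^3" by (rule power_mono) (use vA A in auto)
  then have "\<tau>^3 / (3 * SN)^3 \<le> \<tau>^3 / kin G^3" using A \<tau> SN_pos by (intro divide_left_mono) auto
  then have "\<tau>^3 / (3 * SN)^3 * (SN * (1 - 48 * \<delta>)) \<le> \<tau>^3 / kin G^3 * six v" using \<tau> SN_pos \<delta> A by (intro mult_mono vC) auto
  moreover have "\<tau>^3 / (3 * SN)^3 * (SN * (1 - 48 * \<delta>)) = SQ * (1 - 48 * \<delta>) * \<tau>^3" using SN_pos by (simp add: SQ_def power_mult_distrib field_simps eval_nat_numeral)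
  ultimately show ?thesis unfolding e by (simp add: power_divide)
 qed
 have B2: "k * \<delta> powr ((6 - p) / 2) * \<tau> powr (s / 2) \<le> ppow p w"
 proof -
  have e: "ppow p w = (\<tau> / kin G) powr (s / 2) * (\<alpha> powr ((6 - p) / 2) * ppow p v)"
  proof -
   have "(\<tau> / kin G) powr (s / 2) = (t * \<alpha>) powr s" unfolding \<tau>e using \<tau> A by (simp add: powr_half_sqrt[symmetric] powr_powr)
   also have "\<dots> = t powr s * \<alpha> powr s" by (rule powr_mult)
   finally have "(\<tau> / kin G) powr (s / 2) * \<alpha> powr ((6 - p) / 2) = t powr s * \<alpha> powr (s + (6 - p) / 2)" by (simp add: powr_add)
   also have "s + (6 - p) / 2 = p" by (simp add: s_def field_simps)
   finally show ?thesis unfolding w(4) by (simp flip: mult.assoc)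
  qed
  have 1: "(3 * SN) powr (- (s / 2)) * \<tau> powr (s / 2) \<le> (\<tau> / kin G) powr (s / 2)"
  proof -
   have "(\<tau> / (3 * SN)) powr (s / 2) \<le> (\<tau> / kin G) powr (s / 2)"
    by (rule powr_mono2) (use s \<tau> SN_pos A vA in \<open>auto intro!: divide_left_mono\<close>)
   then show ?thesis using \<tau> SN_pos by (simp add: powr_divide powr_minus field_simps)
  qed
  have 2: "(c / (2 * sqrt SN)) powr ((6 - p) / 2) * \<delta> powr ((6 - p) / 2) \<le> \<alpha> powr ((6 - p) / 2)"
  proof -
   have "sqrt (mass v) \<le> sqrt (4 * SN / \<delta>^2)" using vM by simp
   also have "\<dots> = 2 * sqrt SN / \<delta>" using \<delta> by (simp add: real_sqrt_divide real_sqrt_mult)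
   finally have "c / (2 * sqrt SN / \<delta>) \<le> \<alpha>" unfolding \<alpha>_def using M c SN_pos \<delta> by (intro divide_left_mono) auto
   then have "(c / (2 * sqrt SN) * \<delta>) powr ((6 - p) / 2) \<le> \<alpha> powr ((6 - p) / 2)" using p c SN_pos \<delta> by (intro powr_mono2) auto
   then show ?thesis by (simp only: powr_mult)
  qed
  have "((3 * SN) powr (- (s / 2)) * \<tau> powr (s / 2)) * (((c / (2 * sqrt SN)) powr ((6 - p) / 2) * \<delta> powr ((6 - p) / 2)) * b1) \<le> ppow p w"
   unfolding e by (intro mult_mono 1 2 vB) (use b1 in auto)
  then show ?thesis unfolding k_def by (simp only: mult_ac)
 qed
 have "\<tau> \<le> tm"
 proof (cases "\<tau> \<le> 1")
  case False
  have "0 \<le> s / p * ppow p w" using s p functionals_nonneg by simp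
  then have "six w \<le> a * \<tau> + b * \<tau>^2" using wV unfolding VV_def PV_def Po_def \<tau>_def by simp
  moreover have "SQ * \<tau>^3 * (1/2) \<le> SQ * \<tau>^3 * (1 - 48 * \<delta>)" using \<delta> \<tau> SQ_pos by (intro mult_left_mono) auto
  ultimately have "SQ * \<tau>^3 * (1/2) \<le> a * \<tau> + b * \<tau>^2" using C2 by (simp add: mult_ac)
  also have "\<dots> \<le> (a + b) * \<tau>^2" using False a by (simp add: power2_eq_square algebra_simps)
  finally have "SQ * \<tau> / 2 * \<tau>^2 \<le> (a + b) * \<tau>^2" by (simp add: power2_eq_square power3_eq_cube mult_ac)
  then have "SQ * \<tau> / 2 \<le> a + b" using \<tau> by simp
  then have "\<tau> \<le> 2 * (a + b) / SQ" using SQ_pos by (simp add: field_simps)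
  then show ?thesis by (simp add: tm_def)
 qed (use tm in simp)
 then have "\<tau> powr (3 - s / 2) \<le> tm powr (3 - s / 2)" using s \<tau> by (intro powr_mono2) auto
 then have "8 * SQ * \<tau> powr (3 - s / 2) * \<delta> powr \<theta> \<le> 8 * SQ * tm powr (3 - s / 2) * \<delta> powr \<theta>" using SQ_pos by (intro mult_right_mono mult_left_mono) auto
 also have "\<dots> < 8 * SQ * tm powr (3 - s / 2) * \<eta>" using \<delta>\<eta> SQ_pos tm by (intro mult_strict_left_mono) auto
 also have "\<dots> = k / p" using SQ_pos tm p by (simp add: \<eta>_def)
 finally have key: "8 * SQ * \<tau> powr (3 - s / 2) * \<delta> powr \<theta> < k / p" .
 \<comment> \<open>8 = 48 / 6: this is the truncation loss inside \<open>six w / 6\<close>. It is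
   split as \<open>\<delta> powr \<theta>\<close> times the powers of \<delta> and \<tau> in
   \<open>B2\<close>, so that \<open>key\<close> compares it with the gain.\<close>
 have "8 * SQ * \<delta> * \<tau>^3 = 8 * SQ * \<tau> powr (3 - s / 2) * \<delta> powr \<theta> * (\<delta> powr ((6 - p) / 2) * \<tau> powr (s / 2))"
 proof -
  have "\<tau> powr (3 - s / 2) * \<tau> powr (s / 2) = \<tau>^3" using \<tau> by (simp add: powr_numeral flip: powr_add)
  moreover have "\<theta> + (6 - p) / 2 = 1" by (simp add: \<theta>_def field_simps)
  then have "\<delta> powr \<theta> * \<delta> powr ((6 - p) / 2) = \<delta>" using \<delta> by (simp flip: powr_add)
  moreover have "8 * SQ * \<tau> powr (3 - s / 2) * \<delta> powr \<theta> * (\<delta> powr ((6 - p) / 2) * \<tau> powr (s / 2))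
   = 8 * SQ * (\<delta> powr \<theta> * \<delta> powr ((6 - p) / 2)) * (\<tau> powr (3 - s / 2) * \<tau> powr (s / 2))" by (simp only: mult_ac)
  ultimately show ?thesis by (simp only:)
 qed
 also have "\<dots> < k / p * (\<delta> powr ((6 - p) / 2) * \<tau> powr (s / 2))" using key \<tau> \<delta> by (intro mult_strict_right_mono) auto
 also have "\<dots> = k * \<delta> powr ((6 - p) / 2) * \<tau> powr (s / 2) / p" by simp
 also have "\<dots> \<le> ppow p w / p" using B2 p by (intro divide_right_mono) auto
 finally have "8 * SQ * \<delta> * \<tau>^3 < ppow p w / p" .
 moreover have "SQ * \<tau>^3 / 6 - 8 * SQ * \<delta> * \<tau>^3 \<le> six w / 6" using C2 by (simp add: algebra_simps)
 moreover have "a / 2 * \<tau> = a * \<tau> / 2" "b / 4 * \<tau>^2 = b * \<tau>^2 / 4" by simp_all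
 ultimately have "EV w h < e0 \<tau>" unfolding EV_def En_def e0_def \<tau>_def[symmetric] by linarith
 also have "\<dots> \<le> e0 T" using T(2) \<tau> by simp
 finally show ?thesis by (rule that[OF wV])
qed

lemma VV_nonempty: "VV \<noteq> {}"
proof -
 obtain T where "T > 0" "\<And>\<tau>. \<tau> \<ge> 0 \<Longrightarrow> e0 \<tau> \<le> e0 T" by (rule e0_max) blast
 then obtain w h where "(w, h) \<in> VV" by (rule VV_below)
 then show ?thesis by blast
qed

lemma mm_less:
 assumes "T > 0" "\<And>\<tau>. \<tau> \<ge> 0 \<Longrightarrow> e0 \<tau> \<le> e0 T"
 shows "mm < e0 T"
proof -
 obtain w h where w: "(w, h) \<in> VV" "EV w h < e0 T" by (rule VV_below[OF assms])
 show ?thesis by (rule order_le_less_trans[OF mm_le[OF w(1)] w(2)])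
qed

end

section \<open>Existence of a minimiser\<close>

lemma abs_powr_even: "\<bar>x\<bar> powr 2 = x^2" "\<bar>x\<bar> powr 6 = x^6" for x :: real
 by (cases "x = 0"; simp add: powr_numeral power_even_abs)+

lemma functionals_shift:
 fixes u :: "real^3 \<Rightarrow> real"
 assumes u: "sob u g"
 shows "sob (\<lambda>x. u (x + y)) (\<lambda>x. g (x + y))" "mass (\<lambda>x. u (x + y)) = mass u" "kin (\<lambda>x. g (x + y)) = kin g"
  "ppow p (\<lambda>x. u (x + y)) = ppow p u" "six (\<lambda>x. u (x + y)) = six u"
proof -
 note [measurable] = sobD(4,5)[OF u]
 show "sob (\<lambda>x. u (x + y)) (\<lambda>x. g (x + y))" using sob_affine[OF u, of 1 y] by simp
 show "mass (\<lambda>x. u (x + y)) = mass u" unfolding mass_def by (rule integral_shift[of "\<lambda>x. (u x)^2"]) measurable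
 show "kin (\<lambda>x. g (x + y)) = kin g" unfolding kin_def by (rule integral_shift[of "\<lambda>x. (norm (g x))^2"]) measurable
 show "ppow p (\<lambda>x. u (x + y)) = ppow p u" unfolding ppow_def by (rule integral_shift[of "\<lambda>x. \<bar>u x\<bar> powr p"]) measurable
 show "six (\<lambda>x. u (x + y)) = six u" unfolding six_def by (rule integral_shift[of "\<lambda>x. u x^6"]) measurable
qed

lemma kin_diff:
 assumes g: "g \<in> Lq 2" and h: "h \<in> Lq 2"
 shows "kin (\<lambda>x. g x - h x) = kin g - 2 * (LBINT x. g x \<bullet> h x) + kin h"
proof -
 have e: "(norm (g x - h x))^2 = (norm (g x))^2 - 2 * (g x \<bullet> h x) + (norm (h x))^2" for x
  by (simp add: power2_norm_eq_inner inner_diff_left inner_diff_right inner_commute)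
 show ?thesis unfolding kin_def e using Lq2D(2)[OF g] Lq2D(2)[OF h] Lq2_inner[OF g h] by simp
qed

context kirchhoff
begin

lemma Po_diff: "Po (A - A') (B - B') (C - C') = Po A B C - Po A' B' C' - 2 * b * A' * (A - A')"
 unfolding Po_def by (simp add: power2_eq_square algebra_simps diff_divide_distrib add_divide_distrib)

lemma Jo_diff: "Jo (A - A') (B - B') (C - C') = Jo A B C - Jo A' B' C'"
 unfolding Jo_def by (simp add: algebra_simps diff_divide_distrib add_divide_distrib)

lemma Jo_mono: "A \<le> A' \<Longrightarrow> B \<le> B' \<Longrightarrow> C \<le> C' \<Longrightarrow> Jo A B C \<le> Jo A' B' C'"
 unfolding Jo_def by (intro add_mono mult_left_mono divide_right_mono) (use a s p in auto)

lemma tendsto_Po: "A \<longlonglongrightarrow> A' \<Longrightarrow> B \<longlonglongrightarrow> B' \<Longrightarrow> C \<longlonglongrightarrow> C' \<Longrightarrow> (\<lambda>n. Po (A n) (B n) (C n)) \<longlonglongrightarrow> Po A' B' C'"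
 unfolding Po_def by (intro tendsto_intros)

lemma tendsto_Jo: "A \<longlonglongrightarrow> A' \<Longrightarrow> B \<longlonglongrightarrow> B' \<Longrightarrow> C \<longlonglongrightarrow> C' \<Longrightarrow> (\<lambda>n. Jo (A n) (B n) (C n)) \<longlonglongrightarrow> Jo A' B' C'"
 unfolding Jo_def by (intro tendsto_intros) simp_all

text \<open>Energies within half the gap \<open>e0 T\<close> - \<open>mm\<close> of the infimum
  give, by \<open>EV_ge_e0\<close> and the lower kinetic bound, the uniform lower bound b0. The
  triples of integrals are bounded, so a subsequence has limits A, B, C.\<close>

lemma minimizing_sequence:
 obtains u g A B C A1 b0 where "\<And>n::nat. (u n, g n) \<in> VV" "(\<lambda>n. EV (u n) (g n)) \<longlonglongrightarrow> mm"
  "(\<lambda>n. kin (g n)) \<longlonglongrightarrow> A" "(\<lambda>n. ppow p (u n)) \<longlonglongrightarrow> B" "(\<lambda>n. six (u n)) \<longlonglongrightarrow> C"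
  "\<And>n. kin (g n) \<le> A1" "b0 > 0" "\<And>n. b0 \<le> ppow p (u n)"
proof -
 obtain T where T: "T > 0" "\<And>\<tau>. \<tau> \<ge> 0 \<Longrightarrow> e0 \<tau> \<le> e0 T" by (rule e0_max) blast
 define d where "d = e0 T - mm"
 have d: "d > 0" using mm_less[OF T] by (simp add: d_def)
 obtain A0 where A0: "A0 > 0" "\<And>u g. (u, g) \<in> VV \<Longrightarrow> A0 \<le> kin g" by (rule kin_lower) blast
 define t where "t n = inverse (real (Suc n))" for n
 have t: "t n > 0" "t n \<le> 1" for n by (auto simp: t_def inverse_eq_divide)
 have t0: "t \<longlonglongrightarrow> 0" unfolding t_def by (rule LIMSEQ_inverse_real_of_nat)
 have "\<exists>q. q \<in> VV \<and> EV (fst q) (snd q) < mm + d / 2 * t n" for n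
  using cInf_lessD[of "(\<lambda>(u, g). EV u g) ` VV" "mm + d / 2 * t n"] VV_nonempty d t(1)[of n] unfolding mm_def[symmetric] by fastforce
 then have "\<exists>q. \<forall>n. q n \<in> VV \<and> EV (fst (q n)) (snd (q n)) < mm + d / 2 * t n" by (intro choice) blast
 then obtain q where q: "\<And>n. q n \<in> VV" "\<And>n. EV (fst (q n)) (snd (q n)) < mm + d / 2 * t n" by blast
 define u where "u n = fst (q n)" for n
 define g where "g n = snd (q n)" for n
 have V: "(u n, g n) \<in> VV" for n using q(1)[of n] by (simp add: u_def g_def)
 have E: "EV (u n) (g n) < mm + d / 2 * t n" for n using q(2)[of n] by (simp add: u_def g_def)
 have E2: "EV (u n) (g n) < mm + d / 2" for n
 proof -
  have "d / 2 * t n \<le> d / 2 * 1" using d by (intro mult_left_mono t) simp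
  then show ?thesis using E[of n] by linarith
 qed
 have Elim: "(\<lambda>n. EV (u n) (g n)) \<longlonglongrightarrow> mm"
 proof (rule tendsto_sandwich[of "\<lambda>_. mm"])
  have "(\<lambda>n. mm + d / 2 * t n) \<longlonglongrightarrow> mm + d / 2 * 0" by (intro tendsto_intros t0)
  then show "(\<lambda>n. mm + d / 2 * t n) \<longlonglongrightarrow> mm" by simp
 qed (use mm_le[OF V] less_imp_le[OF E] in auto)
 define A1 where "A1 = 4 / a * (mm + d / 2)"
 have A1: "kin (g n) \<le> A1" for n
 proof -
  have "a / 4 * kin (g n) \<le> mm + d / 2" using JV_ge_kin[of "g n" "u n"] VV_E[OF V] E2[of n] by simp
  then show ?thesis using a by (simp add: A1_def field_simps)
 qed
 define b0 where "b0 = p * (d / 2) / (T / A0) powr (s / 2)"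
 have TA: "(T / A0) powr (s / 2) > 0" using T(1) A0(1) by simp
 have b0: "b0 > 0" using p d TA by (simp add: b0_def)
 have Bb0: "b0 \<le> ppow p (u n)" for n
 proof -
  have "d / 2 \<le> (T / kin (g n)) powr (s / 2) * ppow p (u n) / p"
   using EV_ge_e0[OF V[of n] T(1)] E2[of n] by (simp add: d_def field_simps)
  also have "\<dots> \<le> (T / A0) powr (s / 2) * ppow p (u n) / p"
  proof (intro divide_right_mono mult_right_mono powr_mono2 divide_left_mono A0(2)[OF V])
   show "0 < kin (g n) * A0" using A0(1) A0(2)[OF V, of n] by simp
  qed (use p s T functionals_nonneg A0(1) A0(2)[OF V, of n] in auto)
  finally have "p * (d / 2) \<le> (T / A0) powr (s / 2) * ppow p (u n)" using p by (simp add: field_simps)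
  then show ?thesis unfolding b0_def using TA by (simp add: pos_divide_le_eq mult.commute)
 qed
 have S: "sob (u n) (g n)" "PV (u n) (g n) = 0" for n using V[of n] by (auto simp: VV_def)
 have A1p: "A1 \<ge> 0" using A1[of 0] functionals_nonneg(2)[of "g 0"] by linarith
 define C1 where "C1 = SQ * A1^3"
 define B1 where "B1 = p / s * (a * A1 + b * A1^2)"
 have C1: "six (u n) \<le> C1" for n
  unfolding C1_def by (rule order_trans[OF six_le[OF S(1)]]) (use A1 SQ_pos functionals_nonneg in \<open>auto intro!: mult_left_mono power_mono\<close>)
 have B1: "ppow p (u n) \<le> B1" for n
 proof -
  have "s / p * ppow p (u n) \<le> a * kin (g n) + b * (kin (g n))^2" using S(2)[of n] functionals_nonneg(4)[of "u n"] unfolding PV_def Po_def by linarith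
  also have "\<dots> \<le> a * A1 + b * A1^2" using A1 a b functionals_nonneg by (intro add_mono mult_left_mono power_mono) auto
  finally show ?thesis using s p by (simp add: B1_def field_simps)
 qed
 define f where "f n = (kin (g n), ppow p (u n), six (u n))" for n
 have "range f \<subseteq> {0..A1} \<times> {0..B1} \<times> {0..C1}" using A1 B1 C1 functionals_nonneg by (auto simp: f_def)
 then have "bounded (range f)" by (rule bounded_subset[rotated]) (intro bounded_Times bounded_closed_interval)
 then obtain l r where r: "strict_mono (r :: nat \<Rightarrow> nat)" and l: "(f \<circ> r) \<longlonglongrightarrow> l"
  using bounded_imp_convergent_subsequence[of f] by blast
 show ?thesis
 proof (rule that[of "\<lambda>n. u (r n)" "\<lambda>n. g (r n)"])
  show "(\<lambda>n. EV (u (r n)) (g (r n))) \<longlonglongrightarrow> mm" using LIMSEQ_subseq_LIMSEQ[OF Elim r] by (simp add: o_def)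
  show "(\<lambda>n. kin (g (r n))) \<longlonglongrightarrow> fst l" using tendsto_fst[OF l] by (simp add: f_def o_def)
  show "(\<lambda>n. ppow p (u (r n))) \<longlonglongrightarrow> fst (snd l)" using tendsto_fst[OF tendsto_snd[OF l]] by (simp add: f_def o_def)
  show "(\<lambda>n. six (u (r n))) \<longlonglongrightarrow> snd (snd l)" using tendsto_snd[OF tendsto_snd[OF l]] by (simp add: f_def o_def)
 qed (use V A1 b0 Bb0 in auto)
qed

theorem minimizer_exists:
 obtains u g where "(u, g) \<in> VV" "EV u g = mm"
proof -
 obtain u0 g0 A B C A1 b0 where V0: "\<And>n::nat. (u0 n, g0 n) \<in> VV" and E0: "(\<lambda>n. EV (u0 n) (g0 n)) \<longlonglongrightarrow> mm"
  and lA0: "(\<lambda>n. kin (g0 n)) \<longlonglongrightarrow> A" and lB0: "(\<lambda>n. ppow p (u0 n)) \<longlonglongrightarrow> B" and lC0: "(\<lambda>n. six (u0 n)) \<longlonglongrightarrow> C"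
  and A1: "\<And>n. kin (g0 n) \<le> A1" and b0: "b0 > 0" "\<And>n. b0 \<le> ppow p (u0 n)"
  by (rule minimizing_sequence) blast
 have S0: "sob (u0 n) (g0 n)" "mass (u0 n) = c^2" "PV (u0 n) (g0 n) = 0" for n using V0[of n] by (auto simp: VV_def)
 have M0: "(LBINT x. (u0 n x)^2) \<le> c^2" for n using S0(2)[of n] by (simp add: mass_def)
 have p10: "10/3 \<le> p" using p by simp
 obtain r y U G where r: "strict_mono (r :: nat \<Rightarrow> nat)" and UG: "sob U G" and ae: "AE x in lborel. (\<lambda>n. u0 (r n) (x + y n)) \<longlonglongrightarrow> U x"
  and MU: "(LBINT x. (U x)^2) > 0" and lG: "(\<lambda>n. LBINT x. g0 (r n) (x + y n) \<bullet> G x) \<longlonglongrightarrow> (nsq G)"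
  by (rule concentration_compactness[where u = u0 and g = g0, OF S0(1) M0 A1[unfolded kin_def] p10 p(2) b0(1) b0(2)[unfolded ppow_def]]) blast
 have MU: "mass U > 0" using MU by (simp add: mass_def)
 define v where "v n x = u0 (r n) (x + y n)" for n x
 define h where "h n x = g0 (r n) (x + y n)" for n x
 note sh = functionals_shift[OF S0(1)]
 have vh: "sob (v n) (h n)" and vM: "mass (v n) = c^2" and vA: "kin (h n) = kin (g0 (r n))" and vB: "ppow p (v n) = ppow p (u0 (r n))" and vC: "six (v n) = six (u0 (r n))" for n
  unfolding v_def h_def by (rule sh(1), subst sh(2)[of "r n" "y n"], rule S0(2), rule sh(3), rule sh(4), rule sh(5))
 have lA: "(\<lambda>n. kin (h n)) \<longlonglongrightarrow> A" and lB: "(\<lambda>n. ppow p (v n)) \<longlonglongrightarrow> B" and lC: "(\<lambda>n. six (v n)) \<longlonglongrightarrow> C"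
  unfolding vA vB vC using LIMSEQ_subseq_LIMSEQ[OF lA0 r] LIMSEQ_subseq_LIMSEQ[OF lB0 r] LIMSEQ_subseq_LIMSEQ[OF lC0 r] by (simp_all add: o_def)
 have ae: "AE x in lborel. (\<lambda>n. v n x) \<longlonglongrightarrow> U x" using ae by (simp add: v_def)
 have wS: "sob (\<lambda>x. v n x - U x) (\<lambda>x. h n x - G x)" for n by (rule sob_diff[OF vh UG])
 have BL: "(\<lambda>n. ppow q (\<lambda>x. v n x - U x)) \<longlonglongrightarrow> L - ppow q U" if q: "2 \<le> q" "q \<le> 6" and L: "(\<lambda>n. ppow q (v n)) \<longlonglongrightarrow> L" for q L
 proof -
  obtain K where K: "\<And>n. ppow q (v n) \<le> K"
  proof -
   have "Bseq (\<lambda>n. ppow q (v n))" using L convergentI convergent_imp_Bseq by blast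
   then obtain K where "\<And>n. norm (ppow q (v n)) \<le> K" unfolding Bseq_def by blast
   then have "\<And>n. ppow q (v n) \<le> K" using abs_ge_self order_trans unfolding real_norm_def by blast
   then show ?thesis by (rule that)
  qed
  have "(\<lambda>n. ppow q (v n) - ppow q (\<lambda>x. v n x - U x)) \<longlonglongrightarrow> ppow q U" unfolding ppow_def
  proof (rule brezis_lieb)
   show "(LBINT x. \<bar>v n x\<bar> powr q) \<le> K" for n using K[of n] by (simp add: ppow_def)
   show "AE x in lborel. (\<lambda>n. v n x) \<longlonglongrightarrow> U x" by (rule ae)
  qed (use q ppow_integrable[OF vh] sobD(4)[OF vh] sobD(4)[OF UG] in auto)
  from tendsto_diff[OF L this] show ?thesis by simp
 qed
 \<comment> \<open>Mass and sixth power integral are the cases 2 and 6 of \<open>ppow\<close>, so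
   one splitting statement serves all three integrals.\<close>
 have m2: "mass f = ppow 2 f" and m6: "six f = ppow 6 f" for f by (simp_all add: mass_def six_def ppow_def abs_powr_even)
 have wM: "(\<lambda>n. mass (\<lambda>x. v n x - U x)) \<longlonglongrightarrow> c^2 - mass U"
  unfolding m2 by (rule BL) (simp_all add: m2[symmetric] vM)
 have wB: "(\<lambda>n. ppow p (\<lambda>x. v n x - U x)) \<longlonglongrightarrow> B - ppow p U" by (rule BL[OF _ _ lB]) (use p in auto)
 have wC: "(\<lambda>n. six (\<lambda>x. v n x - U x)) \<longlonglongrightarrow> C - six U"
  unfolding m6 by (rule BL) (use lC in \<open>simp_all add: m6[symmetric]\<close>)
 have wA: "(\<lambda>n. kin (\<lambda>x. h n x - G x)) \<longlonglongrightarrow> A - kin G"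
 proof -
  have "(\<lambda>n. kin (h n) - 2 * (LBINT x. h n x \<bullet> G x) + kin G) \<longlonglongrightarrow> A - 2 * kin G + kin G"
   by (intro tendsto_intros lA) (use lG in \<open>simp add: h_def kin_def\<close>)
  then show ?thesis by (simp add: kin_diff[OF sobD(2)[OF vh] sobD(2)[OF UG]])
 qed
 have le: "kin G \<le> A" "ppow p U \<le> B" "six U \<le> C" "mass U \<le> c^2"
  using LIMSEQ_le_const[OF wA, of 0] LIMSEQ_le_const[OF wB, of 0] LIMSEQ_le_const[OF wC, of 0] LIMSEQ_le_const[OF wM, of 0] functionals_nonneg by auto
 have JABC: "Jo A B C = mm"
 proof -
  have "(\<lambda>n. Jo (kin (g0 n)) (ppow p (u0 n)) (six (u0 n))) \<longlonglongrightarrow> Jo A B C" by (rule tendsto_Jo[OF lA0 lB0 lC0])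
  then have "(\<lambda>n. EV (u0 n) (g0 n)) \<longlonglongrightarrow> Jo A B C" unfolding VV_E[OF V0] JV_def .
  then show ?thesis using E0 LIMSEQ_unique by blast
 qed
 have PABC: "Po A B C = 0"
 proof -
  have "(\<lambda>n. Po (kin (g0 n)) (ppow p (u0 n)) (six (u0 n))) \<longlonglongrightarrow> Po A B C" by (rule tendsto_Po[OF lA0 lB0 lC0])
  then have "(\<lambda>n. 0) \<longlonglongrightarrow> Po A B C" unfolding PV_def[symmetric] S0(3) .
  then show ?thesis using LIMSEQ_unique tendsto_const by blast
 qed
 have "PV U G \<le> 0"
 proof (rule ccontr)
  assume "\<not> ?thesis"
  then have PU: "PV U G > 0" by simp
  \<comment> \<open>Limit of P along the remainders. By \<open>Po_diff\<close> it is - P(U) minus a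
    cross term that is non-negative since \<open>kin G\<close> \<le> A.\<close>
  define L where "L = Po (A - kin G) (B - ppow p U) (C - six U)"
  have "0 \<le> 2 * b * kin G * (A - kin G)" using b le(1) functionals_nonneg by simp
  then have L: "L < 0" unfolding L_def Po_diff PABC using PU unfolding PV_def by linarith
  have "(\<lambda>n. PV (\<lambda>x. v n x - U x) (\<lambda>x. h n x - G x)) \<longlonglongrightarrow> L" unfolding PV_def L_def by (rule tendsto_Po[OF wA wB wC])
  then have e1: "\<forall>\<^sub>F n in sequentially. PV (\<lambda>x. v n x - U x) (\<lambda>x. h n x - G x) < 0" by (rule order_tendstoD(2)[OF _ L])
  have e2: "\<forall>\<^sub>F n in sequentially. mass (\<lambda>x. v n x - U x) < c^2" by (rule order_tendstoD(2)[OF wM]) (use MU in simp)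
  have "\<forall>\<^sub>F n in sequentially. mm \<le> JV (\<lambda>x. v n x - U x) (\<lambda>x. h n x - G x)"
   using e1 e2
  proof eventually_elim
   case (elim n)
   let ?w = "\<lambda>x. v n x - U x" and ?k = "\<lambda>x. h n x - G x"
   \<comment> \<open>\<open>mm_le_JV\<close> asks for positive mass; a remainder that vanishes
     almost everywhere would have P \<ge> 0, against the choice of n.\<close>
   have "mass ?w \<noteq> 0"
   proof
    assume "mass ?w = 0"
    then have z: "AE x in lborel. ?w x = 0" by (rule mass_0_AE[OF wS])
    have "AE x in lborel. \<bar>?w x\<bar> powr p = 0" using z by eventually_elim simp
    then have "ppow p ?w = 0" unfolding ppow_def by (rule integral_eq_zero_AE)
    moreover have "AE x in lborel. ?w x^6 = 0" using z by eventually_elim simp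
    then have "six ?w = 0" unfolding six_def by (rule integral_eq_zero_AE)
    ultimately have "PV ?w ?k \<ge> 0" using a b functionals_nonneg(2)[of ?k] by (simp add: PV_def Po_def)
    then show False using elim by simp
   qed
   then have "mass ?w > 0" using functionals_nonneg(1)[of ?w] by simp
   then show ?case using elim by (intro mm_le_JV wS) auto
  qed
  moreover have "(\<lambda>n. JV (\<lambda>x. v n x - U x) (\<lambda>x. h n x - G x)) \<longlonglongrightarrow> mm - JV U G"
   using tendsto_Jo[OF wA wB wC] unfolding Jo_diff JABC JV_def .
  ultimately have "mm \<le> mm - JV U G" by (intro tendsto_lowerbound) auto
  moreover have "six U > 0" by (rule mass_pos_imp(1)[OF UG MU])
  then have "JV U G > 0" using JV_ge_six[of U G] by simp
  ultimately show False by simp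
 qed
 then obtain w k where w: "(w, k) \<in> VV" "EV w k \<le> JV U G" by (rule VV_project[OF UG MU le(4)])
 \<comment> \<open>The limits A, B, C dominate the integrals of U and \<open>Jo\<close> is monotone,
   so the projection of U, with energy at most JV U G, can only attain the infimum.\<close>
 have "JV U G \<le> mm" unfolding JABC[symmetric] JV_def by (rule Jo_mono[OF le(1-3)])
 then have "EV w k = mm" using w mm_le[OF w(1)] by simp
 then show ?thesis by (rule that[OF w(1)])
qed

end

section \<open>Euler--Lagrange equation\<close>

lemma abs_powr_deriv:
 fixes q :: real assumes q: "q \<ge> 2"
 shows "((\<lambda>x::real. \<bar>x\<bar> powr q) has_real_derivative q * (\<bar>x\<bar> powr (q - 2) * x)) (at x)"
proof (cases x "0::real" rule: linorder_cases)
 case greater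
 have "((\<lambda>x::real. x powr q) has_real_derivative q * x powr (q - 1)) (at x)"
  using greater by (auto intro!: derivative_eq_intros)
 moreover have "x powr (q - 1) = \<bar>x\<bar> powr (q - 2) * x" using greater powr_add[of x "q - 2" 1] by simp
 moreover have "\<forall>\<^sub>F y in nhds x. \<bar>y\<bar> powr q = y powr q"
 proof -
  have "\<forall>\<^sub>F y in nhds x. y \<in> {0<..}" by (rule eventually_nhds_in_open) (use greater in auto)
  then show ?thesis by eventually_elim simp
 qed
 ultimately show ?thesis by (subst DERIV_cong_ev[OF refl _ refl, of _ "\<lambda>y. y powr q"]) auto
next
 case less
 have "(- x) powr (q - 1) * (- 1) = \<bar>x\<bar> powr (q - 2) * x" using less powr_add[of "- x" "q - 2" 1] by simp
 moreover have "((\<lambda>x::real. (- x) powr q) has_real_derivative q * ((- x) powr (q - 1) * (- 1))) (at x)"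
  using less by (auto intro!: derivative_eq_intros)
 ultimately have "((\<lambda>x::real. (- x) powr q) has_real_derivative q * (\<bar>x\<bar> powr (q - 2) * x)) (at x)" by (simp only:)
 moreover have "\<forall>\<^sub>F y in nhds x. \<bar>y\<bar> powr q = (- y) powr q"
 proof -
  have "\<forall>\<^sub>F y in nhds x. y \<in> {..<0}" by (rule eventually_nhds_in_open) (use less in auto)
  then show ?thesis by eventually_elim simp
 qed
 ultimately show ?thesis by (subst DERIV_cong_ev[OF refl _ refl, of _ "\<lambda>y. (- y) powr q"]) auto
next
 case equal
 have "((\<lambda>h. (\<bar>0 + h\<bar> powr q - \<bar>0\<bar> powr q) / h) \<longlongrightarrow> 0) (at (0::real))"
 proof (rule Lim_null_comparison)
  show "\<forall>\<^sub>F h in at (0::real). norm ((\<bar>0 + h\<bar> powr q - \<bar>0\<bar> powr q) / h) \<le> \<bar>h\<bar> powr (q - 1)"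
   unfolding eventually_at_filter
   by (intro always_eventually allI impI) (use q in \<open>simp add: powr_diff\<close>)
  have "((\<lambda>h::real. \<bar>h\<bar> powr (q - 1)) \<longlongrightarrow> \<bar>0\<bar> powr (q - 1)) (at 0)"
   by (intro tendsto_powr' tendsto_rabs tendsto_ident_at tendsto_const) (use q in auto)
  then show "((\<lambda>h::real. \<bar>h\<bar> powr (q - 1)) \<longlongrightarrow> 0) (at 0)" using q by simp
 qed
 then show ?thesis unfolding DERIV_def equal by simp
qed

text \<open>Mean value bound on the ball of radius |x| + |y|, independent of e; it is the majorant
  for differentiating under the integral.\<close>

lemma abs_powr_increment:
 fixes q x y :: real assumes q: "q \<ge> 2" and e: "e \<noteq> 0" "\<bar>e\<bar> \<le> 1"
 shows "\<bar>(\<bar>x + e * y\<bar> powr q - \<bar>x\<bar> powr q) / e\<bar> \<le> q * 2 powr q * (\<bar>x\<bar> powr q + \<bar>y\<bar> powr q)"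
proof -
 define R where "R = \<bar>x\<bar> + \<bar>y\<bar>"
 have R: "\<bar>x\<bar> \<le> R" "\<bar>y\<bar> \<le> R" "R \<ge> 0" by (auto simp: R_def)
 have "\<bar>e * y\<bar> \<le> 1 * \<bar>y\<bar>" unfolding abs_mult by (intro mult_right_mono e) simp
 then have xe: "\<bar>x + e * y\<bar> \<le> R" unfolding R_def by linarith
 have "norm (\<bar>x + e * y\<bar> powr q - \<bar>x\<bar> powr q) \<le> q * R powr (q - 1) * norm (x + e * y - x)"
 proof (rule field_differentiable_bound[of "cball 0 R"])
  show "((\<lambda>x. \<bar>x\<bar> powr q) has_field_derivative q * (\<bar>z\<bar> powr (q - 2) * z)) (at z within cball 0 R)" for z
   by (rule has_field_derivative_at_within[OF abs_powr_deriv[OF q]])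
  fix z :: real assume "z \<in> cball 0 R"
  then have z: "\<bar>z\<bar> \<le> R" by simp
  have "\<bar>z\<bar> powr (q - 2) * \<bar>z\<bar> = \<bar>z\<bar> powr (q - 1)" using powr_add[of "\<bar>z\<bar>" "q - 2" 1] by simp
  then have "norm (q * (\<bar>z\<bar> powr (q - 2) * z)) = q * \<bar>z\<bar> powr (q - 1)" using q by (simp add: abs_mult)
  also have "\<dots> \<le> q * R powr (q - 1)" using q by (intro mult_left_mono powr_mono2 z) auto
  finally show "norm (q * (\<bar>z\<bar> powr (q - 2) * z)) \<le> q * R powr (q - 1)" .
 qed (use R xe in auto)
 then have "\<bar>(\<bar>x + e * y\<bar> powr q - \<bar>x\<bar> powr q) / e\<bar> \<le> q * R powr (q - 1) * \<bar>y\<bar>" using e by (simp add: abs_mult field_simps)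
 also have "\<dots> \<le> q * R powr (q - 1) * R" using q R by (intro mult_left_mono) auto
 also have "\<dots> = q * R powr q" using powr_add[of R "q - 1" 1] R by simp
 also have "R powr q \<le> 2 powr q * (\<bar>x\<bar> powr q + \<bar>y\<bar> powr q)"
  using powr_diff_le[of q "\<bar>x\<bar>" "- \<bar>y\<bar>"] q by (simp add: R_def)
 finally show ?thesis using q by (simp add: mult_left_mono mult.assoc)
qed

lemma ppow_deriv:
 fixes u \<phi> :: "real^3 \<Rightarrow> real"
 assumes u: "sob u g" and \<phi>: "sob \<phi> k" and q: "2 \<le> q" "q \<le> 6"
 shows "integrable lborel (\<lambda>x. \<bar>u x\<bar> powr (q - 2) * u x * \<phi> x)"
  "((\<lambda>e. ppow q (\<lambda>x. u x + e * \<phi> x)) has_real_derivative q * (LBINT x. \<bar>u x\<bar> powr (q - 2) * u x * \<phi> x)) (at 0)"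
proof -
 note [measurable] = sobD(4)[OF u] sobD(4)[OF \<phi>]
 note iu = ppow_integrable[OF u q] and i\<phi> = ppow_integrable[OF \<phi> q]
 have ie: "integrable lborel (\<lambda>x. \<bar>u x + e * \<phi> x\<bar> powr q)" for e
  by (rule ppow_integrable[OF sob_add[OF u sob_scale[OF \<phi>, of e]] q])
 let ?w = "\<lambda>x. q * 2 powr q * (\<bar>u x\<bar> powr q + \<bar>\<phi> x\<bar> powr q)"
 have iw: "integrable lborel ?w" by (intro integrable_mult_right lintegrable_add iu i\<phi>)
 let ?D = "\<lambda>x. q * (\<bar>u x\<bar> powr (q - 2) * u x) * \<phi> x"
 have lim: "(\<lambda>n. (\<bar>u x + X n * \<phi> x\<bar> powr q - \<bar>u x\<bar> powr q) / X n) \<longlonglongrightarrow> ?D x"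
  if X: "\<forall>i. X i \<in> UNIV - {0}" "X \<longlonglongrightarrow> 0" for X :: "nat \<Rightarrow> real" and x
 proof -
  have "((\<lambda>e. \<bar>u x + e * \<phi> x\<bar> powr q) has_real_derivative (q * (\<bar>u x + 0 * \<phi> x\<bar> powr (q - 2) * (u x + 0 * \<phi> x))) * \<phi> x) (at 0)"
   by (rule DERIV_chain2[OF abs_powr_deriv[OF q(1)]]) (auto intro!: derivative_eq_intros)
  then have "((\<lambda>e. (\<bar>u x + e * \<phi> x\<bar> powr q - \<bar>u x\<bar> powr q) / e) \<longlongrightarrow> ?D x) (at 0)" unfolding DERIV_def by simp
  then show ?thesis using X unfolding tendsto_at_iff_sequentially by (auto simp: o_def)
 qed
 have bnd: "\<bar>(\<bar>u x + e * \<phi> x\<bar> powr q - \<bar>u x\<bar> powr q) / e\<bar> \<le> ?w x" if "e \<noteq> 0" "\<bar>e\<bar> \<le> 1" for x e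
  by (rule abs_powr_increment[OF q(1) that])
 \<comment> \<open>As a limit of difference quotients the derivative inherits their majorant, which
   yields its integrability.\<close>
 have Dw: "\<bar>?D x\<bar> \<le> ?w x" for x
 proof (rule LIMSEQ_le_const2)
  let ?X = "\<lambda>n. inverse (real (Suc n))"
  show "(\<lambda>n. \<bar>(\<bar>u x + ?X n * \<phi> x\<bar> powr q - \<bar>u x\<bar> powr q) / ?X n\<bar>) \<longlonglongrightarrow> \<bar>?D x\<bar>"
   by (intro tendsto_rabs lim LIMSEQ_inverse_real_of_nat) auto
  have "\<bar>(\<bar>u x + ?X n * \<phi> x\<bar> powr q - \<bar>u x\<bar> powr q) / ?X n\<bar> \<le> ?w x" for n
   by (rule bnd) (auto simp: inverse_eq_divide)
  then show "\<exists>N. \<forall>n\<ge>N. \<bar>(\<bar>u x + ?X n * \<phi> x\<bar> powr q - \<bar>u x\<bar> powr q) / ?X n\<bar> \<le> ?w x" by blast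
 qed
 have "integrable lborel ?D"
  by (rule lintegrable_bound[OF iw]) (use Dw in \<open>auto intro!: AE_I2 order_trans[OF _ abs_ge_self]\<close>)
 from integrable_mult_right[OF this, of "1/q"] show "integrable lborel (\<lambda>x. \<bar>u x\<bar> powr (q - 2) * u x * \<phi> x)"
  using q by (simp add: mult.assoc)
 have "((\<lambda>e. (ppow q (\<lambda>x. u x + e * \<phi> x) - ppow q u) / e) \<longlongrightarrow> (LBINT x. ?D x)) (at 0)"
  unfolding tendsto_at_iff_sequentially
 proof (intro allI impI)
  fix X :: "nat \<Rightarrow> real" assume X: "\<forall>i. X i \<in> UNIV - {0}" "X \<longlonglongrightarrow> 0"
  have e: "(ppow q (\<lambda>x. u x + X n * \<phi> x) - ppow q u) / X n = (LBINT x. (\<bar>u x + X n * \<phi> x\<bar> powr q - \<bar>u x\<bar> powr q) / X n)" for n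
   unfolding ppow_def using ie[of "X n"] iu by (simp add: lint_diff)
  have "\<forall>\<^sub>F n in sequentially. norm (X n) < 1" using order_tendstoD(2)[OF tendsto_norm[OF X(2)], of 1] by simp
  then obtain N where N: "\<And>n. n \<ge> N \<Longrightarrow> \<bar>X n\<bar> < 1" by (auto simp: eventually_sequentially)
  have "(\<lambda>n. LBINT x. (\<bar>u x + X (n + N) * \<phi> x\<bar> powr q - \<bar>u x\<bar> powr q) / X (n + N)) \<longlonglongrightarrow> (LBINT x. ?D x)"
  proof (rule integral_dominated_convergence)
   show "integrable lborel ?w" by (rule iw)
   show "AE x in lborel. norm ((\<bar>u x + X (n + N) * \<phi> x\<bar> powr q - \<bar>u x\<bar> powr q) / X (n + N)) \<le> ?w x" for n
    unfolding real_norm_def by (rule AE_I2, rule bnd) (use X(1) N[of "n + N"] in auto)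
   show "AE x in lborel. (\<lambda>n. (\<bar>u x + X (n + N) * \<phi> x\<bar> powr q - \<bar>u x\<bar> powr q) / X (n + N)) \<longlonglongrightarrow> ?D x"
    using LIMSEQ_ignore_initial_segment[OF lim[OF X]] by simp
  qed measurable
  then have "(\<lambda>n. LBINT x. (\<bar>u x + X n * \<phi> x\<bar> powr q - \<bar>u x\<bar> powr q) / X n) \<longlonglongrightarrow> (LBINT x. ?D x)" by (rule LIMSEQ_offset)
  then show "((\<lambda>e. (ppow q (\<lambda>x. u x + e * \<phi> x) - ppow q u) / e) \<circ> X) \<longlonglongrightarrow> (LBINT x. ?D x)" unfolding o_def e .
 qed
 then show "((\<lambda>e. ppow q (\<lambda>x. u x + e * \<phi> x)) has_real_derivative q * (LBINT x. \<bar>u x\<bar> powr (q - 2) * u x * \<phi> x)) (at 0)"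
  unfolding DERIV_def by (simp add: mult.assoc)
qed

lemma quadratic_deriv:
 fixes P m n :: real
 assumes "\<And>e. F e = P + 2 * e * m + e^2 * n" shows "(F has_real_derivative 2 * m) (at 0)"
proof -
 have "((\<lambda>e. P + 2 * e * m + e^2 * n) has_real_derivative 2 * m) (at 0)" by (auto intro!: derivative_eq_intros)
 moreover have "F = (\<lambda>e. P + 2 * e * m + e^2 * n)" by (rule ext) (rule assms)
 ultimately show ?thesis by (simp only:)
qed

lemma mass_kin_deriv:
 fixes u \<phi> :: "real^3 \<Rightarrow> real"
 assumes u: "sob u g" and \<phi>: "sob \<phi> k"
 shows "((\<lambda>e. mass (\<lambda>x. u x + e * \<phi> x)) has_real_derivative 2 * (LBINT x. u x * \<phi> x)) (at 0)"
  "((\<lambda>e. kin (\<lambda>x. g x + e *\<^sub>R k x)) has_real_derivative 2 * (LBINT x. g x \<bullet> k x)) (at 0)"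
proof -
 have i: "integrable lborel (\<lambda>x. u x * \<phi> x)" "integrable lborel (\<lambda>x. g x \<bullet> k x)"
  using Lq2_inner[OF sobD(1)[OF u] sobD(1)[OF \<phi>]] Lq2_inner[OF sobD(2)[OF u] sobD(2)[OF \<phi>]] by auto
 show "((\<lambda>e. mass (\<lambda>x. u x + e * \<phi> x)) has_real_derivative 2 * (LBINT x. u x * \<phi> x)) (at 0)"
 proof (rule quadratic_deriv)
  fix e
  have "(u x + e * \<phi> x)^2 = (u x)^2 + 2 * e * (u x * \<phi> x) + e^2 * (\<phi> x)^2" for x by (simp add: power2_sum power_mult_distrib)
  then show "mass (\<lambda>x. u x + e * \<phi> x) = mass u + 2 * e * (LBINT x. u x * \<phi> x) + e^2 * mass \<phi>"
   unfolding mass_def using i sobD(6)[OF u] sobD(6)[OF \<phi>] by simp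
 qed
 show "((\<lambda>e. kin (\<lambda>x. g x + e *\<^sub>R k x)) has_real_derivative 2 * (LBINT x. g x \<bullet> k x)) (at 0)"
 proof (rule quadratic_deriv)
  fix e
  have "(norm (g x + e *\<^sub>R k x))^2 = (norm (g x))^2 + 2 * e * (g x \<bullet> k x) + e^2 * (norm (k x))^2" for x
   unfolding power2_norm_eq_inner by (simp add: inner_add_left inner_add_right inner_commute power2_eq_square algebra_simps)
  then show "kin (\<lambda>x. g x + e *\<^sub>R k x) = kin g + 2 * e * (LBINT x. g x \<bullet> k x) + e^2 * kin k"
   unfolding kin_def using i sobD(7)[OF u] sobD(7)[OF \<phi>] by simp
 qed
qed

section \<open>First variation at the minimiser\<close>

context kirchhoff
begin

text \<open>P on the dilation fibre divided by t^4. As s \<ge> 4, every term is non-increasing in t,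
  and the first one strictly decreases when A > 0.\<close>

definition Fo :: "real \<Rightarrow> real \<Rightarrow> real \<Rightarrow> real \<Rightarrow> real" where
 "Fo A B C t = a * A / t^2 + b * A^2 - s / p * B * t powr (s - 4) - C * t^2"

lemma Po_Fo: "t > 0 \<Longrightarrow> Po (t^2 * A) (t powr s * B) (t^6 * C) = t^4 * Fo A B C t"
 unfolding Po_def Fo_def by (simp add: powr_diff powr_numeral power_mult_distrib field_simps) (simp add: eval_nat_numeral)

lemma Fo_antimono:
 assumes "A \<ge> 0" "B \<ge> 0" "C \<ge> 0" "0 < t" "t \<le> t'"
 shows "Fo A B C t' \<le> Fo A B C t"
 unfolding Fo_def using assms a s p
 by (intro diff_mono add_mono divide_left_mono mult_left_mono powr_mono2 power_mono order_refl) auto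

lemma Fo_strict:
 assumes "A > 0" "B \<ge> 0" "C \<ge> 0" "0 < t" "t < t'"
 shows "Fo A B C t' < Fo A B C t"
proof -
 have "a * A / t'^2 < a * A / t^2" using assms a by (intro divide_strict_left_mono power_strict_mono) auto
 moreover have "s / p * B * t powr (s - 4) \<le> s / p * B * t' powr (s - 4)" by (intro mult_left_mono powr_mono2) (use assms s p in auto)
 moreover have "C * t^2 \<le> C * t'^2" by (intro mult_left_mono power_mono) (use assms in auto)
 ultimately show ?thesis unfolding Fo_def by linarith
qed

text \<open>Strict monotonicity traps the roots: the limiting \<open>Fo\<close> is negative to the
  right of 1 and positive to the left, the perturbed ones have the same sign eventually, and each of
  them is monotone in t. Continuity of the root at the unperturbed point is all that the first
  variation uses.\<close>

lemma root_tendsto_1: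
 assumes A: "An \<longlonglongrightarrow> A" and B: "Bn \<longlonglongrightarrow> B" and C: "Cn \<longlonglongrightarrow> C" and nn: "A > 0" "B \<ge> 0" "C \<ge> 0"
  and nnn: "\<And>n. An n \<ge> 0" "\<And>n. Bn n \<ge> 0" "\<And>n. Cn n \<ge> 0"
  and 0: "Po A B C = 0" and t: "\<And>n. tn n > 0" "\<forall>\<^sub>F n in sequentially. Po ((tn n)^2 * An n) (tn n powr s * Bn n) (tn n^6 * Cn n) = 0"
 shows "tn \<longlonglongrightarrow> 1"
proof -
 have F1: "Fo A B C 1 = 0" using Po_Fo[of 1 A B C] 0 by simp
 have lim: "(\<lambda>n. Fo (An n) (Bn n) (Cn n) t) \<longlonglongrightarrow> Fo A B C t" if "t > 0" for t
  unfolding Fo_def by (intro tendsto_intros A B C) (use that in auto)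
 have z: "\<forall>\<^sub>F n in sequentially. Fo (An n) (Bn n) (Cn n) (tn n) = 0"
  using t(2)
 proof eventually_elim
  case (elim n)
  then show ?case unfolding Po_Fo[OF t(1)] using t(1)[of n] by simp
 qed
 show ?thesis
 proof (rule order_tendstoI)
  fix x :: real assume x: "1 < x"
  have "Fo A B C x < 0" using Fo_strict[of A B C 1 x] nn x F1 by simp
  then have "\<forall>\<^sub>F n in sequentially. Fo (An n) (Bn n) (Cn n) x < 0" using order_tendstoD(2)[OF lim] x by simp
  with z show "\<forall>\<^sub>F n in sequentially. tn n < x"
  proof eventually_elim
   case (elim n)
   show ?case using Fo_antimono[OF nnn(1-3)[of n], of x "tn n"] elim x by (cases "tn n < x") auto
  qed
 next
  fix x :: real assume x: "x < 1"
  show "\<forall>\<^sub>F n in sequentially. x < tn n"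
  proof (cases "x \<le> 0")
   case True
   then have "x < tn n" for n using t(1)[of n] by linarith
   then show ?thesis by simp
  next
   case False
   then have x0: "x > 0" by simp
   have "Fo A B C x > 0" using Fo_strict[of A B C x 1] nn x x0 F1 by simp
   then have "\<forall>\<^sub>F n in sequentially. Fo (An n) (Bn n) (Cn n) x > 0" using order_tendstoD(1)[OF lim[OF x0]] by simp
   with z show "\<forall>\<^sub>F n in sequentially. x < tn n"
   proof eventually_elim
    case (elim n)
    show ?case using Fo_antimono[OF nnn(1-3)[of n] t(1)[of n], of x] elim by (cases "x < tn n") auto
   qed
  qed
 qed
qed

text \<open>The derivative of the energy along the perturbation normalised to mass c^2. The
  subtracted terms divided by c^2 come from the normalising factor, whose derivative is minus the
  pairing of u and \<phi> over c^2.\<close>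

definition dirD :: "(real^3 \<Rightarrow> real) \<Rightarrow> (real^3 \<Rightarrow> real^3) \<Rightarrow> (real^3 \<Rightarrow> real) \<Rightarrow> (real^3 \<Rightarrow> real^3) \<Rightarrow> real" where
 "dirD u g \<phi> k = (a + b * kin g) * ((LBINT x. g x \<bullet> k x) - (LBINT x. u x * \<phi> x) * kin g / c^2)
   - ((LBINT x. \<bar>u x\<bar> powr (p - 2) * u x * \<phi> x) - (LBINT x. u x * \<phi> x) * ppow p u / c^2)
   - ((LBINT x. \<bar>u x\<bar> powr 4 * u x * \<phi> x) - (LBINT x. u x * \<phi> x) * six u / c^2)"

text \<open>The minimiser also maximises the energy along its own dilation fibre. Hence the perturbation,
 normalised to mass \<open>c^2\<close> and dilated back onto the Pohozaev manifold, has at least the energy of the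
 equally dilated minimiser, and only the derivatives of the four functionals enter.\<close>

lemma dirD_nonneg:
 assumes ug: "(u, g) \<in> VV" "EV u g = mm" and \<phi>: "sob \<phi> k"
 shows "dirD u g \<phi> k \<ge> 0"
proof -
 have u: "sob u g" "mass u = c^2" "PV u g = 0" using ug(1) by (auto simp: VV_def)
 define A B C where "A = kin g" and "B = ppow p u" and "C = six u"
 have A: "A > 0" and C: "C > 0" using mass_pos_imp[OF u(1)] u(2) c by (auto simp: A_def C_def)
 have B: "B \<ge> 0" by (simp add: B_def functionals_nonneg)
 define m where "m = (LBINT x. u x * \<phi> x)"
 define v where "v e x = u x + e * \<phi> x" for e x
 define h where "h e x = g x + e *\<^sub>R k x" for e x
 have vh: "sob (v e) (h e)" for e unfolding v_def h_def by (rule sob_add[OF u(1) sob_scale[OF \<phi>]])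
 define \<alpha> where "\<alpha> e = c / sqrt (mass (v e))" for e
 define AA BB CC where "AA e = (\<alpha> e)^2 * kin (h e)" and "BB e = \<alpha> e powr p * ppow p (v e)" and "CC e = \<alpha> e^6 * six (v e)" for e
 have v0: "v 0 = u" "h 0 = g" by (auto simp: v_def h_def)
 have \<alpha>0: "\<alpha> 0 = 1" using c by (simp add: \<alpha>_def v0 u(2))
 have A0: "AA 0 = A" "BB 0 = B" "CC 0 = C" by (simp_all add: AA_def BB_def CC_def \<alpha>0 v0 A_def B_def C_def)
 have dm: "((\<lambda>e. mass (v e)) has_real_derivative 2 * m) (at 0)" unfolding v_def m_def by (rule mass_kin_deriv(1)[OF u(1) \<phi>])
 have d\<alpha>: "(\<alpha> has_real_derivative - m / c^2) (at 0)"
 proof -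
  have mp: "mass (v 0) > 0" using c by (simp add: v0 u(2))
  have "((\<lambda>e. sqrt (mass (v e))) has_real_derivative 1 / (2 * sqrt (mass (v 0))) * (2 * m)) (at 0)"
   by (rule DERIV_chain2[OF DERIV_real_sqrt_generic dm]) (use mp in \<open>auto simp: inverse_eq_divide\<close>)
  then have ds: "((\<lambda>e. sqrt (mass (v e))) has_real_derivative m / c) (at 0)" using c by (simp add: v0 u(2))
  have "((\<lambda>e. c / sqrt (mass (v e))) has_real_derivative (0 * sqrt (mass (v 0)) - c * (m / c)) / (sqrt (mass (v 0)) * sqrt (mass (v 0)))) (at 0)"
   by (rule DERIV_divide[OF DERIV_const ds]) (use mp in simp)
  then show ?thesis unfolding \<alpha>_def[abs_def] using c by (simp add: v0 u(2) power2_eq_square)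
 qed
 have dA: "(AA has_real_derivative 2 * (LBINT x. g x \<bullet> k x) - 2 * m * A / c^2) (at 0)"
 proof -
  have "((\<lambda>e. kin (h e)) has_real_derivative 2 * (LBINT x. g x \<bullet> k x)) (at 0)" unfolding h_def by (rule mass_kin_deriv(2)[OF u(1) \<phi>])
  then show ?thesis unfolding AA_def[abs_def] using d\<alpha> by (auto intro!: derivative_eq_intros simp: \<alpha>0 v0 A_def)
 qed
 have dB: "(BB has_real_derivative p * (LBINT x. \<bar>u x\<bar> powr (p - 2) * u x * \<phi> x) - p * m * B / c^2) (at 0)"
 proof -
  have 1: "((\<lambda>e. ppow p (v e)) has_real_derivative p * (LBINT x. \<bar>u x\<bar> powr (p - 2) * u x * \<phi> x)) (at 0)"
   unfolding v_def by (rule ppow_deriv(2)[OF u(1) \<phi>]) (use p in auto)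
  have "((\<lambda>y. y powr p) has_real_derivative p * 1 powr (p - 1)) (at (\<alpha> 0))" unfolding \<alpha>0 by (auto intro!: derivative_eq_intros)
  from DERIV_chain2[OF this d\<alpha>] have 2: "((\<lambda>e. \<alpha> e powr p) has_real_derivative p * (- m / c^2)) (at 0)" by simp
  from DERIV_mult[OF 2 1] show ?thesis unfolding BB_def[abs_def] by (simp add: \<alpha>0 v0 B_def)
 qed
 have dC: "(CC has_real_derivative 6 * (LBINT x. \<bar>u x\<bar> powr 4 * u x * \<phi> x) - 6 * m * C / c^2) (at 0)"
 proof -
  have "((\<lambda>e. ppow 6 (v e)) has_real_derivative 6 * (LBINT x. \<bar>u x\<bar> powr (6 - 2) * u x * \<phi> x)) (at 0)"
   unfolding v_def by (rule ppow_deriv(2)[OF u(1) \<phi>]) auto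
  then have "((\<lambda>e. six (v e)) has_real_derivative 6 * (LBINT x. \<bar>u x\<bar> powr 4 * u x * \<phi> x)) (at 0)"
   by (simp add: six_def ppow_def abs_powr_even)
  then show ?thesis unfolding CC_def[abs_def] using d\<alpha> by (auto intro!: derivative_eq_intros simp: \<alpha>0 v0 C_def)
 qed
 define e where "e n = inverse (real (Suc n))" for n
 have e: "e n > 0" for n by (simp add: e_def)
 have e_lim: "e \<longlonglongrightarrow> 0" unfolding e_def by (rule LIMSEQ_inverse_real_of_nat)
 have e_at: "filterlim e (at 0) sequentially" using e e_lim by (auto simp: filterlim_at less_imp_neq[symmetric])
 have cont: "(\<lambda>n. F (e n)) \<longlonglongrightarrow> F 0" if "(F has_real_derivative D) (at 0)" for F D
  using isCont_tendsto_compose[OF DERIV_isCont[OF that] e_lim] .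
 have quot: "(\<lambda>n. (F (e n) - F 0) / e n) \<longlonglongrightarrow> D" if "(F has_real_derivative D) (at 0)" for F D
  using filterlim_compose[OF that[unfolded DERIV_def] e_at] by simp
 have nn: "AA x \<ge> 0" "BB x \<ge> 0" "CC x \<ge> 0" for x by (simp_all add: AA_def BB_def CC_def functionals_nonneg)
 \<comment> \<open>The claims are conditional on positive mass, but t > 0 is demanded for every n;
   choice then yields a sequence that is positive throughout, as \<open>root_tendsto_1\<close>
   requires.\<close>
 have "\<forall>n. \<exists>t>0. mass (v (e n)) > 0 \<longrightarrow> Po (t^2 * AA (e n)) (t powr s * BB (e n)) (t^6 * CC (e n)) = 0 \<and>
   mm \<le> En (t^2 * AA (e n)) (t powr s * BB (e n)) (t^6 * CC (e n))"
 proof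
  fix n
  show "\<exists>t>0. mass (v (e n)) > 0 \<longrightarrow> Po (t^2 * AA (e n)) (t powr s * BB (e n)) (t^6 * CC (e n)) = 0 \<and>
   mm \<le> En (t^2 * AA (e n)) (t powr s * BB (e n)) (t^6 * CC (e n))"
  proof (cases "mass (v (e n)) > 0")
   case True
   have \<alpha>p: "\<alpha> (e n) > 0" using True c by (simp add: \<alpha>_def)
   note r = rescale[OF vh[of "e n"] \<alpha>p zero_less_one, simplified]
   have m1: "mass (\<lambda>x. \<alpha> (e n) * v (e n) x) = c^2" unfolding r(2) using True by (simp add: \<alpha>_def power_divide)
   have pos: "AA (e n) > 0" "CC (e n) > 0" using mass_pos_imp[OF vh True] \<alpha>p by (auto simp: AA_def CC_def)
   obtain t where t: "t > 0" "Po (t^2 * AA (e n)) (t powr s * BB (e n)) (t^6 * CC (e n)) = 0"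
    by (rule Po_root[OF pos(1) nn(2) pos(2)])
   obtain w h' where w: "sob w h'" "mass w = c^2" "kin h' = t^2 * AA (e n)" "ppow p w = t powr s * BB (e n)" "six w = t^6 * CC (e n)"
    by (rule dilate[where p = p, OF r(1) t(1), unfolded m1 r(3-) s_def[symmetric] AA_def[symmetric] BB_def[symmetric] CC_def[symmetric]]) blast
   have "(w, h') \<in> VV" using w(1,2) t(2) unfolding w(3-5)[symmetric] PV_def[symmetric] by (simp add: VV_def)
   from mm_le[OF this] have "mm \<le> En (t^2 * AA (e n)) (t powr s * BB (e n)) (t^6 * CC (e n))" unfolding EV_def w(3-5) .
   then show ?thesis using t by blast
  qed (use zero_less_one in blast)
 qed
 from choice[OF this] obtain tn where tn: "\<And>n. tn n > 0"
  "\<And>n. mass (v (e n)) > 0 \<Longrightarrow> Po ((tn n)^2 * AA (e n)) (tn n powr s * BB (e n)) (tn n^6 * CC (e n)) = 0"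
  "\<And>n. mass (v (e n)) > 0 \<Longrightarrow> mm \<le> En ((tn n)^2 * AA (e n)) (tn n powr s * BB (e n)) (tn n^6 * CC (e n))" by blast
 have "(\<lambda>n. mass (v (e n))) \<longlonglongrightarrow> c^2" using cont[OF dm] by (simp add: v0 u(2))
 then have evM: "\<forall>\<^sub>F n in sequentially. mass (v (e n)) > 0" using order_tendstoD(1)[of "\<lambda>n. mass (v (e n))" "c^2" sequentially 0] c by simp
 have lA: "(\<lambda>n. AA (e n)) \<longlonglongrightarrow> A" and lB: "(\<lambda>n. BB (e n)) \<longlonglongrightarrow> B" and lC: "(\<lambda>n. CC (e n)) \<longlonglongrightarrow> C"
  using cont[OF dA] cont[OF dB] cont[OF dC] by (simp_all add: A0)
 have P0: "Po A B C = 0" using u(3) by (simp add: PV_def A_def B_def C_def)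
 have t1: "tn \<longlonglongrightarrow> 1"
  by (rule root_tendsto_1[OF lA lB lC A B less_imp_le[OF C] nn P0 tn(1)]) (use evM tn(2) in \<open>auto elim: eventually_mono\<close>)
 have "\<forall>\<^sub>F n in sequentially. 0 \<le> a / 2 * (tn n)^2 * ((AA (e n) - AA 0) / e n) + b / 4 * tn n^4 * ((AA (e n) + A) * ((AA (e n) - AA 0) / e n))
   - tn n powr s * ((BB (e n) - BB 0) / e n) / p - tn n^6 * ((CC (e n) - CC 0) / e n) / 6" (is "\<forall>\<^sub>F n in sequentially. 0 \<le> ?q n")
  using evM
 proof eventually_elim
  case (elim n)
  let ?t = "tn n"
  have "En (?t^2 * A) (?t powr s * B) (?t^6 * C) \<le> Jo A B C"
   by (rule En_dilate_le_Jo) (use A B C P0 tn(1) in auto)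
  also have "Jo A B C = mm" using ug VV_E[OF ug(1)] by (simp add: JV_def A_def B_def C_def)
  also have "mm \<le> En (?t^2 * AA (e n)) (?t powr s * BB (e n)) (?t^6 * CC (e n))" by (rule tn(3)[OF elim])
  finally have "0 \<le> (En (?t^2 * AA (e n)) (?t powr s * BB (e n)) (?t^6 * CC (e n)) - En (?t^2 * A) (?t powr s * B) (?t^6 * C)) / e n"
   using e[of n] by simp
  also have "\<dots> = ?q n" unfolding En_def A0 using e[of n] p
   by (simp add: field_simps) (simp add: eval_nat_numeral algebra_simps)
  finally show ?case .
 qed
 moreover have "?q \<longlonglongrightarrow> a / 2 * 1^2 * (2 * (LBINT x. g x \<bullet> k x) - 2 * m * A / c^2)
   + b / 4 * 1^4 * ((A + A) * (2 * (LBINT x. g x \<bullet> k x) - 2 * m * A / c^2))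
   - 1 powr s * (p * (LBINT x. \<bar>u x\<bar> powr (p - 2) * u x * \<phi> x) - p * m * B / c^2) / p
   - 1^6 * (6 * (LBINT x. \<bar>u x\<bar> powr 4 * u x * \<phi> x) - 6 * m * C / c^2) / 6" (is "_ \<longlonglongrightarrow> ?L")
  by (intro tendsto_intros t1 lA quot dA dB dC) (use p in auto)
 ultimately have "?L \<ge> 0" by (intro tendsto_lowerbound) auto
 also have "?L = dirD u g \<phi> k" using p unfolding dirD_def m_def[symmetric] A_def[symmetric] B_def[symmetric] C_def[symmetric]
  by (simp add: field_simps) (simp add: add_divide_distrib)
 finally show ?thesis .
qed

lemma dirD_minus: "dirD u g (\<lambda>x. - \<phi> x) (\<lambda>x. - k x) = - dirD u g \<phi> k"
 unfolding dirD_def by (simp add: algebra_simps)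

text \<open>The one-sided inequality holds for \<phi> and for - \<phi>, so the first variation
  vanishes. The multiplier of the mass constraint collects the normalisation terms: it is the
  derivative of the energy at u in direction u, divided by c^2.\<close>

theorem euler_lagrange:
 assumes ug: "(u, g) \<in> VV" "EV u g = mm" and \<phi>: "sob \<phi> k"
 shows "(a + b * kin g) * (LBINT x. g x \<bullet> k x) =
   ((a + b * kin g) * kin g - ppow p u - six u) / c^2 * (LBINT x. u x * \<phi> x)
   + (LBINT x. \<bar>u x\<bar> powr (p - 2) * u x * \<phi> x) + (LBINT x. u x^5 * \<phi> x)"
proof -
 have m: "sob (\<lambda>x. - \<phi> x) (\<lambda>x. - k x)" using sob_scale[OF \<phi>, of "-1"] by simp
 have "dirD u g \<phi> k = 0" using dirD_nonneg[OF ug \<phi>] dirD_nonneg[OF ug m] unfolding dirD_minus by simp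
 moreover have "\<bar>x\<bar> powr 4 * x = x^5" for x :: real
 proof (cases "x = 0")
  case False
  then have "\<bar>x\<bar> powr 4 = \<bar>x\<bar>^4" by (simp add: powr_numeral)
  also have "\<dots> = x^4" by (simp add: power_even_abs)
  finally show ?thesis by (simp add: eval_nat_numeral)
 qed simp
 ultimately show ?thesis unfolding dirD_def by (simp add: algebra_simps add_divide_distrib diff_divide_distrib)
qed

end

section \<open>Return to the given definitions\<close>

lemma Lq_norms:
 shows "(Lq_norm 2 (g :: real^3 \<Rightarrow> real^3))^2 = kin g" "(Lq_norm 2 g)^4 = (kin g)^2"
  "(Lq_norm 6 (u :: real^3 \<Rightarrow> real))^6 = six u" "p > 0 \<Longrightarrow> Lq_norm p u powr p = ppow p u"
proof -
 have n2: "norm (g x) powr 2 = (norm (g x))^2" for x using abs_powr_even(1)[of "norm (g x)"] by simp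
 have L2: "Lq_norm 2 g = sqrt (kin g)" unfolding Lq_norm_def n2 kin_def[symmetric] by (simp add: powr_half_sqrt functionals_nonneg)
 show k: "(Lq_norm 2 g)^2 = kin g" unfolding L2 by (simp add: functionals_nonneg)
 have "(Lq_norm 2 g)^4 = ((Lq_norm 2 g)^2)^2" by (simp flip: power_mult)
 then show "(Lq_norm 2 g)^4 = (kin g)^2" unfolding k .
 have "Lq_norm 6 u = six u powr (1 / 6)" unfolding Lq_norm_def six_def by (simp add: abs_powr_even)
 moreover have "(six u powr (1 / 6))^6 = six u"
 proof (cases "six u = 0")
  case False
  then have "six u > 0" using functionals_nonneg(4)[of u] by simp
  then show ?thesis by (simp add: powr_powr flip: powr_numeral)
 qed simp
 ultimately show "(Lq_norm 6 u)^6 = six u" by simp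
 show "Lq_norm p u powr p = ppow p u" if "p > 0"
  unfolding Lq_norm_def real_norm_def ppow_def[symmetric] using that functionals_nonneg(3)[of p u] by (simp add: powr_powr)
qed

lemma kin_weak_gradient: "sob u g \<Longrightarrow> kin (weak_gradient u) = kin g"
 unfolding kin_def using weak_gradient_props(1,2)[of u g] sobD(5)[of u g] by (intro integral_cong_AE) auto

context kirchhoff
begin

lemma energy_eq: "energy a b p u = EV u (weak_gradient u)" and pohozaev_eq: "pohozaev a b p u = PV u (weak_gradient u)"
 using p by (simp_all add: energy_def pohozaev_def pohozaev_exponent_def EV_def En_def PV_def Po_def s_def Lq_norms)

lemma pohozaev_manifold_iff: "u \<in> pohozaev_manifold a b p c \<longleftrightarrow> (u, weak_gradient u) \<in> VV"
proof -
 have "u \<in> H1 \<longleftrightarrow> sob u (weak_gradient u)" using H1_sob sob_H1 weak_gradient_props(3) by blast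
 then show ?thesis by (auto simp: pohozaev_manifold_def mass_sphere_def VV_def mass_def pohozaev_eq)
qed

lemma ground_state:
 "\<exists>u lam. u \<in> mass_sphere c \<and> kirchhoff_weak_solution a b p lam u \<and>
   ereal (energy a b p u) = (INF v \<in> pohozaev_manifold a b p c. ereal (energy a b p v))"
proof -
 obtain u g where ug: "(u, g) \<in> VV" "EV u g = mm" by (rule minimizer_exists)
 then have u: "sob u g" by (simp add: VV_def)
 let ?G = "weak_gradient u"
 have uG: "(u, ?G) \<in> VV" "EV u ?G = mm"
  using ug weak_gradient_props(3)[OF u] by (simp_all add: VV_def EV_def PV_def kin_weak_gradient[OF u])
 have um: "u \<in> pohozaev_manifold a b p c" using uG(1) by (simp add: pohozaev_manifold_iff)
 define lam where "lam = ((a + b * kin ?G) * kin ?G - ppow p u - six u) / c^2"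
 have "kirchhoff_weak_solution a b p lam u"
  unfolding kirchhoff_weak_solution_def Lq_norms(1)
 proof (intro conjI ballI)
  show "u \<in> H1" by (rule sob_H1[OF u])
  fix \<phi> :: "real^3 \<Rightarrow> real" assume "\<phi> \<in> H1"
  then have "sob \<phi> (weak_gradient \<phi>)" using H1_sob weak_gradient_props(3) by blast
  from euler_lagrange[OF uG this, folded lam_def]
  show "(a + b * kin ?G) * (LBINT x. ?G x \<bullet> weak_gradient \<phi> x) = lam * (LBINT x. u x * \<phi> x)
    + (LBINT x. \<bar>u x\<bar> powr (p - 2) * u x * \<phi> x) + (LBINT x. u x^5 * \<phi> x)" .
 qed
 moreover have "ereal (energy a b p u) = (INF v \<in> pohozaev_manifold a b p c. ereal (energy a b p v))"
 proof (rule antisym)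
  show "ereal (energy a b p u) \<le> (INF v \<in> pohozaev_manifold a b p c. ereal (energy a b p v))"
   by (rule INF_greatest) (simp add: energy_eq uG(2) pohozaev_manifold_iff mm_le)
  show "(INF v \<in> pohozaev_manifold a b p c. ereal (energy a b p v)) \<le> ereal (energy a b p u)" by (rule INF_lower[OF um])
 qed
 ultimately show ?thesis using um by (auto simp: pohozaev_manifold_def)
qed

end

theorem theorem1p1:
 fixes a b p :: real
 assumes "a > 0" and "b > 0" and "14 / 3 \<le> p" and "p < 6"
 shows "\<forall>c>0. \<exists>(u :: real^3 \<Rightarrow> real) (lam :: real).
      u \<in> mass_sphere c \<and> kirchhoff_weak_solution a b p lam u \<and>
      ereal (energy a b p u) = (INF v \<in> pohozaev_manifold a b p c. ereal (energy a b p v))"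
proof (intro allI impI)
 fix c :: real assume "c > 0"
 then interpret kirchhoff a b p c using assms by unfold_locales
 show "\<exists>(u :: real^3 \<Rightarrow> real) (lam :: real).
      u \<in> mass_sphere c \<and> kirchhoff_weak_solution a b p lam u \<and>
      ereal (energy a b p u) = (INF v \<in> pohozaev_manifold a b p c. ereal (energy a b p v))"
  by (rule ground_state)
qed

end
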